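(* For integers $v,e\ge 0$ let $V^{odd}_{v,e}$ and $V^{even}_{v,e}$ be the finite dimensional vector spaces of (possibly disconnected) at least trivalent graphs with $v$ vertices and $e$ edges defined in the context, and define $$P^{odd}(s,t):=\sum_{v,e\ge 0}\dim\left(V^{odd}_{v,e}\right)s^vt^e,\qquad P^{even}(s,t):=\sum_{v,e\ge 0}\dim\left(V^{even}_{v,e}\right)s^vt^e .$$ Write $(a,q)_\infty:=\prod_{k\ge 0}(1-aq^k)$. Then, as formal power series in $s,t$, $$P^{odd}(s,t)=\frac{1}{(-s,(st)^2)_\infty\,((st)^2,(st)^2)_\infty}\sum_{j_1,j_2,\dots\ge 0}\ \prod_{\alpha\ge 1}\left[\frac{(-s)^{\alpha j_\alpha}}{j_\alpha!\,(-\alpha)^{j_\alpha}}\ \frac{1}{\left((-st)^\alpha,(-st)^\alpha\right)_\infty^{j_\alpha}}\left(\frac{(t^{2\alpha-1},(st)^{4\alpha-2})_\infty}{((-s)^{2\alpha-1}t^{4\alpha-2},(st)^{4\alpha-2})_\infty}\right)^{j_{2\alpha-1}/2}\left(\frac{(t^{\alpha},(st)^{2\alpha})_\infty}{((-s)^{\alpha}t^{2\alpha},(st)^{2\alpha})_\infty}\right)^{j_{2\alpha}}\right]\ \prod_{\alpha,\beta\ge 1}\frac{1}{\left(t^{\operatorname{lcm}(\alpha,\beta)},(-st)^{\operatorname{lcm}(\alpha,\beta)}\right)_\infty^{\gcd(\alpha,\beta)j_\alpha j_\beta/2}}$$ and $$P^{even}(s,t)=\frac{(s,(st)^2)_\infty}{(-st,(st)^2)_\infty}\sum_{j_1,j_2,\dots\ge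 0}\ \prod_{\alpha\ge 1}\left[\frac{s^{\alpha j_\alpha}}{j_\alpha!\,\alpha^{j_\alpha}}\ \frac{1}{\left((-st)^\alpha,(-st)^\alpha\right)_\infty^{j_\alpha}}\left(\frac{((-t)^{2\alpha-1},(st)^{4\alpha-2})_\infty}{(s^{2\alpha-1}t^{4\alpha-2},(st)^{4\alpha-2})_\infty}\right)^{j_{2\alpha-1}/2}\left(\frac{((-t)^{\alpha},(st)^{2\alpha})_\infty}{(s^{\alpha}t^{2\alpha},(st)^{2\alpha})_\infty}\right)^{j_{2\alpha}}\right]\ \prod_{\alpha,\beta\ge 1}\left((-t)^{\operatorname{lcm}(\alpha,\beta)},(-st)^{\operatorname{lcm}(\alpha,\beta)}\right)_\infty^{\gcd(\alpha,\beta)j_\alpha j_\beta/2}.$$ Here the sums run over all finitely supported sequences $(j_1,j_2,\dots)$ of nonnegative integers, the products over $\alpha,\beta\geq 1$ run over all ordered pairs (including $\alpha=\beta$), and half-integer powers of power series with constant term $1$ are taken with constant term $1$.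
   Context: Graph spaces. Work over a field $\mathbb K$ of characteristic $0$. For $v,e,i\ge 0$ let $\mathrm{gra}_{v,e,i}$ be the set of all maps $g=(g_1,g_2)\colon E\to V\times V$, where $V=\{1,\dots,v\}$ (vertices) and $E=\{1,\dots,e\}$ (edges; edge $a$ is directed from $g_1(a)$ to $g_2(a)$; tadpoles $g_1(a)=g_2(a)$ and multiple edges are allowed), such that every vertex $x$ has valence at least $i$, where the valence of $x$ is the number of pairs $(a,j)\in E\times\{1,2\}$ with $g_j(a)=x$. For $v=e=0$ this set consists of the empty graph only. Let $V_{v,e,i}$ be the $\mathbb K$-vector space with basis $\mathrm{gra}_{v,e,i}$. Three groups act on it: $(S_2)^e$ by reversing the directions of edges (action $\nu^+$), $S_e$ by permuting edges ($\mu^+$), and $S_v$ by permuting vertices ($\rho^+$). Define twisted actions $\nu^-(g)=(-1)^{r}\nu^+(g)$, with $r$ the number of edges reversed by $g$; $\mu^-(g)=\operatorname{sgn}(g)\mu^+(g)$; $\rho^-(g)=\operatorname{sgn}(g)\rho^+(g)$. For signs $s_\nu,s_\mu,s_\rho\in\{+,-\}$ let $V_{v,e,i}^{s_\nu s_\mu s_\rho}$ be the space obtained from $V_{v,e,i}$ by successively taking coinvariants under $\nu^{s_\nu}$, then $\mu^{s_\mu}$, then $\rho^{s_\rho}$. Set $V^{even}_{v,e}:=V_{v,e,3}^{+-+}$ and $V^{odd}_{v,e}:=V_{v,e,3}^{-+-}$. (Equivalently, $V^{even}_{v,e}$ has a basis given by isomorphism classes of graphs with $v$ vertices, $e$ edges,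 all valences $\ge3$, having no automorphism inducing an odd permutation of the edges; $V^{odd}_{v,e}$ likewise with no automorphism inducing an odd permutation of the set of vertices and half-edges.) *)

theory Defs
  imports
    "HOL-Algebra.Module"
    "HOL-Algebra.AbelCoset"
    "HOL-Combinatorics.Permutations"
    "HOL-Computational_Algebra.Formal_Power_Series"
    "HOL-Analysis.Infinite_Sum"
    "HOL-Analysis.Infinite_Products"
begin

section \<open>Vector spaces over a field, as modules\<close>

text \<open>The vector space with basis \<open>G\<close>, for a finite set \<open>G\<close>: a vector is its coefficient function.
  The ring multiplication and unit of a module record play no role.\<close>

definition free_mod :: "('a, 'm) ring_scheme \<Rightarrow> 'g set \<Rightarrow> ('a, 'g \<Rightarrow> 'a) module" where
  "free_mod K G = \<lparr>carrier = G \<rightarrow>\<^sub>E carrier K, monoid.mult = undefined, one = undefined,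
     zero = (\<lambda>x\<in>G. \<zero>\<^bsub>K\<^esub>), add = (\<lambda>f h. \<lambda>x\<in>G. f x \<oplus>\<^bsub>K\<^esub> h x),
     smult = (\<lambda>c f. \<lambda>x\<in>G. c \<otimes>\<^bsub>K\<^esub> f x)\<rparr>"

text \<open>The linear extension of a map \<open>f : G \<rightarrow> G\<close> of basis elements.\<close>

definition lin_ext :: "('a, 'm) ring_scheme \<Rightarrow> 'g set \<Rightarrow> ('g \<Rightarrow> 'g) \<Rightarrow> ('g \<Rightarrow> 'a) \<Rightarrow> ('g \<Rightarrow> 'a)" where
  "lin_ext K G f x = (\<lambda>d\<in>G. finsum K x {g \<in> G. f g = d})"

definition span_mod :: "('a, 'm) ring_scheme \<Rightarrow> ('a, 'b, 'n) module_scheme \<Rightarrow> 'b set \<Rightarrow> 'b set" where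
  "span_mod K M S = \<Inter>{H. submodule H K M \<and> S \<subseteq> H}"

text \<open>The quotient of a module by a submodule, on the additive cosets (compare \<^const>\<open>A_FactGroup\<close>).\<close>

definition quot_mod :: "('a, 'b, 'n) module_scheme \<Rightarrow> 'b set \<Rightarrow> ('a, 'b set) module" where
  "quot_mod M U = \<lparr>carrier = a_rcosets\<^bsub>M\<^esub> U, monoid.mult = undefined, one = undefined,
     zero = U, add = set_add M,
     smult = (\<lambda>c A. \<Union>x\<in>A. U +>\<^bsub>M\<^esub> (c \<odot>\<^bsub>M\<^esub> x))\<rparr>"

text \<open>The coinvariants of \<open>M\<close> under operators \<open>act a\<close>, \<open>a \<in> A\<close>. An operator \<open>\<phi>\<close> of \<open>M\<close> preserving
  the submodule spanned by the \<open>act a x - x\<close> induces the operator \<open>(`) \<phi>\<close> on the coinvariants.\<close>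

definition coinvariants ::
    "('a, 'm) ring_scheme \<Rightarrow> ('a, 'b, 'n) module_scheme \<Rightarrow> 'c set \<Rightarrow> ('c \<Rightarrow> 'b \<Rightarrow> 'b) \<Rightarrow> ('a, 'b set) module"
  where "coinvariants K M A act =
    quot_mod M (span_mod K M {act a x \<ominus>\<^bsub>M\<^esub> x | a x. a \<in> A \<and> x \<in> carrier M})"

definition is_basis :: "('a, 'm) ring_scheme \<Rightarrow> ('a, 'b, 'n) module_scheme \<Rightarrow> 'b set \<Rightarrow> bool" where
  "is_basis K M B \<longleftrightarrow> finite B \<and> B \<subseteq> carrier M \<and> span_mod K M B = carrier M \<and>
     (\<forall>c \<in> B \<rightarrow> carrier K. finsum M (\<lambda>b. c b \<odot>\<^bsub>M\<^esub> b) B = \<zero>\<^bsub>M\<^esub> \<longrightarrow> (\<forall>b\<in>B. c b = \<zero>\<^bsub>K\<^esub>))"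

text \<open>The dimension of a finite-dimensional vector space (unspecified in infinite dimension).\<close>

definition vdim :: "('a, 'm) ring_scheme \<Rightarrow> ('a, 'b, 'n) module_scheme \<Rightarrow> nat" where
  "vdim K M = (THE n. \<exists>B. is_basis K M B \<and> card B = n)"


section \<open>Graph spaces\<close>

definition valence :: "nat \<Rightarrow> (nat \<Rightarrow> nat \<times> nat) \<Rightarrow> nat \<Rightarrow> nat" where
  "valence e g x = card {a \<in> {1..e}. fst (g a) = x} + card {a \<in> {1..e}. snd (g a) = x}"

definition gra :: "nat \<Rightarrow> nat \<Rightarrow> nat \<Rightarrow> (nat \<Rightarrow> nat \<times> nat) set" where
  "gra v e i = {g \<in> {1..e} \<rightarrow>\<^sub>E {1..v} \<times> {1..v}. \<forall>x \<in> {1..v}. i \<le> valence e g x}"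

datatype pm = Pos | Neg

definition twist :: "('a, 'm) ring_scheme \<Rightarrow> pm \<Rightarrow> bool \<Rightarrow> 'a" where
  "twist K sg p = (if sg = Neg \<and> p then \<ominus>\<^bsub>K\<^esub> \<one>\<^bsub>K\<^esub> else \<one>\<^bsub>K\<^esub>)"

text \<open>The three twisted actions on the space with basis \<^term>\<open>gra v e i\<close>.
  An element of \<open>(S\<^sub>2)\<^sup>e\<close> is given by the set \<open>R\<close> of edges that it reverses.\<close>

definition nu_act :: "('a, 'm) ring_scheme \<Rightarrow> nat \<Rightarrow> nat \<Rightarrow> nat \<Rightarrow> pm \<Rightarrow> nat set \<Rightarrow>
    ((nat \<Rightarrow> nat \<times> nat) \<Rightarrow> 'a) \<Rightarrow> ((nat \<Rightarrow> nat \<times> nat) \<Rightarrow> 'a)" where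
  "nu_act K v e i sg R x = twist K sg (odd (card R)) \<odot>\<^bsub>free_mod K (gra v e i)\<^esub>
     lin_ext K (gra v e i) (\<lambda>g. \<lambda>a\<in>{1..e}. if a \<in> R then prod.swap (g a) else g a) x"

definition mu_act :: "('a, 'm) ring_scheme \<Rightarrow> nat \<Rightarrow> nat \<Rightarrow> nat \<Rightarrow> pm \<Rightarrow> (nat \<Rightarrow> nat) \<Rightarrow>
    ((nat \<Rightarrow> nat \<times> nat) \<Rightarrow> 'a) \<Rightarrow> ((nat \<Rightarrow> nat \<times> nat) \<Rightarrow> 'a)" where
  "mu_act K v e i sg p x = twist K sg (\<not> evenperm p) \<odot>\<^bsub>free_mod K (gra v e i)\<^esub>
     lin_ext K (gra v e i) (\<lambda>g. \<lambda>a\<in>{1..e}. g (inv_into UNIV p a)) x"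

definition rho_act :: "('a, 'm) ring_scheme \<Rightarrow> nat \<Rightarrow> nat \<Rightarrow> nat \<Rightarrow> pm \<Rightarrow> (nat \<Rightarrow> nat) \<Rightarrow>
    ((nat \<Rightarrow> nat \<times> nat) \<Rightarrow> 'a) \<Rightarrow> ((nat \<Rightarrow> nat \<times> nat) \<Rightarrow> 'a)" where
  "rho_act K v e i sg p x = twist K sg (\<not> evenperm p) \<odot>\<^bsub>free_mod K (gra v e i)\<^esub>
     lin_ext K (gra v e i) (\<lambda>g. \<lambda>a\<in>{1..e}. map_prod p p (g a)) x"

definition graph_space :: "('a, 'm) ring_scheme \<Rightarrow> nat \<Rightarrow> nat \<Rightarrow> nat \<Rightarrow> pm \<Rightarrow> pm \<Rightarrow> pm \<Rightarrow>
    ('a, ((nat \<Rightarrow> nat \<times> nat) \<Rightarrow> 'a) set set set) module" where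
  "graph_space K v e i snu smu srho =
    (let V0 = free_mod K (gra v e i);
         V1 = coinvariants K V0 (Pow {1..e}) (nu_act K v e i snu);
         V2 = coinvariants K V1 {p. p permutes {1..e}} (\<lambda>p. (`) (mu_act K v e i smu p));
         V3 = coinvariants K V2 {p. p permutes {1..v}} (\<lambda>p. (`) ((`) (rho_act K v e i srho p)))
     in V3)"

definition V_even where "V_even K v e = graph_space K v e 3 Pos Neg Pos"

definition V_odd where "V_odd K v e = graph_space K v e 3 Neg Pos Neg"


section \<open>Power series in \<open>s\<close> and \<open>t\<close>\<close>

text \<open>A power series in \<open>s, t\<close> is a power series in \<open>s\<close> whose coefficients are power series in \<open>t\<close>;
  the coefficient of \<open>s^v t^e\<close> in \<open>F\<close> is \<open>F $ v $ e\<close>. Limits are taken in the library's metric on \<^typ>\<open>rat fps fps\<close>,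
  that is, in the \<open>s\<close>-adic topology; it is finer than the \<open>(s,t)\<close>-adic one, and
  all the infinite sums and products below converge in it.\<close>

type_synonym ser = "rat fps fps"

definition var_s :: ser where "var_s = fps_X"

definition var_t :: ser where "var_t = fps_const fps_X"

definition scalar :: "rat \<Rightarrow> ser" where "scalar c = fps_const (fps_const c)"

definition P_even :: "('a, 'm) ring_scheme \<Rightarrow> ser" where
  "P_even K = Abs_fps (\<lambda>v. Abs_fps (\<lambda>e. of_nat (vdim K (V_even K v e))))"

definition P_odd :: "('a, 'm) ring_scheme \<Rightarrow> ser" where
  "P_odd K = Abs_fps (\<lambda>v. Abs_fps (\<lambda>e. of_nat (vdim K (V_odd K v e))))"

text \<open>\<open>(a, q)\<^sub>\<infinity>\<close>\<close>

definition qpoch :: "ser \<Rightarrow> ser \<Rightarrow> ser" where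
  "qpoch a q = prodinf (\<lambda>k. 1 - a * q ^ k)"

text \<open>\<open>F\<^sup>n\<^sup>/\<^sup>2\<close>, for \<open>F\<close> with constant term 1.\<close>

definition half_pow :: "ser \<Rightarrow> nat \<Rightarrow> ser" where
  "half_pow F n = (THE G. G ^ 2 = F ^ n \<and> fps_nth (fps_nth G 0) 0 = 1)"

text \<open>The product over all \<open>\<alpha> \<ge> 1\<close>.\<close>

definition prod_pos :: "(nat \<Rightarrow> ser) \<Rightarrow> ser" where
  "prod_pos f = prodinf (\<lambda>n. f (Suc n))"

text \<open>The finitely supported sequences \<open>(j\<^sub>1, j\<^sub>2, \<dots>)\<close>; the entry with index 0 is not used.\<close>

definition fin_seqs :: "(nat \<Rightarrow> nat) set" where
  "fin_seqs = {j. j 0 = 0 \<and> finite {\<alpha>. j \<alpha> \<noteq> 0}}"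

definition odd_summand :: "(nat \<Rightarrow> nat) \<Rightarrow> ser" where
  "odd_summand j = (let s = var_s; t = var_t in
     prod_pos (\<lambda>\<alpha>.
       (- s) ^ (\<alpha> * j \<alpha>) * scalar (1 / (fact (j \<alpha>) * (- of_nat \<alpha>) ^ j \<alpha>))
       * (1 / qpoch ((- (s * t)) ^ \<alpha>) ((- (s * t)) ^ \<alpha>) ^ j \<alpha>)
       * half_pow (qpoch (t ^ (2 * \<alpha> - 1)) ((s * t) ^ (4 * \<alpha> - 2))
                   / qpoch ((- s) ^ (2 * \<alpha> - 1) * t ^ (4 * \<alpha> - 2)) ((s * t) ^ (4 * \<alpha> - 2)))
           (j (2 * \<alpha> - 1))
       * (qpoch (t ^ \<alpha>) ((s * t) ^ (2 * \<alpha>))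
          / qpoch ((- s) ^ \<alpha> * t ^ (2 * \<alpha>)) ((s * t) ^ (2 * \<alpha>))) ^ j (2 * \<alpha>))
     * prod_pos (\<lambda>\<alpha>. prod_pos (\<lambda>\<beta>.
         1 / half_pow (qpoch (t ^ lcm \<alpha> \<beta>) ((- (s * t)) ^ lcm \<alpha> \<beta>)) (gcd \<alpha> \<beta> * j \<alpha> * j \<beta>))))"

definition even_summand :: "(nat \<Rightarrow> nat) \<Rightarrow> ser" where
  "even_summand j = (let s = var_s; t = var_t in
     prod_pos (\<lambda>\<alpha>.
       s ^ (\<alpha> * j \<alpha>) * scalar (1 / (fact (j \<alpha>) * of_nat \<alpha> ^ j \<alpha>))
       * (1 / qpoch ((- (s * t)) ^ \<alpha>) ((- (s * t)) ^ \<alpha>) ^ j \<alpha>)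
       * half_pow (qpoch ((- t) ^ (2 * \<alpha> - 1)) ((s * t) ^ (4 * \<alpha> - 2))
                   / qpoch (s ^ (2 * \<alpha> - 1) * t ^ (4 * \<alpha> - 2)) ((s * t) ^ (4 * \<alpha> - 2)))
           (j (2 * \<alpha> - 1))
       * (qpoch ((- t) ^ \<alpha>) ((s * t) ^ (2 * \<alpha>))
          / qpoch (s ^ \<alpha> * t ^ (2 * \<alpha>)) ((s * t) ^ (2 * \<alpha>))) ^ j (2 * \<alpha>))
     * prod_pos (\<lambda>\<alpha>. prod_pos (\<lambda>\<beta>.
         half_pow (qpoch ((- t) ^ lcm \<alpha> \<beta>) ((- (s * t)) ^ lcm \<alpha> \<beta>)) (gcd \<alpha> \<beta> * j \<alpha> * j \<beta>))))"

end

theory Submission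
  imports Defs "Jordan_Normal_Form.Missing_VectorSpace" "HOL-Combinatorics.Orbits"
    "HOL-Computational_Algebra.Polynomial"
begin

text \<open>
  Put \<open>\<kappa> = 1\<close> in the even and \<open>\<kappa> = -1\<close> in the odd case. In characteristic \<open>0\<close>, \<open>2^e e! v!\<close> times the dimension is the
  signed number of pairs of a group element and a graph fixed by it. Fix a vertex permutation \<open>q\<close> and mark its orbits
  \<open>C\<close> by variables \<open>z_C\<close>; let \<open>p_k\<close> be the sum of \<open>|C| z_C^k\<close> over the orbits with \<open>|C|\<close> dividing \<open>k\<close>. The fixed graphs,
  weighted by the product of the \<open>z_x\<close> over all half-edges, are counted by traces of powers of an operator on \<open>V \<times> V\<close>, and
  the exponential formula gives \<open>2^e e!\<close> times the coefficient of \<open>t^e\<close> in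
  \<open>exp (\<Sum>k. (-\<kappa>)^(k-1) t^k / (2 k) * (p_k^2 + \<kappa> p_2k))\<close>.

  The exponent is quadratic in each \<open>p_k\<close> separately. Introducing dual variables \<open>\<xi>_k\<close>, the valence condition and the sum over
  \<open>q\<close> turn into \<open>exp (\<Sum>a. \<kappa>^(a-1) s^a / a * W_a(\<xi>))\<close>, where \<open>W_a\<close> is the part of \<open>exp (\<Sum>k. a \<xi>_k u^k / k)\<close>, \<open>k\<close> running over the
  multiples of \<open>a\<close>, that has degree at least \<open>3 a\<close> in \<open>u\<close>; here \<open>u^2 = t\<close>. Expanding the full exponentials inside \<open>W_a\<close> in
  powers \<open>j_a\<close> leaves an exponent quadratic in each \<open>\<xi>_k\<close>, so the two sides are paired by one Gaussian integral for each
  \<open>k\<close>, evaluated algebraically by a differential equation. Summed over \<open>k\<close>, the resulting exponents are the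
  logarithms of the q-Pochhammer symbols.
\<close>

text \<open>The valence bound concerns monomials in the \<open>z_C\<close>, not products of power
  sums, so it cannot be imposed on the edge series itself. Pairing with the kernel
  \<open>exp (sum of \<xi>_k p_k u^k / k)\<close> removes this obstacle: the kernel is a product
  over the orbits, and on each factor the bound is a truncation in degree. It may be imposed orbit
  by orbit because a graph fixed by a group element has constant valence along each orbit of
  \<open>q\<close>. The Gaussian form rests on the bound being 3: the part of the vertex weight that
  is cut off, valences 0 to 2, has degree at most two in the \<xi>_k and no mixed products. The z
  and \<xi> are arbitrary rational numbers rather than formal variables. Equality at all rational
  points gives equality of coefficients, so one series ring in two variables serves throughout.
  Exponentials of powers of \<open>u\<close> do not converge \<open>s\<close>-adically; the calculus
  of series therefore works with total degree, and the metric of the statement enters only for the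
  final products and sums.\<close>

declare One_nat_def [simp del]

section \<open>Exponentials of bivariate power series\<close>

abbreviation cf :: "ser \<Rightarrow> nat \<Rightarrow> nat \<Rightarrow> rat" where
  "cf F v n \<equiv> fps_nth (fps_nth F v) n"

lemma ser_eqI: "(\<And>v n. cf F v n = cf G v n) \<Longrightarrow> F = G"
  by (intro fps_ext) auto

lemma cf_mult: "cf (F * G) v n = (\<Sum>i\<le>v. \<Sum>j\<le>n. cf F i j * cf G (v - i) (n - j))"
  by (simp add: fps_mult_nth fps_sum_nth atLeast0AtMost)

lemma scalar_0 [simp]: "scalar 0 = 0" and scalar_1 [simp]: "scalar 1 = 1"
  by (simp_all add: scalar_def)

lemma scalar_add: "scalar (a + b) = scalar a + scalar b"
  and scalar_mult: "scalar (a * b) = scalar a * scalar b"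
  and scalar_minus: "scalar (- a) = - scalar a"
  by (simp_all add: scalar_def fps_const_neg flip: fps_const_add fps_const_mult fps_const_sub)

lemma scalar_power: "scalar (a ^ n) = scalar a ^ n"
  by (induct n) (simp_all add: scalar_mult)

lemma scalar_sum: "scalar (sum f A) = (\<Sum>x\<in>A. scalar (f x))"
  by (induct A rule: infinite_finite_induct) (simp_all add: scalar_add)

lemma scalar_prod: "scalar (prod f A) = (\<Prod>x\<in>A. scalar (f x))"
  by (induct A rule: infinite_finite_induct) (simp_all add: scalar_mult)

lemma cf_scalar_mult [simp]: "cf (scalar c * F) v n = c * cf F v n"
  by (simp add: scalar_def)

lemma cf_scalar: "cf (scalar c) v n = (if v = 0 \<and> n = 0 then c else 0)"
  by (simp add: scalar_def)

lemma of_nat_ser: "(of_nat n :: ser) = scalar (of_nat n)"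
  by (induct n) (simp_all add: scalar_add)

lemma cf_sum: "cf (sum f A) v n = (\<Sum>x\<in>A. cf (f x) v n)"
  by (simp add: fps_sum_nth)

text \<open>Filtration by total degree. Partial sums of a series such as \<open>exp t\<close> never
  stabilise in the coefficient of \<open>s^0\<close>, so convergence in the exponential calculus is
  measured by this filtration and not by the \<open>s\<close>-adic metric.\<close>

definition small :: "ser \<Rightarrow> nat \<Rightarrow> bool" where
  "small F d \<longleftrightarrow> (\<forall>v n. v + n < d \<longrightarrow> cf F v n = 0)"

lemma smallI: "(\<And>v n. v + n < d \<Longrightarrow> cf F v n = 0) \<Longrightarrow> small F d"
  by (simp add: small_def)

lemma smallD: "small F d \<Longrightarrow> v + n < d \<Longrightarrow> cf F v n = 0"
  by (simp add: small_def)

lemma small_0 [simp]: "small F 0" "small 0 d"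
  by (simp_all add: small_def)

lemma small_mono: "small F d \<Longrightarrow> d' \<le> d \<Longrightarrow> small F d'"
  by (simp add: small_def)

lemma small_add: "small F d \<Longrightarrow> small G d \<Longrightarrow> small (F + G) d"
  and small_diff: "small F d \<Longrightarrow> small G d \<Longrightarrow> small (F - G) d"
  and small_minus: "small F d \<Longrightarrow> small (- F) d"
  by (simp_all add: small_def)

lemma small_sum: "(\<And>x. x \<in> A \<Longrightarrow> small (f x) d) \<Longrightarrow> small (sum f A) d"
  by (simp add: small_def cf_sum)

lemma small_mult: assumes "small F a" "small G b" shows "small (F * G) (a + b)"
proof (rule smallI)
  fix v n assume vn: "v + n < a + b"
  have "cf F i j * cf G (v - i) (n - j) = 0" if "i \<le> v" "j \<le> n" for i j
  proof (cases "i + j < a")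
    case False
    then have "(v - i) + (n - j) < b" using vn that by auto
    then show ?thesis using assms(2) by (simp add: smallD)
  qed (use assms(1) in \<open>simp add: smallD\<close>)
  then show "cf (F * G) v n = 0" unfolding cf_mult by (intro sum.neutral ballI) auto
qed

lemma small_mult_left: "small F d \<Longrightarrow> small (F * G) d"
  using small_mult[of F d G 0] by simp

lemma small_mult_right: "small G d \<Longrightarrow> small (F * G) d"
  using small_mult[of F 0 G d] by simp

lemma small_power: "small F d \<Longrightarrow> small (F ^ n) (n * d)"
  by (induct n) (auto intro: small_mult)

lemma small_power1: "small F 1 \<Longrightarrow> small (F ^ n) n"
  using small_power[of F 1 n] by simp

lemma small_all_eq_0: "(\<And>d. small F d) \<Longrightarrow> F = 0"
  by (rule ser_eqI) (metis smallD fps_zero_nth lessI)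

text \<open>The sum of a family whose \<open>i\<close>-th member has order at least \<open>i\<close>; this makes the
  truncation at \<open>v + n\<close> lossless.\<close>

definition tsum :: "(nat \<Rightarrow> ser) \<Rightarrow> ser" where
  "tsum f = Abs_fps (\<lambda>v. Abs_fps (\<lambda>n. \<Sum>i\<le>v+n. cf (f i) v n))"

lemma cf_tsum: "cf (tsum f) v n = (\<Sum>i\<le>v+n. cf (f i) v n)"
  by (simp add: tsum_def)

lemma cf_tsum_ge:
  assumes "\<And>i. small (f i) i" "v + n \<le> N"
  shows "cf (tsum f) v n = (\<Sum>i\<le>N. cf (f i) v n)"
  unfolding cf_tsum by (rule sum.mono_neutral_left) (use assms in \<open>auto intro!: smallD[of "f _"]\<close>)

lemma tsum_add: "tsum (\<lambda>i. f i + g i) = tsum f + tsum g"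
  and tsum_diff: "tsum (\<lambda>i. f i - g i) = tsum f - tsum g"
  by (rule ser_eqI; simp add: cf_tsum sum.distrib sum_subtractf sum_negf)+

lemma tsum_sum: "tsum (\<lambda>i. \<Sum>k\<in>A. f k i) = (\<Sum>k\<in>A. tsum (f k))"
  by (rule ser_eqI) (simp only: cf_tsum cf_sum, rule sum.swap)

text \<open>Both truncations are at \<open>v + n\<close>, which depends on the coefficient alone, so
  two finite sums are exchanged.\<close>

lemma tsum_swap: "tsum (\<lambda>i. tsum (f i)) = tsum (\<lambda>j. tsum (\<lambda>i. f i j))"
  by (rule ser_eqI) (simp only: cf_tsum, rule sum.swap)

lemma tsum_scalar: "tsum (\<lambda>i. scalar c * f i) = scalar c * tsum f"
  by (rule ser_eqI) (simp add: cf_tsum sum_distrib_left)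

lemma tsum_0 [simp]: "tsum (\<lambda>_. 0) = 0"
  by (rule ser_eqI) (simp add: cf_tsum)

lemma small_tsum: "(\<And>i. small (f i) d) \<Longrightarrow> small (tsum f) d"
  by (simp add: small_def cf_tsum)

text \<open>The coefficient of the first factor at \<open>(i, j)\<close> is truncated at
  \<open>i + j\<close>. The order of the members allows all these bounds to be raised to the common
  value \<open>v + n\<close>, and only finite sums remain.\<close>

lemma tsum_mult:
  assumes "\<And>i. small (f i) i"
  shows "tsum f * G = tsum (\<lambda>i. f i * G)"
proof (rule ser_eqI)
  fix v n
  have "cf (tsum f * G) v n = (\<Sum>i\<le>v. \<Sum>j\<le>n. (\<Sum>k\<le>v+n. cf (f k) i j) * cf G (v - i) (n - j))"
    unfolding cf_mult by (intro sum.cong refl arg_cong2[where f="(*)"] cf_tsum_ge assms) auto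
  also have "\<dots> = (\<Sum>i\<le>v. \<Sum>j\<le>n. \<Sum>k\<le>v+n. cf (f k) i j * cf G (v - i) (n - j))"
    by (simp add: sum_distrib_right)
  also have "\<dots> = (\<Sum>k\<le>v+n. \<Sum>i\<le>v. \<Sum>j\<le>n. cf (f k) i j * cf G (v - i) (n - j))"
    by (subst (2) sum.swap, subst sum.swap) simp
  finally show "cf (tsum f * G) v n = cf (tsum (\<lambda>i. f i * G)) v n"
    by (simp add: cf_tsum cf_mult)
qed

lemma tsum_mult': "(\<And>i. small (f i) i) \<Longrightarrow> G * tsum f = tsum (\<lambda>i. G * f i)"
  using tsum_mult[of f G] by (simp add: mult.commute)

lemma tsum_Suc:
  assumes "\<And>i. small (f i) i"
  shows "tsum f = f 0 + tsum (\<lambda>i. f (Suc i))"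
proof (rule ser_eqI)
  fix v n
  have "cf (tsum f) v n = (\<Sum>i\<le>Suc (v+n). cf (f i) v n)" by (rule cf_tsum_ge) (use assms in auto)
  also have "\<dots> = cf (f 0) v n + (\<Sum>i\<le>v+n. cf (f (Suc i)) v n)" by (rule sum.atMost_Suc_shift)
  finally show "cf (tsum f) v n = cf (f 0 + tsum (\<lambda>i. f (Suc i))) v n" by (simp add: cf_tsum)
qed

lemma tsum_finite:
  assumes "\<And>i. i > M \<Longrightarrow> f i = 0" "\<And>i. small (f i) i"
  shows "tsum f = (\<Sum>i\<le>M. f i)"
proof (rule ser_eqI)
  fix v n
  have "cf (tsum f) v n = (\<Sum>i\<le>v+n+M. cf (f i) v n)" by (rule cf_tsum_ge) (use assms in auto)
  also have "\<dots> = (\<Sum>i\<le>M. cf (f i) v n)" by (rule sum.mono_neutral_right) (use assms in auto)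
  finally show "cf (tsum f) v n = cf (\<Sum>i\<le>M. f i) v n" by (simp add: cf_sum)
qed

lemma tsum_multiples:
  assumes "a \<ge> 1" "\<And>k. small (h k) k"
  shows "tsum (\<lambda>m. h (a * m)) = tsum (\<lambda>k. if a dvd k then h k else 0)"
proof (rule ser_eqI)
  fix v n
  have sm: "small (h (a * m)) m" for m using assms by (intro small_mono[OF assms(2)]) auto
  have "cf (tsum (\<lambda>m. h (a * m))) v n = (\<Sum>m\<le>v+n. cf (h (a * m)) v n)" by (simp add: cf_tsum)
  also have "\<dots> = (\<Sum>k\<in>(\<lambda>m. a * m) ` {..v+n}. cf (h k) v n)"
    by (subst sum.reindex) (use assms in \<open>auto simp: inj_on_def\<close>)
  also have "\<dots> = (\<Sum>k\<in>{k\<in>{..a*(v+n)}. a dvd k}. cf (h k) v n)"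
  proof (rule sum.cong[OF Set.set_eqI refl])
    fix k show "k \<in> (\<lambda>m. a * m) ` {..v+n} \<longleftrightarrow> k \<in> {k\<in>{..a*(v+n)}. a dvd k}"
    proof
      assume "k \<in> {k\<in>{..a*(v+n)}. a dvd k}"
      then have "a dvd k" "k \<le> a * (v+n)" by auto
      then obtain m where "k = a * m" "a * m \<le> a * (v+n)" by (metis dvdE)
      then show "k \<in> (\<lambda>m. a * m) ` {..v+n}" using assms by (intro image_eqI[of _ _ m]) auto
    qed auto
  qed
  also have "\<dots> = (\<Sum>k\<le>a*(v+n). cf (if a dvd k then h k else 0) v n)"
    by (subst sum.inter_filter) (auto intro!: sum.cong)
  also have "\<dots> = cf (tsum (\<lambda>k. if a dvd k then h k else 0)) v n"
    by (rule cf_tsum_ge[symmetric]) (use assms in auto)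
  finally show "cf (tsum (\<lambda>m. h (a * m))) v n = cf (tsum (\<lambda>k. if a dvd k then h k else 0)) v n" .
qed

lemma cf_mult_tsum:
  assumes "\<And>i. small (f i) i" "v + n \<le> N"
  shows "cf (H * tsum f) v n = (\<Sum>i\<le>N. cf (H * f i) v n)"
  unfolding tsum_mult'[OF assms(1)] by (rule cf_tsum_ge) (use assms in \<open>auto intro: small_mult_right\<close>)

lemma sum_PiE_insert:
  assumes "a \<notin> I"
  shows "(\<Sum>m\<in>PiE (insert a I) S. h m) = (\<Sum>g\<in>PiE I S. \<Sum>y\<in>S a. h (g(a := y)))"
proof -
  have "(\<Sum>m\<in>PiE (insert a I) S. h m) = (\<Sum>(y, g)\<in>S a \<times> PiE I S. h (g(a := y)))"
    unfolding PiE_insert_eq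
    by (subst sum.reindex[OF inj_combinator[OF assms]]) (simp add: case_prod_unfold)
  also have "\<dots> = (\<Sum>y\<in>S a. \<Sum>g\<in>PiE I S. h (g(a := y)))"
    by (rule sum.cartesian_product[symmetric])
  also have "\<dots> = (\<Sum>g\<in>PiE I S. \<Sum>y\<in>S a. h (g(a := y)))"
    by (rule sum.swap)
  finally show ?thesis .
qed

text \<open>On a single coefficient every factor can be cut at the same \<open>K\<close>, so the
  expanded product runs over a finite box of index functions. The free factor \<open>G\<close>
  absorbs one series at a time in the induction.\<close>

lemma cf_prod_tsum:
  assumes "finite I" "\<And>k n. k \<in> I \<Longrightarrow> small (f k n) n" "v + N \<le> K"
  shows "cf (G * (\<Prod>k\<in>I. tsum (f k))) v N = (\<Sum>m\<in>I \<rightarrow>\<^sub>E {..K}. cf (G * (\<Prod>k\<in>I. f k (m k))) v N)"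
  using assms(1,2)
proof (induction I arbitrary: G rule: finite_induct)
  case empty
  then show ?case by simp
next
  case (insert a I)
  have "cf (G * (\<Prod>k\<in>insert a I. tsum (f k))) v N = cf ((G * tsum (f a)) * (\<Prod>k\<in>I. tsum (f k))) v N"
    using insert by (simp add: mult_ac)
  also have "\<dots> = (\<Sum>m\<in>I \<rightarrow>\<^sub>E {..K}. cf ((G * tsum (f a)) * (\<Prod>k\<in>I. f k (m k))) v N)"
    by (rule insert.IH) (use insert.prems in auto)
  also have "\<dots> = (\<Sum>m\<in>I \<rightarrow>\<^sub>E {..K}. cf ((G * (\<Prod>k\<in>I. f k (m k))) * tsum (f a)) v N)"
    by (simp add: mult_ac)
  also have "\<dots> = (\<Sum>m\<in>I \<rightarrow>\<^sub>E {..K}. \<Sum>i\<le>K. cf ((G * (\<Prod>k\<in>I. f k (m k))) * f a i) v N)"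
    by (intro sum.cong refl cf_mult_tsum) (use insert.prems assms in auto)
  also have "\<dots> = (\<Sum>m\<in>I \<rightarrow>\<^sub>E {..K}. \<Sum>i\<le>K. cf (G * (\<Prod>k\<in>insert a I. f k ((m(a := i)) k))) v N)"
  proof (intro sum.cong refl)
    fix m i
    have "(\<Prod>k\<in>I. f k ((m(a := i)) k)) = (\<Prod>k\<in>I. f k (m k))"
      by (rule prod.cong) (use insert.hyps in auto)
    then show "cf ((G * (\<Prod>k\<in>I. f k (m k))) * f a i) v N = cf (G * (\<Prod>k\<in>insert a I. f k ((m(a := i)) k))) v N"
      using insert.hyps by (simp add: mult_ac)
  qed
  also have "\<dots> = (\<Sum>m\<in>insert a I \<rightarrow>\<^sub>E {..K}. cf (G * (\<Prod>k\<in>insert a I. f k (m k))) v N)"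
    by (rule sum_PiE_insert[OF insert.hyps(2), symmetric,
          where h = "\<lambda>m. cf (G * (\<Prod>k\<in>insert a I. f k (m k))) v N"])
  finally show ?case .
qed

section \<open>Euler derivations and first-order linear equations\<close>

text \<open>The derivation \<open>p s \<partial>/\<partial>s + q t \<partial>/\<partial>t\<close>.\<close>

definition Eul :: "nat \<Rightarrow> nat \<Rightarrow> ser \<Rightarrow> ser" where
  "Eul p q F = Abs_fps (\<lambda>v. Abs_fps (\<lambda>n. of_nat (p * v + q * n) * cf F v n))"

lemma cf_Eul [simp]: "cf (Eul p q F) v n = of_nat (p * v + q * n) * cf F v n"
  by (simp add: Eul_def)

lemma Eul_add: "Eul p q (F + G) = Eul p q F + Eul p q G"
  and Eul_diff: "Eul p q (F - G) = Eul p q F - Eul p q G"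
  and Eul_minus: "Eul p q (- F) = - Eul p q F"
  and Eul_0 [simp]: "Eul p q 0 = 0"
  and Eul_scalar: "Eul p q (scalar c * F) = scalar c * Eul p q F"
  and Eul_1 [simp]: "Eul p q 1 = 0"
proof -
  show "Eul p q (F + G) = Eul p q F + Eul p q G" "Eul p q (F - G) = Eul p q F - Eul p q G"
    "Eul p q (- F) = - Eul p q F" "Eul p q 0 = 0" "Eul p q (scalar c * F) = scalar c * Eul p q F"
    by (rule ser_eqI; simp add: distrib_left right_diff_distrib del: of_nat_add of_nat_mult)+
  show "Eul p q 1 = 0" by (rule ser_eqI) auto
qed

lemma Eul_mult: "Eul p q (F * G) = Eul p q F * G + F * Eul p q G"
proof (rule ser_eqI)
  fix v n
  have "of_nat (p * v + q * n) * (cf F i j * cf G (v - i) (n - j)) =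
     of_nat (p * i + q * j) * cf F i j * cf G (v - i) (n - j)
      + cf F i j * (of_nat (p * (v - i) + q * (n - j)) * cf G (v - i) (n - j))"
    if ij: "i \<le> v" "j \<le> n" for i j
  proof -
    have "p * v + q * n = (p * i + q * j) + (p * (v - i) + q * (n - j))"
    proof -
      obtain v' n' where "v = i + v'" "n = j + n'" using le_Suc_ex[OF ij(1)] le_Suc_ex[OF ij(2)] by metis
      then show ?thesis by (simp add: distrib_left)
    qed
    then have "(of_nat (p * v + q * n) :: rat) = of_nat (p * i + q * j) + of_nat (p * (v - i) + q * (n - j))"
      by (metis of_nat_add)
    then show ?thesis by (simp add: algebra_simps del: of_nat_add of_nat_mult)
  qed
  note * = this
  have "cf (Eul p q (F * G)) v n =
      (\<Sum>i\<le>v. \<Sum>j\<le>n. of_nat (p * v + q * n) * (cf F i j * cf G (v - i) (n - j)))"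
    by (simp only: cf_Eul cf_mult sum_distrib_left)
  also have "\<dots> = (\<Sum>i\<le>v. \<Sum>j\<le>n. of_nat (p * i + q * j) * cf F i j * cf G (v - i) (n - j)
      + cf F i j * (of_nat (p * (v - i) + q * (n - j)) * cf G (v - i) (n - j)))"
    by (intro sum.cong refl *) auto
  also have "\<dots> = cf (Eul p q F * G + F * Eul p q G) v n"
    by (simp only: cf_Eul cf_mult sum.distrib fps_add_nth)
  finally show "cf (Eul p q (F * G)) v n = cf (Eul p q F * G + F * Eul p q G) v n" .
qed

lemma Eul_power: "Eul p q (F ^ Suc n) = of_nat (Suc n) * F ^ n * Eul p q F"
  by (induct n) (simp_all add: Eul_mult algebra_simps)

lemma Eul_tsum: "Eul p q (tsum f) = tsum (\<lambda>i. Eul p q (f i))"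
  by (rule ser_eqI) (simp add: cf_tsum sum_distrib_left)

lemma Eul_sum: "Eul p q (sum f A) = (\<Sum>x\<in>A. Eul p q (f x))"
  by (rule ser_eqI) (simp add: cf_sum sum_distrib_left)

lemma small_Eul: "small F d \<Longrightarrow> small (Eul p q F) d"
  by (simp add: small_def)

lemma small1_Eul: "small (Eul p q F) 1"
  by (simp add: small_def)

text \<open>The difference of two solutions solves the same equation. The right side has order one
  more than the difference, while on the left each coefficient is multiplied by its total degree,
  which is nonzero in positive degree; hence the order grows without bound.\<close>

lemma Eul_unique:
  assumes F: "Eul 1 1 F = F * A" and G: "Eul 1 1 G = G * A" and A: "small A 1"
    and 0: "cf F 0 0 = cf G 0 0"
  shows "F = G"
proof -
  define H where "H = F - G"
  have H: "Eul 1 1 H = H * A" by (simp add: H_def Eul_diff F G algebra_simps)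
  have "small H (Suc d)" for d
  proof (induct d)
    case 0
    then show ?case using \<open>cf F 0 0 = cf G 0 0\<close> by (simp add: small_def H_def)
  next
    case (Suc d)
    have "small (Eul 1 1 H) (Suc (Suc d))" using small_mult[OF Suc A] unfolding H by (simp add: One_nat_def)
    then have "of_nat (v + n) * cf H v n = 0" if "v + n < Suc (Suc d)" for v n
      using that smallD by fastforce
    then show ?case using Suc
      by (intro smallI) (metis of_nat_eq_0_iff mult_eq_0_iff smallD zero_less_Suc)
  qed
  then have "H = 0" by (intro small_all_eq_0) (meson le_SucI order_refl small_mono)
  then show ?thesis by (simp add: H_def)
qed

text \<open>The same argument by degree in \<open>s\<close> alone. The initial value is now the
  whole coefficient of \<open>s^0\<close>, a series in \<open>t\<close>.\<close>

lemma Eul_unique_s: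
  assumes F: "Eul 1 0 F = F * A" and G: "Eul 1 0 G = G * A" and A: "fps_nth A 0 = 0"
    and 0: "fps_nth F 0 = fps_nth G 0"
  shows "F = G"
proof -
  define H where "H = F - G"
  have H: "Eul 1 0 H = H * A" by (simp add: H_def Eul_diff F G algebra_simps)
  have "fps_nth H v = 0" for v
  proof (induct v rule: less_induct)
    case (less v)
    show ?case
    proof (cases "v = 0")
      case False
      have "fps_nth (Eul 1 0 H) v = (\<Sum>i=0..v. fps_nth H i * fps_nth A (v - i))"
        unfolding H by (simp add: fps_mult_nth)
      also have "\<dots> = 0"
      proof (intro sum.neutral ballI)
        fix i assume "i \<in> {0..v}"
        then show "fps_nth H i * fps_nth A (v - i) = 0" using less A by (cases "i = v") auto
      qed
      finally have "cf (Eul 1 0 H) v n = 0" for n by simp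
      then have "cf H v n = 0" for n using False by simp
      then show ?thesis by (intro fps_ext) simp
    qed (use 0 in \<open>simp add: H_def\<close>)
  qed
  then have "H = 0" by (intro fps_ext) simp
  then show ?thesis by (simp add: H_def)
qed

section \<open>Exponential, geometric and logarithmic series\<close>

definition EXP :: "ser \<Rightarrow> ser" where
  "EXP Z = tsum (\<lambda>i. scalar (1 / fact i) * Z ^ i)"

lemma small_EXP_term: "small Z 1 \<Longrightarrow> small (scalar c * Z ^ i) i"
  by (intro small_mult_right small_power1)

lemma Eul_EXP: assumes "small Z 1" shows "Eul p q (EXP Z) = EXP Z * Eul p q Z"
proof -
  have "Eul p q (EXP Z) = tsum (\<lambda>i. scalar (1 / fact i) * Eul p q (Z ^ i))"
    by (simp add: EXP_def Eul_tsum Eul_scalar)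
  also have "\<dots> = tsum (\<lambda>i. scalar (1 / fact (Suc i)) * Eul p q (Z ^ Suc i))"
    by (subst tsum_Suc) (auto intro!: small_mult_right small_Eul small_power1 assms)
  also have "\<dots> = tsum (\<lambda>i. (scalar (1 / fact i) * Z ^ i) * Eul p q Z)"
    by (intro arg_cong[where f=tsum] ext)
      (simp add: Eul_power of_nat_ser mult.assoc[symmetric] scalar_mult[symmetric] del: power_Suc of_nat_Suc)
  also have "\<dots> = EXP Z * Eul p q Z"
    unfolding EXP_def by (rule tsum_mult[symmetric]) (rule small_EXP_term[OF assms])
  finally show ?thesis .
qed

lemma cf_EXP_00 [simp]: "cf (EXP Z) 0 0 = 1"
  by (simp add: EXP_def cf_tsum)

lemma EXP_0 [simp]: "EXP 0 = 1"
proof -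
  have "EXP 0 = tsum (\<lambda>i. if i = 0 then 1 else 0)"
    unfolding EXP_def by (rule arg_cong[where f=tsum]) (auto simp: power_0_left)
  also have "\<dots> = 1" by (subst tsum_Suc) auto
  finally show ?thesis .
qed

lemma EXP_unique:
  assumes "Eul 1 1 F = F * Eul 1 1 Z" "cf F 0 0 = 1" "small Z 1"
  shows "F = EXP Z"
  by (rule Eul_unique[OF assms(1) Eul_EXP[OF assms(3)] small1_Eul]) (simp add: assms)

text \<open>Both sides satisfy the same equation for \<open>Eul 1 1\<close> and have constant
  coefficient 1.\<close>

lemma EXP_add: assumes "small Y 1" "small Z 1" shows "EXP (Y + Z) = EXP Y * EXP Z"
  by (rule EXP_unique[symmetric])
    (use assms in \<open>auto simp: Eul_mult Eul_EXP Eul_add algebra_simps fps_mult_nth intro: small_add\<close>)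

lemma EXP_sum: "finite A \<Longrightarrow> (\<And>x. x \<in> A \<Longrightarrow> small (f x) 1) \<Longrightarrow> EXP (sum f A) = (\<Prod>x\<in>A. EXP (f x))"
  by (induct A rule: finite_induct) (auto simp: EXP_add small_sum)

lemma EXP_of_nat_mult: "small Z 1 \<Longrightarrow> EXP (of_nat n * Z) = EXP Z ^ n"
  using EXP_sum[of "{..<n}" "\<lambda>_. Z"] by simp

lemma EXP_diff: "small Y 1 \<Longrightarrow> small Z 1 \<Longrightarrow> EXP (Y - Z) * EXP Z = EXP Y"
  by (simp add: EXP_add[symmetric] small_diff)

lemma EXP_nonzero: "EXP Z \<noteq> 0"
  using cf_EXP_00[of Z] by force

lemma EXP_eq_1_plus: assumes "small Z 1"
  shows "EXP Z = 1 + Z * tsum (\<lambda>i. scalar (1 / fact (Suc i)) * Z ^ i)"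
proof -
  have "EXP Z = 1 + tsum (\<lambda>i. Z * (scalar (1 / fact (Suc i)) * Z ^ i))"
    unfolding EXP_def by (subst tsum_Suc[OF small_EXP_term[OF assms]]) (simp add: mult_ac)
  also have "tsum (\<lambda>i. Z * (scalar (1 / fact (Suc i)) * Z ^ i)) = Z * tsum (\<lambda>i. scalar (1 / fact (Suc i)) * Z ^ i)"
    by (rule tsum_mult'[symmetric]) (rule small_EXP_term[OF assms])
  finally show ?thesis .
qed

lemma small_EXP_minus_1: assumes "small Z d" "d \<ge> 1" shows "small (EXP Z - 1) d"
proof -
  have "small Z 1" using assms small_mono by blast
  then show ?thesis by (simp only: EXP_eq_1_plus) (simp add: small_mult_left assms)
qed

text \<open>\<open>EXP Y\<close> is \<open>EXP Z\<close> times \<open>EXP (Y - Z)\<close>, and the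
  latter is 1 up to degree \<open>M\<close>. This is what allows exponents to be truncated or
  completed at will.\<close>

lemma cf_EXP_cong:
  assumes "small Y 1" "small Z 1" "small (Y - Z) (Suc M)" "v + n \<le> M"
  shows "cf (G * EXP Y) v n = cf (G * EXP Z) v n"
proof -
  have "EXP Y = EXP (Y - Z) * EXP Z" using assms by (simp add: EXP_diff)
  then have "G * EXP Y - G * EXP Z = (G * EXP Z) * (EXP (Y - Z) - 1)" by (simp add: algebra_simps)
  moreover have "small ((G * EXP Z) * (EXP (Y - Z) - 1)) (Suc M)"
    using assms by (intro small_mult_right small_EXP_minus_1) auto
  ultimately have "cf (G * EXP Y - G * EXP Z) v n = 0" using assms by (auto intro: smallD)
  then show ?thesis by simp
qed

definition GEO :: "ser \<Rightarrow> ser" where "GEO x = tsum (\<lambda>k. x ^ k)"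

lemma GEO: assumes "small x 1" shows "(1 - x) * GEO x = 1"
proof -
  have "GEO x = 1 + tsum (\<lambda>k. x * x ^ k)"
    unfolding GEO_def using assms by (subst tsum_Suc) (auto intro: small_power1)
  also have "tsum (\<lambda>k. x * x ^ k) = x * GEO x"
    unfolding GEO_def by (rule tsum_mult'[symmetric]) (use assms in \<open>auto intro: small_power1\<close>)
  finally show ?thesis by (simp add: algebra_simps)
qed

text \<open>The series of \<open>- log (1 - x)\<close>; its term \<open>m = 0\<close> vanishes
  because \<open>1 / 0 = 0\<close>.\<close>

definition LOG1 :: "ser \<Rightarrow> ser" where
  "LOG1 x = tsum (\<lambda>m. scalar (1 / of_nat m) * x ^ m)"

lemma small_LOG1: "small x 1 \<Longrightarrow> small (LOG1 x) 1"
  unfolding LOG1_def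
  apply (rule small_tsum)
  subgoal for i by (cases "i = 0") (auto intro!: small_mult_right small_mono[OF small_power1])
  done

lemma EXP_LOG1: assumes "small x 1" shows "EXP (- LOG1 x) = 1 - x"
proof (rule EXP_unique[symmetric])
  have "Eul 1 1 (LOG1 x) = tsum (\<lambda>m. scalar (1 / of_nat m) * Eul 1 1 (x ^ m))"
    by (simp add: LOG1_def Eul_tsum Eul_scalar)
  also have "\<dots> = tsum (\<lambda>i. scalar (1 / of_nat (Suc i)) * Eul 1 1 (x ^ Suc i))"
    by (subst tsum_Suc) (auto intro!: small_mult_right small_Eul small_power1 assms)
  also have "\<dots> = tsum (\<lambda>i. x ^ i * Eul 1 1 x)"
    by (intro arg_cong[where f=tsum] ext)
      (simp add: Eul_power of_nat_ser mult.assoc[symmetric] scalar_mult[symmetric] del: power_Suc of_nat_Suc)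
  also have "\<dots> = GEO x * Eul 1 1 x"
    unfolding GEO_def by (rule tsum_mult[symmetric]) (rule small_power1[OF assms])
  finally have "(1 - x) * Eul 1 1 (LOG1 x) = ((1 - x) * GEO x) * Eul 1 1 x" by (simp only: mult.assoc)
  then show "Eul 1 1 (1 - x) = (1 - x) * Eul 1 1 (- LOG1 x)"
    using GEO[OF assms] by (simp add: Eul_minus Eul_diff)
next
  show "cf (1 - x) 0 0 = 1" using assms by (simp add: small_def)
  show "small (- LOG1 x) 1" by (intro small_minus small_LOG1 assms)
qed

section \<open>Gaussian pairing\<close>

text \<open>Third variant, by degree in the second variable, with initial values along
  \<open>n = 0\<close>. It treats series in \<open>s\<close> as constants, which is needed once
  vertex weights involving \<open>s\<close> occur as coefficients.\<close>

lemma Eul_unique_u: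
  assumes F: "Eul 0 1 F = F * A" and G: "Eul 0 1 G = G * A" and A: "\<And>v. cf A v 0 = 0"
    and 0: "\<And>v. cf F v 0 = cf G v 0"
  shows "F = G"
proof -
  define H where "H = F - G"
  have H: "Eul 0 1 H = H * A" by (simp add: H_def Eul_diff F G algebra_simps)
  have "\<forall>v. cf H v n = 0" for n
  proof (induct n rule: less_induct)
    case (less n)
    show ?case
    proof (cases "n = 0")
      case False
      show ?thesis
      proof
        fix v
        have "cf (Eul 0 1 H) v n = (\<Sum>i\<le>v. \<Sum>j\<le>n. cf H i j * cf A (v - i) (n - j))"
          unfolding H by (rule cf_mult)
        also have "\<dots> = 0"
        proof (intro sum.neutral ballI)
          fix i j assume "j \<in> {..n}"
          then show "cf H i j * cf A (v - i) (n - j) = 0" using less A by (cases "j = n") auto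
        qed
        finally show "cf H v n = 0" using False by simp
      qed
    qed (use 0 in \<open>simp add: H_def\<close>)
  qed
  then have "H = 0" by (intro ser_eqI) simp
  then show ?thesis by (simp add: H_def)
qed

lemma cf_mult_u0: "(\<And>v. cf Z v 0 = 0) \<Longrightarrow> cf (Z * W) v 0 = 0"
  by (simp add: cf_mult)

lemma cf_EXP_u0: assumes "small Z 1" "\<And>v. cf Z v 0 = 0" shows "cf (EXP Z) v 0 = cf 1 v 0"
  unfolding EXP_eq_1_plus[OF assms(1)] by (simp add: cf_mult_u0 assms(2) del: fps_one_nth)

section \<open>Hermite coefficients and Mehler's formula\<close>

definition PS :: "ser \<Rightarrow> (nat \<Rightarrow> ser) \<Rightarrow> ser" where
  "PS x f = tsum (\<lambda>n. f n * x ^ n)"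

lemma small_PS_term: "small x 1 \<Longrightarrow> small (f n * x ^ n) n"
  by (intro small_mult_right small_power1)

lemma PS_add: "PS x (\<lambda>n. f n + g n) = PS x f + PS x g"
  by (simp add: PS_def distrib_right tsum_add)

lemma PS_mult: "small x 1 \<Longrightarrow> PS x (\<lambda>n. c * f n) = c * PS x f"
  unfolding PS_def by (subst tsum_mult'[OF small_PS_term]) (simp_all add: mult.assoc)

lemma PS_Suc: assumes "small x 1" shows "PS x f = f 0 + x * PS x (\<lambda>n. f (Suc n))"
proof -
  have "PS x f = f 0 + tsum (\<lambda>n. x * (f (Suc n) * x ^ n))"
    unfolding PS_def by (subst tsum_Suc[OF small_PS_term[OF assms]]) (simp add: mult_ac)
  also have "tsum (\<lambda>n. x * (f (Suc n) * x ^ n)) = x * PS x (\<lambda>n. f (Suc n))"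
    unfolding PS_def by (rule tsum_mult'[symmetric]) (rule small_PS_term[OF assms])
  finally show ?thesis .
qed

lemma Eul_x_power: assumes "Eul p q x = of_nat k * x"
  shows "Eul p q (x ^ n) = of_nat (n * k) * x ^ n"
proof (cases n)
  case (Suc m)
  then show ?thesis using assms by (simp only: Eul_power) (simp add: algebra_simps)
qed simp

lemma Eul_PS: assumes "Eul p q x = of_nat k * x" "\<And>n. Eul p q (f n) = 0"
  shows "Eul p q (PS x f) = of_nat k * PS x (\<lambda>n. of_nat n * f n)"
proof -
  have "Eul p q (PS x f) = tsum (\<lambda>n. of_nat k * (of_nat n * f n * x ^ n))"
    unfolding PS_def Eul_tsum by (simp add: Eul_mult assms Eul_x_power[OF assms(1)] mult_ac)
  also have "\<dots> = of_nat k * PS x (\<lambda>n. of_nat n * f n)"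
    unfolding PS_def by (simp only: of_nat_ser tsum_scalar)
  finally show ?thesis .
qed

lemma cf_PS_u0: assumes "small x 1" "\<And>v. cf x v 0 = 0" shows "cf (PS x f) v 0 = cf (f 0) v 0"
  by (subst PS_Suc[OF assms(1)]) (simp add: cf_mult_u0 assms(2))

text \<open>\<open>herm a b n\<close> is the coefficient of \<open>x^n\<close> in \<open>exp (b x + a x^2 / 2)\<close>.\<close>

fun herm :: "ser \<Rightarrow> ser \<Rightarrow> nat \<Rightarrow> ser" where
  "herm a b 0 = 1"
| "herm a b (Suc 0) = b"
| "herm a b (Suc (Suc n)) = scalar (1 / of_nat (Suc (Suc n))) * (b * herm a b (Suc n) + a * herm a b n)"

lemma herm_Suc_Suc: "of_nat (Suc (Suc n)) * herm a b (Suc (Suc n)) = b * herm a b (Suc n) + a * herm a b n"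
  by (simp add: of_nat_ser mult.assoc[symmetric] scalar_mult[symmetric] del: of_nat_Suc)

lemma herm_scalar: "\<exists>c. herm (scalar a) (scalar b) n = scalar c"
  by (induct n rule: herm.induct[of "\<lambda>a b. \<lambda>n. \<exists>c. herm (scalar x) (scalar y) n = scalar c" for x y])
    (metis scalar_1 herm.simps scalar_mult scalar_add)+

lemma Eul_scalar_const [simp]: "Eul p q (scalar c) = 0"
  using Eul_scalar[of p q c 1] by simp

lemma Eul_herm: assumes "Eul p q a = 0" "Eul p q b = 0" shows "Eul p q (herm a b n) = 0"
proof (induct n rule: less_induct)
  case (less n)
  show ?case
  proof (cases n)
    case (Suc m)
    then show ?thesis using less assms by (cases m) (auto simp: Eul_scalar Eul_add Eul_mult)
  qed simp
qed

lemma herm_rescale: "herm (a * y ^ 2) (b * y) n = herm a b n * y ^ n"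
proof (induct n rule: less_induct)
  case (less n)
  show ?case
  proof (cases n)
    case (Suc m)
    then show ?thesis
      using less[of m] less[of "m - 1"] by (cases m) (auto simp: algebra_simps power2_eq_square)
  qed simp
qed

text \<open>An expansion variable without constant term in \<open>u\<close> that is an eigenvector
  of the \<open>u\<close>-derivation. The instances are \<open>var_t ^ k\<close> and half of
  \<open>var_t ^ 2\<close>, where \<open>var_t\<close> is read as \<open>u\<close>.\<close>

locale gauss_var =
  fixes x :: ser and k :: nat
  assumes x1: "small x 1" and x0: "\<And>v. cf x v 0 = 0" and Ex: "Eul 0 1 x = of_nat k * x"
begin

lemma Ex2: "Eul 0 1 (x\<^sup>2) = of_nat (2 * k) * x\<^sup>2"
  using Eul_x_power[OF Ex, of 2] by simp

text \<open>The three-term recursion of \<open>herm\<close> is the coefficient form of the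
  differential equation of the exponential.\<close>

lemma EXP_herm:
  assumes "Eul 0 1 a = 0" "Eul 0 1 b = 0"
  shows "EXP (b * x + scalar (1/2) * a * x\<^sup>2) = PS x (herm a b)"
proof -
  let ?Z = "b * x + scalar (1/2) * a * x\<^sup>2"
  have s: "small ?Z 1"
    using x1 by (auto simp: power2_eq_square mult.assoc[symmetric] intro!: small_add small_mult_right)
  have half: "scalar (1/2) * of_nat (2 * k) = of_nat k"
    by (simp add: of_nat_ser flip: scalar_mult)
  have EZ: "Eul 0 1 ?Z = of_nat k * (b * x + a * x\<^sup>2)"
  proof -
    have "Eul 0 1 ?Z = of_nat k * (b * x) + (scalar (1/2) * of_nat (2 * k)) * (a * x\<^sup>2)"
      by (simp only: Eul_add mult.assoc Eul_scalar) (simp add: Eul_mult assms Ex Ex2 mult_ac)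
    then show ?thesis by (simp only: half distrib_left)
  qed
  have rec: "PS x (\<lambda>n. of_nat n * herm a b n) = (b * x + a * x\<^sup>2) * PS x (herm a b)"
  proof -
    have "PS x (\<lambda>n. of_nat n * herm a b n) = x * PS x (\<lambda>n. of_nat (Suc n) * herm a b (Suc n))"
      by (subst PS_Suc[OF x1]) simp
    also have "PS x (\<lambda>n. of_nat (Suc n) * herm a b (Suc n)) =
        b + x * PS x (\<lambda>n. b * herm a b (Suc n) + a * herm a b n)"
      by (subst PS_Suc[OF x1]) (simp only: herm_Suc_Suc, simp)
    also have "\<dots> = b * (1 + x * PS x (\<lambda>n. herm a b (Suc n))) + a * x * PS x (herm a b)"
      by (simp add: PS_add PS_mult[OF x1] algebra_simps)
    also have "1 + x * PS x (\<lambda>n. herm a b (Suc n)) = PS x (herm a b)"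
      by (subst (2) PS_Suc[OF x1]) simp
    finally show ?thesis by (simp add: algebra_simps power2_eq_square)
  qed
  show ?thesis
  proof (rule Eul_unique_u[OF Eul_EXP[OF s]])
    show "Eul 0 1 (PS x (herm a b)) = PS x (herm a b) * Eul 0 1 ?Z"
      by (simp only: Eul_PS[OF Ex Eul_herm[OF assms]] rec EZ) (simp only: mult_ac)
    have "?Z = x * (b + scalar (1/2) * a * x)"
      by (simp add: power2_eq_square algebra_simps)
    then have z0: "cf ?Z v 0 = 0" for v
      by (simp only: cf_mult_u0 x0)
    show "cf (Eul 0 1 ?Z) v 0 = 0" for v by simp
    show "cf (EXP ?Z) v 0 = cf (PS x (herm a b)) v 0" for v
      by (simp add: cf_EXP_u0[OF s z0] cf_PS_u0 x1 x0)
  qed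
qed

text \<open>Mehler's formula in unnormalised form: \<open>herm\<close> is a Hermite polynomial
  divided by \<open>n!\<close>, and the \<open>LOG1\<close> term is the factor
  \<open>(1 - a c x^2)^(-1/2)\<close>. It evaluates the Gaussian integral pairing two exponentials
  of quadratic polynomials. The proof derives a first-order equation from the recursions of the two
  sequences.\<close>

theorem gaussian_pairing:
  assumes a: "Eul 0 1 a = 0" and b: "Eul 0 1 b = 0" and c: "Eul 0 1 c = 0" and d: "Eul 0 1 d = 0"
  shows "PS x (\<lambda>n. of_nat (fact n) * herm a b n * herm c d n) =
    EXP ((b * d * x + scalar (1/2) * (a * d\<^sup>2 + c * b\<^sup>2) * x\<^sup>2) * GEO (a * c * x\<^sup>2)
         + scalar (1/2) * LOG1 (a * c * x\<^sup>2))" (is "?Y = EXP ?Z")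
proof -
  define p where "p = herm a b"
  define q where "q = herm c d"
  define y where "y = a * c * x\<^sup>2"
  define G where "G = GEO y"
  have p01: "p 0 = 1" "p (Suc 0) = b" and q01: "q 0 = 1" "q (Suc 0) = d"
    by (simp_all add: p_def q_def)
  have pr: "of_nat (Suc (Suc n)) * p (Suc (Suc n)) = b * p (Suc n) + a * p n"
    and qr: "of_nat (Suc (Suc n)) * q (Suc (Suc n)) = d * q (Suc n) + c * q n" for n
    unfolding p_def q_def by (rule herm_Suc_Suc)+
  \<comment> \<open>Pairings with one or two indices shifted. The recursions make them, together
    with \<open>Y\<close> and its derivative \<open>Y'\<close>, a closed linear system with
    coefficients polynomial in \<open>x\<close>.\<close>
  define V where "V = PS x (\<lambda>n. of_nat (fact (Suc n)) * p n * q (Suc n))"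
  define W where "W = PS x (\<lambda>n. of_nat (fact (Suc n)) * p (Suc n) * q n)"
  define T where "T = PS x (\<lambda>n. of_nat (fact (Suc (Suc n))) * p n * q (Suc (Suc n)))"
  define Y where "Y = PS x (\<lambda>n. of_nat (fact n) * p n * q n)"
  define Y' where "Y' = PS x (\<lambda>n. of_nat n * (of_nat (fact n) * p n * q n))"
  have Y: "Y = 1 + x * PS x (\<lambda>n. of_nat (fact (Suc n)) * p (Suc n) * q (Suc n))"
    unfolding Y_def by (subst PS_Suc[OF x1]) (simp add: p01 q01)
  have V: "V = d * Y + c * x * W"
  proof -
    have "V = d + x * PS x (\<lambda>n. of_nat (fact (Suc n)) * p (Suc n) * (of_nat (Suc (Suc n)) * q (Suc (Suc n))))"
      unfolding V_def by (subst PS_Suc[OF x1]) (simp add: p01 q01 algebra_simps)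
    also have "PS x (\<lambda>n. of_nat (fact (Suc n)) * p (Suc n) * (of_nat (Suc (Suc n)) * q (Suc (Suc n))))
        = PS x (\<lambda>n. d * (of_nat (fact (Suc n)) * p (Suc n) * q (Suc n))
               + c * (of_nat (fact (Suc n)) * p (Suc n) * q n))"
      unfolding qr by (simp add: algebra_simps)
    finally show ?thesis unfolding Y W_def
      by (simp only: PS_add PS_mult[OF x1]) (simp add: algebra_simps)
  qed
  have W: "W = b * Y + a * x * V"
  proof -
    have "W = b + x * PS x (\<lambda>n. of_nat (fact (Suc n)) * (of_nat (Suc (Suc n)) * p (Suc (Suc n))) * q (Suc n))"
      unfolding W_def by (subst PS_Suc[OF x1]) (simp add: p01 q01 algebra_simps)
    also have "PS x (\<lambda>n. of_nat (fact (Suc n)) * (of_nat (Suc (Suc n)) * p (Suc (Suc n))) * q (Suc n))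
        = PS x (\<lambda>n. b * (of_nat (fact (Suc n)) * p (Suc n) * q (Suc n))
               + a * (of_nat (fact (Suc n)) * p n * q (Suc n)))"
      unfolding pr by (simp add: algebra_simps)
    finally show ?thesis unfolding Y V_def
      by (simp only: PS_add PS_mult[OF x1]) (simp add: algebra_simps)
  qed
  have T: "T = d * V + c * (Y' + Y)"
  proof -
    have "T = PS x (\<lambda>n. of_nat (fact (Suc n)) * p n * (of_nat (Suc (Suc n)) * q (Suc (Suc n))))"
      unfolding T_def by (simp add: algebra_simps)
    also have "\<dots> = PS x (\<lambda>n. d * (of_nat (fact (Suc n)) * p n * q (Suc n))
               + c * (of_nat n * (of_nat (fact n) * p n * q n) + of_nat (fact n) * p n * q n))"
      unfolding qr by (simp add: algebra_simps)
    finally show ?thesis unfolding V_def Y_def Y'_def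
      by (simp only: PS_add PS_mult[OF x1])
  qed
  have Y': "Y' = b * x * V + a * x\<^sup>2 * T"
  proof -
    have "Y' = x * PS x (\<lambda>n. of_nat (fact (Suc n)) * (of_nat (Suc n) * p (Suc n)) * q (Suc n))"
      unfolding Y'_def by (subst PS_Suc[OF x1]) (simp add: algebra_simps)
    also have "PS x (\<lambda>n. of_nat (fact (Suc n)) * (of_nat (Suc n) * p (Suc n)) * q (Suc n))
       = b * d + x * PS x (\<lambda>n. of_nat (fact (Suc (Suc n))) * (of_nat (Suc (Suc n)) * p (Suc (Suc n))) * q (Suc (Suc n)))"
      by (subst PS_Suc[OF x1]) (simp add: p01 q01)
    also have "PS x (\<lambda>n. of_nat (fact (Suc (Suc n))) * (of_nat (Suc (Suc n)) * p (Suc (Suc n))) * q (Suc (Suc n)))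
       = PS x (\<lambda>n. b * (of_nat (fact (Suc (Suc n))) * p (Suc n) * q (Suc (Suc n)))
                + a * (of_nat (fact (Suc (Suc n))) * p n * q (Suc (Suc n))))"
      unfolding pr by (simp add: algebra_simps)
    also have "\<dots> = b * PS x (\<lambda>n. of_nat (fact (Suc (Suc n))) * p (Suc n) * q (Suc (Suc n))) + a * T"
      unfolding T_def by (simp only: PS_add PS_mult[OF x1])
    finally have "Y' = x * (b * (d + x * PS x (\<lambda>n. of_nat (fact (Suc (Suc n))) * p (Suc n) * q (Suc (Suc n)))) + a * x * T)"
      by (simp add: algebra_simps)
    also have "d + x * PS x (\<lambda>n. of_nat (fact (Suc (Suc n))) * p (Suc n) * q (Suc (Suc n))) = V"
      unfolding V_def by (subst (2) PS_Suc[OF x1]) (simp add: p01 q01)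
    finally show ?thesis by (simp add: algebra_simps power2_eq_square)
  qed
  define R where "R = (b * x + a * d * x\<^sup>2) * (d + b * c * x) + y * (1 - y)"
  have DV: "(1 - y) * V = (d + b * c * x) * Y"
    using V W unfolding y_def power2_eq_square by Groebner_Basis.algebra
  have DY: "(1 - y) * Y' = (b * x + a * d * x\<^sup>2) * V + y * Y"
    using Y' T unfolding y_def power2_eq_square by Groebner_Basis.algebra
  \<comment> \<open>Eliminating \<open>V\<close> leaves one first-order equation for
    \<open>Y\<close>; \<open>R / (1 - y)^2\<close> has to be the logarithmic derivative of the
    claimed exponential, up to the factor \<open>K\<close>.\<close>
  have main: "(1 - y)\<^sup>2 * Y' = R * Y"
    using DV DY unfolding R_def power2_eq_square by Groebner_Basis.algebra
  have x21: "small (x\<^sup>2) 1" using x1 by (simp add: power2_eq_square small_mult_right)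
  have y1: "small y 1" unfolding y_def by (intro small_mult_right x21)
  have G: "(1 - y) * G = 1" unfolding G_def by (rule GEO[OF y1])
  define B where "B = b * d * x + scalar (1/2) * (a * d\<^sup>2 + c * b\<^sup>2) * x\<^sup>2"
  define K where "K = (of_nat k :: ser)"
  have Ey: "Eul 0 1 y = 2 * K * y"
    unfolding y_def K_def by (simp add: Eul_mult a c Ex2 mult_ac)
  have "Eul 0 1 ((1 - y) * G) = 0" by (simp add: G)
  then have EG: "(1 - y) * Eul 0 1 G = 2 * K * y * G"
    by (simp add: Eul_mult Eul_diff Ey algebra_simps)
  have EB: "Eul 0 1 B = K * (b * d * x + (a * d\<^sup>2 + c * b\<^sup>2) * x\<^sup>2)"
  proof -
    have "Eul 0 1 B = K * (b * d * x) + (scalar (1/2) * 2) * (K * (a * d\<^sup>2 + c * b\<^sup>2) * x\<^sup>2)"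
      unfolding B_def K_def
      by (simp only: Eul_add mult.assoc Eul_scalar)
        (simp add: Eul_mult Eul_add a b c d Ex Ex2 power2_eq_square algebra_simps)
    moreover have "scalar (1/2) * 2 = 1"
      using scalar_mult[of "1/2" 2] of_nat_ser[of 2] by simp
    ultimately show ?thesis by (simp only: mult_1) (simp add: algebra_simps)
  qed
  have Elog: "(1 - y) * Eul 0 1 (LOG1 y) = 2 * K * y"
  proof -
    have "Eul 0 1 (EXP (- LOG1 y)) = EXP (- LOG1 y) * Eul 0 1 (- LOG1 y)"
      by (rule Eul_EXP) (intro small_minus small_LOG1 y1)
    then show ?thesis unfolding EXP_LOG1[OF y1]
      by (simp add: Eul_diff Eul_minus Ey)
  qed
  have half2: "scalar (1/2) * 2 = 1"
    using scalar_mult[of "1/2" 2] of_nat_ser[of 2] by simp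
  have Z: "?Z = B * G + scalar (1/2) * LOG1 y" unfolding B_def G_def y_def ..
  have EZ: "(1 - y)\<^sup>2 * Eul 0 1 ?Z = K * R"
  proof -
    define h where "h = scalar (1/2)"
    have h: "h * 2 = 1" using half2 by (simp add: h_def)
    have e: "Eul 0 1 ?Z = Eul 0 1 B * G + B * Eul 0 1 G + h * Eul 0 1 (LOG1 y)"
      unfolding Z h_def by (simp add: Eul_add Eul_mult Eul_scalar)
    have "(1 - y)\<^sup>2 * Eul 0 1 ?Z = (1 - y) * Eul 0 1 B * ((1 - y) * G) + B * (1 - y) * ((1 - y) * Eul 0 1 G)
        + h * (1 - y) * ((1 - y) * Eul 0 1 (LOG1 y))"
      unfolding e by (simp add: algebra_simps power2_eq_square)
    also have "\<dots> = (1 - y) * Eul 0 1 B * ((1 - y) * G) + B * (2 * K * y) * ((1 - y) * G) + (h * 2) * (1 - y) * (K * y)"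
      unfolding EG Elog by (simp add: algebra_simps)
    also have "\<dots> = (1 - y) * Eul 0 1 B + B * (2 * K * y) + (1 - y) * (K * y)"
      unfolding G h by simp
    also have "B * (2 * K * y) = (2 * b * d * x + (h * 2) * (a * d\<^sup>2 + c * b\<^sup>2) * x\<^sup>2) * (K * y)"
      unfolding B_def h_def by (simp add: algebra_simps)
    also have "(1 - y) * Eul 0 1 B + (2 * b * d * x + (h * 2) * (a * d\<^sup>2 + c * b\<^sup>2) * x\<^sup>2) * (K * y) + (1 - y) * (K * y) = K * R"
      unfolding EB R_def h y_def by (simp add: algebra_simps power2_eq_square)
    finally show ?thesis .
  qed
  have Z1: "small ?Z 1"
    unfolding Z B_def
    by (intro small_add small_mult_right[of _ 1 "scalar _"] small_mult_left small_mult_right x1 x21 small_LOG1 y1)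
  have ne: "(1 - y)\<^sup>2 \<noteq> 0"
    using G by auto
  have x20: "cf (x\<^sup>2) v 0 = 0" for v by (simp add: power2_eq_square cf_mult_u0 x0)
  have y0: "cf y v 0 = 0" for v unfolding y_def by (subst mult.commute) (rule cf_mult_u0[OF x20])
  have "Y = EXP ?Z"
  proof (rule Eul_unique_u[OF _ Eul_EXP[OF Z1]])
    have "Eul 0 1 (of_nat (fact n) * p n * q n) = 0" for n
      unfolding p_def q_def by (simp add: Eul_mult Eul_herm a b c d of_nat_ser)
    then have "Eul 0 1 Y = K * Y'"
      unfolding Y_def Y'_def K_def by (intro Eul_PS Ex)
    then have "(1 - y)\<^sup>2 * Eul 0 1 Y = (1 - y)\<^sup>2 * (Y * Eul 0 1 ?Z)"
      using main EZ by Groebner_Basis.algebra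
    then show "Eul 0 1 Y = Y * Eul 0 1 ?Z" using ne by simp
    show "cf (Eul 0 1 ?Z) v 0 = 0" for v by simp
    have "B = x * (b * d + scalar (1/2) * (a * d\<^sup>2 + c * b\<^sup>2) * x)"
      unfolding B_def by (simp add: power2_eq_square algebra_simps)
    then have B0: "cf (B * G) v 0 = 0" for v
      by (simp only: mult.assoc cf_mult_u0 x0)
    have L0: "cf (LOG1 y) v 0 = 0" for v
      unfolding LOG1_def cf_tsum
      by (rule sum.neutral) (metis (no_types, lifting) cf_mult_u0 cf_scalar_mult mult_zero_left mult_zero_right
          not0_implies_Suc power_Suc y0 div_by_0 of_nat_0)
    have "cf (EXP ?Z) v 0 = cf 1 v 0" for v
      by (rule cf_EXP_u0[OF Z1]) (simp add: Z B0 L0)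
    then show "cf Y v 0 = cf (EXP ?Z) v 0" for v
      by (simp add: Y_def cf_PS_u0 x1 x0 p01 q01)
  qed
  then show ?thesis by (simp add: Y_def p_def q_def)
qed

end

section \<open>The substitution \<open>t = u^2\<close>\<close>

text \<open>The second variable of a \<open>ser\<close> is read as \<open>u\<close> in the
  combinatorial part and as \<open>t\<close> in the theorem; \<open>psi\<close> is the ring
  homomorphism between the two readings, and its coefficients at even degrees recover the
  series.\<close>

definition psi :: "ser \<Rightarrow> ser" where
  "psi F = Abs_fps (\<lambda>v. Abs_fps (\<lambda>n. if even n then cf F v (n div 2) else 0))"

lemma cf_psi: "cf (psi F) v n = (if even n then cf F v (n div 2) else 0)"
  by (simp add: psi_def)

lemma psi_add: "psi (F + G) = psi F + psi G"
  and psi_diff: "psi (F - G) = psi F - psi G"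
  and psi_scalar_mult: "psi (scalar c * F) = scalar c * psi F"
  by (rule ser_eqI; simp add: cf_psi)+

lemma psi_scalar: "psi (scalar c) = scalar c"
  by (rule ser_eqI) (auto simp: cf_psi cf_scalar)

lemma psi_0 [simp]: "psi 0 = 0" and psi_1 [simp]: "psi 1 = 1"
  using psi_scalar[of 0] psi_scalar[of 1] by simp_all

lemma psi_mult: "psi (F * G) = psi F * psi G"
proof (rule ser_eqI)
  fix v n
  show "cf (psi (F * G)) v n = cf (psi F * psi G) v n"
  proof (cases "even n")
    case True
    then obtain m where n: "n = 2 * m" by (elim evenE)
    have "(\<Sum>j\<le>n. cf (psi F) i j * cf (psi G) (v - i) (n - j)) = (\<Sum>j\<le>m. cf F i j * cf G (v - i) (m - j))" for i
    proof -
      have "(\<Sum>j\<le>n. cf (psi F) i j * cf (psi G) (v - i) (n - j))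
          = (\<Sum>j\<in>(\<lambda>j. 2 * j) ` {..m}. cf (psi F) i j * cf (psi G) (v - i) (n - j))"
        by (rule sum.mono_neutral_right) (auto simp: n cf_psi image_iff elim!: evenE)
      also have "\<dots> = (\<Sum>j\<le>m. cf (psi F) i (2 * j) * cf (psi G) (v - i) (n - 2 * j))"
        by (subst sum.reindex) (auto simp: inj_on_def)
      also have "\<dots> = (\<Sum>j\<le>m. cf F i j * cf G (v - i) (m - j))"
        by (rule sum.cong) (auto simp: n cf_psi diff_mult_distrib2[symmetric])
      finally show ?thesis .
    qed
    then show ?thesis by (simp add: cf_mult[of "psi F"] cf_psi[of "F * G"] cf_mult[of F] n)
  next
    case False
    then have "cf (psi F) i j * cf (psi G) (v - i) (n - j) = 0" if "j \<le> n" for i j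
      using that by (auto simp: cf_psi)
    then have "cf (psi F * psi G) v n = 0" unfolding cf_mult by (intro sum.neutral ballI) auto
    then show ?thesis using False by (simp add: cf_psi[of "F * G"])
  qed
qed

lemma psi_power: "psi (F ^ n) = psi F ^ n"
  by (induct n) (simp_all add: psi_mult)

lemma psi_prod: "psi (prod f A) = (\<Prod>x\<in>A. psi (f x))"
  by (induct A rule: infinite_finite_induct) (simp_all add: psi_mult)

lemma psi_sum: "psi (sum f A) = (\<Sum>x\<in>A. psi (f x))"
  by (induct A rule: infinite_finite_induct) (simp_all add: psi_add)

lemma small_psi: "small F d \<Longrightarrow> small (psi F) d"
  unfolding small_def cf_psi by auto

lemma psi_tsum: assumes "\<And>i. small (f i) i" shows "psi (tsum f) = tsum (\<lambda>i. psi (f i))"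
proof (rule ser_eqI)
  fix v n
  show "cf (psi (tsum f)) v n = cf (tsum (\<lambda>i. psi (f i))) v n"
    using cf_tsum_ge[of f v "n div 2" "v + n"] assms by (simp add: cf_psi cf_tsum[of "\<lambda>i. psi (f i)"])
qed

lemma psi_EXP: "small Z 1 \<Longrightarrow> psi (EXP Z) = EXP (psi Z)"
  by (simp add: EXP_def psi_tsum small_EXP_term psi_scalar_mult psi_power)

lemma psi_GEO: "small x 1 \<Longrightarrow> psi (GEO x) = GEO (psi x)"
  by (simp add: GEO_def psi_tsum small_power1 psi_power)

section \<open>Sums over permutations\<close>

text \<open>The trivial character for \<kappa> = 1 and the sign for \<kappa> = -1, with values in
  any commutative ring so that it can be taken in \<open>rat\<close> as well as in
  \<open>ser\<close>.\<close>

definition sg :: "'r::comm_ring_1 \<Rightarrow> ('a \<Rightarrow> 'a) \<Rightarrow> 'r" where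
  "sg \<kappa> p = (if evenperm p then 1 else \<kappa>)"

lemma sg_transpose_comp:
  assumes "permutation p" "a \<noteq> b" "\<kappa> * \<kappa> = 1"
  shows "sg \<kappa> (Transposition.transpose a b \<circ> p) = \<kappa> * sg \<kappa> p"
  using assms by (auto simp: sg_def evenperm_comp evenperm_swap permutation_swap_id)

text \<open>\<open>cyc_sum \<kappa> w n r\<close> is the weighted number of permutations of \<open>n + 1\<close> points, where a cycle of
  length \<open>k\<close> has weight \<open>\<kappa>^(k-1) w k\<close> and one marked point counts \<open>r + 1\<close> times.\<close>

primrec cyc_sum :: "'r::comm_ring_1 \<Rightarrow> (nat \<Rightarrow> 'r) \<Rightarrow> nat \<Rightarrow> nat \<Rightarrow> 'r" where
  "cyc_sum \<kappa> w 0 r = w (Suc r)"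
| "cyc_sum \<kappa> w (Suc n) r = w (Suc r) * cyc_sum \<kappa> w n 0 + \<kappa> * of_nat (Suc n) * cyc_sum \<kappa> w n (Suc r)"

definition perm_sum :: "'r::comm_ring_1 \<Rightarrow> (nat \<Rightarrow> 'r) \<Rightarrow> nat \<Rightarrow> 'r" where
  "perm_sum \<kappa> w n = (case n of 0 \<Rightarrow> 1 | Suc m \<Rightarrow> cyc_sum \<kappa> w m 0)"

text \<open>Removing the marked point \<open>a\<close> from its cycle moves the mark to its predecessor.\<close>

locale cycle_weight =
  fixes \<kappa> :: "'r::comm_ring_1" and w :: "nat \<Rightarrow> 'r"
    and \<Phi> :: "'a set \<Rightarrow> ('a \<Rightarrow> 'a) \<Rightarrow> 'r" and \<Psi> :: "'a set \<Rightarrow> 'a \<Rightarrow> nat \<Rightarrow> ('a \<Rightarrow> 'a) \<Rightarrow> 'r"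
  assumes sq: "\<kappa> * \<kappa> = 1"
    and empty: "\<Phi> {} id = 1"
    and unmark: "\<And>S p a. finite S \<Longrightarrow> p permutes S \<Longrightarrow> a \<in> S \<Longrightarrow> \<Psi> S a 0 p = \<Phi> S p"
    and fixed: "\<And>S p a r. finite S \<Longrightarrow> p permutes S \<Longrightarrow> a \<notin> S \<Longrightarrow> \<Psi> (insert a S) a r p = w (Suc r) * \<Phi> S p"
    and contract: "\<And>S p a c r. finite S \<Longrightarrow> p permutes S \<Longrightarrow> a \<notin> S \<Longrightarrow> c \<in> S \<Longrightarrow>
        \<Psi> (insert a S) a r (Transposition.transpose a (p c) \<circ> p) = \<Psi> S c (Suc r) p"
begin

definition F where "F S = (\<Sum>p | p permutes S. sg \<kappa> p * \<Phi> S p)"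
definition G where "G S a r = (\<Sum>p | p permutes S. sg \<kappa> p * \<Psi> S a r p)"

text \<open>A permutation of \<open>insert a S\<close> is \<open>transpose a b \<circ> p\<close> for
  a unique \<open>b\<close> and a unique \<open>p\<close> on \<open>S\<close>. For
  \<open>b = a\<close> the point \<open>a\<close> is fixed. For \<open>b = p c\<close> it sits
  between \<open>c\<close> and \<open>p c\<close>, and contracting it marks \<open>c\<close> instead
  at the price of one transposition, hence one factor \<kappa>.\<close>

lemma G_insert:
  assumes S: "finite S" "a \<notin> S"
  shows "G (insert a S) a r = w (Suc r) * F S + \<kappa> * (\<Sum>c\<in>S. G S c (Suc r))"
proof -
  have "G (insert a S) a r = (\<Sum>b\<in>insert a S. \<Sum>p | p permutes S.
      sg \<kappa> (Transposition.transpose a b \<circ> p) * \<Psi> (insert a S) a r (Transposition.transpose a b \<circ> p))"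
    unfolding G_def by (rule sum_over_permutations_insert[OF S])
  also have "\<dots> = (\<Sum>p | p permutes S. sg \<kappa> p * \<Psi> (insert a S) a r p) +
     (\<Sum>b\<in>S. \<Sum>p | p permutes S. sg \<kappa> (Transposition.transpose a b \<circ> p) * \<Psi> (insert a S) a r (Transposition.transpose a b \<circ> p))"
    using S by simp
  also have "(\<Sum>p | p permutes S. sg \<kappa> p * \<Psi> (insert a S) a r p) = w (Suc r) * F S"
    unfolding F_def sum_distrib_left by (rule sum.cong) (auto simp: fixed S)
  also have "(\<Sum>b\<in>S. \<Sum>p | p permutes S. sg \<kappa> (Transposition.transpose a b \<circ> p) * \<Psi> (insert a S) a r (Transposition.transpose a b \<circ> p))
     = (\<Sum>p | p permutes S. \<Sum>b\<in>S. sg \<kappa> (Transposition.transpose a b \<circ> p) * \<Psi> (insert a S) a r (Transposition.transpose a b \<circ> p))"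
    by (rule sum.swap)
  \<comment> \<open>Reindexing by the predecessor \<open>c\<close> of the inserted point,
    \<open>b = p c\<close>.\<close>
  also have "\<dots> = (\<Sum>p | p permutes S. \<Sum>c\<in>S. \<kappa> * (sg \<kappa> p * \<Psi> S c (Suc r) p))"
  proof (rule sum.cong[OF refl])
    fix p assume "p \<in> {p. p permutes S}"
    then have p: "p permutes S" by simp
    have "(\<Sum>b\<in>S. sg \<kappa> (Transposition.transpose a b \<circ> p) * \<Psi> (insert a S) a r (Transposition.transpose a b \<circ> p)) =
        (\<Sum>c\<in>S. sg \<kappa> (Transposition.transpose a (p c) \<circ> p) * \<Psi> (insert a S) a r (Transposition.transpose a (p c) \<circ> p))"
      by (rule sum.reindex_bij_betw[symmetric]) (rule permutes_imp_bij[OF p])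
    also have "\<dots> = (\<Sum>c\<in>S. \<kappa> * (sg \<kappa> p * \<Psi> S c (Suc r) p))"
    proof (rule sum.cong[OF refl])
      fix c assume c: "c \<in> S"
      have "a \<noteq> p c" using p c S by (metis permutes_in_image)
      moreover have "permutation p" using p S permutation_permutes by blast
      ultimately show "sg \<kappa> (Transposition.transpose a (p c) \<circ> p) * \<Psi> (insert a S) a r (Transposition.transpose a (p c) \<circ> p)
          = \<kappa> * (sg \<kappa> p * \<Psi> S c (Suc r) p)"
        using contract[OF S(1) p S(2) c] by (simp add: sg_transpose_comp sq mult.assoc)
    qed
    finally show "(\<Sum>b\<in>S. sg \<kappa> (Transposition.transpose a b \<circ> p) * \<Psi> (insert a S) a r (Transposition.transpose a b \<circ> p)) =
        (\<Sum>c\<in>S. \<kappa> * (sg \<kappa> p * \<Psi> S c (Suc r) p))" .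
  qed
  also have "\<dots> = \<kappa> * (\<Sum>c\<in>S. G S c (Suc r))"
    unfolding G_def sum_distrib_left by (rule sum.swap)
  finally show ?thesis .
qed

lemma F_unmark: "finite S \<Longrightarrow> a \<in> S \<Longrightarrow> F S = G S a 0"
  unfolding F_def G_def by (rule sum.cong) (auto simp: unmark)

lemma F_empty: "F {} = 1"
proof -
  have "{p. p permutes {}} = {id}" by auto
  moreover have "sg \<kappa> id = 1" by (simp add: sg_def evenperm_id)
  ultimately show ?thesis by (simp add: F_def empty)
qed

lemma G_eq: "finite S \<Longrightarrow> a \<notin> S \<Longrightarrow> card S = n \<Longrightarrow> G (insert a S) a r = cyc_sum \<kappa> w n r"
proof (induct n arbitrary: S a r)
  case 0
  then show ?case by (simp add: G_insert F_empty)
next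
  case (Suc n)
  have G: "G S c r = cyc_sum \<kappa> w n r" if "c \<in> S" for c r
    using Suc.hyps[of "S - {c}" c r] Suc.prems that by (simp add: insert_absorb)
  obtain c where "c \<in> S" using Suc.prems by fastforce
  then have "F S = cyc_sum \<kappa> w n 0" using F_unmark[of S c] G Suc.prems by simp
  then show ?case using Suc.prems by (simp add: G_insert G algebra_simps)
qed

theorem F_eq: assumes "finite S" shows "F S = perm_sum \<kappa> w (card S)"
proof (cases "S = {}")
  case False
  then obtain a where a: "a \<in> S" by blast
  obtain n where n: "card S = Suc n" using assms False by (metis card_eq_0_iff not0_implies_Suc)
  have "F S = G (insert a (S - {a})) a 0" using a assms by (simp add: F_unmark insert_absorb)
  also have "\<dots> = cyc_sum \<kappa> w n 0" using a assms n by (intro G_eq) auto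
  finally show ?thesis by (simp add: perm_sum_def n)
qed (simp add: F_empty perm_sum_def)

end

subsection \<open>Traces\<close>

fun mpow :: "'w set \<Rightarrow> ('w \<Rightarrow> 'w \<Rightarrow> 'r::comm_ring_1) \<Rightarrow> nat \<Rightarrow> 'w \<Rightarrow> 'w \<Rightarrow> 'r" where
  "mpow W T 0 x y = (if x = y then 1 else 0)"
| "mpow W T (Suc n) x y = (\<Sum>z\<in>W. T x z * mpow W T n z y)"

lemma mpow_1: "finite W \<Longrightarrow> y \<in> W \<Longrightarrow> mpow W T (Suc 0) x y = T x y"
  by (simp add: if_distrib sum.delta' cong: if_cong)

text \<open>The sum over colourings by \<open>W\<close> of the products of \<open>T\<close> along
  the arrows splits over the cycles into traces of powers. In the marked version the arrow out of
  \<open>a\<close> carries \<open>T^(r+1)\<close>, standing for \<open>r\<close> contracted points;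
  summing over the colour of a point that is contracted multiplies one more \<open>T\<close> onto
  it.\<close>

lemma cycle_weight_trace:
  assumes W: "finite W" and sq: "\<kappa> * \<kappa> = (1::'r::comm_ring_1)"
  shows "cycle_weight \<kappa> (\<lambda>k. \<Sum>x\<in>W. mpow W T k x x)
     (\<lambda>(S::'a set) p. \<Sum>g\<in>S \<rightarrow>\<^sub>E W. \<Prod>x\<in>S. T (g x) (g (p x)))
     (\<lambda>S a r p. \<Sum>g\<in>S \<rightarrow>\<^sub>E W. (\<Prod>x\<in>S-{a}. T (g x) (g (p x))) * mpow W T (Suc r) (g a) (g (p a)))"
proof
  fix S :: "'a set" and p a r
  assume S: "finite S" "p permutes S"
  {
    assume a: "a \<in> S"
    show "(\<Sum>g\<in>S \<rightarrow>\<^sub>E W. (\<Prod>x\<in>S-{a}. T (g x) (g (p x))) * mpow W T (Suc 0) (g a) (g (p a)))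
       = (\<Sum>g\<in>S \<rightarrow>\<^sub>E W. \<Prod>x\<in>S. T (g x) (g (p x)))"
    proof (rule sum.cong[OF refl])
      fix g assume g: "g \<in> S \<rightarrow>\<^sub>E W"
      have "p a \<in> S" using S a by (simp add: permutes_in_image)
      then have "g (p a) \<in> W" using g by auto
      then show "(\<Prod>x\<in>S-{a}. T (g x) (g (p x))) * mpow W T (Suc 0) (g a) (g (p a)) = (\<Prod>x\<in>S. T (g x) (g (p x)))"
        using S a by (simp only: mpow_1[OF W]) (simp add: prod.remove[of S a] mult.commute)
    qed
  }
  assume a: "a \<notin> S"
  have pS: "p x \<in> S" "p x \<noteq> a" if "x \<in> S" for x
    using S a that by (metis permutes_in_image)+
  have pa: "p a = a" using S a by (simp add: permutes_not_in)
  have split: "(\<Sum>g\<in>insert a S \<rightarrow>\<^sub>E W. (\<Prod>x\<in>insert a S-{a}. T (g x) (g (q x))) * mpow W T (Suc r) (g a) (g (q a)))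
     = (\<Sum>g\<in>S \<rightarrow>\<^sub>E W. \<Sum>y\<in>W. (\<Prod>x\<in>S. T (g x) ((g(a := y)) (q x))) * mpow W T (Suc r) y ((g(a := y)) (q a)))" for q
  proof -
    have "insert a S - {a} = S" using a by auto
    moreover have "(\<Prod>x\<in>S. T ((g(a := y)) x) ((g(a := y)) (q x))) = (\<Prod>x\<in>S. T (g x) ((g(a := y)) (q x)))" for g y
      by (rule prod.cong) (use a in auto)
    ultimately show ?thesis
      by (subst sum_PiE_insert[OF a]) simp
  qed
  {
    have "(\<Sum>g\<in>insert a S \<rightarrow>\<^sub>E W. (\<Prod>x\<in>insert a S-{a}. T (g x) (g (p x))) * mpow W T (Suc r) (g a) (g (p a)))
       = (\<Sum>g\<in>S \<rightarrow>\<^sub>E W. \<Sum>y\<in>W. (\<Prod>x\<in>S. T (g x) (g (p x))) * mpow W T (Suc r) y y)"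
      unfolding split unfolding pa by (intro sum.cong refl arg_cong2[where f="(*)"] prod.cong) (auto simp: pS)
    also have "\<dots> = (\<Sum>x\<in>W. mpow W T (Suc r) x x) * (\<Sum>g\<in>S \<rightarrow>\<^sub>E W. \<Prod>x\<in>S. T (g x) (g (p x)))"
      by (simp only: sum_distrib_left[symmetric] sum_distrib_right[symmetric]) (rule mult.commute)
    finally show "(\<Sum>g\<in>insert a S \<rightarrow>\<^sub>E W. (\<Prod>x\<in>insert a S-{a}. T (g x) (g (p x))) * mpow W T (Suc r) (g a) (g (p a)))
       = (\<Sum>x\<in>W. mpow W T (Suc r) x x) * (\<Sum>g\<in>S \<rightarrow>\<^sub>E W. \<Prod>x\<in>S. T (g x) (g (p x)))" .
  }
  fix c assume c: "c \<in> S"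
  define q where "q = Transposition.transpose a (p c) \<circ> p"
  have qa: "q a = p c" by (simp add: q_def pa)
  have qc: "q c = a" by (simp add: q_def)
  have qx: "q x = p x" if "x \<in> S - {c}" for x
  proof -
    have "p x \<noteq> p c" using that S permutes_inj[of p S] by (auto dest: injD)
    then show ?thesis using pS[of x] that by (simp add: q_def transpose_def)
  qed
  have "(\<Sum>g\<in>insert a S \<rightarrow>\<^sub>E W. (\<Prod>x\<in>insert a S-{a}. T (g x) (g (q x))) * mpow W T (Suc r) (g a) (g (q a)))
    = (\<Sum>g\<in>S \<rightarrow>\<^sub>E W. \<Sum>y\<in>W. (\<Prod>x\<in>S-{c}. T (g x) (g (p x))) * (T (g c) y * mpow W T (Suc r) y (g (p c))))"
    unfolding split
  proof (intro sum.cong refl)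
    fix g y
    have "(\<Prod>x\<in>S. T (g x) ((g(a := y)) (q x))) = T (g c) y * (\<Prod>x\<in>S-{c}. T (g x) ((g(a := y)) (q x)))"
      using S c by (simp add: prod.remove[of S c] qc)
    also have "(\<Prod>x\<in>S-{c}. T (g x) ((g(a := y)) (q x))) = (\<Prod>x\<in>S-{c}. T (g x) (g (p x)))"
      by (rule prod.cong) (auto simp: qx pS)
    finally show "(\<Prod>x\<in>S. T (g x) ((g(a := y)) (q x))) * mpow W T (Suc r) y ((g(a := y)) (q a))
      = (\<Prod>x\<in>S-{c}. T (g x) (g (p x))) * (T (g c) y * mpow W T (Suc r) y (g (p c)))"
      using pS[OF c] by (simp add: qa mult_ac del: mpow.simps)
  qed
  also have "\<dots> = (\<Sum>g\<in>S \<rightarrow>\<^sub>E W. (\<Prod>x\<in>S-{c}. T (g x) (g (p x))) * mpow W T (Suc (Suc r)) (g c) (g (p c)))"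
    by (simp only: sum_distrib_left[symmetric] mpow.simps(2)[of W T "Suc r"])
  finally show "(\<Sum>g\<in>insert a S \<rightarrow>\<^sub>E W. (\<Prod>x\<in>insert a S-{a}. T (g x) (g ((Transposition.transpose a (p c) \<circ> p) x))) *
        mpow W T (Suc r) (g a) (g ((Transposition.transpose a (p c) \<circ> p) a)))
     = (\<Sum>g\<in>S \<rightarrow>\<^sub>E W. (\<Prod>x\<in>S-{c}. T (g x) (g (p x))) * mpow W T (Suc (Suc r)) (g c) (g (p c)))"
    unfolding q_def .
qed (use sq in auto)

theorem sum_permutes_trace:
  assumes "finite W" "\<kappa> * \<kappa> = 1" "finite S"
  shows "(\<Sum>p | p permutes S. sg \<kappa> p * (\<Sum>g\<in>S \<rightarrow>\<^sub>E W. \<Prod>x\<in>S. T (g x) (g (p x))))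
     = perm_sum \<kappa> (\<lambda>k. \<Sum>x\<in>W. mpow W T k x x) (card S)"
proof -
  interpret cycle_weight \<kappa> "\<lambda>k. \<Sum>x\<in>W. mpow W T k x x"
     "\<lambda>S p. \<Sum>g\<in>S \<rightarrow>\<^sub>E W. \<Prod>x\<in>S. T (g x) (g (p x))"
     "\<lambda>S a r p. \<Sum>g\<in>S \<rightarrow>\<^sub>E W. (\<Prod>x\<in>S-{a}. T (g x) (g (p x))) * mpow W T (Suc r) (g a) (g (p a))"
    by (rule cycle_weight_trace[OF assms(1,2)])
  show ?thesis using F_eq[OF assms(3)] by (simp add: F_def)
qed

subsection \<open>Orbits\<close>

lemma permutes_self_in_orbit: "finite S \<Longrightarrow> p permutes S \<Longrightarrow> x \<in> orbit p x"
  by (rule permutation_self_in_orbit) (auto simp: permutation_permutes)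

lemma orbit_eq_of_mem:
  assumes "finite S" "p permutes S" "y \<in> orbit p x" shows "orbit p y = orbit p x"
  using orbit_cyclic_eq3[OF cyclic_on_orbit[OF assms(2,1)] assms(3)] .

lemma orbit_subset_of_permutes:
  assumes "finite S" "p permutes S" "x \<in> S" shows "orbit p x \<subseteq> S"
  by (rule permutes_orbit_subset[OF assms(2,3)])

text \<open>\<open>q\<close> agrees with \<open>p\<close> on \<open>S\<close> except at
  \<open>c\<close>, where the step from \<open>c\<close> to \<open>p c\<close> is replaced by the
  two steps from \<open>c\<close> to \<open>a\<close> to \<open>p c\<close>.\<close>

lemma orbit_insert:
  assumes S: "finite S" "p permutes S" "a \<notin> S" "c \<in> S"
  defines "q \<equiv> Transposition.transpose a (p c) \<circ> p"
  defines "f \<equiv> \<lambda>C. if c \<in> C then insert a C else C"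
  shows "\<And>x. x \<in> S \<Longrightarrow> orbit q x = f (orbit p x)" "orbit q a = f (orbit p c)"
proof -
  have pS: "p x \<in> S" "p x \<noteq> a" if "x \<in> S" for x
    using S that by (metis permutes_in_image)+
  have pa: "p a = a" using S by (simp add: permutes_not_in)
  have qa: "q a = p c" by (simp add: q_def pa)
  have qc: "q c = a" by (simp add: q_def)
  have qx: "q x = p x" if "x \<in> S" "x \<noteq> c" for x
  proof -
    have "p x \<noteq> p c" using that S permutes_inj[of p S] by (auto dest: injD)
    then show ?thesis using pS[of x] that by (simp add: q_def transpose_def)
  qed
  have q: "q permutes insert a S"
    unfolding q_def using S pS
    by (intro permutes_compose permutes_swap_id permutes_subset[OF S(2)]) auto
  have self: "x \<in> orbit q x" for x by (rule permutes_self_in_orbit[OF _ q]) (use S in simp)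
  have pself: "x \<in> orbit p x" for x by (rule permutes_self_in_orbit[OF S(1,2)])
  have *: "orbit q x = f (orbit p x)" if x: "x \<in> S" for x
  proof -
    have sub: "orbit p x \<subseteq> S" by (rule orbit_subset_of_permutes[OF S(1,2) x])
    have step: "p y \<in> orbit q x" if "y \<in> orbit q x" "y \<in> S" for y
    proof (cases "y = c")
      case True
      then have "q (q y) \<in> orbit q x" using that by (intro orbit.step)
      then show ?thesis using True by (simp add: qc qa)
    next
      case False
      then show ?thesis using that orbit.step[of y q x] by (simp add: qx)
    qed
    have 1: "y \<in> orbit q x" if "y \<in> orbit p x" for y
      using that by induct (use step self x sub in auto)
    have stepf: "q y \<in> f (orbit p x)" if y: "y \<in> f (orbit p x)" for y
    proof -
      consider "y = a" "c \<in> orbit p x" | "y = c" "y \<in> orbit p x" | "y \<noteq> c" "y \<in> orbit p x"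
        using y by (auto simp: f_def split: if_splits)
      then show ?thesis
      proof cases
        case 1 then show ?thesis by (auto simp: f_def qa intro: orbit.step)
      next
        case 2 then show ?thesis by (auto simp: f_def qc)
      next
        case 3
        then have "q y = p y" using sub qx by auto
        then show ?thesis using orbit.step[OF 3(2)] by (simp add: f_def)
      qed
    qed
    have 2: "y \<in> f (orbit p x)" if "y \<in> orbit q x" for y
      using that
    proof induct
      case base
      show ?case by (rule stepf) (use pself[of x] in \<open>auto simp: f_def\<close>)
    qed (rule stepf)
    have 3: "a \<in> orbit q x" if "c \<in> orbit p x"
      using orbit.step[OF 1[OF that]] by (simp add: qc)
    show ?thesis
    proof (intro subset_antisym subsetI)
      fix y assume "y \<in> f (orbit p x)"
      then show "y \<in> orbit q x" using 1[of y] 3 by (auto simp: f_def split: if_splits)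
    qed (rule 2)
  qed
  then show "\<And>x. x \<in> S \<Longrightarrow> orbit q x = f (orbit p x)" .
  have "a \<in> orbit q c" using orbit.step[OF self[of c]] by (simp add: qc)
  then have "orbit q a = orbit q c" by (intro orbit_eq_of_mem[OF _ q]) (use S in auto)
  then show "orbit q a = f (orbit p c)" using *[OF S(4)] by simp
qed

text \<open>The marked orbit is counted as longer by \<open>r\<close>, the number of points already
  contracted out of it, so contraction leaves all weights unchanged.\<close>

lemma cycle_weight_orbits:
  assumes sq: "\<kappa> * \<kappa> = (1::'r::comm_ring_1)"
  shows "cycle_weight \<kappa> w (\<lambda>(S::'a set) p. \<Prod>C\<in>orbit p ` S. w (card C))
     (\<lambda>S a r p. \<Prod>C\<in>orbit p ` S. w (card C + (if a \<in> C then r else 0)))"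
proof
  fix S :: "'a set" and p a r
  assume S: "finite S" "p permutes S"
  assume a: "a \<notin> S"
  have sub: "orbit p x \<subseteq> S" if "x \<in> S" for x by (rule orbit_subset_of_permutes[OF S that])
  {
    have "orbit p a = {a}" using S a by (simp add: orbit_eq_singleton_iff permutes_not_in)
    moreover have "{a} \<notin> orbit p ` S" using sub a by auto
    moreover have "(\<Prod>C\<in>orbit p ` S. w (card C + (if a \<in> C then r else 0))) = (\<Prod>C\<in>orbit p ` S. w (card C))"
      by (rule prod.cong) (use sub a in auto)
    ultimately show "(\<Prod>C\<in>orbit p ` insert a S. w (card C + (if a \<in> C then r else 0)))
        = w (Suc r) * (\<Prod>C\<in>orbit p ` S. w (card C))"
      using S by simp
  }
  fix c assume c: "c \<in> S"
  define q where "q = Transposition.transpose a (p c) \<circ> p"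
  define f where "f C = (if c \<in> C then insert a C else C)" for C
  have o: "orbit q ` insert a S = f ` (orbit p ` S)"
    using orbit_insert[OF S a c] c unfolding q_def[symmetric] f_def by (auto simp: image_image)
  have inj: "inj_on f (orbit p ` S)"
  proof (rule inj_onI)
    fix C D assume "C \<in> orbit p ` S" "D \<in> orbit p ` S" "f C = f D"
    then have "a \<notin> C" "a \<notin> D" "f C - {a} = f D - {a}" using sub a by auto
    then show "C = D" by (auto simp: f_def split: if_splits)
  qed
  have "(\<Prod>C\<in>orbit q ` insert a S. w (card C + (if a \<in> C then r else 0)))
      = (\<Prod>C\<in>orbit p ` S. w (card (f C) + (if a \<in> f C then r else 0)))"
    unfolding o by (simp add: prod.reindex[OF inj])
  also have "\<dots> = (\<Prod>C\<in>orbit p ` S. w (card C + (if c \<in> C then Suc r else 0)))"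
  proof (rule prod.cong[OF refl])
    fix C assume "C \<in> orbit p ` S"
    then have "C \<subseteq> S" using sub by auto
    then have "a \<notin> C" "finite C" using a S finite_subset by auto
    then show "w (card (f C) + (if a \<in> f C then r else 0)) = w (card C + (if c \<in> C then Suc r else 0))"
      by (simp add: f_def)
  qed
  finally show "(\<Prod>C\<in>orbit (Transposition.transpose a (p c) \<circ> p) ` insert a S. w (card C + (if a \<in> C then r else 0)))
      = (\<Prod>C\<in>orbit p ` S. w (card C + (if c \<in> C then Suc r else 0)))"
    unfolding q_def .
qed (use sq in auto)

theorem sum_permutes_orbits:
  assumes "\<kappa> * \<kappa> = 1" "finite S"
  shows "(\<Sum>p | p permutes S. sg \<kappa> p * (\<Prod>C\<in>orbit p ` S. w (card C))) = perm_sum \<kappa> w (card S)"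
proof -
  interpret cycle_weight \<kappa> w "\<lambda>S p. \<Prod>C\<in>orbit p ` S. w (card C)"
     "\<lambda>S a r p. \<Prod>C\<in>orbit p ` S. w (card C + (if a \<in> C then r else 0))"
    by (rule cycle_weight_orbits[OF assms(1)])
  show ?thesis using F_eq[OF assms(2)] by (simp add: F_def)
qed

text \<open>The powers of \<open>p\<close> up to the first return enumerate the orbit injectively,
  so its size is the exact period.\<close>

lemma funpow_eq_self_iff:
  assumes "finite S" "p permutes S"
  shows "(p ^^ k) x = x \<longleftrightarrow> card (orbit p x) dvd k"
proof -
  define d where "d = funpow_dist1 p x x"
  have self: "x \<in> orbit p x" by (rule permutes_self_in_orbit[OF assms])
  have d: "(p ^^ d) x = x" unfolding d_def by (rule funpow_dist1_prop[OF self])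
  have inj: "inj_on (\<lambda>n. (p ^^ n) x) {0..<d}" unfolding d_def by (rule inj_on_funpow_dist1[OF self])
  have card: "card (orbit p x) = d"
    unfolding orbit_conv_funpow_dist1[OF self] d_def[symmetric] by (simp add: card_image inj)
  have "d > 0" by (simp add: d_def)
  have "(p ^^ k) x = (p ^^ (k mod d)) x" using d by (simp add: funpow_mod_eq)
  moreover have "(p ^^ (k mod d)) x = x \<longleftrightarrow> k mod d = 0"
    using inj_onD[OF inj, of "k mod d" 0] \<open>d > 0\<close> by auto
  ultimately show ?thesis by (simp add: card dvd_eq_mod_eq_0)
qed

text \<open>By the period criterion an orbit \<open>C\<close> consists of fixed points of
  \<open>p ^^ k\<close> or contains none; in the first case it contributes \<open>card C\<close>
  equal terms.\<close>

lemma sum_fixed_points_orbits: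
  assumes S: "finite S" "p permutes S"
  shows "(\<Sum>x\<in>{x\<in>S. (p ^^ k) x = x}. h (orbit p x)) =
    (\<Sum>C\<in>orbit p ` S. if card C dvd k then of_nat (card C) * h C else (0::'r::comm_ring_1))"
proof -
  have fib: "{x\<in>S. orbit p x = C} = C" if C: "C \<in> orbit p ` S" for C
  proof -
    obtain y where y: "y \<in> S" "C = orbit p y" using C by auto
    then show ?thesis
      using orbit_subset_of_permutes[OF S y(1)] orbit_eq_of_mem[OF S] permutes_self_in_orbit[OF S] by blast
  qed
  have "(\<Sum>x\<in>{x\<in>S. (p ^^ k) x = x}. h (orbit p x)) = (\<Sum>x\<in>S. if card (orbit p x) dvd k then h (orbit p x) else 0)"
    using S by (simp add: funpow_eq_self_iff[OF S] sum.inter_filter)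
  also have "\<dots> = (\<Sum>C\<in>orbit p ` S. \<Sum>x\<in>{x\<in>S. orbit p x = C}. if card (orbit p x) dvd k then h (orbit p x) else 0)"
    by (rule sum.image_gen[OF S(1)])
  also have "\<dots> = (\<Sum>C\<in>orbit p ` S. \<Sum>x\<in>C. if card C dvd k then h C else 0)"
  proof (rule sum.cong[OF refl])
    fix C assume C: "C \<in> orbit p ` S"
    show "(\<Sum>x\<in>{x\<in>S. orbit p x = C}. if card (orbit p x) dvd k then h (orbit p x) else 0) = (\<Sum>x\<in>C. if card C dvd k then h C else 0)"
      by (rule sum.cong) (use fib[OF C] in auto)
  qed
  also have "\<dots> = (\<Sum>C\<in>orbit p ` S. if card C dvd k then of_nat (card C) * h C else 0)"
    by (rule sum.cong) auto
  finally show ?thesis .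
qed

subsection \<open>Exponential generating functions\<close>

lemma tsum_mult_cauchy:
  assumes f: "\<And>i. small (f i) i" and g: "\<And>i. small (g i) i"
  shows "tsum f * tsum g = tsum (\<lambda>n. \<Sum>k\<le>n. f k * g (n - k))"
proof (rule ser_eqI)
  fix v n :: nat
  define N where "N = v + n"
  have "cf (tsum f * tsum g) v n = (\<Sum>j\<le>N. \<Sum>i\<le>N. cf (g j * f i) v n)"
    by (subst cf_mult_tsum[where f=g and N=N]) (auto simp: N_def g f mult.commute[of "tsum f"] intro!: sum.cong cf_mult_tsum)
  also have "\<dots> = (\<Sum>i\<le>N. \<Sum>j\<le>N. cf (f i * g j) v n)"
    by (subst sum.swap) (simp add: mult.commute)
  also have "\<dots> = (\<Sum>(i,j)\<in>{..N} \<times> {..N}. cf (f i * g j) v n)"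
    by (rule sum.cartesian_product)
  also have "\<dots> = (\<Sum>(i,j)\<in>{(i,j). i + j \<le> N}. cf (f i * g j) v n)"
  proof (rule sum.mono_neutral_right)
    have "cf (f i * g j) v n = 0" if "\<not> i + j \<le> N" for i j
      using small_mult[OF f[of i] g[of j]] that by (intro smallD[where d="i+j"]) (auto simp: N_def)
    then show "\<forall>x\<in>{..N} \<times> {..N} - {(i,j). i + j \<le> N}. (case x of (i, j) \<Rightarrow> cf (f i * g j) v n) = 0"
      by auto
  qed auto
  also have "\<dots> = (\<Sum>k\<le>N. \<Sum>i\<le>k. cf (f i * g (k - i)) v n)"
    by (rule sum.triangle_reindex_eq)
  finally show "cf (tsum f * tsum g) v n = cf (tsum (\<lambda>n. \<Sum>k\<le>n. f k * g (n - k))) v n"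
    by (simp add: cf_tsum cf_sum N_def)
qed

lemma PS_mult_cauchy: assumes "small x 1"
  shows "PS x f * PS x g = PS x (\<lambda>n. \<Sum>k\<le>n. f k * g (n - k))"
proof -
  have "(\<Sum>k\<le>n. f k * x ^ k * (g (n - k) * x ^ (n - k))) = (\<Sum>k\<le>n. f k * g (n - k)) * x ^ n" for n
    unfolding sum_distrib_right
  proof (rule sum.cong[OF refl])
    fix k assume "k \<in> {..n}"
    then have "x ^ k * x ^ (n - k) = x ^ n" by (simp flip: power_add)
    then show "f k * x ^ k * (g (n - k) * x ^ (n - k)) = f k * g (n - k) * x ^ n"
      by (metis mult.assoc mult.left_commute)
  qed
  then show ?thesis unfolding PS_def
    by (subst tsum_mult_cauchy[OF small_PS_term[OF assms] small_PS_term[OF assms]]) simp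
qed

definition perm_egf :: "ser \<Rightarrow> (nat \<Rightarrow> ser) \<Rightarrow> nat \<Rightarrow> ser" where
  "perm_egf \<kappa> w n = scalar (1 / fact n) * perm_sum \<kappa> w n"

text \<open>The recursion unrolled: \<open>k\<close> is the number of further points in the cycle of
  the marked point, and the other \<open>n - k\<close> points are permuted freely.\<close>

lemma cyc_sum_closed:
  "scalar (1 / fact n) * cyc_sum \<kappa> w n r = (\<Sum>k\<le>n. \<kappa> ^ k * w (Suc (r + k)) * perm_egf \<kappa> w (n - k))"
proof (induct n arbitrary: r)
  case 0
  then show ?case by (simp add: perm_egf_def perm_sum_def)
next
  case (Suc n)
  have e: "scalar (1 / fact (Suc n)) * of_nat (Suc n) = scalar (1 / fact n)"
    by (simp add: of_nat_ser flip: scalar_mult del: of_nat_Suc)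
  have "scalar (1 / fact (Suc n)) * cyc_sum \<kappa> w (Suc n) r =
      w (Suc r) * perm_egf \<kappa> w (Suc n) + \<kappa> * ((scalar (1 / fact (Suc n)) * of_nat (Suc n)) * cyc_sum \<kappa> w n (Suc r))"
    by (simp add: perm_egf_def perm_sum_def algebra_simps)
  also have "\<dots> = w (Suc r) * perm_egf \<kappa> w (Suc n) + \<kappa> * (\<Sum>k\<le>n. \<kappa> ^ k * w (Suc (Suc r + k)) * perm_egf \<kappa> w (n - k))"
    by (simp only: e Suc)
  also have "\<dots> = (\<Sum>k\<le>Suc n. \<kappa> ^ k * w (Suc (r + k)) * perm_egf \<kappa> w (Suc n - k))"
    by (subst sum.atMost_Suc_shift) (simp add: sum_distrib_left mult_ac)
  finally show ?case .
qed

text \<open>With power sums for \<open>w\<close> these are Newton's identities, for the complete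
  symmetric functions if \<kappa> = 1 and for the elementary ones if \<kappa> = -1.\<close>

lemma perm_egf_Suc:
  "of_nat (Suc n) * perm_egf \<kappa> w (Suc n) = (\<Sum>k\<le>n. \<kappa> ^ k * w (Suc k) * perm_egf \<kappa> w (n - k))"
proof -
  have "of_nat (Suc n) * scalar (1 / fact (Suc n)) = scalar (1 / fact n)"
    by (simp add: of_nat_ser flip: scalar_mult del: of_nat_Suc)
  then have "of_nat (Suc n) * perm_egf \<kappa> w (Suc n) = scalar (1 / fact n) * cyc_sum \<kappa> w n 0"
    by (simp add: perm_egf_def perm_sum_def mult.assoc[symmetric] del: of_nat_Suc)
  then show ?thesis by (simp add: cyc_sum_closed)
qed

text \<open>The sum of \<kappa>^(k-1) \<open>w k x^k / k\<close> over \<open>k >= 1\<close>, written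
  with one factor \<open>x\<close> in front so that it visibly has no constant term in
  \<open>x\<close>.\<close>

definition cyc_log :: "ser \<Rightarrow> ser \<Rightarrow> (nat \<Rightarrow> ser) \<Rightarrow> ser" where
  "cyc_log x \<kappa> w = x * PS x (\<lambda>k. scalar (1 / of_nat (Suc k)) * \<kappa> ^ k * w (Suc k))"

lemma perm_egf_ODE:
  assumes x: "small x 1" and Ex: "Eul p q x = of_nat m * x" and Ek: "Eul p q \<kappa> = 0" and Ew: "\<And>k. Eul p q (w k) = 0"
  shows "Eul p q (PS x (perm_egf \<kappa> w)) = PS x (perm_egf \<kappa> w) * Eul p q (cyc_log x \<kappa> w)"
proof -
  have Ekk: "Eul p q (\<kappa> ^ k) = 0" for k by (induct k) (auto simp: Eul_mult Ek)
  have Ec: "Eul p q (cyc_sum \<kappa> w n r) = 0" for n r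
    by (induct n arbitrary: r) (auto simp: Eul_mult Eul_add Ek Ew of_nat_ser simp del: of_nat_Suc)
  have Ef: "Eul p q (perm_egf \<kappa> w n) = 0" for n
    unfolding perm_egf_def Eul_scalar perm_sum_def by (cases n) (auto simp: Ec)
  define h where "h = (\<lambda>k. \<kappa> ^ k * w (Suc k))"
  have "Eul p q (PS x (perm_egf \<kappa> w)) = of_nat m * (x * PS x (\<lambda>n. of_nat (Suc n) * perm_egf \<kappa> w (Suc n)))"
    unfolding Eul_PS[OF Ex Ef] by (subst PS_Suc[OF x]) simp
  also have "\<dots> = of_nat m * x * (PS x h * PS x (perm_egf \<kappa> w))"
    unfolding perm_egf_Suc h_def PS_mult_cauchy[OF x] by (simp add: mult.assoc)
  finally have 1: "Eul p q (PS x (perm_egf \<kappa> w)) = PS x (perm_egf \<kappa> w) * (of_nat m * x * PS x h)"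
    by (simp add: mult_ac)
  let ?g = "\<lambda>k. scalar (1 / of_nat (Suc k)) * \<kappa> ^ k * w (Suc k)"
  have Eg: "Eul p q (?g k) = 0" for k by (simp only: mult.assoc Eul_scalar) (simp add: Eul_mult Ekk Ew)
  have "Eul p q (cyc_log x \<kappa> w) = of_nat m * x * (PS x ?g + PS x (\<lambda>n. of_nat n * ?g n))"
    unfolding cyc_log_def Eul_mult Ex Eul_PS[OF Ex Eg] by (simp add: algebra_simps)
  also have "PS x ?g + PS x (\<lambda>n. of_nat n * ?g n) = PS x (\<lambda>n. of_nat (Suc n) * ?g n)"
    by (simp add: PS_add[symmetric] algebra_simps)
  also have "\<dots> = PS x h"
    by (intro arg_cong[where f="PS x"] ext)
      (simp add: h_def of_nat_ser mult.assoc[symmetric] scalar_mult[symmetric] del: of_nat_Suc)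
  finally show ?thesis using 1 by simp
qed

lemma small_cyc_log: "small x 1 \<Longrightarrow> small (cyc_log x \<kappa> w) 1"
  unfolding cyc_log_def by (rule small_mult_left)

lemma perm_egf_0: "perm_egf \<kappa> w 0 = 1"
  by (simp add: perm_egf_def perm_sum_def)

text \<open>The exponential formula: the identities \<open>perm_egf_Suc\<close> say that the left
  side satisfies the equation of the exponential.\<close>

theorem (in gauss_var) PS_perm_egf:
  assumes Ek: "Eul 0 1 \<kappa> = 0" and Ew: "\<And>k. Eul 0 1 (w k) = 0"
  shows "PS x (perm_egf \<kappa> w) = EXP (cyc_log x \<kappa> w)"
proof (rule Eul_unique_u[OF perm_egf_ODE[OF x1 Ex Ek Ew] Eul_EXP[OF small_cyc_log[OF x1]]])
  show "cf (Eul 0 1 (cyc_log x \<kappa> w)) v 0 = 0" for v by simp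
  show "cf (PS x (perm_egf \<kappa> w)) v 0 = cf (EXP (cyc_log x \<kappa> w)) v 0" for v
    by (subst cf_EXP_u0[OF small_cyc_log[OF x1]])
      (auto simp: cyc_log_def cf_mult_u0 x0 x1 cf_PS_u0 perm_egf_0 simp del: fps_one_nth)
qed

lemma small_s: "small var_s 1" and Eul_s: "Eul 1 q var_s = of_nat 1 * var_s"
  by (auto simp: small_def var_s_def fps_X_def One_nat_def intro!: ser_eqI)

text \<open>The exponential formula along \<open>s\<close>, for weights that may be arbitrary series
  in the other variable; uniqueness is therefore taken from \<open>Eul_unique_s\<close>.\<close>

theorem PS_s_perm_egf:
  assumes Ek: "Eul 1 0 \<kappa> = 0" and Ew: "\<And>k. Eul 1 0 (w k) = 0"
  shows "PS var_s (perm_egf \<kappa> w) = EXP (cyc_log var_s \<kappa> w)"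
proof (rule Eul_unique_s[OF perm_egf_ODE[OF small_s Eul_s Ek Ew] Eul_EXP[OF small_cyc_log[OF small_s]]])
  show "fps_nth (Eul 1 0 (cyc_log var_s \<kappa> w)) 0 = 0" by (rule fps_ext) simp
  have X: "fps_nth (var_s * H) 0 = 0" for H by (simp add: var_s_def)
  show "fps_nth (PS var_s (perm_egf \<kappa> w)) 0 = fps_nth (EXP (cyc_log var_s \<kappa> w)) 0"
    unfolding EXP_eq_1_plus[OF small_cyc_log[OF small_s]]
    by (subst PS_Suc[OF small_s]) (simp only: fps_add_nth perm_egf_0 cyc_log_def mult.assoc X)
qed

section \<open>Coinvariants\<close>

lemma submodule_iff:
  assumes "Module.module K M"
  shows "Module.submodule H K M \<longleftrightarrow> H \<subseteq> carrier M \<and> \<zero>\<^bsub>M\<^esub> \<in> H \<and> (\<forall>x\<in>H. \<forall>y\<in>H. x \<oplus>\<^bsub>M\<^esub> y \<in> H)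
     \<and> (\<forall>c\<in>carrier K. \<forall>x\<in>H. c \<odot>\<^bsub>M\<^esub> x \<in> H)" (is "?L \<longleftrightarrow> ?R")
proof -
  interpret Module.module K M by fact
  show ?thesis
  proof
    assume ?L
    then interpret s: Module.submodule H K M .
    show ?R using s.subset s.one_closed s.m_closed s.smult_closed by auto
  next
    assume R: ?R
    have "\<ominus>\<^bsub>M\<^esub> x \<in> H" if "x \<in> H" for x
    proof -
      have "(\<ominus>\<^bsub>K\<^esub> \<one>\<^bsub>K\<^esub>) \<odot>\<^bsub>M\<^esub> x \<in> H" using R that by auto
      then show ?thesis using smult_minus_1 R that by (metis subsetD)
    qed
    then show ?L using R
      by (intro Module.submodule.intro Module.submodule_axioms.intro subgroup.intro) (auto simp: a_inv_def)
  qed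
qed

lemma span_mod_least: "Module.submodule H K M \<Longrightarrow> S \<subseteq> H \<Longrightarrow> span_mod K M S \<subseteq> H"
  unfolding span_mod_def by auto

lemma span_mod_superset: "S \<subseteq> span_mod K M S"
  unfolding span_mod_def by auto

lemma submodule_carrier: "Module.module K M \<Longrightarrow> Module.submodule (carrier M) K M"
proof -
  assume "Module.module K M"
  then interpret Module.module K M .
  show ?thesis by (simp add: submodule_iff \<open>Module.module K M\<close>)
qed

lemma submodule_span_mod:
  assumes "Module.module K M" "S \<subseteq> carrier M" shows "Module.submodule (span_mod K M S) K M"
proof -
  have c: "Module.submodule (carrier M) K M" using assms(1) by (rule submodule_carrier)
  have "span_mod K M S \<subseteq> carrier M" using span_mod_least[OF c assms(2)] .
  then show ?thesis unfolding submodule_iff[OF assms(1)]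
    unfolding span_mod_def by (auto simp: submodule_iff[OF assms(1)])
qed

definition lfun :: "('a, 'm) ring_scheme \<Rightarrow> ('a, 'b, 'n) module_scheme \<Rightarrow> ('b \<Rightarrow> 'a) \<Rightarrow> bool" where
  "lfun K M l \<longleftrightarrow> l \<in> carrier M \<rightarrow> carrier K \<and>
     (\<forall>x\<in>carrier M. \<forall>y\<in>carrier M. l (x \<oplus>\<^bsub>M\<^esub> y) = l x \<oplus>\<^bsub>K\<^esub> l y) \<and>
     (\<forall>c\<in>carrier K. \<forall>x\<in>carrier M. l (c \<odot>\<^bsub>M\<^esub> x) = c \<otimes>\<^bsub>K\<^esub> l x)"

lemma lfun_zero: assumes "Module.module K M" "lfun K M l" shows "l \<zero>\<^bsub>M\<^esub> = \<zero>\<^bsub>K\<^esub>"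
proof -
  interpret Module.module K M by fact
  have "l (\<zero>\<^bsub>K\<^esub> \<odot>\<^bsub>M\<^esub> \<zero>\<^bsub>M\<^esub>) = \<zero>\<^bsub>K\<^esub> \<otimes>\<^bsub>K\<^esub> l \<zero>\<^bsub>M\<^esub>" using assms(2) unfolding lfun_def by blast
  moreover have "l \<zero>\<^bsub>M\<^esub> \<in> carrier K" using assms(2) by (auto simp: lfun_def)
  ultimately show ?thesis by simp
qed

lemma lfun_finsum:
  assumes "Module.module K M" "lfun K M l" "finite A" "f \<in> A \<rightarrow> carrier M"
  shows "l (finsum M f A) = finsum K (\<lambda>a. l (f a)) A"
proof -
  interpret Module.module K M by fact
  have l: "l \<in> carrier M \<rightarrow> carrier K" using assms(2) by (simp add: lfun_def)
  show ?thesis using assms(3,4)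
  proof (induct A rule: finite_induct)
    case empty
    then show ?case by (simp add: lfun_zero[OF assms(1,2)])
  next
    case (insert a A)
    have fa: "f a \<in> carrier M" "f \<in> A \<rightarrow> carrier M" using insert.prems by auto
    then have "(\<lambda>a. l (f a)) \<in> A \<rightarrow> carrier K" "l (f a) \<in> carrier K" using l by auto
    moreover have "l (f a \<oplus>\<^bsub>M\<^esub> finsum M f A) = l (f a) \<oplus>\<^bsub>K\<^esub> l (finsum M f A)"
      using assms(2) fa by (auto simp: lfun_def)
    ultimately show ?case using insert fa by simp
  qed
qed

text \<open>Spanning comes from \<open>gen\<close>. Independence comes from functionals that are
  dual to the vectors up to nonzero factors: applying \<open>l a\<close> to a linear relation
  isolates the coefficient of \<open>b a\<close>.\<close>

lemma vdim_eq_card: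
  assumes K: "field K" and M: "Module.module K M" and A: "finite A" and b: "b \<in> A \<rightarrow> carrier M"
    and gen: "\<And>H. Module.submodule H K M \<Longrightarrow> b ` A \<subseteq> H \<Longrightarrow> carrier M \<subseteq> H"
    and l: "\<And>a. a \<in> A \<Longrightarrow> lfun K M (l a)"
    and d: "\<And>a. a \<in> A \<Longrightarrow> l a (b a) \<noteq> \<zero>\<^bsub>K\<^esub>"
    and od: "\<And>a a'. a \<in> A \<Longrightarrow> a' \<in> A \<Longrightarrow> a \<noteq> a' \<Longrightarrow> l a (b a') = \<zero>\<^bsub>K\<^esub>"
  shows "vdim K M = card A"
proof -
  interpret V: vectorspace K M using K M by (simp add: vectorspace_def)
  \<comment> \<open>Identification with the notion of basis from the theory of vector spaces, which
    provides that all finite bases have the same size; the description in \<open>vdim\<close> is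
    then meaningful.\<close>
  have bas: "is_basis K M B \<longleftrightarrow> finite B \<and> V.basis B" for B
  proof -
    have s: "LinearCombinations.submodule K H M \<longleftrightarrow> Module.submodule H K M" for H
      unfolding submodule_iff[OF M] LinearCombinations.submodule_def using M by auto
    have "span_mod K M B = V.span B" if "B \<subseteq> carrier M"
    proof
      show "span_mod K M B \<subseteq> V.span B"
        by (rule span_mod_least) (use that s V.span_is_submodule V.in_own_span in auto)
      show "V.span B \<subseteq> span_mod K M B"
        by (rule V.span_is_subset[OF span_mod_superset]) (simp add: s submodule_span_mod[OF M that])
    qed
    moreover have "V.lin_indpt B \<longleftrightarrow> (\<forall>c \<in> B \<rightarrow> carrier K. finsum M (\<lambda>b. c b \<odot>\<^bsub>M\<^esub> b) B = \<zero>\<^bsub>M\<^esub> \<longrightarrow> (\<forall>b\<in>B. c b = \<zero>\<^bsub>K\<^esub>))"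
      if "finite B" "B \<subseteq> carrier M"
    proof
      assume "V.lin_indpt B"
      then show "\<forall>c \<in> B \<rightarrow> carrier K. finsum M (\<lambda>b. c b \<odot>\<^bsub>M\<^esub> b) B = \<zero>\<^bsub>M\<^esub> \<longrightarrow> (\<forall>b\<in>B. c b = \<zero>\<^bsub>K\<^esub>)"
        unfolding V.lin_dep_def V.lincomb_def using that by blast
    next
      assume "\<forall>c \<in> B \<rightarrow> carrier K. finsum M (\<lambda>b. c b \<odot>\<^bsub>M\<^esub> b) B = \<zero>\<^bsub>M\<^esub> \<longrightarrow> (\<forall>b\<in>B. c b = \<zero>\<^bsub>K\<^esub>)"
      then show "V.lin_indpt B"
        by (intro V.finite_lin_indpt2 that) (auto simp: V.lincomb_def)
    qed
    ultimately show ?thesis unfolding is_basis_def V.basis_def by auto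
  qed
  have bM: "b a \<in> carrier M" if "a \<in> A" for a using b that by auto
  have inj: "inj_on b A" using d od by (metis inj_onI)
  have "is_basis K M (b ` A)"
    unfolding is_basis_def
  proof (intro conjI ballI impI)
    have bc: "b ` A \<subseteq> carrier M" using b by auto
    show "finite (b ` A)" "b ` A \<subseteq> carrier M" using A bc by auto
    show "span_mod K M (b ` A) = carrier M"
      using gen[OF submodule_span_mod[OF M bc] span_mod_superset] span_mod_least[OF submodule_carrier[OF M] bc] by auto
    fix c v assume c: "c \<in> b ` A \<rightarrow> carrier K" and 0: "finsum M (\<lambda>b. c b \<odot>\<^bsub>M\<^esub> b) (b ` A) = \<zero>\<^bsub>M\<^esub>" and v: "v \<in> b ` A"
    then obtain a where a: "a \<in> A" "v = b a" by auto
    have cK: "c (b a') \<in> carrier K" if "a' \<in> A" for a' using c that by auto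
    have lK: "l a (b a') \<in> carrier K" if "a' \<in> A" for a' using l[OF a(1)] bM[OF that] by (auto simp: lfun_def)
    have "\<zero>\<^bsub>K\<^esub> = l a (finsum M (\<lambda>b. c b \<odot>\<^bsub>M\<^esub> b) (b ` A))" using 0 lfun_zero[OF M l[OF a(1)]] by simp
    also have "finsum M (\<lambda>b. c b \<odot>\<^bsub>M\<^esub> b) (b ` A) = finsum M (\<lambda>a'. c (b a') \<odot>\<^bsub>M\<^esub> b a') A"
      by (rule V.M.finsum_reindex) (use inj cK bM in auto)
    also have "l a \<dots> = finsum K (\<lambda>a'. l a (c (b a') \<odot>\<^bsub>M\<^esub> b a')) A"
      by (rule lfun_finsum[OF M l[OF a(1)] A]) (use cK bM in auto)
    also have "\<dots> = finsum K (\<lambda>a'. if a = a' then c (b a) \<otimes>\<^bsub>K\<^esub> l a (b a) else \<zero>\<^bsub>K\<^esub>) A"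
    proof (rule V.R.finsum_cong')
      fix a' assume a': "a' \<in> A"
      have "l a (c (b a') \<odot>\<^bsub>M\<^esub> b a') = c (b a') \<otimes>\<^bsub>K\<^esub> l a (b a')"
        using l[OF a(1)] cK[OF a'] bM[OF a'] by (simp add: lfun_def)
      then show "l a (c (b a') \<odot>\<^bsub>M\<^esub> b a') = (if a = a' then c (b a) \<otimes>\<^bsub>K\<^esub> l a (b a) else \<zero>\<^bsub>K\<^esub>)"
        using od[OF a(1) a'] cK[OF a'] by auto
    qed (use cK lK a in auto)
    also have "\<dots> = c (b a) \<otimes>\<^bsub>K\<^esub> l a (b a)"
      by (rule V.R.finsum_singleton) (use a A cK lK in auto)
    finally show "c v = \<zero>\<^bsub>K\<^esub>" using d[OF a(1)] cK[OF a(1)] lK[OF a(1)] a(2)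
      by (metis field.axioms(1) K domain.integral)
  qed
  then have basis: "is_basis K M (b ` A)" "card (b ` A) = card A" using inj card_image by auto
  have "card B = V.dim" if "is_basis K M B" for B
    using V.dim_basis that bas by auto
  then show ?thesis unfolding vdim_def using basis by (intro the_equality) auto
qed

lemma a_r_coset_iff: "x \<in> U +>\<^bsub>M\<^esub> m \<longleftrightarrow> (\<exists>u\<in>U. x = u \<oplus>\<^bsub>M\<^esub> m)"
  by (auto simp: a_r_coset_def')

lemma quot_mod:
  assumes M: "Module.module K M" and U: "Module.submodule U K M"
  shows "Module.module K (quot_mod M U)" "(\<lambda>m. U +>\<^bsub>M\<^esub> m) \<in> module_hom K M (quot_mod M U)"
    "(\<lambda>m. U +>\<^bsub>M\<^esub> m) ` carrier M = carrier (quot_mod M U)"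
    "\<And>m. m \<in> carrier M \<Longrightarrow> U +>\<^bsub>M\<^esub> m = \<zero>\<^bsub>quot_mod M U\<^esub> \<longleftrightarrow> m \<in> U"
proof -
  interpret Module.module K M by fact
  interpret U: Module.submodule U K M by fact
  interpret A: abelian_subgroup U M
  proof (rule abelian_subgroupI3)
    show "additive_subgroup U M"
      by (rule additive_subgroup.intro) (rule U.subgroup_axioms)
  qed (rule M.abelian_group_axioms)
  let ?Q = "quot_mod M U" and ?k = "\<lambda>m. U +>\<^bsub>M\<^esub> m"
  have car: "carrier ?Q = ?k ` carrier M" by (auto simp: quot_mod_def A_RCOSETS_def')
  then show "?k ` carrier M = carrier ?Q" by simp
  have add: "?k x \<oplus>\<^bsub>?Q\<^esub> ?k y = ?k (x \<oplus>\<^bsub>M\<^esub> y)" if "x \<in> carrier M" "y \<in> carrier M" for x y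
    using A.a_rcos_sum[OF that] by (simp add: quot_mod_def)
  have eqI: "?k x = ?k y" if "x \<in> ?k y" "y \<in> carrier M" for x y
    using A.a_repr_independence'[OF that] by simp
  \<comment> \<open>Scalar multiplication is a union over all representatives of the coset; they
    give one and the same coset, so the union collapses to it.\<close>
  have sm: "c \<odot>\<^bsub>?Q\<^esub> ?k x = ?k (c \<odot>\<^bsub>M\<^esub> x)" if c: "c \<in> carrier K" and x: "x \<in> carrier M" for c x
  proof -
    have "?k (c \<odot>\<^bsub>M\<^esub> y) = ?k (c \<odot>\<^bsub>M\<^esub> x)" if y: "y \<in> ?k x" for y
    proof (rule eqI)
      obtain u where u: "u \<in> U" "y = u \<oplus>\<^bsub>M\<^esub> x" using y by (auto simp: a_r_coset_iff)
      have "u \<in> carrier M" using u U.subset by auto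
      then have "c \<odot>\<^bsub>M\<^esub> y = c \<odot>\<^bsub>M\<^esub> u \<oplus>\<^bsub>M\<^esub> c \<odot>\<^bsub>M\<^esub> x" using c x u by (simp add: smult_r_distr)
      then show "c \<odot>\<^bsub>M\<^esub> y \<in> ?k (c \<odot>\<^bsub>M\<^esub> x)" using c u by (auto simp: a_r_coset_iff)
    qed (use c x in simp)
    note * = this
    have "x \<in> ?k x" using x by (rule A.a_rcos_self)
    then have "(\<Union>y\<in>?k x. ?k (c \<odot>\<^bsub>M\<^esub> x)) = ?k (c \<odot>\<^bsub>M\<^esub> x)" by (intro UN_constant_eq) auto
    moreover have "c \<odot>\<^bsub>?Q\<^esub> ?k x = (\<Union>y\<in>?k x. ?k (c \<odot>\<^bsub>M\<^esub> y))" by (simp add: quot_mod_def)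
    moreover have "(\<Union>y\<in>?k x. ?k (c \<odot>\<^bsub>M\<^esub> y)) = (\<Union>y\<in>?k x. ?k (c \<odot>\<^bsub>M\<^esub> x))"
      using * by (rule SUP_cong[OF refl])
    ultimately show ?thesis by simp
  qed
  have zero: "\<zero>\<^bsub>?Q\<^esub> = ?k \<zero>\<^bsub>M\<^esub>"
  proof -
    have "u \<oplus>\<^bsub>M\<^esub> \<zero>\<^bsub>M\<^esub> = u" if "u \<in> U" for u using that U.subset by auto
    then have "?k \<zero>\<^bsub>M\<^esub> = U" by (intro Set.set_eqI) (simp add: a_r_coset_iff)
    then show ?thesis by (simp add: quot_mod_def)
  qed
  show hom: "?k \<in> module_hom K M ?Q"
    unfolding module_hom_def using car add sm by auto
  have "abelian_group ?Q"
  proof (rule abelian_groupI)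
    fix x assume "x \<in> carrier ?Q"
    then obtain m where m: "m \<in> carrier M" "x = ?k m" using car by auto
    show "\<zero>\<^bsub>?Q\<^esub> \<oplus>\<^bsub>?Q\<^esub> x = x" using m zero add by auto
    have "?k (\<ominus>\<^bsub>M\<^esub> m) \<oplus>\<^bsub>?Q\<^esub> x = \<zero>\<^bsub>?Q\<^esub>" using m zero add M.l_neg by auto
    then show "\<exists>y\<in>carrier ?Q. y \<oplus>\<^bsub>?Q\<^esub> x = \<zero>\<^bsub>?Q\<^esub>" using m car by auto
  next
    fix x y assume "x \<in> carrier ?Q" "y \<in> carrier ?Q"
    then obtain m n where mn: "m \<in> carrier M" "n \<in> carrier M" "x = ?k m" "y = ?k n" using car by auto
    show "x \<oplus>\<^bsub>?Q\<^esub> y \<in> carrier ?Q" using mn car add by auto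
    show "x \<oplus>\<^bsub>?Q\<^esub> y = y \<oplus>\<^bsub>?Q\<^esub> x" using mn add M.a_comm by simp
    fix z assume "z \<in> carrier ?Q"
    then obtain l where l: "l \<in> carrier M" "z = ?k l" using car by auto
    show "x \<oplus>\<^bsub>?Q\<^esub> y \<oplus>\<^bsub>?Q\<^esub> z = x \<oplus>\<^bsub>?Q\<^esub> (y \<oplus>\<^bsub>?Q\<^esub> z)"
      using mn l add M.a_assoc by simp
  qed (use car zero in auto)
  then show "Module.module K ?Q"
    by (rule Module.moduleI[OF R.is_cring]) (auto simp: car sm add smult_l_distr smult_r_distr smult_assoc1)
  fix m assume m: "m \<in> carrier M"
  show "?k m = \<zero>\<^bsub>?Q\<^esub> \<longleftrightarrow> m \<in> U"
    using A.a_rcos_const[of m] A.a_rcos_self[OF m] by (auto simp: quot_mod_def)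
qed

text \<open>\<open>pres K V M \<pi> T\<close>: the map \<open>\<pi>\<close> exhibits \<open>M\<close> as the space of coinvariants of \<open>V\<close> under the operators
  in \<open>T\<close>; the kernel is only described through the invariant functionals, which is what is needed to
  compute a dimension.\<close>

definition pres :: "('a, 'm) ring_scheme \<Rightarrow> ('a, 'v, 'p) module_scheme \<Rightarrow> ('a, 'b, 'n) module_scheme \<Rightarrow>
    ('v \<Rightarrow> 'b) \<Rightarrow> ('v \<Rightarrow> 'v) set \<Rightarrow> bool" where
  "pres K V M \<pi> T \<longleftrightarrow> Module.module K M \<and> \<pi> \<in> module_hom K V M \<and> \<pi> ` carrier V = carrier M \<and>
     (\<forall>t\<in>T. \<forall>x\<in>carrier V. \<pi> (t x) = \<pi> x) \<and>
     (\<forall>l. lfun K V l \<longrightarrow> (\<forall>t\<in>T. \<forall>x\<in>carrier V. l (t x) = l x) \<longrightarrow>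
        (\<forall>x\<in>carrier V. \<pi> x = \<zero>\<^bsub>M\<^esub> \<longrightarrow> l x = \<zero>\<^bsub>K\<^esub>))"

lemma pres_self: "Module.module K V \<Longrightarrow> pres K V V (\<lambda>x. x) {}"
  by (auto simp: pres_def module_hom_def lfun_zero)

text \<open>One further quotient. The operators \<open>act a\<close> on \<open>M\<close> are covered
  by operators \<open>S a\<close> on \<open>V\<close>, so statements about the quotient of
  \<open>M\<close> can be checked in \<open>V\<close>.\<close>

context
  fixes K :: "('a, 'm) ring_scheme" and V :: "('a, 'v, 'p) module_scheme" and M :: "('a, 'b, 'n) module_scheme"
    and \<pi> :: "'v \<Rightarrow> 'b" and T :: "('v \<Rightarrow> 'v) set" and A :: "'c set" and act :: "'c \<Rightarrow> 'b \<Rightarrow> 'b"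
    and S :: "'c \<Rightarrow> 'v \<Rightarrow> 'v"
  assumes V: "Module.module K V" and pres: "pres K V M \<pi> T"
    and S: "\<And>a. a \<in> A \<Longrightarrow> S a \<in> carrier V \<rightarrow> carrier V"
    and act: "\<And>a x. a \<in> A \<Longrightarrow> x \<in> carrier V \<Longrightarrow> act a (\<pi> x) = \<pi> (S a x)"
begin

interpretation V: Module.module K V by (rule V)
interpretation M: Module.module K M using pres by (simp add: pres_def)

definition gens where "gens = {act a x \<ominus>\<^bsub>M\<^esub> x | a x. a \<in> A \<and> x \<in> carrier M}"

lemma hom: "x \<in> carrier V \<Longrightarrow> \<pi> x \<in> carrier M"
  "x \<in> carrier V \<Longrightarrow> y \<in> carrier V \<Longrightarrow> \<pi> (x \<oplus>\<^bsub>V\<^esub> y) = \<pi> x \<oplus>\<^bsub>M\<^esub> \<pi> y"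
  "c \<in> carrier K \<Longrightarrow> x \<in> carrier V \<Longrightarrow> \<pi> (c \<odot>\<^bsub>V\<^esub> x) = c \<odot>\<^bsub>M\<^esub> \<pi> x"
  using pres by (auto simp: pres_def module_hom_def)

lemma hom_zero: "\<pi> \<zero>\<^bsub>V\<^esub> = \<zero>\<^bsub>M\<^esub>"
  using hom(3)[of "\<zero>\<^bsub>K\<^esub>" "\<zero>\<^bsub>V\<^esub>"] hom(1)[of "\<zero>\<^bsub>V\<^esub>"] by simp

lemma hom_minus: "x \<in> carrier V \<Longrightarrow> \<pi> (\<ominus>\<^bsub>V\<^esub> x) = \<ominus>\<^bsub>M\<^esub> \<pi> x"
  using hom(3)[of "\<ominus>\<^bsub>K\<^esub> \<one>\<^bsub>K\<^esub>" x] hom(1)[of x] V.smult_minus_1[of x] M.smult_minus_1[of "\<pi> x"] by simp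

lemma hom_diff: "x \<in> carrier V \<Longrightarrow> y \<in> carrier V \<Longrightarrow> \<pi> (x \<ominus>\<^bsub>V\<^esub> y) = \<pi> x \<ominus>\<^bsub>M\<^esub> \<pi> y"
  by (simp add: a_minus_def hom hom_minus)

lemma surj: "m \<in> carrier M \<Longrightarrow> \<exists>x\<in>carrier V. m = \<pi> x"
  using pres by (auto simp: pres_def)

lemma gens_eq: "gens = {\<pi> (S a x \<ominus>\<^bsub>V\<^esub> x) | a x. a \<in> A \<and> x \<in> carrier V}"
proof -
  have "act a (\<pi> x) \<ominus>\<^bsub>M\<^esub> \<pi> x = \<pi> (S a x \<ominus>\<^bsub>V\<^esub> x)" if "a \<in> A" "x \<in> carrier V" for a x
  proof -
    have "S a x \<in> carrier V" using S that by auto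
    then show ?thesis using act[OF that] that by (simp add: hom_diff)
  qed
  note * = this
  show ?thesis
  proof (intro Set.set_eqI iffI)
    fix g assume "g \<in> gens"
    then obtain a m where am: "a \<in> A" "m \<in> carrier M" "g = act a m \<ominus>\<^bsub>M\<^esub> m" by (auto simp: gens_def)
    obtain x where "x \<in> carrier V" "m = \<pi> x" using surj[OF am(2)] by blast
    then show "g \<in> {\<pi> (S a x \<ominus>\<^bsub>V\<^esub> x) | a x. a \<in> A \<and> x \<in> carrier V}" using am * by blast
  next
    fix g assume "g \<in> {\<pi> (S a x \<ominus>\<^bsub>V\<^esub> x) | a x. a \<in> A \<and> x \<in> carrier V}"
    then obtain a x where ax: "a \<in> A" "x \<in> carrier V" "g = \<pi> (S a x \<ominus>\<^bsub>V\<^esub> x)" by blast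
    then have "g = act a (\<pi> x) \<ominus>\<^bsub>M\<^esub> \<pi> x" by (simp only: *)
    then show "g \<in> gens" unfolding gens_def using ax hom(1) by blast
  qed
qed

lemma gens_sub: "gens \<subseteq> carrier M"
  unfolding gens_eq using S hom(1) by (auto intro!: hom V.minus_closed)

lemma sub: "Module.submodule (span_mod K M gens) K M"
  using submodule_span_mod[OF _ gens_sub] M.module_axioms by blast

text \<open>Taking coinvariants in stages accumulates the operators of all stages on the original
  space, so successive quotients can be treated as one.\<close>

lemma pres_coinvariants:
  "pres K V (coinvariants K M A act) (\<lambda>x. span_mod K M gens +>\<^bsub>M\<^esub> \<pi> x) (T \<union> S ` A)"
proof -
  let ?U = "span_mod K M gens"
  have C: "coinvariants K M A act = quot_mod M ?U" by (simp add: coinvariants_def gens_def)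
  note q = quot_mod[OF M.module_axioms sub]
  have sg: "gens \<subseteq> ?U" by (rule span_mod_superset)
  have homq: "?U +>\<^bsub>M\<^esub> (x \<oplus>\<^bsub>M\<^esub> y) = (?U +>\<^bsub>M\<^esub> x) \<oplus>\<^bsub>quot_mod M ?U\<^esub> (?U +>\<^bsub>M\<^esub> y)"
     if "x \<in> carrier M" "y \<in> carrier M" for x y
    using q(2) that by (auto simp: module_hom_def)
  have step: "?U +>\<^bsub>M\<^esub> \<pi> (S a x) = ?U +>\<^bsub>M\<^esub> \<pi> x" if "a \<in> A" "x \<in> carrier V" for a x
  proof -
    interpret Q: Module.module K "quot_mod M ?U" by (rule q(1))
    have Sx: "S a x \<in> carrier V" using S that by auto
    have mem: "\<pi> (S a x \<ominus>\<^bsub>V\<^esub> x) \<in> ?U" using that sg by (auto simp: gens_eq)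
    have "\<pi> (S a x) = \<pi> (S a x \<ominus>\<^bsub>V\<^esub> x) \<oplus>\<^bsub>M\<^esub> \<pi> x"
      using Sx that by (simp only: hom_diff) (simp add: a_minus_def M.a_assoc M.l_neg hom(1))
    then have "?U +>\<^bsub>M\<^esub> \<pi> (S a x) = (?U +>\<^bsub>M\<^esub> \<pi> (S a x \<ominus>\<^bsub>V\<^esub> x)) \<oplus>\<^bsub>quot_mod M ?U\<^esub> (?U +>\<^bsub>M\<^esub> \<pi> x)"
      using homq Sx that by (simp add: hom(1) V.minus_closed)
    also have "?U +>\<^bsub>M\<^esub> \<pi> (S a x \<ominus>\<^bsub>V\<^esub> x) = \<zero>\<^bsub>quot_mod M ?U\<^esub>"
      using q(4) mem Sx that by (simp add: hom(1) V.minus_closed)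
    finally show ?thesis using q(3) that hom(1)[of x] by (metis Q.M.l_zero imageI)
  qed
  have ker: "l x = \<zero>\<^bsub>K\<^esub>" if l: "lfun K V l" and inv: "\<And>t x. t \<in> T \<union> S ` A \<Longrightarrow> x \<in> carrier V \<Longrightarrow> l (t x) = l x"
    and x: "x \<in> carrier V" and z: "?U +>\<^bsub>M\<^esub> \<pi> x = \<zero>\<^bsub>quot_mod M ?U\<^esub>" for l x
  proof -
    have ladd: "l (x \<oplus>\<^bsub>V\<^esub> y) = l x \<oplus>\<^bsub>K\<^esub> l y" and lsm: "c \<in> carrier K \<Longrightarrow> l (c \<odot>\<^bsub>V\<^esub> x) = c \<otimes>\<^bsub>K\<^esub> l x"
      and lK: "l x \<in> carrier K"
      if "x \<in> carrier V" "y \<in> carrier V" for x y c using l that by (auto simp: lfun_def)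
    have lm: "l (x \<ominus>\<^bsub>V\<^esub> y) = l x \<ominus>\<^bsub>K\<^esub> l y" if "x \<in> carrier V" "y \<in> carrier V" for x y
    proof -
      have "l (\<ominus>\<^bsub>V\<^esub> y) = \<ominus>\<^bsub>K\<^esub> l y"
        using lsm[of y y "\<ominus>\<^bsub>K\<^esub> \<one>\<^bsub>K\<^esub>"] V.smult_minus_1[of y] that lK[of y y] by (simp add: V.R.l_minus)
      then show ?thesis using that ladd by (simp add: a_minus_def)
    qed
    \<comment> \<open>The image of the kernel of \<open>l\<close> is a submodule containing the new
      relations, hence their span. So \<open>x\<close> differs from a vector killed by
      \<open>l\<close> by an element of the kernel of \<pi>, and \<open>l\<close> vanishes there
      because it is invariant under \<open>T\<close>.\<close>
    let ?H = "{m. \<exists>x\<in>carrier V. m = \<pi> x \<and> l x = \<zero>\<^bsub>K\<^esub>}"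
    have "Module.submodule ?H K M"
      unfolding submodule_iff[OF M.module_axioms]
    proof (intro conjI ballI)
      show "?H \<subseteq> carrier M" using hom by auto
      show "\<zero>\<^bsub>M\<^esub> \<in> ?H" using hom_zero lfun_zero[OF V l] by (metis (mono_tags, lifting) V.M.zero_closed mem_Collect_eq)
      fix m n assume "m \<in> ?H" "n \<in> ?H"
      then obtain x y where "x \<in> carrier V" "y \<in> carrier V" "m = \<pi> x" "n = \<pi> y" "l x = \<zero>\<^bsub>K\<^esub>" "l y = \<zero>\<^bsub>K\<^esub>" by auto
      then show "m \<oplus>\<^bsub>M\<^esub> n \<in> ?H" by (intro CollectI bexI[of _ "x \<oplus>\<^bsub>V\<^esub> y"]) (auto simp: hom ladd)
    next
      fix c m assume c: "c \<in> carrier K" and "m \<in> ?H"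
      then obtain x where "x \<in> carrier V" "m = \<pi> x" "l x = \<zero>\<^bsub>K\<^esub>" by auto
      then show "c \<odot>\<^bsub>M\<^esub> m \<in> ?H" using c by (intro CollectI bexI[of _ "c \<odot>\<^bsub>V\<^esub> x"]) (auto simp: hom lsm)
    qed
    moreover have "gens \<subseteq> ?H"
    proof
      fix g assume "g \<in> gens"
      then obtain a x where ax: "a \<in> A" "x \<in> carrier V" "g = \<pi> (S a x \<ominus>\<^bsub>V\<^esub> x)" by (auto simp: gens_eq)
      have Sx: "S a x \<in> carrier V" using S ax by auto
      have "l (S a x \<ominus>\<^bsub>V\<^esub> x) = \<zero>\<^bsub>K\<^esub>" using inv[of "S a" x] ax Sx lK[of x x]
        by (simp only: lm) (simp add: a_minus_def V.R.r_neg)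
      then show "g \<in> ?H" using ax Sx by auto
    qed
    ultimately have "?U \<subseteq> ?H" by (rule span_mod_least)
    moreover have "\<pi> x \<in> ?U" using q(4)[of "\<pi> x"] z x by (simp add: hom(1))
    ultimately obtain y where y: "y \<in> carrier V" "\<pi> x = \<pi> y" "l y = \<zero>\<^bsub>K\<^esub>" by auto
    have "\<pi> (x \<ominus>\<^bsub>V\<^esub> y) = \<zero>\<^bsub>M\<^esub>" using x y by (simp only: hom_diff) (simp add: a_minus_def M.r_neg hom(1))
    moreover have "\<And>z. z \<in> carrier V \<Longrightarrow> \<pi> z = \<zero>\<^bsub>M\<^esub> \<Longrightarrow> l z = \<zero>\<^bsub>K\<^esub>"
      using pres l inv unfolding pres_def by blast
    ultimately have "l (x \<ominus>\<^bsub>V\<^esub> y) = \<zero>\<^bsub>K\<^esub>" using x y(1) by (simp add: V.minus_closed)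
    then have "l x \<ominus>\<^bsub>K\<^esub> \<zero>\<^bsub>K\<^esub> = \<zero>\<^bsub>K\<^esub>" using x y by (simp only: lm)
    then show ?thesis using x lK[of x x] by (simp add: a_minus_def)
  qed
  have T: "\<pi> (t x) = \<pi> x" if "t \<in> T" "x \<in> carrier V" for t x using pres that by (auto simp: pres_def)
  have mh: "(\<lambda>x. ?U +>\<^bsub>M\<^esub> \<pi> x) \<in> module_hom K V (quot_mod M ?U)"
    using q(2) by (auto simp: module_hom_def hom)
  have im: "(\<lambda>x. ?U +>\<^bsub>M\<^esub> \<pi> x) ` carrier V = carrier (quot_mod M ?U)"
    unfolding q(3)[symmetric] using pres by (auto simp: pres_def image_image[symmetric])
  show ?thesis
    unfolding C pres_def using q(1) mh im step T ker by auto
qed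

text \<open>The next group acts on a coset by elementwise image. Since \<open>R\<close> permutes the
  operators \<open>S a\<close> up to renaming, \<psi> maps the span of the relations into itself;
  the inverse \<open>R'\<close> shows that it does so onto, and therefore the image of a coset is a
  full coset.\<close>

lemma coinvariants_image:
  assumes R: "R \<in> module_hom K V V" "R' \<in> carrier V \<rightarrow> carrier V"
    and inv: "\<And>x. x \<in> carrier V \<Longrightarrow> R (R' x) = x"
    and \<psi>: "\<And>x. x \<in> carrier V \<Longrightarrow> \<psi> (\<pi> x) = \<pi> (R x)" and \<psi>': "\<And>x. x \<in> carrier V \<Longrightarrow> \<psi>' (\<pi> x) = \<pi> (R' x)"
    and R'hom: "R' \<in> module_hom K V V"
    and norm: "\<And>a. a \<in> A \<Longrightarrow> \<exists>a'\<in>A. \<forall>x\<in>carrier V. R (S a x) = S a' (R x)"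
      "\<And>a. a \<in> A \<Longrightarrow> \<exists>a'\<in>A. \<forall>x\<in>carrier V. R' (S a x) = S a' (R' x)"
    and x: "x \<in> carrier V"
  shows "\<psi> ` (span_mod K M gens +>\<^bsub>M\<^esub> \<pi> x) = span_mod K M gens +>\<^bsub>M\<^esub> \<pi> (R x)"
proof -
  let ?U = "span_mod K M gens"
  have pm: "\<phi> u \<in> ?U"
    if F: "F \<in> module_hom K V V" and \<phi>: "\<And>x. x \<in> carrier V \<Longrightarrow> \<phi> (\<pi> x) = \<pi> (F x)"
      and n: "\<And>a. a \<in> A \<Longrightarrow> \<exists>a'\<in>A. \<forall>x\<in>carrier V. F (S a x) = S a' (F x)" and u: "u \<in> ?U" for F \<phi> u
  proof -
    have FV: "F x \<in> carrier V" if "x \<in> carrier V" for x using F that by (auto simp: module_hom_def)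
    have Fa: "F (x \<oplus>\<^bsub>V\<^esub> y) = F x \<oplus>\<^bsub>V\<^esub> F y" if "x \<in> carrier V" "y \<in> carrier V" for x y
      using F that by (auto simp: module_hom_def)
    have Fs: "F (c \<odot>\<^bsub>V\<^esub> x) = c \<odot>\<^bsub>V\<^esub> F x" if "c \<in> carrier K" "x \<in> carrier V" for x c
      using F that by (auto simp: module_hom_def)
    have F0: "F \<zero>\<^bsub>V\<^esub> = \<zero>\<^bsub>V\<^esub>" using Fs[of "\<zero>\<^bsub>K\<^esub>" "\<zero>\<^bsub>V\<^esub>"] FV[of "\<zero>\<^bsub>V\<^esub>"] by simp
    have Fm: "F (x \<ominus>\<^bsub>V\<^esub> y) = F x \<ominus>\<^bsub>V\<^esub> F y" if "x \<in> carrier V" "y \<in> carrier V" for x y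
      using that Fs[of "\<ominus>\<^bsub>K\<^esub> \<one>\<^bsub>K\<^esub>" y] Fa[of x "\<ominus>\<^bsub>V\<^esub> y"] FV[of y] by (simp add: a_minus_def V.smult_minus_1)
    let ?H = "{m. \<exists>x\<in>carrier V. m = \<pi> x \<and> \<pi> (F x) \<in> ?U}"
    have U: "?U \<subseteq> carrier M" "\<zero>\<^bsub>M\<^esub> \<in> ?U" "\<And>x y. x \<in> ?U \<Longrightarrow> y \<in> ?U \<Longrightarrow> x \<oplus>\<^bsub>M\<^esub> y \<in> ?U"
      "\<And>c x. c \<in> carrier K \<Longrightarrow> x \<in> ?U \<Longrightarrow> c \<odot>\<^bsub>M\<^esub> x \<in> ?U"
      using sub unfolding submodule_iff[OF M.module_axioms] by auto
    have "Module.submodule ?H K M"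
      unfolding submodule_iff[OF M.module_axioms]
    proof (intro conjI ballI)
      show "?H \<subseteq> carrier M" using hom by auto
      show "\<zero>\<^bsub>M\<^esub> \<in> ?H" using hom_zero F0 U(2) by (metis (mono_tags, lifting) V.M.zero_closed mem_Collect_eq)
      fix m n assume "m \<in> ?H" "n \<in> ?H"
      then obtain x y where "x \<in> carrier V" "y \<in> carrier V" "m = \<pi> x" "n = \<pi> y" "\<pi> (F x) \<in> ?U" "\<pi> (F y) \<in> ?U" by auto
      then show "m \<oplus>\<^bsub>M\<^esub> n \<in> ?H" using U(3) by (intro CollectI bexI[of _ "x \<oplus>\<^bsub>V\<^esub> y"]) (auto simp: hom Fa FV)
    next
      fix c m assume c: "c \<in> carrier K" and "m \<in> ?H"
      then obtain x where "x \<in> carrier V" "m = \<pi> x" "\<pi> (F x) \<in> ?U" by auto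
      then show "c \<odot>\<^bsub>M\<^esub> m \<in> ?H" using c U(4) by (intro CollectI bexI[of _ "c \<odot>\<^bsub>V\<^esub> x"]) (auto simp: hom Fs FV)
    qed
    moreover have "gens \<subseteq> ?H"
    proof
      fix g assume "g \<in> gens"
      then obtain a x where ax: "a \<in> A" "x \<in> carrier V" "g = \<pi> (S a x \<ominus>\<^bsub>V\<^esub> x)" by (auto simp: gens_eq)
      obtain a' where a': "a' \<in> A" "F (S a x) = S a' (F x)" using n[OF ax(1)] ax(2) by blast
      have Sx: "S a x \<in> carrier V" using S ax by auto
      have "\<pi> (F (S a x \<ominus>\<^bsub>V\<^esub> x)) \<in> gens"
        unfolding gens_eq using a' ax Sx FV by (auto simp: Fm)
      then show "g \<in> ?H" using ax Sx span_mod_superset[of gens K M] by auto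
    qed
    ultimately have "?U \<subseteq> ?H" by (rule span_mod_least)
    then show ?thesis using u \<phi> by auto
  qed
  have Usub: "?U \<subseteq> carrier M" using sub unfolding submodule_iff[OF M.module_axioms] by auto
  have R1: "R x \<in> carrier V" if "x \<in> carrier V" for x using R that by (auto simp: module_hom_def)
  have R2: "R (x \<oplus>\<^bsub>V\<^esub> y) = R x \<oplus>\<^bsub>V\<^esub> R y" if "x \<in> carrier V" "y \<in> carrier V" for x y
    using R that by (auto simp: module_hom_def)
  have \<psi>add: "\<psi> (u \<oplus>\<^bsub>M\<^esub> \<pi> x) = \<psi> u \<oplus>\<^bsub>M\<^esub> \<pi> (R x)" if u: "u \<in> ?U" for u
  proof -
    obtain y where y: "y \<in> carrier V" "u = \<pi> y" using surj u Usub by blast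
    have "\<psi> (\<pi> (y \<oplus>\<^bsub>V\<^esub> x)) = \<pi> (R (y \<oplus>\<^bsub>V\<^esub> x))" using y(1) x by (intro \<psi>) simp
    then show ?thesis using y x by (simp add: \<psi>[OF y(1)] hom R1 R2)
  qed
  have \<psi>\<psi>': "\<psi> (\<psi>' u) = u" if u: "u \<in> ?U" for u
  proof -
    obtain y where y: "y \<in> carrier V" "u = \<pi> y" using surj u Usub by blast
    moreover have "R' y \<in> carrier V" using R(2) y(1) by auto
    ultimately show ?thesis by (simp add: \<psi> \<psi>' inv)
  qed
  show ?thesis
  proof (intro Set.set_eqI iffI)
    fix m assume "m \<in> \<psi> ` (?U +>\<^bsub>M\<^esub> \<pi> x)"
    then obtain u where u: "u \<in> ?U" "m = \<psi> (u \<oplus>\<^bsub>M\<^esub> \<pi> x)" by (auto simp: a_r_coset_iff)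
    then show "m \<in> ?U +>\<^bsub>M\<^esub> \<pi> (R x)"
      using pm[OF R(1) \<psi> norm(1) u(1)] by (auto simp: a_r_coset_iff \<psi>add)
  next
    fix m assume "m \<in> ?U +>\<^bsub>M\<^esub> \<pi> (R x)"
    then obtain u where u: "u \<in> ?U" "m = u \<oplus>\<^bsub>M\<^esub> \<pi> (R x)" by (auto simp: a_r_coset_iff)
    have u': "\<psi>' u \<in> ?U" by (rule pm[OF R'hom \<psi>' norm(2) u(1)])
    have "m = \<psi> (\<psi>' u \<oplus>\<^bsub>M\<^esub> \<pi> x)" using u by (simp add: \<psi>add[OF u'] \<psi>\<psi>')
    moreover have "\<psi>' u \<oplus>\<^bsub>M\<^esub> \<pi> x \<in> ?U +>\<^bsub>M\<^esub> \<pi> x" using u' unfolding a_r_coset_iff by blast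
    ultimately show "m \<in> \<psi> ` (?U +>\<^bsub>M\<^esub> \<pi> x)" by (simp only: imageI)
  qed
qed

end

section \<open>Signed permutation representations\<close>

lemma sum_if_eq_card: "finite A \<Longrightarrow> (\<Sum>x\<in>A. if P x then 1 else 0) = (card {x\<in>A. P x} :: nat)"
  by (subst sum.inter_filter[symmetric]) simp_all

text \<open>A finite group acting with a sign character. Only a unit and injective left translations
  are demanded; inverses are then produced by finiteness, acting as inverses on
  \<open>X\<close>.\<close>

locale signed_action =
  fixes H :: "'h set" and X :: "'g set" and mul :: "'h \<Rightarrow> 'h \<Rightarrow> 'h" and e :: 'h
    and f :: "'h \<Rightarrow> 'g \<Rightarrow> 'g" and sn :: "'h \<Rightarrow> int"
  assumes finH: "finite H" and finX: "finite X"
    and e: "e \<in> H" "\<And>x. x \<in> X \<Longrightarrow> f e x = x" "sn e = 1"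
    and mul: "\<And>h k. h \<in> H \<Longrightarrow> k \<in> H \<Longrightarrow> mul h k \<in> H" "\<And>h. h \<in> H \<Longrightarrow> inj_on (mul h) H"
    and fX: "\<And>h x. h \<in> H \<Longrightarrow> x \<in> X \<Longrightarrow> f h x \<in> X"
    and f_mul: "\<And>h k x. h \<in> H \<Longrightarrow> k \<in> H \<Longrightarrow> x \<in> X \<Longrightarrow> f (mul h k) x = f h (f k x)"
    and sn_mul: "\<And>h k. h \<in> H \<Longrightarrow> k \<in> H \<Longrightarrow> sn (mul h k) = sn h * sn k"
    and sn: "\<And>h. h \<in> H \<Longrightarrow> sn h = 1 \<or> sn h = -1"
begin

lemma bij_mul: "h \<in> H \<Longrightarrow> bij_betw (mul h) H H"
  unfolding bij_betw_def by (intro conjI mul endo_inj_surj finH) (use mul in auto)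

lemma sn_sq: "h \<in> H \<Longrightarrow> sn h * sn h = 1"
  using sn by force

lemma inverse:
  assumes h: "h \<in> H"
  obtains k where "k \<in> H" "\<forall>x\<in>X. f h (f k x) = x" "\<forall>x\<in>X. f k (f h x) = x" "sn k = sn h"
proof -
  obtain k where k: "k \<in> H" "mul h k = e" using bij_mul[OF h] e(1) by (metis bij_betw_iff_bijections)
  have 1: "f h (f k x) = x" if "x \<in> X" for x using f_mul[OF h k(1) that] k e that by simp
  have "f h ` X = X" using 1 fX h k(1) by force
  then have inj: "inj_on (f h) X" using finX by (intro eq_card_imp_inj_on) auto
  have 2: "f k (f h x) = x" if "x \<in> X" for x
    using inj 1[of "f h x"] fX h k(1) that by (meson inj_onD)
  have "sn h * sn k = 1" using sn_mul[OF h k(1)] k e by simp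
  then have "sn k = sn h" using sn[OF h] sn[OF k(1)] by auto
  then show ?thesis using 1 2 by (intro that[OF k(1)]) auto
qed

lemma bij_f: assumes "h \<in> H" shows "bij_betw (f h) X X"
proof -
  obtain k where "k \<in> H" "\<forall>x\<in>X. f h (f k x) = x" "\<forall>x\<in>X. f k (f h x) = x" "sn k = sn h"
    using inverse[OF assms] by metis
  then show ?thesis using fX assms by (intro bij_betw_byWitness[where f'="f k"]) auto
qed

definition orb where "orb x = {f h x | h. h \<in> H}"
definition stab where "stab x = {h\<in>H. f h x = x}"
text \<open>The choice is made from \<open>orb x\<close> and not from \<open>x\<close>, so it is
  constant on orbits.\<close>

definition rep where "rep x = (SOME y. y \<in> orb x)"
text \<open>A stabilising element of sign -1 identifies a basis vector with its own negative in the
  coinvariants; exactly the orbits without such an element survive.\<close>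

definition good where "good x \<longleftrightarrow> (\<forall>h\<in>stab x. sn h = 1)"
definition reps where "reps = {x\<in>X. rep x = x \<and> good x}"

lemma orb_self: "x \<in> X \<Longrightarrow> x \<in> orb x"
  using e by (auto simp: orb_def intro!: exI[of _ e])

lemma orb_sub: "x \<in> X \<Longrightarrow> orb x \<subseteq> X"
  using fX by (auto simp: orb_def)

lemma orb_eq: assumes x: "x \<in> X" and y: "y \<in> orb x" shows "orb y = orb x"
proof -
  have sub: "orb z \<subseteq> orb x" if xz: "x \<in> X" "z \<in> orb x" for x z
  proof
    fix w assume "w \<in> orb z"
    then obtain h k where "h \<in> H" "k \<in> H" "w = f h (f k x)" using xz by (auto simp: orb_def)
    then have "w = f (mul h k) x" "mul h k \<in> H" using xz f_mul mul by auto
    then show "w \<in> orb x" by (auto simp: orb_def)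
  qed
  obtain h where h: "h \<in> H" "y = f h x" using y by (auto simp: orb_def)
  obtain k where "k \<in> H" "\<forall>x\<in>X. f h (f k x) = x" "\<forall>x\<in>X. f k (f h x) = x" "sn k = sn h"
    using inverse[OF h(1)] by metis
  then have "x \<in> orb y" using h x by (auto simp: orb_def intro!: exI[of _ k])
  then show ?thesis using sub[OF x y] sub[of y x] orb_sub[OF x] y by blast
qed

lemma rep: assumes "x \<in> X" shows "rep x \<in> orb x" "rep x \<in> X" "rep (rep x) = rep x"
proof -
  show 1: "rep x \<in> orb x" unfolding rep_def using orb_self[OF assms] by (rule someI)
  then show "rep x \<in> X" using orb_sub assms by auto
  show "rep (rep x) = rep x" using orb_eq[OF assms 1] by (simp add: rep_def)
qed

lemma rep_eq_iff: "x \<in> X \<Longrightarrow> y \<in> X \<Longrightarrow> rep x = rep y \<longleftrightarrow> y \<in> orb x"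
proof -
  assume x: "x \<in> X" and y: "y \<in> X"
  have "orb (rep x) = orb x" "orb (rep y) = orb y"
    using orb_eq[OF x rep(1)[OF x]] orb_eq[OF y rep(1)[OF y]] by auto
  then show ?thesis using orb_self[OF y] orb_eq[OF x] by (metis rep_def)
qed

text \<open>Stabilisers in one orbit are conjugate, and conjugation does not change signs.\<close>

lemma good_orb: assumes x: "x \<in> X" and y: "y \<in> orb x" and g: "good x" shows "good y"
proof -
  obtain h where h: "h \<in> H" "y = f h x" using y by (auto simp: orb_def)
  obtain k where k: "k \<in> H" "\<forall>x\<in>X. f h (f k x) = x" "\<forall>x\<in>X. f k (f h x) = x" "sn k = sn h"
    using inverse[OF h(1)] by metis
  show ?thesis unfolding good_def
  proof
    fix l assume "l \<in> stab y"
    then have l: "l \<in> H" "f l (f h x) = f h x" by (auto simp: stab_def h)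
    have "f (mul k (mul l h)) x = x" using l h k x fX by (simp add: f_mul mul)
    then have "sn (mul k (mul l h)) = 1" using g l h k mul by (auto simp: good_def stab_def)
    then have "sn h * sn h * sn l = 1" using l h k by (simp add: sn_mul mul mult_ac)
    then show "sn l = 1" using sn_sq h by simp
  qed
qed

text \<open>If some stabilising element has sign -1, translation by it pairs off the signs, so the
  sum equals its own negative.\<close>

lemma sum_stab: assumes x: "x \<in> X" shows "(\<Sum>h\<in>stab x. sn h) = (if good x then int (card (stab x)) else 0)"
proof (cases "good x")
  case False
  then obtain k where k: "k \<in> stab x" "sn k \<noteq> 1" by (auto simp: good_def)
  then have kH: "k \<in> H" "f k x = x" "sn k = -1" using sn by (auto simp: stab_def)
  have "inj_on (mul k) (stab x)" by (rule inj_on_subset[OF mul(2)[OF kH(1)]]) (auto simp: stab_def)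
  moreover have "mul k ` stab x \<subseteq> stab x" using kH x by (auto simp: stab_def mul f_mul)
  moreover have "finite (stab x)" using finH by (simp add: stab_def)
  ultimately have "bij_betw (mul k) (stab x) (stab x)" by (simp add: bij_betw_def endo_inj_surj)
  then have "(\<Sum>h\<in>stab x. sn h) = (\<Sum>h\<in>stab x. sn (mul k h))" by (rule sum.reindex_bij_betw[symmetric])
  also have "\<dots> = - (\<Sum>h\<in>stab x. sn h)"
    unfolding sum_negf[symmetric] by (rule sum.cong) (use kH in \<open>auto simp: stab_def sn_mul\<close>)
  finally show ?thesis using False by simp
qed (auto simp: good_def)

lemma card_transporter: assumes x: "x \<in> X" and y: "y \<in> orb x"
  shows "card {h\<in>H. f h x = y} = card (stab x)"
proof -
  obtain k where k: "k \<in> H" "y = f k x" using y by (auto simp: orb_def)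
  obtain l where l: "l \<in> H" "\<forall>x\<in>X. f k (f l x) = x" "\<forall>x\<in>X. f l (f k x) = x" "sn l = sn k"
    using inverse[OF k(1)] by metis
  have "card {h\<in>H. f h x = y} \<le> card (stab x)"
  proof (rule card_inj_on_le[of "mul l"])
    show "inj_on (mul l) {h\<in>H. f h x = y}" by (rule inj_on_subset[OF mul(2)[OF l(1)]]) auto
  qed (use k l x finH in \<open>auto simp: f_mul mul stab_def\<close>)
  moreover have "card (stab x) \<le> card {h\<in>H. f h x = y}"
  proof (rule card_inj_on_le[of "mul k"])
    show "inj_on (mul k) (stab x)" by (rule inj_on_subset[OF mul(2)[OF k(1)]]) (auto simp: stab_def)
  qed (use k l x finH in \<open>auto simp: f_mul mul stab_def\<close>)
  ultimately show ?thesis by simp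
qed

lemma sum_card_stab: assumes r: "r \<in> X" shows "(\<Sum>x\<in>orb r. card (stab x)) = card H"
proof -
  have fin: "finite (orb r)" using orb_sub[OF r] finX finite_subset by auto
  have "(\<Sum>x\<in>orb r. card (stab x)) = (\<Sum>x\<in>orb r. card {h\<in>H. f h x = r})"
  proof (rule sum.cong[OF refl])
    fix x assume x: "x \<in> orb r"
    then have "r \<in> orb x" using orb_eq[OF r x] orb_self[OF r] by simp
    then show "card (stab x) = card {h\<in>H. f h x = r}" using card_transporter[of x r] x orb_sub[OF r] by auto
  qed
  also have "\<dots> = (\<Sum>x\<in>orb r. \<Sum>h\<in>H. if f h x = r then 1 else 0)"
    by (simp only: sum_if_eq_card[OF finH])
  also have "\<dots> = (\<Sum>h\<in>H. \<Sum>x\<in>orb r. if f h x = r then 1 else 0)"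
    by (rule sum.swap)
  also have "\<dots> = (\<Sum>h\<in>H. 1)"
  proof (rule sum.cong[OF refl])
    fix h assume h: "h \<in> H"
    obtain l where l: "l \<in> H" "\<forall>x\<in>X. f h (f l x) = x" "\<forall>x\<in>X. f l (f h x) = x" "sn l = sn h"
      using inverse[OF h] by metis
    have "{x\<in>orb r. f h x = r} = {f l r}"
      using l r orb_sub[OF r] by (auto simp: orb_def)
    then have "card {x\<in>orb r. f h x = r} = 1" by simp
    then show "(\<Sum>x\<in>orb r. if f h x = r then 1 else 0) = (1::nat)"
      by (simp only: sum_if_eq_card[OF fin])
  qed
  finally show ?thesis by simp
qed

text \<open>Exchanging the sums turns fixed points into stabilisers. Orbits that are not good
  cancel, and over a good orbit the orders of the stabilisers add up to
  \<open>card H\<close>.\<close>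

theorem signed_burnside:
  "(\<Sum>h\<in>H. sn h * int (card {x\<in>X. f h x = x})) = int (card H * card reps)"
proof -
  have "(\<Sum>h\<in>H. sn h * int (card {x\<in>X. f h x = x})) = (\<Sum>h\<in>H. \<Sum>x\<in>X. if f h x = x then sn h else 0)"
  proof (rule sum.cong[OF refl])
    fix h
    have "(\<Sum>x\<in>X. if f h x = x then sn h else 0) = (\<Sum>x\<in>{x\<in>X. f h x = x}. sn h)"
      using finX by (rule sum.inter_filter[symmetric])
    then show "sn h * int (card {x\<in>X. f h x = x}) = (\<Sum>x\<in>X. if f h x = x then sn h else 0)" by simp
  qed
  also have "\<dots> = (\<Sum>x\<in>X. \<Sum>h\<in>H. if f h x = x then sn h else 0)" by (rule sum.swap)
  also have "\<dots> = (\<Sum>x\<in>X. \<Sum>h\<in>stab x. sn h)"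
    unfolding stab_def using finH by (simp add: sum.inter_filter)
  also have "\<dots> = (\<Sum>x\<in>X. if good x then int (card (stab x)) else 0)"
    by (rule sum.cong) (simp_all add: sum_stab)
  also have "\<dots> = (\<Sum>x\<in>{x\<in>X. good x}. int (card (stab x)))"
    using finX by (rule sum.inter_filter[symmetric])
  also have "\<dots> = (\<Sum>r\<in>rep ` {x\<in>X. good x}. \<Sum>x\<in>{x\<in>{x\<in>X. good x}. rep x = r}. int (card (stab x)))"
    by (rule sum.image_gen) (use finX in simp)
  also have "rep ` {x\<in>X. good x} = reps"
  proof
    show "rep ` {x\<in>X. good x} \<subseteq> reps"
    proof
      fix y assume "y \<in> rep ` {x\<in>X. good x}"
      then obtain x where "x \<in> X" "good x" "y = rep x" by auto
      then show "y \<in> reps" using rep[of x] good_orb[of x "rep x"] by (simp add: reps_def)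
    qed
    show "reps \<subseteq> rep ` {x\<in>X. good x}"
    proof
      fix y assume "y \<in> reps"
      then show "y \<in> rep ` {x\<in>X. good x}" by (intro image_eqI[of _ _ y]) (auto simp: reps_def)
    qed
  qed
  also have "(\<Sum>r\<in>reps. \<Sum>x\<in>{x\<in>{x\<in>X. good x}. rep x = r}. int (card (stab x))) = (\<Sum>r\<in>reps. int (card H))"
  proof (rule sum.cong[OF refl])
    fix r assume r: "r \<in> reps"
    then have rX: "r \<in> X" "rep r = r" "good r" by (auto simp: reps_def)
    have "{x\<in>{x\<in>X. good x}. rep x = r} = orb r"
    proof (intro Set.set_eqI iffI)
      fix x assume "x \<in> {x\<in>{x\<in>X. good x}. rep x = r}"
      then show "x \<in> orb r" using rep_eq_iff[OF rX(1), of x] rX by auto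
    next
      fix x assume x: "x \<in> orb r"
      then have "x \<in> X" using orb_sub[OF rX(1)] by auto
      then show "x \<in> {x\<in>{x\<in>X. good x}. rep x = r}"
        using x rep_eq_iff[OF rX(1), of x] good_orb[OF rX(1) x rX(3)] rX by auto
    qed
    then show "(\<Sum>x\<in>{x\<in>{x\<in>X. good x}. rep x = r}. int (card (stab x))) = int (card H)"
      using sum_card_stab[OF rX(1)] by (simp flip: of_nat_sum)
  qed
  finally show ?thesis by simp
qed

end

section \<open>Free modules and monomial operators\<close>

lemma free_mod_simps:
  "carrier (free_mod K X) = X \<rightarrow>\<^sub>E carrier K" "\<zero>\<^bsub>free_mod K X\<^esub> = (\<lambda>x\<in>X. \<zero>\<^bsub>K\<^esub>)"
  "y \<oplus>\<^bsub>free_mod K X\<^esub> z = (\<lambda>x\<in>X. y x \<oplus>\<^bsub>K\<^esub> z x)" "c \<odot>\<^bsub>free_mod K X\<^esub> y = (\<lambda>x\<in>X. c \<otimes>\<^bsub>K\<^esub> y x)"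
  by (simp_all add: free_mod_def)

lemma free_mod_module: assumes "cring K" shows "Module.module K (free_mod K X)"
proof -
  interpret cring K by fact
  have "abelian_group (free_mod K X)"
  proof (rule abelian_groupI)
    fix x assume x: "x \<in> carrier (free_mod K X)"
    show "\<exists>y\<in>carrier (free_mod K X). y \<oplus>\<^bsub>free_mod K X\<^esub> x = \<zero>\<^bsub>free_mod K X\<^esub>"
    proof (rule bexI[of _ "\<lambda>i\<in>X. \<ominus>\<^bsub>K\<^esub> x i"])
      have xK: "x i \<in> carrier K" if "i \<in> X" for i using x that by (auto simp: free_mod_simps)
      then show "(\<lambda>i\<in>X. \<ominus>\<^bsub>K\<^esub> x i) \<oplus>\<^bsub>free_mod K X\<^esub> x = \<zero>\<^bsub>free_mod K X\<^esub>"
        "(\<lambda>i\<in>X. \<ominus>\<^bsub>K\<^esub> x i) \<in> carrier (free_mod K X)"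
        by (auto simp: free_mod_simps l_neg intro!: restrict_ext)
    qed
  qed (auto simp: free_mod_simps a_ac PiE_iff extensional_def intro!: ext)
  then show ?thesis
    by (rule Module.moduleI[OF is_cring]) (auto simp: free_mod_simps l_distr r_distr m_assoc PiE_iff extensional_def intro!: ext)
qed

definition unit_vec :: "('a, 'm) ring_scheme \<Rightarrow> 'g set \<Rightarrow> 'g \<Rightarrow> 'g \<Rightarrow> 'a" where
  "unit_vec K X g = (\<lambda>x\<in>X. if x = g then \<one>\<^bsub>K\<^esub> else \<zero>\<^bsub>K\<^esub>)"

lemma unit_vec_carrier: "cring K \<Longrightarrow> unit_vec K X g \<in> carrier (free_mod K X)"
  by (auto simp: unit_vec_def free_mod_simps cring_def ring.ring_simprules)

lemma free_mod_generated:
  assumes K: "cring K" and X: "finite X" and S: "Module.submodule S K (free_mod K X)"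
    and u: "\<And>g. g \<in> X \<Longrightarrow> unit_vec K X g \<in> S"
  shows "carrier (free_mod K X) \<subseteq> S"
proof -
  interpret cring K by fact
  have M: "Module.module K (free_mod K X)" by (rule free_mod_module[OF K])
  have S': "(\<lambda>x\<in>X. \<zero>\<^bsub>K\<^esub>) \<in> S" "\<And>y z. y \<in> S \<Longrightarrow> z \<in> S \<Longrightarrow> (\<lambda>x\<in>X. y x \<oplus>\<^bsub>K\<^esub> z x) \<in> S"
     "\<And>c y. c \<in> carrier K \<Longrightarrow> y \<in> S \<Longrightarrow> (\<lambda>x\<in>X. c \<otimes>\<^bsub>K\<^esub> y x) \<in> S"
    using S unfolding submodule_iff[OF M] by (auto simp: free_mod_simps)
  have "x \<in> S" if "finite F" "x \<in> X \<rightarrow>\<^sub>E carrier K" "\<And>g. g \<in> X - F \<Longrightarrow> x g = \<zero>\<^bsub>K\<^esub>" "F \<subseteq> X" for F x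
    using that
  proof (induct F arbitrary: x rule: finite_induct)
    case empty
    then have "x = (\<lambda>x\<in>X. \<zero>\<^bsub>K\<^esub>)" by (auto intro!: ext simp: PiE_iff extensional_def restrict_def)
    then show ?case using S'(1) by (simp only:)
  next
    case (insert a F)
    have xa: "x a \<in> carrier K" using insert.prems by auto
    have xg: "x g \<in> carrier K" if "g \<in> X" for g using insert.prems that by auto
    define y where "y = x(a := \<zero>\<^bsub>K\<^esub>)"
    have "y \<in> S"
      by (rule insert.hyps(3)) (use insert in \<open>auto simp: y_def PiE_iff extensional_def\<close>)
    moreover have "(\<lambda>x'\<in>X. x a \<otimes>\<^bsub>K\<^esub> unit_vec K X a x') \<in> S" using S'(3)[OF xa u] insert.prems by auto
    ultimately have "(\<lambda>g\<in>X. y g \<oplus>\<^bsub>K\<^esub> (\<lambda>x'\<in>X. x a \<otimes>\<^bsub>K\<^esub> unit_vec K X a x') g) \<in> S" by (rule S'(2))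
    also have "(\<lambda>g\<in>X. y g \<oplus>\<^bsub>K\<^esub> (\<lambda>x'\<in>X. x a \<otimes>\<^bsub>K\<^esub> unit_vec K X a x') g) = x"
    proof
      fix g show "(\<lambda>g\<in>X. y g \<oplus>\<^bsub>K\<^esub> (\<lambda>x'\<in>X. x a \<otimes>\<^bsub>K\<^esub> unit_vec K X a x') g) g = x g"
        using insert.prems(1) xa xg by (cases "g \<in> X") (auto simp: y_def unit_vec_def PiE_iff extensional_def)
    qed
    finally show ?case .
  qed
  from this[OF X] show ?thesis by (auto simp: free_mod_simps)
qed

text \<open>A scalar times a permutation of the basis: the common shape of the three graph
  actions.\<close>

definition mono_op :: "('a, 'm) ring_scheme \<Rightarrow> 'g set \<Rightarrow> 'a \<Rightarrow> ('g \<Rightarrow> 'g) \<Rightarrow> ('g \<Rightarrow> 'a) \<Rightarrow> ('g \<Rightarrow> 'a)" where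
  "mono_op K X c f x = c \<odot>\<^bsub>free_mod K X\<^esub> lin_ext K X f x"

lemma mono_op_apply:
  assumes K: "cring K" and f: "bij_betw f X X" and x: "x \<in> carrier (free_mod K X)" and g: "g \<in> X"
  shows "mono_op K X c f x (f g) = c \<otimes>\<^bsub>K\<^esub> x g"
proof -
  interpret cring K by fact
  have "{g' \<in> X. f g' = f g} = {g}" using f g by (auto simp: bij_betw_def inj_on_def)
  moreover have "f g \<in> X" using f g by (auto simp: bij_betw_def)
  moreover have "x g \<in> carrier K" using x g by (auto simp: free_mod_simps)
  ultimately show ?thesis by (simp add: mono_op_def lin_ext_def free_mod_simps)
qed

lemma mono_op_carrier:
  assumes K: "cring K" and f: "bij_betw f X X" and x: "x \<in> carrier (free_mod K X)" and c: "c \<in> carrier K"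
  shows "mono_op K X c f x \<in> carrier (free_mod K X)"
proof -
  interpret cring K by fact
  have "mono_op K X c f x d \<in> carrier K" if d: "d \<in> X" for d
  proof -
    obtain g where g: "g \<in> X" "d = f g" using f d by (auto simp: bij_betw_def)
    then show ?thesis using mono_op_apply[OF K f x g(1)] x c by (auto simp: free_mod_simps)
  qed
  then show ?thesis unfolding free_mod_simps by (auto simp: PiE_iff mono_op_def free_mod_simps)
qed

lemma free_mod_eqI:
  assumes "bij_betw f X X" "y \<in> carrier (free_mod K X)" "z \<in> carrier (free_mod K X)"
    "\<And>g. g \<in> X \<Longrightarrow> y (f g) = z (f g)"
  shows "y = z"
proof
  fix d show "y d = z d"
  proof (cases "d \<in> X")
    case True
    then obtain g where "g \<in> X" "d = f g" using assms(1) by (auto simp: bij_betw_def)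
    then show ?thesis using assms(4) by simp
  qed (use assms in \<open>auto simp: free_mod_simps PiE_iff extensional_def\<close>)
qed

lemma mono_op_hom:
  assumes K: "cring K" and f: "bij_betw f X X" and c: "c \<in> carrier K"
  shows "mono_op K X c f \<in> module_hom K (free_mod K X) (free_mod K X)"
proof -
  interpret cring K by fact
  let ?V = "free_mod K X" and ?o = "mono_op K X c f"
  interpret V: Module.module K ?V by (rule free_mod_module[OF K])
  note car = mono_op_carrier[OF K f _ c] and app = mono_op_apply[OF K f]
  have fX: "f g \<in> X" if "g \<in> X" for g using f that by (auto simp: bij_betw_def)
  have xK: "x g \<in> carrier K" if "x \<in> carrier ?V" "g \<in> X" for x g using that by (auto simp: free_mod_simps)
  have "?o (x \<oplus>\<^bsub>?V\<^esub> y) = ?o x \<oplus>\<^bsub>?V\<^esub> ?o y" if xy: "x \<in> carrier ?V" "y \<in> carrier ?V" for x y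
  proof (rule free_mod_eqI[OF f])
    fix g assume g: "g \<in> X"
    have "?o (x \<oplus>\<^bsub>?V\<^esub> y) (f g) = c \<otimes>\<^bsub>K\<^esub> (x \<oplus>\<^bsub>?V\<^esub> y) g" using xy g by (intro app) auto
    also have "\<dots> = c \<otimes>\<^bsub>K\<^esub> x g \<oplus>\<^bsub>K\<^esub> c \<otimes>\<^bsub>K\<^esub> y g" using xy g xK c by (simp add: free_mod_simps r_distr)
    also have "\<dots> = (?o x \<oplus>\<^bsub>?V\<^esub> ?o y) (f g)" using xy g fX by (simp add: free_mod_simps(3) app)
    finally show "?o (x \<oplus>\<^bsub>?V\<^esub> y) (f g) = (?o x \<oplus>\<^bsub>?V\<^esub> ?o y) (f g)" .
  qed (use xy car in auto)
  moreover have "?o (d \<odot>\<^bsub>?V\<^esub> x) = d \<odot>\<^bsub>?V\<^esub> ?o x" if xd: "x \<in> carrier ?V" "d \<in> carrier K" for x d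
  proof (rule free_mod_eqI[OF f])
    fix g assume g: "g \<in> X"
    have "?o (d \<odot>\<^bsub>?V\<^esub> x) (f g) = c \<otimes>\<^bsub>K\<^esub> (d \<odot>\<^bsub>?V\<^esub> x) g" using xd g by (intro app) auto
    also have "\<dots> = d \<otimes>\<^bsub>K\<^esub> (c \<otimes>\<^bsub>K\<^esub> x g)" using xd g xK c by (simp add: free_mod_simps m_lcomm)
    also have "\<dots> = (d \<odot>\<^bsub>?V\<^esub> ?o x) (f g)" using xd g fX by (simp add: free_mod_simps(4) app)
    finally show "?o (d \<odot>\<^bsub>?V\<^esub> x) (f g) = (d \<odot>\<^bsub>?V\<^esub> ?o x) (f g)" .
  qed (use xd car in auto)
  ultimately show ?thesis using car by (auto simp: module_hom_def)
qed

lemma mono_op_comp: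
  assumes K: "cring K" and f: "bij_betw f X X" "bij_betw f' X X" and c: "c \<in> carrier K" "c' \<in> carrier K"
    and x: "x \<in> carrier (free_mod K X)"
    and d: "d = c \<otimes>\<^bsub>K\<^esub> c'" and h: "\<And>g. g \<in> X \<Longrightarrow> h g = f (f' g)"
  shows "mono_op K X c f (mono_op K X c' f' x) = mono_op K X d h x"
proof -
  interpret cring K by fact
  have hb: "bij_betw h X X" using bij_betw_trans[OF f(2,1)] h by (simp cong: bij_betw_cong)
  note x' = mono_op_carrier[OF K f(2) x c(2)]
  show ?thesis
  proof (rule free_mod_eqI[OF hb mono_op_carrier[OF K f(1) x' c(1)] mono_op_carrier[OF K hb x]])
    fix g assume g: "g \<in> X"
    have f'g: "f' g \<in> X" using f g by (auto simp: bij_betw_def)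
    have "x g \<in> carrier K" using x g by (auto simp: free_mod_simps)
    then show "mono_op K X c f (mono_op K X c' f' x) (h g) = mono_op K X d h x (h g)"
      using mono_op_apply[OF K f(1) x' f'g] mono_op_apply[OF K f(2) x g] mono_op_apply[OF K hb x g] c g
      by (simp add: h d m_assoc)
  qed (use c d in simp)
qed

definition ksign :: "('a, 'm) ring_scheme \<Rightarrow> int \<Rightarrow> 'a" where
  "ksign K c = (if c = 1 then \<one>\<^bsub>K\<^esub> else \<ominus>\<^bsub>K\<^esub> \<one>\<^bsub>K\<^esub>)"

text \<open>Stabiliser orders enter \<open>K\<close> as multiples of one in this way; characteristic
  0 keeps them from vanishing.\<close>

lemma finsum_indicator:
  assumes "cring K" "finite A"
  shows "finsum K (\<lambda>h. if P h then \<one>\<^bsub>K\<^esub> else \<zero>\<^bsub>K\<^esub>) A = add_pow K (card {h\<in>A. P h}) \<one>\<^bsub>K\<^esub>"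
proof -
  interpret cring K by fact
  show ?thesis using assms(2)
  proof (induct A rule: finite_induct)
    case empty
    then show ?case by simp
  next
    case (insert a A)
    have "{h \<in> insert a A. P h} = (if P a then insert a {h\<in>A. P h} else {h\<in>A. P h})" by auto
    then show ?case using insert by (auto simp: a_comm)
  qed
qed

context signed_action
begin

lemma mono_op_mul:
  assumes K: "cring K" and h: "h \<in> H" and k: "k \<in> H" and x: "x \<in> carrier (free_mod K X)"
  shows "mono_op K X (ksign K (sn h)) (f h) (mono_op K X (ksign K (sn k)) (f k) x) =
    mono_op K X (ksign K (sn (mul h k))) (f (mul h k)) x"
proof -
  interpret cring K by fact
  have "ksign K (sn (mul h k)) = ksign K (sn h) \<otimes>\<^bsub>K\<^esub> ksign K (sn k)"
    using sn[OF h] sn[OF k] by (auto simp: ksign_def sn_mul[OF h k] l_minus r_minus)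
  then show ?thesis
    by (intro mono_op_comp[OF K bij_f[OF h] bij_f[OF k] _ _ x]) (auto simp: ksign_def f_mul h k)
qed

text \<open>The images of the basis vectors of \<open>reps\<close> form a basis. The operators in
  \<open>T\<close> need only be some of those of \<open>H\<close>, provided that \<pi> is invariant
  under all of them; this matches a quotient taken in stages by generating subgroups.\<close>

theorem dim_coinvariants:
  assumes K: "field K" and char: "\<And>n::nat. n > 0 \<Longrightarrow> add_pow K n \<one>\<^bsub>K\<^esub> \<noteq> \<zero>\<^bsub>K\<^esub>"
    and P: "pres K (free_mod K X) M \<pi> T"
    and T: "\<And>t. t \<in> T \<Longrightarrow> \<exists>h\<in>H. t = mono_op K X (ksign K (sn h)) (f h)"
    and inv: "\<And>h x. h \<in> H \<Longrightarrow> x \<in> carrier (free_mod K X) \<Longrightarrow> \<pi> (mono_op K X (ksign K (sn h)) (f h) x) = \<pi> x"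
  shows "int (card H * vdim K M) = (\<Sum>h\<in>H. sn h * int (card {x\<in>X. f h x = x}))"
proof -
  interpret K: field K by fact
  have C: "cring K" ..
  let ?V = "free_mod K X" and ?k = "\<lambda>h. ksign K (sn h)"
  interpret V: Module.module K ?V by (rule free_mod_module[OF C])
  have M: "Module.module K M" using P by (simp add: pres_def)
  interpret M: Module.module K M by (rule M)
  have kK: "?k h \<in> carrier K" for h by (simp add: ksign_def)
  have kk: "?k h \<otimes>\<^bsub>K\<^esub> ?k h = \<one>\<^bsub>K\<^esub>" for h by (simp add: ksign_def K.l_minus K.r_minus)
  have kmul: "?k (mul h k) = ?k h \<otimes>\<^bsub>K\<^esub> ?k k" if "h \<in> H" "k \<in> H" for h k
    using sn[OF that(1)] sn[OF that(2)] by (auto simp: ksign_def sn_mul[OF that] K.l_minus K.r_minus)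
  define op where "op h = mono_op K X (?k h) (f h)" for h
  have opc: "op h x \<in> carrier ?V" if "h \<in> H" "x \<in> carrier ?V" for h x
    unfolding op_def by (rule mono_op_carrier[OF C bij_f[OF that(1)] that(2) kK])
  have opa: "op h x (f h g) = ?k h \<otimes>\<^bsub>K\<^esub> x g" if "h \<in> H" "x \<in> carrier ?V" "g \<in> X" for h x g
    unfolding op_def using mono_op_apply[OF C bij_f[OF that(1)] that(2,3)] .
  \<comment> \<open>Signed orbit sums: translation in the group makes them invariant, so they
    descend to \<open>M\<close>, where they serve as dual functionals.\<close>
  define l where "l r x = finsum K (\<lambda>h. ?k h \<otimes>\<^bsub>K\<^esub> x (f h r)) H" for r x
  have xK: "x g \<in> carrier K" if "x \<in> carrier ?V" "g \<in> X" for x g using that by (auto simp: free_mod_simps)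
  have lfun: "lfun K ?V (l r)" if r: "r \<in> X" for r
    unfolding lfun_def
  proof (intro conjI ballI funcsetI)
    fix x assume x: "x \<in> carrier ?V"
    show "l r x \<in> carrier K" unfolding l_def by (rule K.finsum_closed) (use x r fX xK kK in auto)
    fix y assume y: "y \<in> carrier ?V"
    have "l r (x \<oplus>\<^bsub>?V\<^esub> y) = finsum K (\<lambda>h. ?k h \<otimes>\<^bsub>K\<^esub> x (f h r) \<oplus>\<^bsub>K\<^esub> ?k h \<otimes>\<^bsub>K\<^esub> y (f h r)) H"
      unfolding l_def
      by (rule K.finsum_cong') (use x y r fX xK kK in \<open>auto simp: free_mod_simps(3) K.r_distr\<close>)
    also have "\<dots> = l r x \<oplus>\<^bsub>K\<^esub> l r y"
      unfolding l_def by (rule K.finsum_addf) (use x y r fX xK kK in auto)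
    finally show "l r (x \<oplus>\<^bsub>?V\<^esub> y) = l r x \<oplus>\<^bsub>K\<^esub> l r y" .
  next
    fix c x assume c: "c \<in> carrier K" and x: "x \<in> carrier ?V"
    have "l r (c \<odot>\<^bsub>?V\<^esub> x) = finsum K (\<lambda>h. c \<otimes>\<^bsub>K\<^esub> (?k h \<otimes>\<^bsub>K\<^esub> x (f h r))) H"
      unfolding l_def
      by (rule K.finsum_cong') (use x c r fX xK kK in \<open>auto simp: free_mod_simps(4) K.m_lcomm\<close>)
    also have "\<dots> = c \<otimes>\<^bsub>K\<^esub> l r x"
      unfolding l_def by (rule K.finsum_rdistr[symmetric]) (use finH c x r fX xK kK in auto)
    finally show "l r (c \<odot>\<^bsub>?V\<^esub> x) = c \<otimes>\<^bsub>K\<^esub> l r x" .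
  qed
  have linv: "l r (op k x) = l r x" if k: "k \<in> H" and r: "r \<in> X" and x: "x \<in> carrier ?V" for k r x
  proof -
    have opx: "op k x \<in> carrier ?V" by (rule opc[OF k x])
    have "l r (op k x) = finsum K (\<lambda>h. ?k h \<otimes>\<^bsub>K\<^esub> op k x (f h r)) (mul k ` H)"
      unfolding l_def using bij_mul[OF k] by (simp add: bij_betw_def)
    also have "\<dots> = finsum K (\<lambda>h. ?k (mul k h) \<otimes>\<^bsub>K\<^esub> op k x (f (mul k h) r)) H"
      by (rule K.finsum_reindex) (use k r x opx kK xK fX mul in auto)
    also have "\<dots> = l r x"
      unfolding l_def
    proof (rule K.finsum_cong')
      fix h assume h: "h \<in> H"
      have fr: "f h r \<in> X" using fX h r by auto
      have "op k x (f (mul k h) r) = ?k k \<otimes>\<^bsub>K\<^esub> x (f h r)" using opa[OF k x fr] by (simp add: f_mul k h r)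
      then have "?k (mul k h) \<otimes>\<^bsub>K\<^esub> op k x (f (mul k h) r) = (?k k \<otimes>\<^bsub>K\<^esub> ?k h) \<otimes>\<^bsub>K\<^esub> (?k k \<otimes>\<^bsub>K\<^esub> x (f h r))"
        by (simp only: kmul[OF k h])
      also have "\<dots> = (?k k \<otimes>\<^bsub>K\<^esub> ?k k) \<otimes>\<^bsub>K\<^esub> (?k h \<otimes>\<^bsub>K\<^esub> x (f h r))"
        using kK xK[OF x fr] by (simp only: K.m_assoc K.m_lcomm K.m_closed)
      also have "\<dots> = ?k h \<otimes>\<^bsub>K\<^esub> x (f h r)" using kK[of h] xK[OF x fr] by (simp only: kk K.l_one K.m_closed)
      finally show "?k (mul k h) \<otimes>\<^bsub>K\<^esub> op k x (f (mul k h) r) = ?k h \<otimes>\<^bsub>K\<^esub> x (f h r)" .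
    qed (use r x xK fX kK in auto)
    finally show ?thesis .
  qed
  have lker: "l r x = \<zero>\<^bsub>K\<^esub>" if r: "r \<in> X" and x: "x \<in> carrier ?V" and z: "\<pi> x = \<zero>\<^bsub>M\<^esub>" for r x
  proof -
    have "\<forall>t\<in>T. \<forall>x\<in>carrier ?V. l r (t x) = l r x"
      using T linv r unfolding op_def by blast
    then show ?thesis using P lfun[OF r] x z unfolding pres_def by blast
  qed
  have \<pi>: "\<And>x. x \<in> carrier ?V \<Longrightarrow> \<pi> x \<in> carrier M"
    "\<And>x y. x \<in> carrier ?V \<Longrightarrow> y \<in> carrier ?V \<Longrightarrow> \<pi> (x \<oplus>\<^bsub>?V\<^esub> y) = \<pi> x \<oplus>\<^bsub>M\<^esub> \<pi> y"
    "\<And>x c. x \<in> carrier ?V \<Longrightarrow> c \<in> carrier K \<Longrightarrow> \<pi> (c \<odot>\<^bsub>?V\<^esub> x) = c \<odot>\<^bsub>M\<^esub> \<pi> x"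
    using P by (auto simp: pres_def module_hom_def)
  have surj: "\<exists>x\<in>carrier ?V. m = \<pi> x" if "m \<in> carrier M" for m using P that by (auto simp: pres_def)
  \<comment> \<open>The functionals descend through chosen preimages; \<open>leq\<close> shows
    independence of the choice, as \<open>l r\<close> vanishes on the kernel of \<pi>.\<close>
  define pre where "pre m = (SOME x. x \<in> carrier ?V \<and> \<pi> x = m)" for m
  have pre: "pre m \<in> carrier ?V" "\<pi> (pre m) = m" if "m \<in> carrier M" for m
    using someI_ex[of "\<lambda>x. x \<in> carrier ?V \<and> \<pi> x = m"] surj[OF that] by (auto simp: pre_def)
  have leq: "l r x = l r y" if r: "r \<in> X" and xy: "x \<in> carrier ?V" "y \<in> carrier ?V" "\<pi> x = \<pi> y" for r x y
  proof -
    have y': "\<ominus>\<^bsub>K\<^esub> \<one>\<^bsub>K\<^esub> \<odot>\<^bsub>?V\<^esub> y \<in> carrier ?V" using xy by simp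
    have "\<pi> (x \<oplus>\<^bsub>?V\<^esub> \<ominus>\<^bsub>K\<^esub> \<one>\<^bsub>K\<^esub> \<odot>\<^bsub>?V\<^esub> y) = \<pi> x \<oplus>\<^bsub>M\<^esub> \<ominus>\<^bsub>K\<^esub> \<one>\<^bsub>K\<^esub> \<odot>\<^bsub>M\<^esub> \<pi> y"
      using \<pi>(2)[OF xy(1) y'] \<pi>(3)[OF xy(2), of "\<ominus>\<^bsub>K\<^esub> \<one>\<^bsub>K\<^esub>"] by simp
    also have "\<dots> = \<zero>\<^bsub>M\<^esub>" using xy \<pi>(1)[OF xy(2)] by (simp add: M.smult_minus_1 M.r_neg)
    finally have "l r (x \<oplus>\<^bsub>?V\<^esub> \<ominus>\<^bsub>K\<^esub> \<one>\<^bsub>K\<^esub> \<odot>\<^bsub>?V\<^esub> y) = \<zero>\<^bsub>K\<^esub>" using lker[OF r] xy y' by (meson V.M.a_closed)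
    moreover have "l r (x \<oplus>\<^bsub>?V\<^esub> \<ominus>\<^bsub>K\<^esub> \<one>\<^bsub>K\<^esub> \<odot>\<^bsub>?V\<^esub> y) = l r x \<oplus>\<^bsub>K\<^esub> (\<ominus>\<^bsub>K\<^esub> \<one>\<^bsub>K\<^esub>) \<otimes>\<^bsub>K\<^esub> l r y"
      using lfun[OF r] xy y' unfolding lfun_def by (metis K.add.inv_closed K.one_closed)
    moreover have "l r x \<in> carrier K" "l r y \<in> carrier K" using lfun[OF r] xy by (auto simp: lfun_def)
    ultimately have "l r x \<oplus>\<^bsub>K\<^esub> \<ominus>\<^bsub>K\<^esub> l r y = \<zero>\<^bsub>K\<^esub>" "l r x \<in> carrier K" "l r y \<in> carrier K"
      by (simp_all add: K.l_minus)
    then show ?thesis using K.minus_equality[of "l r x" "\<ominus>\<^bsub>K\<^esub> l r y"] by simp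
  qed
  define \<Lambda> where "\<Lambda> r m = l r (pre m)" for r m
  have \<Lambda>\<pi>: "\<Lambda> r (\<pi> x) = l r x" if "r \<in> X" "x \<in> carrier ?V" for r x
    unfolding \<Lambda>_def by (rule leq) (use that pre \<pi> in auto)
  have \<Lambda>fun: "lfun K M (\<Lambda> r)" if r: "r \<in> X" for r
    unfolding lfun_def
  proof (intro conjI ballI funcsetI)
    fix m assume m: "m \<in> carrier M"
    then show "\<Lambda> r m \<in> carrier K" unfolding \<Lambda>_def using lfun[OF r] pre by (auto simp: lfun_def)
    fix n assume n: "n \<in> carrier M"
    obtain x y where xy: "x \<in> carrier ?V" "m = \<pi> x" "y \<in> carrier ?V" "n = \<pi> y" using surj m n by metis
    have "m \<oplus>\<^bsub>M\<^esub> n = \<pi> (x \<oplus>\<^bsub>?V\<^esub> y)" using xy \<pi> by simp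
    then show "\<Lambda> r (m \<oplus>\<^bsub>M\<^esub> n) = \<Lambda> r m \<oplus>\<^bsub>K\<^esub> \<Lambda> r n" using xy lfun[OF r] by (simp add: \<Lambda>\<pi> r lfun_def)
  next
    fix c m assume c: "c \<in> carrier K" and m: "m \<in> carrier M"
    obtain x where x: "x \<in> carrier ?V" "m = \<pi> x" using surj m by metis
    have "c \<odot>\<^bsub>M\<^esub> m = \<pi> (c \<odot>\<^bsub>?V\<^esub> x)" using x \<pi> c by simp
    then show "\<Lambda> r (c \<odot>\<^bsub>M\<^esub> m) = c \<otimes>\<^bsub>K\<^esub> \<Lambda> r m" using x c lfun[OF r] by (simp add: \<Lambda>\<pi> r lfun_def)
  qed
  let ?u = "unit_vec K X"
  have uV: "?u g \<in> carrier ?V" for g by (rule unit_vec_carrier[OF C])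
  have lu: "l r (?u s) = (if r = s then add_pow K (card (stab r)) \<one>\<^bsub>K\<^esub> else \<zero>\<^bsub>K\<^esub>)"
    if r: "r \<in> reps" and s: "s \<in> reps" for r s
  proof -
    have rX: "r \<in> X" "s \<in> X" "rep r = r" "rep s = s" "good r" using r s by (auto simp: reps_def)
    have "l r (?u s) = finsum K (\<lambda>h. if f h r = s then \<one>\<^bsub>K\<^esub> else \<zero>\<^bsub>K\<^esub>) H"
      unfolding l_def
    proof (rule K.finsum_cong')
      fix h assume h: "h \<in> H"
      have frX: "f h r \<in> X" using fX h rX by auto
      show "?k h \<otimes>\<^bsub>K\<^esub> ?u s (f h r) = (if f h r = s then \<one>\<^bsub>K\<^esub> else \<zero>\<^bsub>K\<^esub>)"
      proof (cases "f h r = s")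
        case True
        then have "s \<in> orb r" using h by (auto simp: orb_def)
        then have "r = s" using rep_eq_iff[OF rX(1,2)] rX by simp
        then have "sn h = 1" using rX(5) True h by (auto simp: good_def stab_def)
        then show ?thesis using True rX(2) by (simp add: unit_vec_def ksign_def)
      next
        case False
        then show ?thesis using kK frX by (simp add: unit_vec_def)
      qed
    qed auto
    also have "\<dots> = add_pow K (card {h\<in>H. f h r = s}) \<one>\<^bsub>K\<^esub>" by (rule finsum_indicator[OF C finH])
    also have "\<dots> = (if r = s then add_pow K (card (stab r)) \<one>\<^bsub>K\<^esub> else \<zero>\<^bsub>K\<^esub>)"
    proof (cases "r = s")
      case False
      then have E: "{h\<in>H. f h r = s} = {}" using rep_eq_iff[OF rX(1,2)] rX by (auto simp: orb_def)
      show ?thesis unfolding E using False by simp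
    qed (simp add: stab_def)
    finally show ?thesis .
  qed
  have uop: "op h (?u g) = ?k h \<odot>\<^bsub>?V\<^esub> ?u (f h g)" if h: "h \<in> H" and g: "g \<in> X" for h g
  proof (rule free_mod_eqI[OF bij_f[OF h] opc[OF h uV]])
    fix g' assume g': "g' \<in> X"
    have "f h g' = f h g \<longleftrightarrow> g' = g" using bij_f[OF h] g g' by (auto simp: bij_betw_def inj_on_def)
    then show "op h (?u g) (f h g') = (?k h \<odot>\<^bsub>?V\<^esub> ?u (f h g)) (f h g')"
      using opa[OF h uV g'] fX[OF h g'] g' kK by (simp add: free_mod_simps unit_vec_def)
  qed (use kK uV in simp)
  have \<pi>u: "\<pi> (?u g) = ?k h \<odot>\<^bsub>M\<^esub> \<pi> (?u (f h g))" if h: "h \<in> H" and g: "g \<in> X" for h g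
  proof -
    have "\<pi> (?u g) = \<pi> (op h (?u g))" using inv[OF h uV] by (simp add: op_def)
    then show ?thesis using uop[OF h g] \<pi>(3)[OF uV kK] by simp
  qed
  have "vdim K M = card reps"
  proof (rule vdim_eq_card[where b="\<lambda>r. \<pi> (?u r)" and l=\<Lambda>, OF K M])
    show "finite reps" using finX by (simp add: reps_def)
    show "(\<lambda>r. \<pi> (?u r)) \<in> reps \<rightarrow> carrier M" using \<pi> uV by auto
    show "lfun K M (\<Lambda> a)" if "a \<in> reps" for a using \<Lambda>fun that by (auto simp: reps_def)
    show "\<Lambda> a (\<pi> (?u a)) \<noteq> \<zero>\<^bsub>K\<^esub>" if a: "a \<in> reps" for a
    proof -
      have "a \<in> X" using a by (simp add: reps_def)
      then have "e \<in> stab a" using e by (simp add: stab_def)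
      moreover have "finite (stab a)" using finH by (simp add: stab_def)
      ultimately have "card (stab a) > 0" using card_gt_0_iff by blast
      then show ?thesis using lu[OF a a] \<Lambda>\<pi>[OF \<open>a \<in> X\<close> uV] char by simp
    qed
    show "\<Lambda> a (\<pi> (?u a')) = \<zero>\<^bsub>K\<^esub>" if "a \<in> reps" "a' \<in> reps" "a \<noteq> a'" for a a'
      using lu[OF that(1,2)] \<Lambda>\<pi>[OF _ uV, of a a'] that by (simp add: reps_def)
    fix S assume S: "Module.submodule S K M" and b: "(\<lambda>r. \<pi> (?u r)) ` reps \<subseteq> S"
    have S': "\<zero>\<^bsub>M\<^esub> \<in> S" "\<And>x y. x \<in> S \<Longrightarrow> y \<in> S \<Longrightarrow> x \<oplus>\<^bsub>M\<^esub> y \<in> S" "\<And>c x. c \<in> carrier K \<Longrightarrow> x \<in> S \<Longrightarrow> c \<odot>\<^bsub>M\<^esub> x \<in> S"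
      using S unfolding submodule_iff[OF M] by auto
    have uS: "\<pi> (?u g) \<in> S" if g: "g \<in> X" for g
    proof (cases "good g")
      case True
      obtain h where h: "h \<in> H" "rep g = f h g" using rep(1)[OF g] by (auto simp: orb_def)
      have "rep g \<in> reps" using rep[OF g] good_orb[OF g _ True] by (simp add: reps_def)
      then show ?thesis using \<pi>u[OF h(1) g] h(2) b S'(3)[OF kK] by auto
    next
      case False
      \<comment> \<open>The image of this basis vector equals its own negative, hence is zero after
        dividing by 2.\<close>
      then obtain h where h: "h \<in> H" "f h g = g" "sn h \<noteq> 1" by (auto simp: good_def stab_def)
      have uM: "\<pi> (?u g) \<in> carrier M" using \<pi>(1)[OF uV] .
      have "\<pi> (?u g) = (\<ominus>\<^bsub>K\<^esub> \<one>\<^bsub>K\<^esub>) \<odot>\<^bsub>M\<^esub> \<pi> (?u g)" using \<pi>u[OF h(1) g] h by (simp add: ksign_def)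
      then have m: "\<pi> (?u g) = \<ominus>\<^bsub>M\<^esub> \<pi> (?u g)" using uM by (simp add: M.smult_minus_1)
      have "add_pow K (2::nat) \<one>\<^bsub>K\<^esub> \<odot>\<^bsub>M\<^esub> \<pi> (?u g) = \<pi> (?u g) \<oplus>\<^bsub>M\<^esub> \<pi> (?u g)"
        using uM by (simp add: numeral_2_eq_2 M.smult_l_distr)
      also have "\<dots> = \<zero>\<^bsub>M\<^esub>" using m uM M.r_neg by metis
      finally have 0: "add_pow K (2::nat) \<one>\<^bsub>K\<^esub> \<odot>\<^bsub>M\<^esub> \<pi> (?u g) = \<zero>\<^bsub>M\<^esub>" .
      let ?t = "add_pow K (2::nat) \<one>\<^bsub>K\<^esub>"
      have t: "?t \<in> carrier K" "?t \<noteq> \<zero>\<^bsub>K\<^esub>" using char[of 2] by auto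
      then have tu: "?t \<in> Units K" by (simp add: K.field_Units)
      then have ti: "m_inv K ?t \<in> carrier K" "m_inv K ?t \<otimes>\<^bsub>K\<^esub> ?t = \<one>\<^bsub>K\<^esub>" by auto
      have "\<pi> (?u g) = (m_inv K ?t \<otimes>\<^bsub>K\<^esub> ?t) \<odot>\<^bsub>M\<^esub> \<pi> (?u g)" using uM ti by simp
      also have "\<dots> = m_inv K ?t \<odot>\<^bsub>M\<^esub> (?t \<odot>\<^bsub>M\<^esub> \<pi> (?u g))" using uM ti(1) t(1) by (rule M.smult_assoc1[rotated 2])
      also have "\<dots> = \<zero>\<^bsub>M\<^esub>" using 0 ti(1) by simp
      finally show ?thesis using S'(1) by simp
    qed
    let ?S = "{x\<in>carrier ?V. \<pi> x \<in> S}"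
    have "Module.submodule ?S K ?V"
      unfolding submodule_iff[OF V.module_axioms]
    proof (intro conjI ballI)
      have "\<pi> (\<zero>\<^bsub>K\<^esub> \<odot>\<^bsub>?V\<^esub> \<zero>\<^bsub>?V\<^esub>) = \<zero>\<^bsub>K\<^esub> \<odot>\<^bsub>M\<^esub> \<pi> \<zero>\<^bsub>?V\<^esub>"
        by (rule \<pi>(3)[OF V.M.zero_closed K.zero_closed])
      then have "\<pi> \<zero>\<^bsub>?V\<^esub> = \<zero>\<^bsub>M\<^esub>" using \<pi>(1)[OF V.M.zero_closed] by simp
      then show "\<zero>\<^bsub>?V\<^esub> \<in> ?S" using S' by simp
    qed (use \<pi> S' in auto)
    then have "carrier ?V \<subseteq> ?S" by (rule free_mod_generated[OF C finX]) (use uS uV in auto)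
    then show "carrier M \<subseteq> S" using surj by blast
  qed
  then show ?thesis using signed_burnside by simp
qed

end

section \<open>The dimension of a graph space\<close>

lemma valence_eq_sum:
  "valence e g x = (\<Sum>a\<in>{1..e}. (if fst (g a) = x then 1 else 0) + (if snd (g a) = x then 1 else 0))"
  unfolding valence_def sum.distrib by (simp only: sum_if_eq_card[OF finite_atLeastAtMost])

definition tw :: "pm \<Rightarrow> bool \<Rightarrow> int" where "tw s b = (if s = Neg \<and> b then -1 else 1)"

lemma twist_eq: "twist K s b = ksign K (tw s b)"
  by (simp add: twist_def ksign_def tw_def)

lemma tw_mult: "tw s (b \<noteq> c) = tw s b * tw s c"
  by (simp add: tw_def)

abbreviation inv' :: "('a \<Rightarrow> 'a) \<Rightarrow> 'a \<Rightarrow> 'a" where "inv' \<equiv> inv_into UNIV"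

locale graph_action =
  fixes v e i :: nat and snu smu srho :: pm
begin

definition H :: "(nat set \<times> (nat \<Rightarrow> nat) \<times> (nat \<Rightarrow> nat)) set" where
  "H = Pow {1..e} \<times> {p. p permutes {1..e}} \<times> {p. p permutes {1..v}}"

definition nuf :: "nat set \<Rightarrow> (nat \<Rightarrow> nat \<times> nat) \<Rightarrow> (nat \<Rightarrow> nat \<times> nat)" where
  "nuf R g = (\<lambda>a\<in>{1..e}. if a \<in> R then prod.swap (g a) else g a)"
definition muf :: "(nat \<Rightarrow> nat) \<Rightarrow> (nat \<Rightarrow> nat \<times> nat) \<Rightarrow> (nat \<Rightarrow> nat \<times> nat)" where
  "muf p g = (\<lambda>a\<in>{1..e}. g (inv' p a))"
definition rhof :: "(nat \<Rightarrow> nat) \<Rightarrow> (nat \<Rightarrow> nat \<times> nat) \<Rightarrow> (nat \<Rightarrow> nat \<times> nat)" where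
  "rhof p g = (\<lambda>a\<in>{1..e}. map_prod p p (g a))"

definition act :: "nat set \<times> (nat \<Rightarrow> nat) \<times> (nat \<Rightarrow> nat) \<Rightarrow> (nat \<Rightarrow> nat \<times> nat) \<Rightarrow> (nat \<Rightarrow> nat \<times> nat)" where
  "act h g = (case h of (R, p, q) \<Rightarrow> rhof q (muf p (nuf R g)))"
text \<open>A semidirect product. Reversals act first and are labelled by the edges before
  permutation, so those of \<open>h\<close> are pulled back along \<open>p'\<close>; two reversals
  of one edge cancel, which gives the exclusive or.\<close>

definition mul where
  "mul h k = (case h of (R, p, q) \<Rightarrow> case k of (R', p', q') \<Rightarrow>
     ({b\<in>{1..e}. (p' b \<in> R) \<noteq> (b \<in> R')}, p \<circ> p', q \<circ> q'))"
definition sn :: "nat set \<times> (nat \<Rightarrow> nat) \<times> (nat \<Rightarrow> nat) \<Rightarrow> int" where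
  "sn h = (case h of (R, p, q) \<Rightarrow> tw snu (odd (card R)) * tw smu (\<not> evenperm p) * tw srho (\<not> evenperm q))"

lemma nuf_gra: "g \<in> gra v e i \<Longrightarrow> nuf R g \<in> gra v e i"
proof -
  assume g: "g \<in> gra v e i"
  have "valence e (nuf R g) x = valence e g x" for x
    unfolding valence_eq_sum by (rule sum.cong) (auto simp: nuf_def)
  then show ?thesis using g by (auto simp: gra_def nuf_def PiE_iff mem_Times_iff)
qed

lemma muf_gra: "g \<in> gra v e i \<Longrightarrow> p permutes {1..e} \<Longrightarrow> muf p g \<in> gra v e i"
proof -
  assume g: "g \<in> gra v e i" and p: "p permutes {1..e}"
  have b: "bij_betw (inv' p) {1..e} {1..e}" by (rule permutes_imp_bij[OF permutes_inv[OF p]])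
  have "valence e (muf p g) x = valence e g x" for x
  proof -
    have "valence e g x = (\<Sum>a\<in>{1..e}. (if fst (g (inv' p a)) = x then 1 else 0) + (if snd (g (inv' p a)) = x then 1 else 0))"
      unfolding valence_eq_sum by (rule sum.reindex_bij_betw[OF b, symmetric])
    then show ?thesis unfolding valence_eq_sum by (simp add: muf_def)
  qed
  moreover have "inv' p a \<in> {1..e}" if "a \<in> {1..e}" for a using b that by (auto simp: bij_betw_def)
  ultimately show ?thesis using g by (auto simp: gra_def muf_def PiE_iff)
qed

lemma valence_rhof: "q permutes {1..v} \<Longrightarrow> valence e (rhof q g) x = valence e g (inv' q x)"
proof -
  assume q: "q permutes {1..v}"
  have "q y = x \<longleftrightarrow> y = inv' q x" for y using permutes_inv_eq[OF q] by metis
  then show ?thesis unfolding valence_eq_sum by (intro sum.cong) (auto simp: rhof_def)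
qed

lemma rhof_gra: "g \<in> gra v e i \<Longrightarrow> q permutes {1..v} \<Longrightarrow> rhof q g \<in> gra v e i"
proof -
  assume g: "g \<in> gra v e i" and q: "q permutes {1..v}"
  have "i \<le> valence e (rhof q g) x" if "x \<in> {1..v}" for x
    unfolding valence_rhof[OF q] using g that permutes_in_image[OF permutes_inv[OF q]] by (auto simp: gra_def)
  moreover have "rhof q g \<in> {1..e} \<rightarrow>\<^sub>E {1..v} \<times> {1..v}"
    using g permutes_in_image[OF q] by (auto simp: gra_def rhof_def PiE_iff mem_Times_iff)
  ultimately show ?thesis by (simp add: gra_def)
qed

lemma act_apply:
  "(R, p, q) \<in> H \<Longrightarrow> act (R, p, q) g = (\<lambda>a\<in>{1..e}. map_prod q q (if inv' p a \<in> R then prod.swap (g (inv' p a)) else g (inv' p a)))"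
proof -
  assume h: "(R, p, q) \<in> H"
  have "inv' p a \<in> {1..e} \<longleftrightarrow> a \<in> {1..e}" for a
    using h permutes_in_image[OF permutes_inv, of p "{1..e}"] by (auto simp: H_def)
  then show ?thesis by (intro ext) (auto simp: act_def rhof_def muf_def nuf_def)
qed

lemma even_card_xor: "finite A \<Longrightarrow> odd (card {b\<in>A. P b \<noteq> Q b}) \<longleftrightarrow> odd (card {b\<in>A. P b}) \<noteq> odd (card {b\<in>A. Q b})"
proof (induct A rule: finite_induct)
  case (insert a A)
  have *: "card {b \<in> insert a A. T b} = (if T a then Suc (card {b\<in>A. T b}) else card {b\<in>A. T b})" for T
  proof -
    have "{b \<in> insert a A. T b} = (if T a then insert a {b\<in>A. T b} else {b\<in>A. T b})" by auto
    then show ?thesis using insert.hyps by simp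
  qed
  show ?case using insert.hyps unfolding * by (auto split: if_splits)
qed simp

sublocale signed_action H "gra v e i" mul "({}, id, id)" act sn
proof
  show "finite H" unfolding H_def by (intro finite_cartesian_product finite_permutations) auto
  have "gra v e i \<subseteq> {1..e} \<rightarrow>\<^sub>E {1..v} \<times> {1..v}" by (auto simp: gra_def)
  then show "finite (gra v e i)" by (rule finite_subset) (auto intro: finite_PiE)
  show id: "({}, id, id) \<in> H" by (auto simp: H_def permutes_id)
  show "sn ({}, id, id) = 1" by (simp add: sn_def tw_def evenperm_id)
  fix g assume g: "g \<in> gra v e i"
  then show "act ({}, id, id) g = g"
    unfolding act_apply[OF id] by (auto simp: gra_def PiE_iff extensional_def prod.map_id0 intro!: ext)
next
  fix h assume h: "h \<in> H"
  obtain R p q where hd: "h = (R, p, q)" by (cases h) auto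
  have R: "R \<subseteq> {1..e}" "p permutes {1..e}" "q permutes {1..v}" using h by (auto simp: H_def hd)
  show "act h g \<in> gra v e i" if "g \<in> gra v e i" for g
    unfolding hd act_def using that R by (simp add: rhof_gra muf_gra nuf_gra)
  show "sn h = 1 \<or> sn h = -1" by (auto simp: hd sn_def tw_def)
  show "inj_on (mul h) H"
  proof (rule inj_onI)
    fix k l assume k: "k \<in> H" and l: "l \<in> H" and eq: "mul h k = mul h l"
    obtain R1 p1 q1 R2 p2 q2 where kl: "k = (R1, p1, q1)" "l = (R2, p2, q2)" by (cases k, cases l) auto
    have "p \<circ> p1 = p \<circ> p2" "q \<circ> q1 = q \<circ> q2"
      and S: "{b\<in>{1..e}. (p1 b \<in> R) \<noteq> (b \<in> R1)} = {b\<in>{1..e}. (p2 b \<in> R) \<noteq> (b \<in> R2)}"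
      using eq by (auto simp: mul_def hd kl)
    then have pq: "p1 = p2" "q1 = q2"
      using permutes_inj[OF R(2)] permutes_inj[OF R(3)] by (auto simp: fun_eq_iff dest: injD)
    have "R1 = R2"
    proof (rule Set.set_eqI)
      fix b show "b \<in> R1 \<longleftrightarrow> b \<in> R2"
      proof (cases "b \<in> {1..e}")
        case True
        then have "((p1 b \<in> R) \<noteq> (b \<in> R1)) = ((p2 b \<in> R) \<noteq> (b \<in> R2))" using S by blast
        then show ?thesis using pq by auto
      qed (use k l kl in \<open>auto simp: H_def\<close>)
    qed
    then show "k = l" using kl pq by simp
  qed
  fix k assume k: "k \<in> H"
  obtain R' p' q' where kd: "k = (R', p', q')" by (cases k) auto
  have R': "R' \<subseteq> {1..e}" "p' permutes {1..e}" "q' permutes {1..v}" using k by (auto simp: H_def kd)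
  let ?R = "{b\<in>{1..e}. (p' b \<in> R) \<noteq> (b \<in> R')}"
  have mulhk: "mul h k = (?R, p \<circ> p', q \<circ> q')" by (simp add: mul_def hd kd)
  show mH: "mul h k \<in> H"
    unfolding mulhk H_def using permutes_compose[OF R'(2) R(2)] permutes_compose[OF R'(3) R(3)] by auto
  show "sn (mul h k) = sn h * sn k"
  proof -
    have pp: "permutation p" "permutation p'" "permutation q" "permutation q'"
      using R R' by (meson finite_atLeastAtMost permutation_permutes)+
    have "card {b\<in>{1..e}. p' b \<in> R} = card R"
    proof -
      have "p' ` {b\<in>{1..e}. p' b \<in> R} = R"
      proof (intro subset_antisym subsetI)
        fix x assume x: "x \<in> R"
        then have "inv' p' x \<in> {1..e}" using R(1) permutes_in_image[OF permutes_inv[OF R'(2)]] by blast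
        then show "x \<in> p' ` {b\<in>{1..e}. p' b \<in> R}"
          using x permutes_inverses(1)[OF R'(2), of x] by (intro image_eqI[of _ _ "inv' p' x"]) auto
      qed auto
      moreover have "inj_on p' {b\<in>{1..e}. p' b \<in> R}" using permutes_inj[OF R'(2)] inj_on_subset by blast
      ultimately show ?thesis by (metis card_image)
    qed
    moreover have "{b\<in>{1..e}. b \<in> R'} = R'" using R' by auto
    ultimately have "odd (card ?R) = (odd (card R) \<noteq> odd (card R'))"
      using even_card_xor[of "{1..e}" "\<lambda>b. p' b \<in> R" "\<lambda>b. b \<in> R'"] by simp
    moreover have "(\<not> evenperm (p \<circ> p')) = ((\<not> evenperm p) \<noteq> (\<not> evenperm p'))"
      "(\<not> evenperm (q \<circ> q')) = ((\<not> evenperm q) \<noteq> (\<not> evenperm q'))"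
      using pp by (auto simp: evenperm_comp)
    moreover have "sn (mul h k) = sn (?R, p \<circ> p', q \<circ> q')" by (simp only: mulhk)
    ultimately show ?thesis unfolding sn_def hd kd by (simp only: split tw_mult mult_ac)
  qed
  fix g assume g: "g \<in> gra v e i"
  have L: "act (mul h k) g = act (?R, p \<circ> p', q \<circ> q') g" by (simp only: mulhk)
  show "act (mul h k) g = act h (act k g)"
  proof
    fix a
    show "act (mul h k) g a = act h (act k g) a"
    proof (cases "a \<in> {1..e}")
      case True
      let ?b = "inv' p a"
      let ?c = "inv' p' ?b"
      have b: "?b \<in> {1..e}" using permutes_in_image[OF permutes_inv[OF R(2)]] True by simp
      have c: "?c \<in> {1..e}" using permutes_in_image[OF permutes_inv[OF R'(2)]] b by simp
      have i: "inv' (p \<circ> p') a = ?c"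
        using o_inv_distrib[OF permutes_bij[OF R(2)] permutes_bij[OF R'(2)]] by simp
      have pc: "p' ?c = ?b" by (rule permutes_inverses(1)[OF R'(2)])
      show ?thesis
        unfolding L unfolding act_apply[OF mH[unfolded mulhk]] hd act_apply[OF h[unfolded hd]] kd act_apply[OF k[unfolded kd]]
        using True b c by (auto simp: i pc prod.map_comp prod.swap_def map_prod_def split_beta)
    next
      case False
      then show ?thesis
        unfolding L unfolding act_apply[OF mH[unfolded mulhk]] hd act_apply[OF h[unfolded hd]]
        by (simp only: restrict_apply if_False)
    qed
  qed
qed

lemma card_H: "card H = 2 ^ e * fact e * fact v"
  unfolding H_def by (simp add: card_cartesian_product card_Pow card_permutations[OF refl])

context
  fixes K :: "('a, 'm) ring_scheme"
  assumes K: "field K" and char: "\<And>n::nat. n > 0 \<Longrightarrow> add_pow K n \<one>\<^bsub>K\<^esub> \<noteq> \<zero>\<^bsub>K\<^esub>"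
begin

lemma cringK: "cring K"
proof -
  interpret field K by (rule K)
  show ?thesis ..
qed

definition op where "op h = mono_op K (gra v e i) (ksign K (sn h)) (act h)"

abbreviation V where "V \<equiv> free_mod K (gra v e i)"

lemma gens_H: "R \<subseteq> {1..e} \<Longrightarrow> (R, id, id) \<in> H" "p permutes {1..e} \<Longrightarrow> ({}, p, id) \<in> H"
   "q permutes {1..v} \<Longrightarrow> ({}, id, q) \<in> H"
  by (auto simp: H_def permutes_id)

lemma mono_op_cong: "(\<And>g. g \<in> X \<Longrightarrow> f g = f' g) \<Longrightarrow> mono_op K X c f = mono_op K X c f'"
  unfolding mono_op_def lin_ext_def by (intro ext) (auto simp: free_mod_simps intro!: arg_cong[where f="\<lambda>S. _ \<otimes>\<^bsub>K\<^esub> finsum K _ S"])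

lemma nu_op: assumes "R \<subseteq> {1..e}" shows "nu_act K v e i snu R = op (R, id, id)"
proof -
  have "nu_act K v e i snu R = mono_op K (gra v e i) (ksign K (sn (R, id, id))) (nuf R)"
    by (intro ext) (simp add: nu_act_def mono_op_def twist_eq sn_def nuf_def[abs_def] tw_def[of _ False] evenperm_id)
  also have "\<dots> = op (R, id, id)"
    unfolding op_def by (rule mono_op_cong) (auto simp: act_apply[OF gens_H(1)[OF assms]] nuf_def prod.map_id0)
  finally show ?thesis .
qed

lemma mu_op: assumes "p permutes {1..e}" shows "mu_act K v e i smu p = op ({}, p, id)"
proof -
  have "mu_act K v e i smu p = mono_op K (gra v e i) (ksign K (sn ({}, p, id))) (muf p)"
    by (intro ext) (simp add: mu_act_def mono_op_def twist_eq sn_def muf_def[abs_def] tw_def[of _ False] evenperm_id)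
  also have "\<dots> = op ({}, p, id)"
    unfolding op_def by (rule mono_op_cong) (auto simp: act_apply[OF gens_H(2)[OF assms]] muf_def prod.map_id0)
  finally show ?thesis .
qed

lemma rho_op: assumes "q permutes {1..v}" shows "rho_act K v e i srho q = op ({}, id, q)"
proof -
  have "rho_act K v e i srho q = mono_op K (gra v e i) (ksign K (sn ({}, id, q))) (rhof q)"
    by (intro ext) (simp add: rho_act_def mono_op_def twist_eq sn_def rhof_def[abs_def] tw_def[of _ False] evenperm_id)
  also have "\<dots> = op ({}, id, q)"
    unfolding op_def by (rule mono_op_cong) (auto simp: act_apply[OF gens_H(3)[OF assms]] rhof_def)
  finally show ?thesis .
qed

lemma ksign_carrier: "ksign K c \<in> carrier K"
proof -
  interpret cring K by (rule cringK)
  show ?thesis by (simp add: ksign_def)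
qed

lemma op_hom: "h \<in> H \<Longrightarrow> op h \<in> module_hom K V V"
  unfolding op_def by (rule mono_op_hom[OF cringK bij_f ksign_carrier])

lemma op_carrier: "h \<in> H \<Longrightarrow> op h \<in> carrier V \<rightarrow> carrier V"
  using op_hom by (auto simp: module_hom_def)

lemma op_mul: "h \<in> H \<Longrightarrow> k \<in> H \<Longrightarrow> x \<in> carrier V \<Longrightarrow> op h (op k x) = op (mul h k) x"
  unfolding op_def by (rule mono_op_mul[OF cringK])

lemma op_id: assumes x: "x \<in> carrier V" shows "op ({}, id, id) x = x"
proof -
  interpret cring K by (rule cringK)
  have id: "bij_betw (act ({}, id, id)) (gra v e i) (gra v e i)" by (rule bij_f[OF e(1)])
  show ?thesis
    unfolding op_def
  proof (rule free_mod_eqI[OF id mono_op_carrier[OF cringK id x ksign_carrier] x])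
    fix g assume g: "g \<in> gra v e i"
    have "x g \<in> carrier K" using x g by (auto simp: free_mod_simps)
    then show "mono_op K (gra v e i) (ksign K (sn ({}, id, id))) (act ({}, id, id)) x (act ({}, id, id) g) = x (act ({}, id, id) g)"
      unfolding mono_op_apply[OF cringK id x g] using e g by (simp add: ksign_def)
  qed
qed

lemma mu_nu: assumes "p permutes {1..e}" "R \<subseteq> {1..e}" "x \<in> carrier V"
  shows "op ({}, p, id) (op (R, id, id) x) = op (p ` R, id, id) (op ({}, p, id) x)"
proof -
  have pR: "p ` R \<subseteq> {1..e}" using assms permutes_image by blast
  have "{b \<in> {1..e}. b \<in> R} = {b \<in> {1..e}. p b \<in> p ` R}"
    using permutes_inj[OF assms(1)] by (auto dest: injD)
  then show ?thesis
    by (simp add: op_mul gens_H assms pR mul_def)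
qed

lemma rho_nu: assumes "q permutes {1..v}" "R \<subseteq> {1..e}" "x \<in> carrier V"
  shows "op ({}, id, q) (op (R, id, id) x) = op (R, id, id) (op ({}, id, q) x)"
  by (simp add: op_mul gens_H assms mul_def)

lemma rho_mu: assumes "q permutes {1..v}" "p permutes {1..e}" "x \<in> carrier V"
  shows "op ({}, id, q) (op ({}, p, id) x) = op ({}, p, id) (op ({}, id, q) x)"
  by (simp add: op_mul gens_H assms mul_def)

lemma mu_inv: "p permutes {1..e} \<Longrightarrow> x \<in> carrier V \<Longrightarrow> op ({}, p, id) (op ({}, inv' p, id) x) = x"
  by (simp add: op_mul gens_H permutes_inv mul_def permutes_inv_o op_id)

lemma rho_inv: "q permutes {1..v} \<Longrightarrow> x \<in> carrier V \<Longrightarrow> op ({}, id, q) (op ({}, id, inv' q) x) = x"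
  by (simp add: op_mul gens_H permutes_inv mul_def permutes_inv_o op_id)

text \<open>Each later group normalises the earlier ones, as the induced actions on the quotients
  require: an edge permutation \<open>p\<close> carries reversal of \<open>R\<close> to reversal of
  its image under \<open>p\<close>, and vertex permutations commute with both other groups.\<close>

lemma graph_space_pres:
  "\<exists>\<pi>. pres K V (graph_space K v e i snu smu srho) \<pi>
     ({nu_act K v e i snu R | R. R \<subseteq> {1..e}} \<union> {mu_act K v e i smu p | p. p permutes {1..e}}
       \<union> {rho_act K v e i srho p | p. p permutes {1..v}})"
proof -
  let ?nu = "nu_act K v e i snu" and ?mu = "mu_act K v e i smu" and ?rho = "rho_act K v e i srho"
  let ?E = "{p. p permutes {1..e}}" and ?Q = "{p. p permutes {1..v}}"
  note VM = free_mod_module[OF cringK, of "gra v e i"]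
  define V1 where "V1 = coinvariants K V (Pow {1..e}) ?nu"
  define V2 where "V2 = coinvariants K V1 ?E (\<lambda>p. (`) (?mu p))"
  have nuV: "?nu R \<in> carrier V \<rightarrow> carrier V" if "R \<in> Pow {1..e}" for R
    using that by (simp add: nu_op op_carrier gens_H)
  have muV: "?mu p \<in> carrier V \<rightarrow> carrier V" if "p \<in> ?E" for p
    using that by (simp add: mu_op op_carrier gens_H)
  have rhoV: "?rho p \<in> carrier V \<rightarrow> carrier V" if "p \<in> ?Q" for p
    using that by (simp add: rho_op op_carrier gens_H)
  note P0 = pres_self[OF VM]
  define \<pi>1 where "\<pi>1 = (\<lambda>x. span_mod K V (gens V (Pow {1..e}) ?nu) +>\<^bsub>V\<^esub> x)"
  have P1: "pres K V V1 \<pi>1 ({} \<union> ?nu ` Pow {1..e})"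
    unfolding V1_def \<pi>1_def by (rule pres_coinvariants[OF VM P0]) (use nuV in auto)
  have mu1: "(?mu p) ` \<pi>1 x = \<pi>1 (?mu p x)" if p: "p \<in> ?E" and x: "x \<in> carrier V" for p x
    unfolding \<pi>1_def
  proof (rule coinvariants_image[OF VM P0, where R' = "?mu (inv' p)" and \<psi>' = "?mu (inv' p)" and S = ?nu])
    have p': "p permutes {1..e}" "inv' p permutes {1..e}" using p permutes_inv by auto
    show "?mu (inv' p) \<in> carrier V \<rightarrow> carrier V" using muV[of "inv' p"] p' by simp
    show "?mu p \<in> module_hom K V V" "?mu (inv' p) \<in> module_hom K V V"
      using p' by (simp_all add: mu_op op_hom gens_H)
    show "?mu p (?mu (inv' p) x) = x" if "x \<in> carrier V" for x using p' that by (simp add: mu_op mu_inv)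
    show "\<exists>a'\<in>Pow {1..e}. \<forall>x\<in>carrier V. ?mu p (?nu a x) = ?nu a' (?mu p x)" if a: "a \<in> Pow {1..e}" for a
    proof (rule bexI[of _ "p ` a"])
      show "p ` a \<in> Pow {1..e}" using a p' permutes_image by blast
      then show "\<forall>x\<in>carrier V. ?mu p (?nu a x) = ?nu (p ` a) (?mu p x)"
        using a p' by (simp add: mu_op nu_op mu_nu)
    qed
    show "\<exists>a'\<in>Pow {1..e}. \<forall>x\<in>carrier V. ?mu (inv' p) (?nu a x) = ?nu a' (?mu (inv' p) x)" if a: "a \<in> Pow {1..e}" for a
    proof (rule bexI[of _ "inv' p ` a"])
      show "inv' p ` a \<in> Pow {1..e}" using a p'(2) permutes_image by blast
      then show "\<forall>x\<in>carrier V. ?mu (inv' p) (?nu a x) = ?nu (inv' p ` a) (?mu (inv' p) x)"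
        using a p' by (simp add: mu_op nu_op mu_nu)
    qed
  qed (use nuV muV p x permutes_inv in auto)
  have rho1: "(?rho p) ` \<pi>1 x = \<pi>1 (?rho p x)" if p: "p \<in> ?Q" and x: "x \<in> carrier V" for p x
    unfolding \<pi>1_def
  proof (rule coinvariants_image[OF VM P0, where R' = "?rho (inv' p)" and \<psi>' = "?rho (inv' p)" and S = ?nu])
    have p': "p permutes {1..v}" "inv' p permutes {1..v}" using p permutes_inv by auto
    show "?rho (inv' p) \<in> carrier V \<rightarrow> carrier V" using rhoV[of "inv' p"] p' by simp
    show "?rho p \<in> module_hom K V V" "?rho (inv' p) \<in> module_hom K V V"
      using p' by (simp_all add: rho_op op_hom gens_H)
    show "?rho p (?rho (inv' p) x) = x" if "x \<in> carrier V" for x using p' that by (simp add: rho_op rho_inv)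
    show "\<exists>a'\<in>Pow {1..e}. \<forall>x\<in>carrier V. ?rho p (?nu a x) = ?nu a' (?rho p x)" if a: "a \<in> Pow {1..e}" for a
      using a p' by (intro bexI[of _ a]) (auto simp: rho_op nu_op rho_nu)
    show "\<exists>a'\<in>Pow {1..e}. \<forall>x\<in>carrier V. ?rho (inv' p) (?nu a x) = ?nu a' (?rho (inv' p) x)" if a: "a \<in> Pow {1..e}" for a
      using a p' by (intro bexI[of _ a]) (auto simp: rho_op nu_op rho_nu)
  qed (use nuV rhoV p x permutes_inv in auto)
  define \<pi>2 where "\<pi>2 = (\<lambda>x. span_mod K V1 (gens V1 ?E (\<lambda>p. (`) (?mu p))) +>\<^bsub>V1\<^esub> \<pi>1 x)"
  have P2: "pres K V V2 \<pi>2 (({} \<union> ?nu ` Pow {1..e}) \<union> ?mu ` ?E)"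
    unfolding V2_def \<pi>2_def by (rule pres_coinvariants[OF VM P1]) (use muV mu1 in auto)
  have rho2: "((`) (?rho p)) ` \<pi>2 x = \<pi>2 (?rho p x)" if p: "p \<in> ?Q" and x: "x \<in> carrier V" for p x
    unfolding \<pi>2_def
  proof (rule coinvariants_image[OF VM P1, where R' = "?rho (inv' p)" and \<psi>' = "(`) (?rho (inv' p))" and S = ?mu])
    have p': "p permutes {1..v}" "inv' p permutes {1..v}" using p permutes_inv by auto
    show "?rho (inv' p) \<in> carrier V \<rightarrow> carrier V" using rhoV[of "inv' p"] p' by simp
    show "?rho p \<in> module_hom K V V" "?rho (inv' p) \<in> module_hom K V V"
      using p' by (simp_all add: rho_op op_hom gens_H)
    show "?rho p (?rho (inv' p) x) = x" if "x \<in> carrier V" for x using p' that by (simp add: rho_op rho_inv)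
    show "?rho p ` \<pi>1 x = \<pi>1 (?rho p x)" "?rho (inv' p) ` \<pi>1 x = \<pi>1 (?rho (inv' p) x)" if "x \<in> carrier V" for x
      using rho1 p' that by auto
    show "\<exists>a'\<in>?E. \<forall>x\<in>carrier V. ?rho p (?mu a x) = ?mu a' (?rho p x)" if a: "a \<in> ?E" for a
      using a p' by (intro bexI[of _ a]) (auto simp: rho_op mu_op rho_mu)
    show "\<exists>a'\<in>?E. \<forall>x\<in>carrier V. ?rho (inv' p) (?mu a x) = ?mu a' (?rho (inv' p) x)" if a: "a \<in> ?E" for a
      using a p' by (intro bexI[of _ a]) (auto simp: rho_op mu_op rho_mu)
  qed (use muV mu1 rhoV p x permutes_inv in auto)
  define \<pi>3 where "\<pi>3 = (\<lambda>x. span_mod K V2 (gens V2 ?Q (\<lambda>p. (`) ((`) (?rho p)))) +>\<^bsub>V2\<^esub> \<pi>2 x)"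
  have "pres K V (coinvariants K V2 ?Q (\<lambda>p. (`) ((`) (?rho p)))) \<pi>3 ((({} \<union> ?nu ` Pow {1..e}) \<union> ?mu ` ?E) \<union> ?rho ` ?Q)"
    unfolding \<pi>3_def by (rule pres_coinvariants[OF VM P2]) (use rhoV rho2 in auto)
  moreover have "coinvariants K V2 ?Q (\<lambda>p. (`) ((`) (?rho p))) = graph_space K v e i snu smu srho"
    by (simp add: graph_space_def Let_def V1_def V2_def)
  moreover have "(({} \<union> ?nu ` Pow {1..e}) \<union> ?mu ` ?E) \<union> ?rho ` ?Q =
     {nu_act K v e i snu R | R. R \<subseteq> {1..e}} \<union> {mu_act K v e i smu p | p. p permutes {1..e}}
       \<union> {rho_act K v e i srho p | p. p permutes {1..v}}" by auto
  ultimately show ?thesis by metis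
qed

theorem graph_space_dim:
  "int (2 ^ e * fact e * fact v * vdim K (graph_space K v e i snu smu srho)) =
    (\<Sum>h\<in>H. sn h * int (card {g\<in>gra v e i. act h g = g}))"
proof -
  let ?T = "{nu_act K v e i snu R | R. R \<subseteq> {1..e}} \<union> {mu_act K v e i smu p | p. p permutes {1..e}}
       \<union> {rho_act K v e i srho p | p. p permutes {1..v}}"
  obtain \<pi> where P: "pres K V (graph_space K v e i snu smu srho) \<pi> ?T" using graph_space_pres by blast
  have inv: "\<pi> (t x) = \<pi> x" if "t \<in> ?T" "x \<in> carrier V" for t x
    using P that unfolding pres_def by blast
  have "int (card H * vdim K (graph_space K v e i snu smu srho)) = (\<Sum>h\<in>H. sn h * int (card {g\<in>gra v e i. act h g = g}))"
  proof (rule dim_coinvariants[OF K char P])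
    fix t assume "t \<in> ?T"
    then consider R where "R \<subseteq> {1..e}" "t = op (R, id, id)" | p where "p permutes {1..e}" "t = op ({}, p, id)"
      | q where "q permutes {1..v}" "t = op ({}, id, q)"
      using nu_op mu_op rho_op by auto
    then show "\<exists>h\<in>H. t = mono_op K (gra v e i) (ksign K (sn h)) (act h)"
      by cases (use gens_H op_def in blast)+
  next
    fix h x assume h: "h \<in> H" and x: "x \<in> carrier V"
    obtain R p q where hd: "h = (R, p, q)" by (cases h) auto
    have R: "R \<subseteq> {1..e}" "p permutes {1..e}" "q permutes {1..v}" using h by (auto simp: H_def hd)
    have c1: "op (R, id, id) x \<in> carrier V" using funcset_mem[OF op_carrier[OF gens_H(1)[OF R(1)]] x] .
    have c2: "op ({}, p, id) (op (R, id, id) x) \<in> carrier V"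
      using funcset_mem[OF op_carrier[OF gens_H(2)[OF R(2)]] c1] .
    have "{b \<in> {1..e}. b \<in> R} = R" using R by auto
    \<comment> \<open>A general group element is a product of one element from each of the three
      groups, so invariance under these gives invariance under all of \<open>H\<close>.\<close>
    then have "op ({}, id, q) (op ({}, p, id) (op (R, id, id) x)) = op h x"
      using R x by (simp add: op_mul gens_H H_def mul_def hd)
    moreover have "\<pi> (op ({}, id, q) (op ({}, p, id) (op (R, id, id) x))) = \<pi> x"
    proof -
      have T: "nu_act K v e i snu R \<in> ?T" "mu_act K v e i smu p \<in> ?T" "rho_act K v e i srho q \<in> ?T"
        using R by blast+
      have "\<pi> (op ({}, id, q) (op ({}, p, id) (op (R, id, id) x))) = \<pi> (op ({}, p, id) (op (R, id, id) x))"
        by (rule inv[OF T(3)[unfolded rho_op[OF R(3)]] c2])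
      also have "\<dots> = \<pi> (op (R, id, id) x)" by (rule inv[OF T(2)[unfolded mu_op[OF R(2)]] c1])
      also have "\<dots> = \<pi> x" by (rule inv[OF T(1)[unfolded nu_op[OF R(1)]] x])
      finally show ?thesis .
    qed
    ultimately show "\<pi> (mono_op K (gra v e i) (ksign K (sn h)) (act h) x) = \<pi> x" by (simp add: op_def)
  qed
  then show ?thesis by (simp only: card_H)
qed

end

end

section \<open>Counting fixed graphs by a trace\<close>

lemma prod_add_Pow:
  fixes f h :: "'a \<Rightarrow> 'r::comm_semiring_1"
  assumes "finite A"
  shows "(\<Prod>b\<in>A. f b + h b) = (\<Sum>R\<in>Pow A. \<Prod>b\<in>A. if b \<in> R then h b else f b)"
  using assms
proof (induct A rule: finite_induct)
  case (insert a A)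
  have 1: "(\<Prod>b\<in>insert a A. if b \<in> R then h b else f b) = f a * (\<Prod>b\<in>A. if b \<in> R then h b else f b)"
    if "R \<in> Pow A" for R using insert.hyps that by auto
  have 2: "(\<Prod>b\<in>insert a A. if b \<in> insert a R then h b else f b) = h a * (\<Prod>b\<in>A. if b \<in> R then h b else f b)"
    if "R \<in> Pow A" for R
  proof -
    have "(\<Prod>b\<in>A. if b \<in> insert a R then h b else f b) = (\<Prod>b\<in>A. if b \<in> R then h b else f b)"
      by (rule prod.cong) (use insert.hyps in auto)
    then show ?thesis using insert.hyps by simp
  qed
  have inj: "inj_on (insert a) (Pow A)" using insert.hyps by (auto simp: inj_on_def)
  have "(\<Sum>R\<in>Pow (insert a A). \<Prod>b\<in>insert a A. if b \<in> R then h b else f b) =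
     (\<Sum>R\<in>Pow A. \<Prod>b\<in>insert a A. if b \<in> R then h b else f b) +
     (\<Sum>R\<in>insert a ` Pow A. \<Prod>b\<in>insert a A. if b \<in> R then h b else f b)"
    unfolding Pow_insert by (rule sum.union_disjoint) (use insert.hyps in auto)
  also have "\<dots> = (\<Sum>R\<in>Pow A. f a * (\<Prod>b\<in>A. if b \<in> R then h b else f b))
      + (\<Sum>R\<in>Pow A. h a * (\<Prod>b\<in>A. if b \<in> R then h b else f b))"
    unfolding sum.reindex[OF inj] o_def by (intro arg_cong2[where f="(+)"] sum.cong refl 1 2) auto
  finally show ?case using insert by (simp add: sum_distrib_left[symmetric] distrib_right)
qed simp

lemma funpow_map_prod:
  fixes q :: "'a \<Rightarrow> 'a"
  shows "(map_prod q q ^^ k) w = ((q ^^ k) (fst w), (q ^^ k) (snd w))"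
  by (induct k) auto

locale vertex_perm =
  fixes v e :: nat and q :: "nat \<Rightarrow> nat" and \<kappa> :: rat
  assumes q: "q permutes {1..v}" and sq: "\<kappa> * \<kappa> = 1"
begin

abbreviation orbs :: "nat set set" where "orbs \<equiv> orbit q ` {1..v}"

definition pow_sum :: "(nat set \<Rightarrow> rat) \<Rightarrow> nat \<Rightarrow> rat" where
  "pow_sum z k = (\<Sum>C\<in>orbs. if card C dvd k then of_nat (card C) * z C ^ k else 0)"

lemma orbit_q: "orbit q (q x) = orbit q x"
  by (rule orbit_eq_of_mem[OF _ q]) (auto intro: orbit.base)

lemma orbit_q_pow: "orbit q ((q ^^ k) x) = orbit q x"
  by (induct k) (auto simp: orbit_q)

lemma pow_sum_eq: "pow_sum z k = (\<Sum>x\<in>{x\<in>{1..v}. (q ^^ k) x = x}. z (orbit q x) ^ k)"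
  unfolding pow_sum_def by (rule sum_fixed_points_orbits[OF _ q, symmetric]) simp

text \<open>Transfer matrix of the fixed-graph condition. If edge \<open>b\<close> has ends
  \<open>w\<close>, then edge \<open>p b\<close> must have the ends \<open>q w\<close>, or those of
  the reversed pair with factor \<kappa> if \<open>b\<close> is reversed. The two terms thus carry
  the sum over reversals, one edge at a time.\<close>

definition trans :: "(nat set \<Rightarrow> rat) \<Rightarrow> nat \<times> nat \<Rightarrow> nat \<times> nat \<Rightarrow> rat" where
  "trans z w w' = z (orbit q (fst w)) * z (orbit q (snd w)) *
     ((if w' = map_prod q q w then 1 else 0) + \<kappa> * (if w' = map_prod q q (prod.swap w) then 1 else 0))"

abbreviation W where "W \<equiv> {1..v} \<times> {1..v}"

lemma mapW: "w \<in> W \<Longrightarrow> map_prod q q w \<in> W" "w \<in> W \<Longrightarrow> prod.swap w \<in> W"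
  using permutes_in_image[OF q] by (auto simp: mem_Times_iff)

text \<open>The swap commutes with \<open>q\<close>, and \<open>1 + \<kappa> swap\<close> squares to
  twice itself because \<kappa>^2 = 1; this produces the power of 2. The \<open>z\<close>-factors
  are constant along orbits.\<close>

lemma mpow_trans:
  "w \<in> W \<Longrightarrow> w' \<in> W \<Longrightarrow> mpow W (trans z) (Suc n) w w' =
    2 ^ n * (z (orbit q (fst w)) * z (orbit q (snd w))) ^ Suc n *
     ((if w' = (map_prod q q ^^ Suc n) w then 1 else 0)
      + \<kappa> * (if w' = (map_prod q q ^^ Suc n) (prod.swap w) then 1 else 0))"
proof (induct n arbitrary: w)
  case 0
  then show ?case by (subst mpow_1) (simp_all add: trans_def)
next
  case (Suc n)
  let ?Q = "map_prod q q" and ?m = "mpow W (trans z) (Suc n)"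
  let ?u = "z (orbit q (fst w)) * z (orbit q (snd w))"
  define D1 where "D1 = (if w' = (?Q ^^ Suc (Suc n)) w then 1 else 0 :: rat)"
  define D2 where "D2 = (if w' = (?Q ^^ Suc (Suc n)) (prod.swap w) then 1 else 0 :: rat)"
  have A: "(?Q ^^ Suc n) (?Q x) = (?Q ^^ Suc (Suc n)) x" for x
    by (simp only: funpow_Suc_right[of "Suc n"] o_apply)
  have B: "prod.swap (?Q x) = ?Q (prod.swap x)" for x by (cases x) simp
  have D: "z (orbit q (fst (?Q w))) * z (orbit q (snd (?Q w))) = ?u"
    "z (orbit q (fst (?Q (prod.swap w)))) * z (orbit q (snd (?Q (prod.swap w)))) = ?u"
    by (cases w; simp add: orbit_q)+
  have "mpow W (trans z) (Suc (Suc n)) w w' = (\<Sum>x\<in>W. trans z w x * ?m x w')"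
    by (rule mpow.simps(2))
  also have "\<dots> = (\<Sum>x\<in>W. (if x = ?Q w then ?u * ?m x w' else 0) + (if x = ?Q (prod.swap w) then ?u * \<kappa> * ?m x w' else 0))"
    by (rule sum.cong) (auto simp: trans_def algebra_simps simp del: mpow.simps)
  also have "\<dots> = ?u * ?m (?Q w) w' + ?u * \<kappa> * ?m (?Q (prod.swap w)) w'"
    using mapW(1)[OF Suc.prems(1)] mapW(1)[OF mapW(2)[OF Suc.prems(1)]]
    by (simp only: sum.distrib sum.delta finite_cartesian_product finite_atLeastAtMost if_True)
  also have "?m (?Q w) w' = 2 ^ n * ?u ^ Suc n * (D1 + \<kappa> * D2)"
    unfolding Suc.hyps[OF mapW(1)[OF Suc.prems(1)] Suc.prems(2)] D1_def D2_def
    by (simp only: A B D)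
  also have "?m (?Q (prod.swap w)) w' = 2 ^ n * ?u ^ Suc n * (D2 + \<kappa> * D1)"
    unfolding Suc.hyps[OF mapW(1)[OF mapW(2)[OF Suc.prems(1)]] Suc.prems(2)] D1_def D2_def
    by (simp only: A B D swap_swap)
  also have "?u * (2 ^ n * ?u ^ Suc n * (D1 + \<kappa> * D2)) + ?u * \<kappa> * (2 ^ n * ?u ^ Suc n * (D2 + \<kappa> * D1))
     = 2 ^ n * ?u ^ Suc (Suc n) * ((D1 + \<kappa> * D2) + (\<kappa> * D2 + (\<kappa> * \<kappa>) * D1))"
    by (simp add: algebra_simps)
  finally show ?case unfolding sq D1_def D2_def by (simp add: algebra_simps del: funpow.simps mpow.simps)
qed

text \<open>The unswapped term requires both ends to be fixed by \<open>q ^^ k\<close>, giving a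
  square. The swapped one requires \<open>j = (q ^^ k) i\<close> and \<open>i = (q ^^ k) j\<close>,
  so \<open>i\<close> is fixed by \<open>q ^^ (2 * k)\<close> and determines
  \<open>j\<close>.\<close>

lemma trace_trans:
  "(\<Sum>w\<in>W. mpow W (trans z) (Suc n) w w) = 2 ^ n * ((pow_sum z (Suc n))\<^sup>2 + \<kappa> * pow_sum z (2 * Suc n))"
proof -
  let ?k = "Suc n"
  define y where "y x = z (orbit q x)" for x
  have V: "(q ^^ k) x \<in> {1..v}" if "x \<in> {1..v}" for x k
    using that permutes_in_image[OF q] by (induct k) auto
  have 1: "(\<Sum>w\<in>W. if w = (map_prod q q ^^ ?k) w then (y (fst w) * y (snd w)) ^ ?k else 0) = (pow_sum z ?k)\<^sup>2"
  proof -
    have "(\<Sum>w\<in>W. if w = (map_prod q q ^^ ?k) w then (y (fst w) * y (snd w)) ^ ?k else 0)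
      = (\<Sum>(i,j)\<in>W. (if (q ^^ ?k) i = i then y i ^ ?k else 0) * (if (q ^^ ?k) j = j then y j ^ ?k else 0))"
    proof (rule sum.cong[OF refl])
      fix w assume "w \<in> W"
      obtain i j where w: "w = (i, j)" by (cases w)
      have "w = (map_prod q q ^^ ?k) w \<longleftrightarrow> (q ^^ ?k) i = i \<and> (q ^^ ?k) j = j"
        unfolding funpow_map_prod w fst_conv snd_conv prod.inject by metis
      then show "(if w = (map_prod q q ^^ ?k) w then (y (fst w) * y (snd w)) ^ ?k else 0) =
         (case w of (i, j) \<Rightarrow> (if (q ^^ ?k) i = i then y i ^ ?k else 0) * (if (q ^^ ?k) j = j then y j ^ ?k else 0))"
        by (simp add: w power_mult_distrib del: funpow.simps)
    qed
    also have "\<dots> = (\<Sum>i\<in>{1..v}. if (q ^^ ?k) i = i then y i ^ ?k else 0) * (\<Sum>j\<in>{1..v}. if (q ^^ ?k) j = j then y j ^ ?k else 0)"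
      unfolding sum_product by (rule sum.cartesian_product[symmetric])
    also have "(\<Sum>i\<in>{1..v}. if (q ^^ ?k) i = i then y i ^ ?k else 0) = pow_sum z ?k"
      unfolding pow_sum_eq y_def by (rule sum.inter_filter[symmetric]) simp
    finally show ?thesis by (simp add: power2_eq_square)
  qed
  have 2: "(\<Sum>w\<in>W. if w = (map_prod q q ^^ ?k) (prod.swap w) then (y (fst w) * y (snd w)) ^ ?k else 0) = pow_sum z (2 * ?k)"
  proof -
    have "(\<Sum>w\<in>W. if w = (map_prod q q ^^ ?k) (prod.swap w) then (y (fst w) * y (snd w)) ^ ?k else 0)
      = (\<Sum>(i,j)\<in>W. if j = (q ^^ ?k) i then (if i = (q ^^ ?k) j then (y i * y j) ^ ?k else 0) else 0)"
    proof (rule sum.cong[OF refl])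
      fix w assume "w \<in> W"
      obtain i j where w: "w = (i, j)" by (cases w)
      have "w = (map_prod q q ^^ ?k) (prod.swap w) \<longleftrightarrow> j = (q ^^ ?k) i \<and> i = (q ^^ ?k) j"
        unfolding funpow_map_prod w swap_simp fst_conv snd_conv prod.inject by metis
      then show "(if w = (map_prod q q ^^ ?k) (prod.swap w) then (y (fst w) * y (snd w)) ^ ?k else 0) =
         (case w of (i, j) \<Rightarrow> if j = (q ^^ ?k) i then (if i = (q ^^ ?k) j then (y i * y j) ^ ?k else 0) else 0)"
        by (simp add: w del: funpow.simps)
    qed
    also have "\<dots> = (\<Sum>i\<in>{1..v}. \<Sum>j\<in>{1..v}. if j = (q ^^ ?k) i then (if i = (q ^^ ?k) j then (y i * y j) ^ ?k else 0) else 0)"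
      by (rule sum.cartesian_product[symmetric])
    also have "\<dots> = (\<Sum>i\<in>{1..v}. if (q ^^ (2 * ?k)) i = i then y i ^ (2 * ?k) else 0)"
    proof (rule sum.cong[OF refl])
      fix i assume i: "i \<in> {1..v}"
      have "(q ^^ (2 * ?k)) i = (q ^^ ?k) ((q ^^ ?k) i)" by (simp only: mult_2 funpow_add o_apply)
      moreover have "y ((q ^^ ?k) i) = y i" by (simp only: y_def orbit_q_pow)
      ultimately show "(\<Sum>j\<in>{1..v}. if j = (q ^^ ?k) i then (if i = (q ^^ ?k) j then (y i * y j) ^ ?k else 0) else 0)
          = (if (q ^^ (2 * ?k)) i = i then y i ^ (2 * ?k) else 0)"
        using V[OF i, of ?k] by (simp add: power_mult power2_eq_square power_mult_distrib del: funpow.simps power_Suc mult_Suc_right)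
    qed
    also have "\<dots> = pow_sum z (2 * ?k)"
      unfolding pow_sum_eq y_def by (rule sum.inter_filter[symmetric]) simp
    finally show ?thesis .
  qed
  have "(\<Sum>w\<in>W. mpow W (trans z) ?k w w) = (\<Sum>w\<in>W. 2 ^ n *
      ((if w = (map_prod q q ^^ ?k) w then (y (fst w) * y (snd w)) ^ ?k else 0)
       + \<kappa> * (if w = (map_prod q q ^^ ?k) (prod.swap w) then (y (fst w) * y (snd w)) ^ ?k else 0)))"
  proof (rule sum.cong[OF refl])
    fix w assume "w \<in> W"
    then show "mpow W (trans z) ?k w w = 2 ^ n *
      ((if w = (map_prod q q ^^ ?k) w then (y (fst w) * y (snd w)) ^ ?k else 0)
       + \<kappa> * (if w = (map_prod q q ^^ ?k) (prod.swap w) then (y (fst w) * y (snd w)) ^ ?k else 0))"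
      unfolding mpow_trans[OF \<open>w \<in> W\<close> \<open>w \<in> W\<close>] y_def by (simp add: algebra_simps del: funpow.simps)
  qed
  also have "\<dots> = 2 ^ n * ((pow_sum z ?k)\<^sup>2 + \<kappa> * pow_sum z (2 * ?k))"
    by (simp only: sum_distrib_left[symmetric] sum.distrib 1 2)
  finally show ?thesis .
qed

definition graphs where "graphs = {1..e} \<rightarrow>\<^sub>E W"

abbreviation act where "act \<equiv> graph_action.act e"

lemma act_fixed_iff:
  assumes R: "R \<subseteq> {1..e}" and p: "p permutes {1..e}" and g: "g \<in> graphs"
  shows "act (R, p, q) g = g \<longleftrightarrow> (\<forall>b\<in>{1..e}. g (p b) = map_prod q q (if b \<in> R then prod.swap (g b) else g b))"
proof -
  have "(R, p, q) \<in> graph_action.H v e" using R p q by (simp add: graph_action.H_def)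
  note a = graph_action.act_apply[OF this, of g]
  let ?r = "\<lambda>a. map_prod q q (if inv' p a \<in> R then prod.swap (g (inv' p a)) else g (inv' p a))"
  have "act (R, p, q) g = g \<longleftrightarrow> (\<forall>a\<in>{1..e}. ?r a = g a)"
    unfolding a using g by (auto simp: graphs_def fun_eq_iff PiE_iff extensional_def restrict_def)
  also have "\<dots> \<longleftrightarrow> (\<forall>a\<in>p ` {1..e}. ?r a = g a)" by (simp only: permutes_image[OF p])
  also have "\<dots> \<longleftrightarrow> (\<forall>b\<in>{1..e}. ?r (p b) = g (p b))" by blast
  also have "\<dots> \<longleftrightarrow> (\<forall>b\<in>{1..e}. g (p b) = map_prod q q (if b \<in> R then prod.swap (g b) else g b))"
    unfolding permutes_inverses(2)[OF p] by (intro ball_cong) auto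
  finally show ?thesis .
qed

text \<open>Being fixed is a condition on each edge separately, hence a product of indicators.
  Expanding the product of the two-term entries of \<open>trans\<close> over subsets recovers the
  sum over \<open>R\<close> with weight \<kappa>^|R|, and the sum over \<open>p\<close> is then a
  sum of traces.\<close>

lemma count_trace:
  "(\<Sum>R\<in>Pow {1..e}. \<Sum>p | p permutes {1..e}. \<kappa> ^ card R * sg (- \<kappa>) p *
      (\<Sum>g\<in>{g\<in>graphs. act (R, p, q) g = g}. \<Prod>a\<in>{1..e}. z (orbit q (fst (g a))) * z (orbit q (snd (g a)))))
   = perm_sum (- \<kappa>) (\<lambda>k. 2 ^ (k - 1) * ((pow_sum z k)\<^sup>2 + \<kappa> * pow_sum z (2 * k))) e" (is "?L = _")
proof -
  define y where "y w = z (orbit q (fst w)) * z (orbit q (snd w))" for w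
  define F where "F R g b = map_prod q q (if b \<in> R then prod.swap (g b) else (g b :: nat \<times> nat))" for R g and b :: nat
  have finG: "finite graphs" unfolding graphs_def by (intro finite_PiE) auto
  have "?L = (\<Sum>R\<in>Pow {1..e}. \<Sum>p | p permutes {1..e}. \<kappa> ^ card R * sg (- \<kappa>) p *
      (\<Sum>g\<in>graphs. \<Prod>b\<in>{1..e}. if g (p b) = F R g b then y (g b) else 0))"
  proof (rule sum.cong[OF refl], rule sum.cong[OF refl], rule arg_cong2[where f="(*)", OF refl])
    fix R p assume R: "R \<in> Pow {1..e}" and p: "p \<in> {p. p permutes {1..e}}"
    have "(\<Sum>g\<in>{g\<in>graphs. act (R, p, q) g = g}. \<Prod>a\<in>{1..e}. z (orbit q (fst (g a))) * z (orbit q (snd (g a))))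
      = (\<Sum>g\<in>graphs. if act (R, p, q) g = g then \<Prod>a\<in>{1..e}. y (g a) else 0)"
      unfolding y_def by (rule sum.inter_filter[OF finG])
    also have "\<dots> = (\<Sum>g\<in>graphs. \<Prod>b\<in>{1..e}. if g (p b) = F R g b then y (g b) else 0)"
    proof (rule sum.cong[OF refl])
      fix g assume g: "g \<in> graphs"
      have i: "act (R, p, q) g = g \<longleftrightarrow> (\<forall>b\<in>{1..e}. g (p b) = F R g b)"
        unfolding F_def using R p by (intro act_fixed_iff[OF _ _ g]) auto
      show "(if act (R, p, q) g = g then \<Prod>a\<in>{1..e}. y (g a) else 0) = (\<Prod>b\<in>{1..e}. if g (p b) = F R g b then y (g b) else 0)"
      proof (cases "act (R, p, q) g = g")
        case True
        then show ?thesis using i by (auto intro!: prod.cong)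
      next
        case False
        then obtain b where "b \<in> {1..e}" "g (p b) \<noteq> F R g b" using i by blast
        then have "(\<Prod>b\<in>{1..e}. if g (p b) = F R g b then y (g b) else 0) = 0"
          by (intro prod_zero) auto
        then show ?thesis using False by simp
      qed
    qed
    finally show "(\<Sum>g\<in>{g\<in>graphs. act (R, p, q) g = g}. \<Prod>a\<in>{1..e}. z (orbit q (fst (g a))) * z (orbit q (snd (g a))))
      = (\<Sum>g\<in>graphs. \<Prod>b\<in>{1..e}. if g (p b) = F R g b then y (g b) else 0)" .
  qed
  also have "\<dots> = (\<Sum>p | p permutes {1..e}. sg (- \<kappa>) p * (\<Sum>g\<in>graphs. \<Sum>R\<in>Pow {1..e}.
      \<kappa> ^ card R * (\<Prod>b\<in>{1..e}. if g (p b) = F R g b then y (g b) else 0)))"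
  proof -
    let ?X = "\<lambda>R p g. \<Prod>b\<in>{1..e}. if g (p b) = F R g b then y (g b) else 0"
    have "(\<Sum>R\<in>Pow {1..e}. \<Sum>p | p permutes {1..e}. \<kappa> ^ card R * sg (- \<kappa>) p * (\<Sum>g\<in>graphs. ?X R p g))
      = (\<Sum>p | p permutes {1..e}. \<Sum>R\<in>Pow {1..e}. \<kappa> ^ card R * sg (- \<kappa>) p * (\<Sum>g\<in>graphs. ?X R p g))"
      by (rule sum.swap)
    also have "\<dots> = (\<Sum>p | p permutes {1..e}. sg (- \<kappa>) p * (\<Sum>g\<in>graphs. \<Sum>R\<in>Pow {1..e}. \<kappa> ^ card R * ?X R p g))"
    proof (rule sum.cong[OF refl])
      fix p
      have "(\<Sum>g\<in>graphs. \<Sum>R\<in>Pow {1..e}. \<kappa> ^ card R * ?X R p g) = (\<Sum>R\<in>Pow {1..e}. \<Sum>g\<in>graphs. \<kappa> ^ card R * ?X R p g)"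
        by (rule sum.swap)
      also have "\<dots> = (\<Sum>R\<in>Pow {1..e}. \<kappa> ^ card R * (\<Sum>g\<in>graphs. ?X R p g))"
        by (simp only: sum_distrib_left)
      finally show "(\<Sum>R\<in>Pow {1..e}. \<kappa> ^ card R * sg (- \<kappa>) p * (\<Sum>g\<in>graphs. ?X R p g)) =
         sg (- \<kappa>) p * (\<Sum>g\<in>graphs. \<Sum>R\<in>Pow {1..e}. \<kappa> ^ card R * ?X R p g)"
        by (simp only: sum_distrib_left[of "sg (- \<kappa>) p"]) (simp only: mult_ac)
    qed
    finally show ?thesis .
  qed
  also have "\<dots> = (\<Sum>p | p permutes {1..e}. sg (- \<kappa>) p * (\<Sum>g\<in>graphs. \<Prod>b\<in>{1..e}. trans z (g b) (g (p b))))"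
  proof (intro sum.cong refl arg_cong2[where f="(*)"])
    fix p g
    have "(\<Prod>b\<in>{1..e}. trans z (g b) (g (p b))) = (\<Prod>b\<in>{1..e}.
       (if g (p b) = map_prod q q (g b) then y (g b) else 0) + (if g (p b) = map_prod q q (prod.swap (g b)) then \<kappa> * y (g b) else 0))"
      by (rule prod.cong) (auto simp: trans_def y_def algebra_simps)
    also have "\<dots> = (\<Sum>R\<in>Pow {1..e}. \<Prod>b\<in>{1..e}. if b \<in> R then if g (p b) = map_prod q q (prod.swap (g b)) then \<kappa> * y (g b) else 0
        else if g (p b) = map_prod q q (g b) then y (g b) else 0)"
      by (rule prod_add_Pow) simp
    also have "\<dots> = (\<Sum>R\<in>Pow {1..e}. \<kappa> ^ card R * (\<Prod>b\<in>{1..e}. if g (p b) = F R g b then y (g b) else 0))"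
    proof (rule sum.cong[OF refl])
      fix R assume R: "R \<in> Pow {1..e}"
      have "(\<Prod>b\<in>{1..e}. if b \<in> R then if g (p b) = map_prod q q (prod.swap (g b)) then \<kappa> * y (g b) else 0
          else if g (p b) = map_prod q q (g b) then y (g b) else 0)
         = (\<Prod>b\<in>{1..e}. (if b \<in> R then \<kappa> else 1) * (if g (p b) = F R g b then y (g b) else 0))"
        by (rule prod.cong) (auto simp: F_def)
      also have "\<dots> = (\<Prod>b\<in>{1..e}. if b \<in> R then \<kappa> else 1) * (\<Prod>b\<in>{1..e}. if g (p b) = F R g b then y (g b) else 0)"
        by (rule prod.distrib)
      also have "(\<Prod>b\<in>{1..e}. if b \<in> R then \<kappa> else 1) = (\<Prod>b\<in>{b\<in>{1..e}. b \<in> R}. \<kappa>)"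
        by (rule prod.inter_filter[symmetric]) simp
      also have "{b\<in>{1..e}. b \<in> R} = R" using R by auto
      finally show "(\<Prod>b\<in>{1..e}. if b \<in> R then if g (p b) = map_prod q q (prod.swap (g b)) then \<kappa> * y (g b) else 0
          else if g (p b) = map_prod q q (g b) then y (g b) else 0) =
          \<kappa> ^ card R * (\<Prod>b\<in>{1..e}. if g (p b) = F R g b then y (g b) else 0)" by simp
    qed
    finally show "(\<Sum>R\<in>Pow {1..e}. \<kappa> ^ card R * (\<Prod>b\<in>{1..e}. if g (p b) = F R g b then y (g b) else 0))
        = (\<Prod>b\<in>{1..e}. trans z (g b) (g (p b)))" by simp
  qed
  also have "\<dots> = perm_sum (- \<kappa>) (\<lambda>k. \<Sum>w\<in>W. mpow W (trans z) k w w) e"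
    unfolding graphs_def by (subst sum_permutes_trace) (auto simp: sq)
  also have "\<dots> = perm_sum (- \<kappa>) (\<lambda>k. 2 ^ (k - 1) * ((pow_sum z k)\<^sup>2 + \<kappa> * pow_sum z (2 * k))) e"
  proof -
    \<comment> \<open>Cycle weights are evaluated at positive lengths only; at length 0 the trace
      formula does not apply.\<close>
    have cs: "cyc_sum l f n r = cyc_sum l f' n r" if "\<And>k. f (Suc k) = f' (Suc k)" for l :: rat and f f' n r
      by (induct n arbitrary: r) (auto simp: that)
    have "(\<Sum>w\<in>W. mpow W (trans z) (Suc n) w w) = 2 ^ (Suc n - 1) * ((pow_sum z (Suc n))\<^sup>2 + \<kappa> * pow_sum z (2 * Suc n))" for n
      unfolding trace_trans by simp
    then show ?thesis
      unfolding perm_sum_def by (cases e) (auto simp del: mpow.simps intro!: cs)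
  qed
  finally show ?thesis .
qed

text \<open>Half-edges are regrouped by vertex and then by orbit, so the exponent of
  \<open>z C\<close> counts the half-edges at \<open>C\<close>.\<close>

lemma prod_valence:
  assumes "g \<in> graphs"
  shows "(\<Prod>a\<in>{1..e}. z (orbit q (fst (g a))) * z (orbit q (snd (g a)))) = (\<Prod>C\<in>orbs. z C ^ (\<Sum>x\<in>C. valence e g x))"
proof -
  have g: "fst (g a) \<in> {1..v}" "snd (g a) \<in> {1..v}" if "a \<in> {1..e}" for a
    using assms that by (auto simp: graphs_def PiE_iff mem_Times_iff)
  have C: "C = {x\<in>{1..v}. orbit q x = C}" if C: "C \<in> orbs" for C
  proof -
    obtain y where y: "y \<in> {1..v}" "C = orbit q y" using C by auto
    have f: "finite {1..v}" by simp
    show ?thesis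
      using orbit_subset_of_permutes[OF f q y(1)] orbit_eq_of_mem[OF f q] permutes_self_in_orbit[OF f q] y by blast
  qed
  have one: "(\<Prod>x\<in>{1..v}. z (orbit q x) ^ (if h a = x then 1 else 0)) = z (orbit q (h a))" if "h a \<in> {1..v}"
    for h :: "nat \<Rightarrow> nat" and a
  proof -
    have "(\<Prod>x\<in>{1..v}. z (orbit q x) ^ (if h a = x then 1 else 0)) = (\<Prod>x\<in>{1..v}. if x = h a then z (orbit q x) else 1)"
      by (rule prod.cong) auto
    then show ?thesis using that by (simp only: prod.delta finite_atLeastAtMost if_True)
  qed
  have "(\<Prod>a\<in>{1..e}. z (orbit q (fst (g a))) * z (orbit q (snd (g a)))) =
     (\<Prod>a\<in>{1..e}. \<Prod>x\<in>{1..v}. z (orbit q x) ^ ((if fst (g a) = x then 1 else 0) + (if snd (g a) = x then 1 else 0)))"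
    by (rule prod.cong) (simp_all only: power_add prod.distrib one[of "\<lambda>a. fst (g a)", OF g(1)] one[of "\<lambda>a. snd (g a)", OF g(2)])
  also have "\<dots> = (\<Prod>x\<in>{1..v}. z (orbit q x) ^ valence e g x)"
    unfolding valence_eq_sum power_sum by (rule prod.swap)
  also have "\<dots> = (\<Prod>C\<in>orbs. \<Prod>x\<in>{x\<in>{1..v}. orbit q x = C}. z (orbit q x) ^ valence e g x)"
    by (rule prod.image_gen) simp
  also have "\<dots> = (\<Prod>C\<in>orbs. z C ^ (\<Sum>x\<in>C. valence e g x))"
  proof (rule prod.cong[OF refl])
    fix C assume "C \<in> orbs"
    have "(\<Prod>x\<in>{x\<in>{1..v}. orbit q x = C}. z (orbit q x) ^ valence e g x) = (\<Prod>x\<in>{x\<in>{1..v}. orbit q x = C}. z C ^ valence e g x)"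
      by (rule prod.cong) auto
    also have "\<dots> = (\<Prod>x\<in>C. z C ^ valence e g x)" using C[OF \<open>C \<in> orbs\<close>] by simp
    finally show "(\<Prod>x\<in>{x\<in>{1..v}. orbit q x = C}. z (orbit q x) ^ valence e g x) = z C ^ (\<Sum>x\<in>C. valence e g x)"
      by (simp add: power_sum)
  qed
  finally show ?thesis .
qed

text \<open>A fixed graph has the same valence along each orbit of \<open>q\<close>, so the bound on
  single vertices can be read off from the exponents of the orbit variables.\<close>

lemma fixed_trivalent_iff:
  assumes R: "R \<subseteq> {1..e}" and p: "p permutes {1..e}" and g: "g \<in> graphs" and fx: "act (R, p, q) g = g"
  shows "g \<in> gra v e i \<longleftrightarrow> (\<forall>C\<in>orbs. i * card C \<le> (\<Sum>x\<in>C. valence e g x))"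
proof -
  have inv: "valence e g x = valence e g (q x)" for x
  proof -
    have 1: "valence e (graph_action.nuf e R g) x = valence e g x" for x
      unfolding valence_eq_sum by (rule sum.cong) (auto simp: graph_action.nuf_def)
    have b: "bij_betw (inv' p) {1..e} {1..e}" by (rule permutes_imp_bij[OF permutes_inv[OF p]])
    have 2: "valence e (graph_action.muf e p h) x = valence e h x" for h x
    proof -
      have "valence e h x = (\<Sum>a\<in>{1..e}. (if fst (h (inv' p a)) = x then 1 else 0) + (if snd (h (inv' p a)) = x then 1 else 0))"
        unfolding valence_eq_sum by (rule sum.reindex_bij_betw[OF b, symmetric])
      then show ?thesis unfolding valence_eq_sum by (simp add: graph_action.muf_def)
    qed
    have "valence e g (q x) = valence e (act (R, p, q) g) (q x)" by (simp add: fx)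
    also have "\<dots> = valence e g (inv' q (q x))"
      by (simp add: graph_action.act_def graph_action.valence_rhof[OF q] 1 2)
    finally show ?thesis by (simp add: permutes_inverses(2)[OF q])
  qed
  have const: "valence e g y = valence e g x" if "y \<in> orbit q x" for x y
    using that by induct (simp_all add: inv[symmetric])
  have sum: "(\<Sum>y\<in>orbit q x. valence e g y) = card (orbit q x) * valence e g x" for x
    using const by simp
  have card: "card (orbit q x) > 0" if "x \<in> {1..v}" for x
    using orbit_subset_of_permutes[OF _ q that] permutes_self_in_orbit[OF _ q, of x]
    by (metis card_gt_0_iff empty_iff finite_atLeastAtMost finite_subset)
  have "(\<forall>C\<in>orbs. i * card C \<le> (\<Sum>x\<in>C. valence e g x)) \<longleftrightarrow> (\<forall>x\<in>{1..v}. i \<le> valence e g x)"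
    using card by (auto simp: sum mult.commute[of i])
  then show ?thesis using g by (auto simp: gra_def graphs_def)
qed

end

section \<open>Polynomial functions\<close>

text \<open>A polynomial is handled through its values at all rational points, with coefficients
  \<open>c\<close> read on a box of exponents; over an infinite field the values determine
  them.\<close>

definition is_poly :: "'i set \<Rightarrow> nat \<Rightarrow> (('i \<Rightarrow> rat) \<Rightarrow> rat) \<Rightarrow> (('i \<Rightarrow> nat) \<Rightarrow> rat) \<Rightarrow> bool" where
  "is_poly I K F c \<longleftrightarrow> (\<forall>z. F z = (\<Sum>n\<in>I \<rightarrow>\<^sub>E {..K}. c n * (\<Prod>i\<in>I. z i ^ n i)))"

lemma poly_coeffs_zero:
  fixes c :: "nat \<Rightarrow> rat"
  assumes "\<And>x. (\<Sum>k\<le>K. c k * x ^ k) = 0" "k \<le> K"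
  shows "c k = 0"
proof -
  define p where "p = (\<Sum>k\<le>K. Polynomial.monom (c k) k)"
  have "poly p x = 0" for x :: rat using assms(1)[of x] by (simp add: p_def Polynomial.poly_sum Polynomial.poly_monom)
  then have "p = 0" using poly_all_0_iff_0 by blast
  moreover have "Polynomial.coeff p k = c k" using assms(2) by (simp add: p_def Polynomial.coeff_sum Polynomial.coeff_monom)
  ultimately show ?thesis by simp
qed

text \<open>Fixing all variables but one leaves a polynomial in one variable that vanishes at every
  rational number.\<close>

lemma is_poly_zero:
  assumes "finite I" "\<And>z. (\<Sum>n\<in>I \<rightarrow>\<^sub>E {..K}. c n * (\<Prod>i\<in>I. z i ^ n i)) = (0::rat)" "n \<in> I \<rightarrow>\<^sub>E {..K}"
  shows "c n = 0"
  using assms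
proof (induction I arbitrary: c n rule: finite_induct)
  case empty
  then show ?case by (simp add: PiE_def)
next
  case (insert a I)
  have eq: "(\<Sum>y\<le>K. (\<Sum>g\<in>I \<rightarrow>\<^sub>E {..K}. c (g(a := y)) * (\<Prod>i\<in>I. z i ^ g i)) * x ^ y) = 0" for z and x :: rat
  proof -
    have "0 = (\<Sum>m\<in>insert a I \<rightarrow>\<^sub>E {..K}. c m * (\<Prod>i\<in>insert a I. (z(a := x)) i ^ m i))"
      using insert.prems(1)[of "z(a := x)"] by simp
    also have "\<dots> = (\<Sum>g\<in>I \<rightarrow>\<^sub>E {..K}. \<Sum>y\<le>K. c (g(a := y)) * (\<Prod>i\<in>insert a I. (z(a := x)) i ^ (g(a := y)) i))"
      by (rule sum_PiE_insert[OF insert.hyps(2), where h="\<lambda>m. c m * (\<Prod>i\<in>insert a I. (z(a := x)) i ^ m i)"])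
    also have "\<dots> = (\<Sum>g\<in>I \<rightarrow>\<^sub>E {..K}. \<Sum>y\<le>K. c (g(a := y)) * (\<Prod>i\<in>I. z i ^ g i) * x ^ y)"
    proof (intro sum.cong refl)
      fix g y
      have "(\<Prod>i\<in>I. (z(a := x)) i ^ (g(a := y)) i) = (\<Prod>i\<in>I. z i ^ g i)"
        by (rule prod.cong) (use insert.hyps in auto)
      then show "c (g(a := y)) * (\<Prod>i\<in>insert a I. (z(a := x)) i ^ (g(a := y)) i) = c (g(a := y)) * (\<Prod>i\<in>I. z i ^ g i) * x ^ y"
        using insert.hyps by simp
    qed
    also have "\<dots> = (\<Sum>y\<le>K. \<Sum>g\<in>I \<rightarrow>\<^sub>E {..K}. c (g(a := y)) * (\<Prod>i\<in>I. z i ^ g i) * x ^ y)" by (rule sum.swap)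
    finally show ?thesis by (simp add: sum_distrib_right)
  qed
  have z: "(\<Sum>g\<in>I \<rightarrow>\<^sub>E {..K}. c (g(a := y)) * (\<Prod>i\<in>I. z i ^ g i)) = 0" if "y \<le> K" for z y
    by (rule poly_coeffs_zero[OF eq that])
  obtain g y where n: "n = g(a := y)" "g \<in> I \<rightarrow>\<^sub>E {..K}" "y \<le> K"
    using insert.prems(2) unfolding PiE_insert_eq by auto
  show ?case unfolding n(1)
    by (rule insert.IH[where c="\<lambda>g. c (g(a := y))", OF z[OF n(3)] n(2)])
qed

lemma is_poly_unique:
  assumes "finite I" "is_poly I K F c" "is_poly I K F d" "n \<in> I \<rightarrow>\<^sub>E {..K}"
  shows "c n = d n"
proof -
  have "(\<Sum>n\<in>I \<rightarrow>\<^sub>E {..K}. (c n - d n) * (\<Prod>i\<in>I. z i ^ n i)) = 0" for z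
    using assms(2,3) by (simp add: is_poly_def left_diff_distrib sum_subtractf)
  from is_poly_zero[OF assms(1) this assms(4)] show ?thesis by simp
qed

text \<open>Collecting terms by exponent; in this way a signed count of objects with prescribed
  exponent appears as a coefficient.\<close>

lemma is_poly_family:
  assumes "finite I" "finite J" "\<And>j. j \<in> J \<Longrightarrow> ex j \<in> I \<rightarrow>\<^sub>E {..K}"
    "\<And>z. F z = (\<Sum>j\<in>J. d j * (\<Prod>i\<in>I. z i ^ ex j i))"
  shows "is_poly I K F (\<lambda>n. \<Sum>j\<in>{j\<in>J. ex j = n}. d j)"
  unfolding is_poly_def
proof
  fix z
  have "F z = (\<Sum>n\<in>I \<rightarrow>\<^sub>E {..K}. \<Sum>j\<in>{j\<in>J. ex j = n}. d j * (\<Prod>i\<in>I. z i ^ ex j i))"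
    unfolding assms(4) by (rule sum.group[symmetric]) (use assms in \<open>auto intro: finite_PiE\<close>)
  also have "\<dots> = (\<Sum>n\<in>I \<rightarrow>\<^sub>E {..K}. (\<Sum>j\<in>{j\<in>J. ex j = n}. d j) * (\<Prod>i\<in>I. z i ^ n i))"
    unfolding sum_distrib_right by (intro sum.cong refl) auto
  finally show "F z = (\<Sum>n\<in>I \<rightarrow>\<^sub>E {..K}. (\<Sum>j\<in>{j\<in>J. ex j = n}. d j) * (\<Prod>i\<in>I. z i ^ n i))" .
qed

lemma is_poly_const: "finite I \<Longrightarrow> \<exists>c. is_poly I K (\<lambda>z. r) c"
  using is_poly_family[of I "{()}" "\<lambda>_. \<lambda>i\<in>I. 0" K "\<lambda>z. r" "\<lambda>_. r"] by auto

lemma is_poly_monom: "finite I \<Longrightarrow> a \<in> I \<Longrightarrow> k \<le> K \<Longrightarrow> \<exists>c. is_poly I K (\<lambda>z. r * z a ^ k) c"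
proof -
  assume I: "finite I" and a: "a \<in> I" and k: "k \<le> K"
  have "(\<Prod>i\<in>I. z i ^ (\<lambda>i\<in>I. if i = a then k else 0) i) = z a ^ k" for z :: "'a \<Rightarrow> rat"
  proof -
    have "(\<Prod>i\<in>I. z i ^ (\<lambda>i\<in>I. if i = a then k else 0) i) = (\<Prod>i\<in>I. if i = a then z i ^ k else 1)"
      by (rule prod.cong) auto
    then show ?thesis using I a by simp
  qed
  then show ?thesis
    using is_poly_family[of I "{()}" "\<lambda>_. \<lambda>i\<in>I. if i = a then k else 0" K "\<lambda>z. r * z a ^ k" "\<lambda>_. r"] I k by auto
qed

lemma is_poly_sum:
  assumes "finite A" "\<And>a. a \<in> A \<Longrightarrow> \<exists>c. is_poly I K (F a) c"
  shows "\<exists>c. is_poly I K (\<lambda>z. \<Sum>a\<in>A. F a z) c"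
proof -
  obtain c where "\<And>a. a \<in> A \<Longrightarrow> is_poly I K (F a) (c a)" using assms(2) by metis
  then have "is_poly I K (\<lambda>z. \<Sum>a\<in>A. F a z) (\<lambda>n. \<Sum>a\<in>A. c a n)"
    unfolding is_poly_def by (simp add: sum_distrib_right) (subst sum.swap, simp)
  then show ?thesis by blast
qed

lemma is_poly_mult:
  assumes I: "finite I" and "\<exists>c. is_poly I K F c" "\<exists>c. is_poly I L G c"
  shows "\<exists>c. is_poly I (K + L) (\<lambda>z. F z * G z) c"
proof -
  obtain c d where c: "is_poly I K F c" and d: "is_poly I L G d" using assms by blast
  let ?J = "(I \<rightarrow>\<^sub>E {..K}) \<times> (I \<rightarrow>\<^sub>E {..L})"
  have "is_poly I (K + L) (\<lambda>z. F z * G z) (\<lambda>n. \<Sum>j\<in>{j\<in>?J. (\<lambda>i\<in>I. fst j i + snd j i) = n}. c (fst j) * d (snd j))"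
  proof (rule is_poly_family[OF I])
    show "finite ?J" using I by (intro finite_cartesian_product finite_PiE) auto
    show "(\<lambda>i\<in>I. fst j i + snd j i) \<in> I \<rightarrow>\<^sub>E {..K + L}" if "j \<in> ?J" for j
      using that by (auto simp: PiE_iff add_mono)
    fix z
    have "F z * G z = (\<Sum>j\<in>?J. (c (fst j) * (\<Prod>i\<in>I. z i ^ fst j i)) * (d (snd j) * (\<Prod>i\<in>I. z i ^ snd j i)))"
      using c d unfolding is_poly_def by (simp add: sum_product sum.cartesian_product case_prod_unfold)
    also have "\<dots> = (\<Sum>j\<in>?J. c (fst j) * d (snd j) * (\<Prod>i\<in>I. z i ^ (\<lambda>i\<in>I. fst j i + snd j i) i))"
      by (rule sum.cong) (simp_all add: power_add prod.distrib mult_ac)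
    finally show "F z * G z = (\<Sum>j\<in>?J. c (fst j) * d (snd j) * (\<Prod>i\<in>I. z i ^ (\<lambda>i\<in>I. fst j i + snd j i) i))" .
  qed
  then show ?thesis by blast
qed

lemma is_poly_prod_power:
  assumes I: "finite I" and A: "finite A" "\<And>a. a \<in> A \<Longrightarrow> \<exists>c. is_poly I (d a) (F a) c"
  shows "\<exists>c. is_poly I (\<Sum>a\<in>A. d a * m a) (\<lambda>z. \<Prod>a\<in>A. F a z ^ m a) c"
proof -
  have p: "\<exists>c. is_poly I (d a * n) (\<lambda>z. F a z ^ n) c" if "a \<in> A" for a n
  proof (induct n)
    case 0
    then show ?case using is_poly_const[OF I, of 0 1] by simp
  next
    case (Suc n)
    then show ?case using is_poly_mult[OF I A(2)[OF that] Suc] by simp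
  qed
  show ?thesis using A(1) p
  proof (induct A rule: finite_induct)
    case empty
    then show ?case using is_poly_const[OF I, of 0 1] by simp
  next
    case (insert a A)
    then show ?case using is_poly_mult[OF I, of "d a * m a" "\<lambda>z. F a z ^ m a" "\<Sum>a\<in>A. d a * m a" "\<lambda>z. \<Prod>a\<in>A. F a z ^ m a"]
      by simp
  qed
qed

lemma is_poly_mono:
  assumes I: "finite I" and c: "\<exists>c. is_poly I K F c" and "K \<le> L"
  shows "\<exists>c. is_poly I L F c"
proof -
  obtain c where c: "is_poly I K F c" using c by blast
  have "is_poly I L F (\<lambda>n. \<Sum>j\<in>{j\<in>I \<rightarrow>\<^sub>E {..K}. j = n}. c j)"
    by (rule is_poly_family[OF I]) (use c I assms(3) in \<open>auto simp: is_poly_def intro: finite_PiE order_trans\<close>)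
  then show ?thesis by blast
qed

declare fps_mult_nth_0 [simp del]

section \<open>Extracting the trivalent graphs\<close>

lemma t_pow: "var_t ^ n = fps_const (fps_X ^ n)"
  by (simp add: var_t_def fps_const_power)

lemma cf_t_pow [simp]: "cf (var_t ^ n) v m = (if v = 0 \<and> m = n then 1 else 0)"
  by (simp add: t_pow)

lemma small_t_pow: "small (var_t ^ n) n"
  by (simp add: small_def cf_t_pow)

lemma small_scalar_t_pow: "d \<le> n \<Longrightarrow> small (scalar c * var_t ^ n) d"
  by (intro small_mult_right small_mono[OF small_t_pow])

lemma Eul_t_pow: "Eul p q (var_t ^ n) = of_nat (q * n) * var_t ^ n"
  by (rule ser_eqI) (simp add: cf_t_pow of_nat_ser)

lemma Eul10_t [simp]: "Eul 1 0 (scalar c * var_t ^ n) = 0"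
  by (simp add: Eul_scalar Eul_t_pow)

lemma gauss_var_t: "k \<ge> 1 \<Longrightarrow> gauss_var (var_t ^ k) k"
  by standard (auto simp: small_mono[OF small_t_pow] cf_t_pow Eul_t_pow)

lemma cf_prod_scalar:
  assumes "finite I" "\<And>k. k \<in> I \<Longrightarrow> d k \<ge> 1" "N \<le> K"
  shows "cf (\<Prod>k\<in>I. tsum (\<lambda>n. scalar (c k n) * var_t ^ (d k * n))) 0 N =
    (\<Sum>m\<in>I \<rightarrow>\<^sub>E {..K}. if (\<Sum>k\<in>I. d k * m k) = N then \<Prod>k\<in>I. c k (m k) else 0)"
proof -
  have "cf (1 * (\<Prod>k\<in>I. tsum (\<lambda>n. scalar (c k n) * var_t ^ (d k * n)))) 0 N =
    (\<Sum>m\<in>I \<rightarrow>\<^sub>E {..K}. cf (1 * (\<Prod>k\<in>I. scalar (c k (m k)) * var_t ^ (d k * m k))) 0 N)"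
    by (rule cf_prod_tsum[OF assms(1)]) (use assms in \<open>auto simp: One_nat_def intro!: small_scalar_t_pow\<close>)
  also have "\<dots> = (\<Sum>m\<in>I \<rightarrow>\<^sub>E {..K}. if (\<Sum>k\<in>I. d k * m k) = N then \<Prod>k\<in>I. c k (m k) else 0)"
    by (rule sum.cong) (auto simp: prod.distrib scalar_prod[symmetric] power_sum[symmetric])
  finally show ?thesis by simp
qed

lemma cf_tsum_scalar: "cf (tsum (\<lambda>n. scalar (c n) * var_t ^ n)) v n = (if v = 0 then c n else 0)"
proof -
  have "cf (tsum (\<lambda>n. scalar (c n) * var_t ^ n)) v n = (\<Sum>i\<le>v+n. if i = n then (if v = 0 then c n else 0) else 0)"
    unfolding cf_tsum by (rule sum.cong) auto
  then show ?thesis by simp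
qed

text \<open>The hypothesis says that \<open>s\<close> does not occur in \<open>F\<close>.\<close>

lemma t_only_expand:
  assumes "Eul 1 0 F = 0" shows "F = tsum (\<lambda>n. scalar (cf F 0 n) * var_t ^ n)"
proof (rule ser_eqI)
  fix v n
  have "of_nat v * cf F v n = 0" using arg_cong[OF assms, of "\<lambda>F. cf F v n"] by simp
  then have "v > 0 \<Longrightarrow> cf F v n = 0" by simp
  then show "cf F v n = cf (tsum (\<lambda>n. scalar (cf F 0 n) * var_t ^ n)) v n"
    by (cases "v = 0") (auto simp: cf_tsum_scalar)
qed

text \<open>The substitution of \<open>z u\<close> for \<open>u\<close>, which brings the orbit
  variable into the vertex weight.\<close>

definition sub :: "rat \<Rightarrow> ser \<Rightarrow> ser" where
  "sub z F = Abs_fps (\<lambda>v. Abs_fps (\<lambda>n. z ^ n * cf F v n))"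

lemma cf_sub: "cf (sub z F) v n = z ^ n * cf F v n"
  by (simp add: sub_def)

lemma sub_mult: "sub z (F * G) = sub z F * sub z G"
proof (rule ser_eqI)
  fix v n
  have "z ^ n * (cf F i j * cf G (v - i) (n - j)) = z ^ j * cf F i j * (z ^ (n - j) * cf G (v - i) (n - j))"
    if "j \<le> n" for i j
    using power_add[of z j "n - j"] that by (simp add: mult_ac)
  then show "cf (sub z (F * G)) v n = cf (sub z F * sub z G) v n"
    unfolding cf_sub cf_mult sum_distrib_left by (intro sum.cong refl) auto
qed

lemma sub_scalar_mult: "sub z (scalar c * F) = scalar c * sub z F"
  and sub_1: "sub z 1 = 1"
  by (rule ser_eqI; auto simp: cf_sub)+

lemma sub_power: "sub z (F ^ n) = sub z F ^ n"
  by (induct n) (simp_all add: sub_1 sub_mult)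

lemma sub_sum: "sub z (sum f A) = (\<Sum>x\<in>A. sub z (f x))"
  by (rule ser_eqI) (simp add: cf_sub cf_sum sum_distrib_left)

lemma sub_t_pow: "sub z (scalar c * var_t ^ n) = scalar (c * z ^ n) * var_t ^ n"
  by (rule ser_eqI) (auto simp: cf_sub)

lemma sub_EXP: "sub z (EXP Z) = EXP (sub z Z)"
proof -
  have "sub z (tsum f) = tsum (\<lambda>i. sub z (f i))" for f
    by (rule ser_eqI) (simp add: cf_sub cf_tsum sum_distrib_left)
  then show ?thesis by (simp add: EXP_def sub_scalar_mult sub_power)
qed

section \<open>Vertex weights truncated by valence\<close>

text \<open>For the variables \<open>\<xi>\<close> dual to the power sums, \<open>Qs\<close> is the weight of an \<open>a\<close>-cycle of vertices of arbitrary
  valence, marked by \<open>t\<close>; \<open>Rs\<close> collects the valences \<open>0, 1, 2\<close>, and \<open>Ws = Qs - Rs\<close> the valences at least \<open>3\<close>.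
  The truncation at \<open>M\<close> leaves finitely many variables.\<close>

definition Qs :: "nat \<Rightarrow> (nat \<Rightarrow> rat) \<Rightarrow> nat \<Rightarrow> ser" where
  "Qs M \<xi> a = EXP (\<Sum>k\<in>{k\<in>{1..M}. a dvd k}. scalar (of_nat a * \<xi> k / of_nat k) * var_t ^ k)"

definition Rs :: "nat \<Rightarrow> (nat \<Rightarrow> rat) \<Rightarrow> nat \<Rightarrow> ser" where
  "Rs M \<xi> a = 1 + scalar (\<xi> a) * var_t ^ a + scalar (\<xi> a ^ 2 / 2) * var_t ^ (2 * a)
     + (if 2 * a \<le> M then scalar (\<xi> (2 * a) / 2) * var_t ^ (2 * a) else 0)"

definition Ws :: "nat \<Rightarrow> (nat \<Rightarrow> rat) \<Rightarrow> nat \<Rightarrow> ser" where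
  "Ws M \<xi> a = tsum (\<lambda>n. scalar (if 3 * a \<le> n then cf (Qs M \<xi> a) 0 n else 0) * var_t ^ n)"

lemma small_Qs_exponent: "small (\<Sum>k\<in>{k\<in>{1..M}. a dvd k}. scalar (c k) * var_t ^ k) 1"
  by (rule small_sum) (auto intro: small_scalar_t_pow)

lemma Eul10_Qs: "Eul 1 0 (Qs M \<xi> a) = 0"
  unfolding Qs_def by (subst Eul_EXP[OF small_Qs_exponent]) (simp add: Eul_sum)

lemma Eul10_Ws: "Eul 1 0 (Ws M \<xi> a) = 0"
  by (simp add: Ws_def Eul_tsum)

lemma Ws_eq_0: assumes "a > M" shows "Ws M \<xi> a = 0"
proof -
  have E: "{k\<in>{1..M}. a dvd k} = {}" using assms by (auto dest: dvd_imp_le)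
  have "Qs M \<xi> a = 1" unfolding Qs_def E by simp
  then have "(if 3 * a \<le> n then cf (Qs M \<xi> a) 0 n else 0) = 0" for n using assms by auto
  then show ?thesis unfolding Ws_def by simp
qed

text \<open>Below degree \<open>3 a\<close> only the terms \<open>k = a\<close> and
  \<open>k = 2 a\<close> of the exponent matter, and the exponential only up to second order. This
  leaves \<open>1 + A + A^2 / 2 + B\<close>, which is \<open>Rs\<close>.\<close>

lemma Ws_eq: assumes a: "a \<in> {1..M}" shows "Ws M \<xi> a = Qs M \<xi> a - Rs M \<xi> a"
proof -
  define Z where "Z = (\<Sum>k\<in>{k\<in>{1..M}. a dvd k}. scalar (of_nat a * \<xi> k / of_nat k) * var_t ^ k)"
  define A where "A = scalar (\<xi> a) * var_t ^ a"
  define B where "B = (if 2 * a \<le> M then scalar (\<xi> (2 * a) / 2) * var_t ^ (2 * a) else 0)"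
  have Q: "Qs M \<xi> a = EXP Z" by (simp add: Qs_def Z_def)
  have a1: "a \<ge> 1" using a by simp
  \<comment> \<open>A positive multiple of \<open>a\<close> is \<open>a\<close>, \<open>2 a\<close>
    or at least \<open>3 a\<close>.\<close>
  have ZAB: "small (Z - A - B) (3 * a)"
  proof -
    let ?S = "{k\<in>{1..M}. a dvd k}" and ?f = "\<lambda>k. scalar (of_nat a * \<xi> k / of_nat k) * var_t ^ k"
    have "?S = {a} \<union> ({k\<in>?S. k = 2 * a} \<union> {k\<in>?S. 3 * a \<le> k})"
    proof -
      have "k = a \<or> k = 2 * a \<or> 3 * a \<le> k" if "k \<in> ?S" for k
      proof -
        obtain m where m: "k = a * m" using \<open>k \<in> ?S\<close> by (auto simp: dvd_def)
        then have "m \<noteq> 0" using \<open>k \<in> ?S\<close> by (cases m) auto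
        then consider "m = 1" | "m = 2" | "m \<ge> 3" by linarith
        then show ?thesis
        proof cases
          case 3
          then have "3 * a \<le> m * a" by (rule mult_right_mono) simp
          then show ?thesis by (simp add: m mult.commute)
        qed (simp_all add: m)
      qed
      then show ?thesis using a by auto
    qed
    then have "Z = (\<Sum>k\<in>{a} \<union> ({k\<in>?S. k = 2 * a} \<union> {k\<in>?S. 3 * a \<le> k}). ?f k)" by (simp only: Z_def)
    also have "\<dots> = ?f a + ((\<Sum>k\<in>{k\<in>?S. k = 2 * a}. ?f k) + (\<Sum>k\<in>{k\<in>?S. 3 * a \<le> k}. ?f k))"
      using a1 by (subst sum.union_disjoint; (subst sum.union_disjoint)?) auto
    also have "?f a = A" using a1 by (simp add: A_def)
    also have "(\<Sum>k\<in>{k\<in>?S. k = 2 * a}. ?f k) = B"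
    proof (cases "2 * a \<le> M")
      case True
      then have "{k\<in>?S. k = 2 * a} = {2 * a}" using a1 by auto
      then show ?thesis using True a1 by (simp add: B_def)
    next
      case False
      then have "{k\<in>?S. k = 2 * a} = {}" by auto
      then show ?thesis using False by (simp add: B_def)
    qed
    finally have "Z - A - B = (\<Sum>k\<in>{k\<in>?S. 3 * a \<le> k}. ?f k)" by simp
    then show ?thesis by (auto intro!: small_sum small_scalar_t_pow)
  qed
  have sA: "small A a" and sB: "small B (2 * a)" by (auto simp: A_def B_def intro: small_scalar_t_pow)
  have ZA: "small (Z - A) (2 * a)"
    using small_add[OF small_mono[OF ZAB, of "2 * a"] sB] by simp
  have sZ: "small Z a"
    using small_add[OF small_mono[OF ZA, of a] sA] by simp
  have sZ1: "small Z 1" using small_mono[OF sZ a1] .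
  have sm: "small (scalar c * Z ^ (i + 3)) (3 * a)" for c i
    by (rule small_mult_right, rule small_mono[OF small_power[OF sZ]]) simp
  define Y where "Y = tsum (\<lambda>i. scalar (1 / fact (i + 3)) * Z ^ (i + 3))"
  have tm: "small (scalar c * Z ^ (i + j)) i" for c i j
    by (rule small_mult_right, rule small_mono[OF small_power1[OF sZ1]]) simp
  have "EXP Z = 1 + (Z + (scalar (1/2) * Z ^ 2 + Y))"
  proof -
    have "EXP Z = 1 + tsum (\<lambda>i. scalar (1 / fact (i + 1)) * Z ^ (i + 1))"
      unfolding EXP_def by (subst tsum_Suc[OF small_EXP_term[OF sZ1]]) (simp add: One_nat_def)
    also have "tsum (\<lambda>i. scalar (1 / fact (i + 1)) * Z ^ (i + 1)) = Z + tsum (\<lambda>i. scalar (1 / fact (i + 2)) * Z ^ (i + 2))"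
      by (subst tsum_Suc[OF tm]) (simp add: One_nat_def numeral_2_eq_2)
    also have "tsum (\<lambda>i. scalar (1 / fact (i + 2)) * Z ^ (i + 2)) = scalar (1/2) * Z ^ 2 + Y"
      unfolding Y_def by (subst tsum_Suc[OF tm]) (simp add: numeral_3_eq_3 numeral_2_eq_2)
    finally show ?thesis .
  qed
  then have "Qs M \<xi> a - Rs M \<xi> a = (Z - A - B) + (scalar (1/2) * ((Z - A) * (Z + A)) + Y)"
  proof -
    have "scalar (\<xi> a ^ 2 / 2) * var_t ^ (2 * a) = scalar (1/2) * A ^ 2"
      by (simp add: A_def power_mult_distrib scalar_power[symmetric] mult.assoc[symmetric] scalar_mult[symmetric] mult.commute[of 2] power_mult)
    then have "Rs M \<xi> a = 1 + A + scalar (1/2) * A ^ 2 + B" by (simp add: Rs_def A_def B_def)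
    then show ?thesis unfolding Q \<open>EXP Z = 1 + (Z + (scalar (1/2) * Z ^ 2 + Y))\<close>
      by (simp add: algebra_simps power2_eq_square)
  qed
  moreover have "small ((Z - A) * (Z + A)) (3 * a)"
    using small_mult[OF ZA small_add[OF sZ sA]] by (simp add: algebra_simps)
  moreover have "small Y (3 * a)" unfolding Y_def by (rule small_tsum) (rule sm)
  ultimately have D: "small (Qs M \<xi> a - Rs M \<xi> a) (3 * a)"
    using ZAB by (auto intro!: small_add small_mult_right)
  show ?thesis
  proof (rule ser_eqI)
    fix v n
    have w: "cf (Ws M \<xi> a) v n = (if v = 0 \<and> 3 * a \<le> n then cf (Qs M \<xi> a) 0 n else 0)"
      unfolding Ws_def cf_tsum_scalar by simp
    have r: "cf (Rs M \<xi> a) v n = 0" if "v > 0 \<or> 3 * a \<le> n"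
      using that a1 by (auto simp: Rs_def)
    show "cf (Ws M \<xi> a) v n = cf (Qs M \<xi> a - Rs M \<xi> a) v n"
    proof (cases "v = 0")
      case True
      then show ?thesis using w r D by (cases "3 * a \<le> n") (auto dest!: smallD[of _ _ 0 n])
    next
      case False
      have "of_nat v * cf (Qs M \<xi> a) v n = 0" using arg_cong[OF Eul10_Qs, of "\<lambda>F. cf F v n"] by simp
      then show ?thesis using w r False by simp
    qed
  qed
qed

section \<open>Edge weights as Hermite coefficients\<close>

text \<open>The edges contribute \<open>exp (\<Sum>k. bh k * p k * u^k + ah k * (p k)^2 / 2 * u^(2 k))\<close> with \<open>u^2 = t\<close> and
  \<open>p k\<close> the \<open>k\<close>-th power sum; \<open>eh k n\<close> is the coefficient of \<open>(p k)^n\<close> in its \<open>k\<close>-th factor.\<close>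

definition ah :: "rat \<Rightarrow> nat \<Rightarrow> rat" where "ah \<kappa> k = (- \<kappa>) ^ (k - 1) / of_nat k"
definition bh :: "rat \<Rightarrow> nat \<Rightarrow> rat" where
  "bh \<kappa> k = (if even k then \<kappa> * (- \<kappa>) ^ (k div 2 - 1) / of_nat k else 0)"
definition eh :: "rat \<Rightarrow> nat \<Rightarrow> nat \<Rightarrow> rat" where
  "eh \<kappa> k n = cf (herm (scalar (ah \<kappa> k)) (scalar (bh \<kappa> k)) n) 0 0"

lemma eh: "herm (scalar (ah \<kappa> k)) (scalar (bh \<kappa> k)) n = scalar (eh \<kappa> k n)"
proof -
  obtain c where "herm (scalar (ah \<kappa> k)) (scalar (bh \<kappa> k)) n = scalar c" using herm_scalar by blast
  then show ?thesis by (simp add: eh_def cf_scalar)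
qed

lemma scalar_cyc_sum: "cyc_sum (scalar \<kappa>) (\<lambda>k. scalar (w k)) n r = scalar (cyc_sum \<kappa> w n r)"
  by (induct n arbitrary: r) (simp_all add: scalar_add scalar_mult of_nat_ser del: of_nat_Suc)

lemma scalar_perm_egf: "perm_egf (scalar \<kappa>) (\<lambda>k. scalar (w k)) n = scalar (perm_sum \<kappa> w n / fact n)"
proof -
  have "perm_sum (scalar \<kappa>) (\<lambda>k. scalar (w k)) n = scalar (perm_sum \<kappa> w n)"
    by (cases n) (simp_all add: perm_sum_def scalar_cyc_sum)
  then show ?thesis by (simp add: perm_egf_def scalar_mult[symmetric])
qed

text \<open>The exponential formula at \<open>x = u^2 / 2\<close>, whose powers cancel the
  \<open>2 ^ (k - 1)\<close> up to one half. The term \<open>p (2 * k)\<close> of a cycle of length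
  \<open>k\<close> has degree \<open>2 k\<close> in \<open>u\<close> and is booked under the index
  \<open>2 k\<close>; hence \<open>bh\<close> lives on even indices. The bound on \<open>M\<close>
  leaves all terms up to degree \<open>2 e\<close> intact.\<close>

lemma perm_sum_coeff:
  assumes "2 * e \<le> M"
  shows "perm_sum (- \<kappa>) (\<lambda>k. 2 ^ (k - 1) * ((p k)\<^sup>2 + \<kappa> * p (2 * k))) e = 2 ^ e * fact e *
    cf (EXP (\<Sum>k\<in>{1..M}. scalar (bh \<kappa> k * p k) * var_t ^ k + scalar (ah \<kappa> k * (p k)\<^sup>2 / 2) * var_t ^ (2 * k))) 0 (2 * e)"
proof -
  define w where "w k = 2 ^ (k - 1) * ((p k)\<^sup>2 + \<kappa> * p (2 * k))" for k
  define x where "x = scalar (1/2) * var_t ^ 2"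
  interpret gauss_var x 2
    by standard (auto simp: x_def Eul_scalar Eul_t_pow intro!: small_scalar_t_pow ser_eqI simp: of_nat_ser)
  have xn: "x ^ n = scalar ((1/2) ^ n) * var_t ^ (2 * n)" for n
    by (simp add: x_def power_mult_distrib scalar_power power_mult)
  have "perm_sum (- \<kappa>) w e / fact e * (1/2) ^ e = cf (PS x (perm_egf (scalar (- \<kappa>)) (\<lambda>k. scalar (w k)))) 0 (2 * e)"
  proof -
    have "PS x (perm_egf (scalar (- \<kappa>)) (\<lambda>k. scalar (w k))) =
       tsum (\<lambda>n. scalar (perm_sum (- \<kappa>) w n / fact n * (1/2) ^ n) * var_t ^ (2 * n))"
      unfolding PS_def scalar_perm_egf xn by (simp only: scalar_mult mult.assoc)
    moreover have "cf (tsum (\<lambda>n. scalar (perm_sum (- \<kappa>) w n / fact n * (1/2) ^ n) * var_t ^ (2 * n))) 0 (2 * e)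
       = (\<Sum>i\<le>2 * e. if i = e then perm_sum (- \<kappa>) w e / fact e * (1/2) ^ e else 0)"
      unfolding cf_tsum by (rule sum.cong) auto
    ultimately show ?thesis by simp
  qed
  also have "PS x (perm_egf (scalar (- \<kappa>)) (\<lambda>k. scalar (w k))) = EXP (cyc_log x (scalar (- \<kappa>)) (\<lambda>k. scalar (w k)))"
    by (rule PS_perm_egf) simp_all
  also have "cf (EXP (cyc_log x (scalar (- \<kappa>)) (\<lambda>k. scalar (w k)))) 0 (2 * e) =
     cf (EXP (\<Sum>k\<in>{1..M}. scalar (bh \<kappa> k * p k) * var_t ^ k + scalar (ah \<kappa> k * (p k)\<^sup>2 / 2) * var_t ^ (2 * k))) 0 (2 * e)"
    (is "cf (EXP ?Y) _ _ = cf (EXP ?Z) _ _")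
  proof -
    have Y: "?Y = tsum (\<lambda>k. scalar (if k = 0 then 0 else (- \<kappa>) ^ (k - 1) / of_nat k * w k * (1/2) ^ k) * var_t ^ (2 * k))"
      (is "_ = tsum ?g")
    proof -
      have "?Y = tsum (\<lambda>k. x * (scalar (1 / of_nat (Suc k)) * scalar (- \<kappa>) ^ k * scalar (w (Suc k)) * x ^ k))"
        unfolding cyc_log_def PS_def by (rule tsum_mult') (rule small_PS_term[OF x1])
      also have "\<dots> = tsum (\<lambda>k. ?g (Suc k))"
      proof (intro arg_cong[where f=tsum] ext)
        fix k
        have "x * (scalar (1 / of_nat (Suc k)) * scalar (- \<kappa>) ^ k * scalar (w (Suc k)) * x ^ k)
           = (scalar (1 / of_nat (Suc k)) * scalar (- \<kappa>) ^ k * scalar (w (Suc k))) * x ^ Suc k"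
          by (simp add: mult_ac)
        also have "\<dots> = scalar (1 / of_nat (Suc k) * (- \<kappa>) ^ k * w (Suc k) * (1/2) ^ Suc k) * var_t ^ (2 * Suc k)"
          unfolding xn by (simp only: scalar_mult scalar_power mult.assoc)
        finally show "x * (scalar (1 / of_nat (Suc k)) * scalar (- \<kappa>) ^ k * scalar (w (Suc k)) * x ^ k) = ?g (Suc k)"
          by simp
      qed
      also have "\<dots> = tsum ?g"
        by (subst (2) tsum_Suc) (auto intro: small_scalar_t_pow)
      finally show ?thesis .
    qed
    have Ycf: "cf ?Y v n = (if v = 0 \<and> even n \<and> n \<noteq> 0 then (- \<kappa>) ^ (n div 2 - 1) / of_nat (n div 2) * w (n div 2) * (1/2) ^ (n div 2) else 0)" for v n
    proof -
      have "cf ?Y v n = (\<Sum>k\<le>v+n. if k = n div 2 \<and> v = 0 \<and> even n \<and> n \<noteq> 0 then (- \<kappa>) ^ (k - 1) / of_nat k * w k * (1/2) ^ k else 0)"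
        unfolding Y cf_tsum by (rule sum.cong) auto
      then show ?thesis by (cases "v = 0 \<and> even n \<and> n \<noteq> 0") auto
    qed
    have Zcf: "cf ?Z v n = (if v = 0 \<and> n \<in> {1..M} then bh \<kappa> n * p n else 0)
       + (if v = 0 \<and> even n \<and> n div 2 \<in> {1..M} then ah \<kappa> (n div 2) * (p (n div 2))\<^sup>2 / 2 else 0)" for v n
    proof -
      have "cf ?Z v n = (\<Sum>k\<in>{1..M}. (if n = k then (if v = 0 then bh \<kappa> n * p n else 0) else 0))
        + (\<Sum>k\<in>{1..M}. (if n div 2 = k then (if v = 0 \<and> even n then ah \<kappa> (n div 2) * (p (n div 2))\<^sup>2 / 2 else 0) else 0))"
        unfolding cf_sum fps_add_nth sum.distrib by (intro arg_cong2[where f="(+)"] sum.cong) auto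
      then show ?thesis by (simp only: sum.delta' finite_atLeastAtMost) auto
    qed
    have sY: "small ?Y 1" by (rule small_cyc_log[OF x1])
    have sZ: "small ?Z 1" by (intro small_sum small_add small_scalar_t_pow) auto
    have "small (?Y - ?Z) (Suc (2 * e))"
    proof (rule smallI)
      fix v n assume vn: "v + n < Suc (2 * e)"
      show "cf (?Y - ?Z) v n = 0"
      proof (cases "v = 0 \<and> even n \<and> n \<noteq> 0")
        case True
        then obtain m where m: "n = 2 * m" "m \<ge> 1" by (auto elim!: evenE)
        obtain l where l: "m = Suc l" using m by (cases m) auto
        have h: "(1/2 :: rat) ^ m * 2 ^ (m - 1) = 1/2" by (simp add: l power_one_over)
        have "(- \<kappa>) ^ (m - 1) / of_nat m * w m * (1/2) ^ m = (- \<kappa>) ^ (m - 1) / of_nat m * ((p m)\<^sup>2 + \<kappa> * p (2 * m)) * ((1/2) ^ m * 2 ^ (m - 1))"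
          unfolding w_def by (simp only: mult_ac)
        then have "(- \<kappa>) ^ (m - 1) / of_nat m * w m * (1/2) ^ m = (- \<kappa>) ^ (m - 1) / of_nat m * ((p m)\<^sup>2 + \<kappa> * p (2 * m)) / 2"
          by (simp only: h times_divide_eq_right mult_1_right)
        then show ?thesis using True m assms vn
          by (simp only: fps_sub_nth Ycf Zcf) (auto simp: ah_def bh_def field_simps)
      next
        case False
        then show ?thesis by (simp only: fps_sub_nth Ycf Zcf) (auto simp: bh_def)
      qed
    qed
    from cf_EXP_cong[OF sY sZ this, of 0 "2 * e" 1] show ?thesis by simp
  qed
  finally show ?thesis unfolding w_def by (simp add: field_simps power_one_over)
qed

text \<open>Each factor is expanded by \<open>EXP_herm\<close>; rescaling splits off the power of
  \<open>p k\<close> and leaves the number \<open>eh\<close>.\<close>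

lemma EXP_quadratic_expand:
  "EXP (\<Sum>k\<in>{1..M}. scalar (bh \<kappa> k * p k) * var_t ^ k + scalar (ah \<kappa> k * (p k)\<^sup>2 / 2) * var_t ^ (2 * k)) =
   (\<Prod>k\<in>{1..M}. tsum (\<lambda>n. scalar (eh \<kappa> k n * p k ^ n) * var_t ^ (k * n)))"
proof -
  have "EXP (scalar (bh \<kappa> k * p k) * var_t ^ k + scalar (ah \<kappa> k * (p k)\<^sup>2 / 2) * var_t ^ (2 * k)) =
     tsum (\<lambda>n. scalar (eh \<kappa> k n * p k ^ n) * var_t ^ (k * n))" if k: "k \<in> {1..M}" for k
  proof -
    interpret gauss_var "var_t ^ k" k using k by (intro gauss_var_t) simp
    let ?a = "scalar (ah \<kappa> k) * scalar (p k) ^ 2" and ?b = "scalar (bh \<kappa> k) * scalar (p k)"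
    have "scalar (bh \<kappa> k * p k) * var_t ^ k + scalar (ah \<kappa> k * (p k)\<^sup>2 / 2) * var_t ^ (2 * k)
        = ?b * var_t ^ k + scalar (1/2) * ?a * (var_t ^ k)\<^sup>2"
      by (simp add: scalar_mult[symmetric] scalar_power[symmetric] power_mult[symmetric] mult.commute[of k])
    also have "EXP \<dots> = PS (var_t ^ k) (herm ?a ?b)"
      by (rule EXP_herm) (simp_all add: scalar_mult[symmetric] scalar_power[symmetric])
    also have "\<dots> = tsum (\<lambda>n. scalar (eh \<kappa> k n * p k ^ n) * var_t ^ (k * n))"
      unfolding PS_def herm_rescale eh by (simp only: scalar_mult scalar_power power_mult)
    finally show ?thesis .
  qed
  then show ?thesis
    by (subst EXP_sum) (auto intro!: small_add small_scalar_t_pow prod.cong)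
qed

section \<open>Comparison of coefficients in the orbit variables\<close>

context vertex_perm
begin

lemma sum_valence_le: "finite C \<Longrightarrow> (\<Sum>x\<in>C. valence e g x) \<le> 2 * e"
proof -
  assume C: "finite C"
  have one: "(\<Sum>x\<in>C. if h = x then 1 else 0) \<le> (1::nat)" for h
    using C by (simp add: sum.delta')
  have "(\<Sum>x\<in>C. valence e g x) = (\<Sum>a\<in>{1..e}. (\<Sum>x\<in>C. if fst (g a) = x then 1 else 0) + (\<Sum>x\<in>C. if snd (g a) = x then 1 else 0))"
    unfolding valence_eq_sum by (subst sum.swap) (simp only: sum.distrib)
  also have "\<dots> \<le> (\<Sum>a\<in>{1..e}. 1 + 1)" by (intro sum_mono add_mono one)
  finally show ?thesis by simp
qed

lemma is_poly_pow_sum: "\<exists>c. is_poly orbs k (\<lambda>z. pow_sum z k) c"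
  unfolding pow_sum_def
proof (rule is_poly_sum)
  fix C assume C: "C \<in> orbs"
  show "\<exists>c. is_poly orbs k (\<lambda>z. if card C dvd k then of_nat (card C) * z C ^ k else 0) c"
    using is_poly_monom[of orbs C k k "of_nat (card C)"] is_poly_const[of orbs k 0] C by (cases "card C dvd k") auto
qed simp

definition good_box where "good_box K = {n \<in> orbs \<rightarrow>\<^sub>E {..K}. \<forall>C\<in>orbs. 3 * card C \<le> n C}"

text \<open>\<open>N' m\<close> applies one linear functional, the sum of the coefficients over
  admissible exponents, to the product of the \<open>p_k^(m k)\<close>. Applied to the edge series
  it counts the at least trivalent fixed graphs; applied to the exponential kernel it truncates each
  orbit factor. Both conclusions share the same \<open>N'\<close>, which does not depend on \<xi>;
  this is what links edges to vertices.\<close>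

theorem good_count:
  assumes M: "2 * e \<le> M" and K: "2 * e \<le> K"
  shows "\<exists>N'. (\<Sum>R\<in>Pow {1..e}. \<Sum>p | p permutes {1..e}. \<kappa> ^ card R * sg (- \<kappa>) p *
        of_nat (card {g\<in>gra v e 3. act (R, p, q) g = g}))
      = 2 ^ e * fact e * (\<Sum>m\<in>{1..M} \<rightarrow>\<^sub>E {..K}. if (\<Sum>k\<in>{1..M}. k * m k) = 2 * e then (\<Prod>k\<in>{1..M}. eh \<kappa> k (m k)) * N' m else 0)
    \<and> (\<forall>\<xi>. (\<Sum>m\<in>{1..M} \<rightarrow>\<^sub>E {..K}. if (\<Sum>k\<in>{1..M}. k * m k) = 2 * e
           then (\<Prod>k\<in>{1..M}. (\<xi> k / of_nat k) ^ m k / fact (m k)) * N' m else 0)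
        = cf (\<Prod>C\<in>orbs. Ws M \<xi> (card C)) 0 (2 * e))"
proof -
  let ?I = "{1..M}" and ?B = "{1..M} \<rightarrow>\<^sub>E {..K}" and ?O = "orbs \<rightarrow>\<^sub>E {..K}"
  let ?w = "\<lambda>m. (\<Sum>k\<in>{1..M}. k * m k) = 2 * e"
  have finO: "finite orbs" "finite ?O" "finite ?B" by (auto intro!: finite_PiE)
  \<comment> \<open>Monomial coefficients of a product of power sums. It has total degree
    \<open>2 e\<close> when the weight condition holds, so the box with bound \<open>K\<close>
    contains all its exponents.\<close>
  define c where "c m = (SOME c. is_poly orbs K (\<lambda>z. \<Prod>k\<in>?I. pow_sum z k ^ m k) c)" for m
  have c: "is_poly orbs K (\<lambda>z. \<Prod>k\<in>?I. pow_sum z k ^ m k) (c m)" if "?w m" for m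
  proof -
    have "\<exists>c. is_poly orbs (\<Sum>k\<in>?I. k * m k) (\<lambda>z. \<Prod>k\<in>?I. pow_sum z k ^ m k) c"
      by (rule is_poly_prod_power[OF finO(1)]) (simp_all add: is_poly_pow_sum)
    from is_poly_mono[OF finO(1) this, of K] have "\<exists>c. is_poly orbs K (\<lambda>z. \<Prod>k\<in>?I. pow_sum z k ^ m k) c"
      using that K by simp
    then show ?thesis unfolding c_def by (rule someI_ex)
  qed
  have lin: "is_poly orbs K (\<lambda>z. \<Sum>m\<in>?B. if ?w m then h m * (\<Prod>k\<in>?I. pow_sum z k ^ m k) else 0)
      (\<lambda>n. \<Sum>m\<in>?B. if ?w m then h m * c m n else 0)" for h
    unfolding is_poly_def
  proof
    fix z
    have "(\<Sum>m\<in>?B. if ?w m then h m * (\<Prod>k\<in>?I. pow_sum z k ^ m k) else 0)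
       = (\<Sum>m\<in>?B. \<Sum>n\<in>?O. (if ?w m then h m * c m n else 0) * (\<Prod>C\<in>orbs. z C ^ n C))"
    proof (rule sum.cong[OF refl])
      fix m
      show "(if ?w m then h m * (\<Prod>k\<in>?I. pow_sum z k ^ m k) else 0) = (\<Sum>n\<in>?O. (if ?w m then h m * c m n else 0) * (\<Prod>C\<in>orbs. z C ^ n C))"
        using c[of m] by (cases "?w m") (simp_all add: is_poly_def sum_distrib_left mult.assoc)
    qed
    also have "\<dots> = (\<Sum>n\<in>?O. (\<Sum>m\<in>?B. if ?w m then h m * c m n else 0) * (\<Prod>C\<in>orbs. z C ^ n C))"
      by (subst sum.swap) (simp only: sum_distrib_right)
    finally show "(\<Sum>m\<in>?B. if ?w m then h m * (\<Prod>k\<in>?I. pow_sum z k ^ m k) else 0) =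
        (\<Sum>n\<in>?O. (\<Sum>m\<in>?B. if ?w m then h m * c m n else 0) * (\<Prod>C\<in>orbs. z C ^ n C))" .
  qed
  have finC: "finite C" if "C \<in> orbs" for C
  proof -
    obtain x where "x \<in> {1..v}" "C = orbit q x" using \<open>C \<in> orbs\<close> by blast
    then have "C \<subseteq> {1..v}" using orbit_subset_of_permutes[OF finite_atLeastAtMost q] by blast
    then show ?thesis by (rule finite_subset) simp
  qed
  \<comment> \<open>The admissible exponents give at least three half-edges per vertex of every
    orbit.\<close>
  define N' where "N' m = (\<Sum>n\<in>good_box K. c m n)" for m
  have gb: "good_box K \<subseteq> ?O" "finite (good_box K)" using finO(2) by (auto simp: good_box_def intro: finite_subset)
  have swap: "(\<Sum>n\<in>good_box K. \<Sum>m\<in>?B. if ?w m then h m * c m n else 0) = (\<Sum>m\<in>?B. if ?w m then h m * N' m else 0)" for h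
    by (subst sum.swap, rule sum.cong[OF refl]) (simp add: N'_def sum_distrib_left)
  define J where "J = (Pow {1..e} \<times> {p. p permutes {1..e}}) \<times> graphs"
  define J' where "J' = {j\<in>J. act (fst (fst j), snd (fst j), q) (snd j) = snd j}"
  define ex where "ex j = (\<lambda>C\<in>orbs. \<Sum>x\<in>C. valence e (snd j) x)" for j :: "(nat set \<times> (nat \<Rightarrow> nat)) \<times> (nat \<Rightarrow> nat \<times> nat)"
  define d where "d j = \<kappa> ^ card (fst (fst j)) * sg (- \<kappa>) (snd (fst j))" for j :: "(nat set \<times> (nat \<Rightarrow> nat)) \<times> (nat \<Rightarrow> nat \<times> nat)"
  have finG: "finite graphs" unfolding graphs_def by (intro finite_PiE) auto
  have finP: "finite {p. p permutes {1..e}}" by (rule finite_permutations) simp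
  have finJ: "finite J'" unfolding J'_def J_def using finG finP by auto
  have sumJ: "(\<Sum>j\<in>{j\<in>J'. P (snd j)}. d j * h (snd j)) = (\<Sum>R\<in>Pow {1..e}. \<Sum>p | p permutes {1..e}. \<kappa> ^ card R * sg (- \<kappa>) p *
      (\<Sum>g\<in>{g\<in>graphs. act (R, p, q) g = g \<and> P g}. h g))" for P h
  proof -
    have "(\<Sum>j\<in>{j\<in>J'. P (snd j)}. d j * h (snd j)) =
       (\<Sum>j\<in>J. if act (fst (fst j), snd (fst j), q) (snd j) = snd j \<and> P (snd j) then d j * h (snd j) else 0)"
    proof -
      have "{j\<in>J'. P (snd j)} = {j\<in>J. act (fst (fst j), snd (fst j), q) (snd j) = snd j \<and> P (snd j)}" by (auto simp: J'_def)
      moreover have "finite J" unfolding J_def using finG finP by auto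
      ultimately show ?thesis by (simp only: sum.inter_filter)
    qed
    also have "\<dots> = (\<Sum>Rp\<in>Pow {1..e} \<times> {p. p permutes {1..e}}. \<Sum>g\<in>graphs.
        if act (fst Rp, snd Rp, q) g = g \<and> P g then d (Rp, g) * h g else 0)"
      unfolding J_def by (subst sum.cartesian_product) (simp add: case_prod_unfold cong: if_cong)
    also have "\<dots> = (\<Sum>R\<in>Pow {1..e}. \<Sum>p | p permutes {1..e}. \<Sum>g\<in>graphs.
        if act (R, p, q) g = g \<and> P g then \<kappa> ^ card R * sg (- \<kappa>) p * h g else 0)"
      by (subst sum.cartesian_product) (simp add: case_prod_unfold d_def cong: if_cong)
    also have "\<dots> = (\<Sum>R\<in>Pow {1..e}. \<Sum>p | p permutes {1..e}. \<kappa> ^ card R * sg (- \<kappa>) p *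
      (\<Sum>g\<in>{g\<in>graphs. act (R, p, q) g = g \<and> P g}. h g))"
      by (intro sum.cong refl) (simp only: sum.inter_filter[OF finG, symmetric] sum_distrib_left)
    finally show ?thesis .
  qed
  \<comment> \<open>First description of the edge polynomial: its coefficients are signed counts of
    fixed graphs with given numbers of half-edges at the orbits.\<close>
  have P1: "is_poly orbs K (\<lambda>z. perm_sum (- \<kappa>) (\<lambda>k. 2 ^ (k - 1) * ((pow_sum z k)\<^sup>2 + \<kappa> * pow_sum z (2 * k))) e)
      (\<lambda>n. \<Sum>j\<in>{j\<in>J'. ex j = n}. d j)"
  proof (rule is_poly_family[OF finO(1) finJ])
    show "ex j \<in> ?O" if "j \<in> J'" for j
    proof -
      have "(\<Sum>x\<in>C. valence e (snd j) x) \<le> K" if C: "C \<in> orbs" for C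
      proof -
        have "finite C" using finC[OF C] .
        then show ?thesis using sum_valence_le[of C "snd j"] K by linarith
      qed
      then show ?thesis by (auto simp: ex_def)
    qed
    fix z
    have "perm_sum (- \<kappa>) (\<lambda>k. 2 ^ (k - 1) * ((pow_sum z k)\<^sup>2 + \<kappa> * pow_sum z (2 * k))) e
      = (\<Sum>R\<in>Pow {1..e}. \<Sum>p | p permutes {1..e}. \<kappa> ^ card R * sg (- \<kappa>) p *
      (\<Sum>g\<in>{g\<in>graphs. act (R, p, q) g = g \<and> True}. \<Prod>C\<in>orbs. z C ^ (\<Sum>x\<in>C. valence e g x)))"
      unfolding count_trace[symmetric]
    proof (intro sum.cong[OF refl] arg_cong2[where f="(*)"] refl)
      fix R p
      show "(\<Sum>g\<in>{g\<in>graphs. act (R, p, q) g = g}. \<Prod>a\<in>{1..e}. z (orbit q (fst (g a))) * z (orbit q (snd (g a))))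
        = (\<Sum>g\<in>{g\<in>graphs. act (R, p, q) g = g \<and> True}. \<Prod>C\<in>orbs. z C ^ (\<Sum>x\<in>C. valence e g x))"
        by (rule sum.cong) (auto intro: prod_valence)
    qed
    also have "\<dots> = (\<Sum>j\<in>{j\<in>J'. True}. d j * (\<Prod>C\<in>orbs. z C ^ (\<Sum>x\<in>C. valence e (snd j) x)))"
      by (rule sumJ[symmetric])
    also have "\<dots> = (\<Sum>j\<in>J'. d j * (\<Prod>C\<in>orbs. z C ^ ex j C))"
      by (intro sum.cong arg_cong2[where f="(*)"] prod.cong) (auto simp: ex_def)
    finally show "perm_sum (- \<kappa>) (\<lambda>k. 2 ^ (k - 1) * ((pow_sum z k)\<^sup>2 + \<kappa> * pow_sum z (2 * k))) e =
       (\<Sum>j\<in>J'. d j * (\<Prod>C\<in>orbs. z C ^ ex j C))" .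
  qed
  \<comment> \<open>Second description of the same polynomial, through power sums. Uniqueness of
    coefficients equates it with the first.\<close>
  have P2: "is_poly orbs K (\<lambda>z. perm_sum (- \<kappa>) (\<lambda>k. 2 ^ (k - 1) * ((pow_sum z k)\<^sup>2 + \<kappa> * pow_sum z (2 * k))) e)
      (\<lambda>n. \<Sum>m\<in>?B. if ?w m then (2 ^ e * fact e * (\<Prod>k\<in>?I. eh \<kappa> k (m k))) * c m n else 0)"
  proof -
    have "perm_sum (- \<kappa>) (\<lambda>k. 2 ^ (k - 1) * ((pow_sum z k)\<^sup>2 + \<kappa> * pow_sum z (2 * k))) e =
      (\<Sum>m\<in>?B. if ?w m then (2 ^ e * fact e * (\<Prod>k\<in>?I. eh \<kappa> k (m k))) * (\<Prod>k\<in>?I. pow_sum z k ^ m k) else 0)" for z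
      unfolding perm_sum_coeff[OF M] EXP_quadratic_expand
      by (subst cf_prod_scalar[where K=K]) (use K in \<open>auto simp: sum_distrib_left prod.distrib mult_ac intro!: sum.cong\<close>)
    then show ?thesis using lin[of "\<lambda>m. 2 ^ e * fact e * (\<Prod>k\<in>?I. eh \<kappa> k (m k))"] by simp
  qed
  have C1: "(\<Sum>R\<in>Pow {1..e}. \<Sum>p | p permutes {1..e}. \<kappa> ^ card R * sg (- \<kappa>) p *
        of_nat (card {g\<in>gra v e 3. act (R, p, q) g = g}))
      = 2 ^ e * fact e * (\<Sum>m\<in>?B. if ?w m then (\<Prod>k\<in>?I. eh \<kappa> k (m k)) * N' m else 0)"
  proof -
    have "(\<Sum>R\<in>Pow {1..e}. \<Sum>p | p permutes {1..e}. \<kappa> ^ card R * sg (- \<kappa>) p *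
        of_nat (card {g\<in>gra v e 3. act (R, p, q) g = g}))
      = (\<Sum>R\<in>Pow {1..e}. \<Sum>p | p permutes {1..e}. \<kappa> ^ card R * sg (- \<kappa>) p *
        (\<Sum>g\<in>{g\<in>graphs. act (R, p, q) g = g \<and> (\<forall>C\<in>orbs. 3 * card C \<le> (\<Sum>x\<in>C. valence e g x))}. 1))"
    proof (rule sum.cong[OF refl], rule sum.cong[OF refl], rule arg_cong2[where f="(*)", OF refl])
      fix R p assume "R \<in> Pow {1..e}" "p \<in> {p. p permutes {1..e}}"
      moreover have "gra v e 3 \<subseteq> graphs" by (auto simp: gra_def graphs_def)
      ultimately have "{g\<in>gra v e 3. act (R, p, q) g = g} =
         {g\<in>graphs. act (R, p, q) g = g \<and> (\<forall>C\<in>orbs. 3 * card C \<le> (\<Sum>x\<in>C. valence e g x))}"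
        using fixed_trivalent_iff by blast
      then show "of_nat (card {g\<in>gra v e 3. act (R, p, q) g = g}) =
        (\<Sum>g\<in>{g\<in>graphs. act (R, p, q) g = g \<and> (\<forall>C\<in>orbs. 3 * card C \<le> (\<Sum>x\<in>C. valence e g x))}. (1::rat))" by simp
    qed
    also have "\<dots> = (\<Sum>j\<in>{j\<in>J'. \<forall>C\<in>orbs. 3 * card C \<le> (\<Sum>x\<in>C. valence e (snd j) x)}. d j * 1)"
      by (rule sumJ[symmetric])
    also have "{j\<in>J'. \<forall>C\<in>orbs. 3 * card C \<le> (\<Sum>x\<in>C. valence e (snd j) x)} = {j\<in>J'. ex j \<in> good_box K}"
    proof -
      have "ex j \<in> ?O" if "j \<in> J'" for j
      proof -
        have "(\<Sum>x\<in>C. valence e (snd j) x) \<le> K" if C: "C \<in> orbs" for C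
        proof -
          have "finite C" using finC[OF C] .
          then show ?thesis using sum_valence_le[of C "snd j"] K by linarith
        qed
        then show ?thesis by (auto simp: ex_def)
      qed
      note exO = this
      show ?thesis
      proof (rule Collect_cong)
        fix j
        have "(\<forall>C\<in>orbs. 3 * card C \<le> (\<Sum>x\<in>C. valence e (snd j) x)) \<longleftrightarrow> (\<forall>C\<in>orbs. 3 * card C \<le> ex j C)"
          by (rule ball_cong) (simp_all add: ex_def)
        then show "(j \<in> J' \<and> (\<forall>C\<in>orbs. 3 * card C \<le> (\<Sum>x\<in>C. valence e (snd j) x))) = (j \<in> J' \<and> ex j \<in> good_box K)"
          using exO[of j] unfolding good_box_def by blast
      qed
    qed
    also have "(\<Sum>j\<in>{j\<in>J'. ex j \<in> good_box K}. d j * 1) = (\<Sum>n\<in>good_box K. \<Sum>j\<in>{j\<in>{j\<in>J'. ex j \<in> good_box K}. ex j = n}. d j * 1)"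
      by (rule sum.group[symmetric]) (use finJ gb in auto)
    also have "\<dots> = (\<Sum>n\<in>good_box K. \<Sum>j\<in>{j\<in>J'. ex j = n}. d j)"
      by (intro sum.cong) auto
    also have "\<dots> = (\<Sum>n\<in>good_box K. \<Sum>m\<in>?B. if ?w m then (2 ^ e * fact e * (\<Prod>k\<in>?I. eh \<kappa> k (m k))) * c m n else 0)"
      by (rule sum.cong[OF refl], rule is_poly_unique[OF finO(1) P1 P2]) (use gb in auto)
    also have "\<dots> = (\<Sum>m\<in>?B. if ?w m then (2 ^ e * fact e * (\<Prod>k\<in>?I. eh \<kappa> k (m k))) * N' m else 0)"
      by (rule swap)
    finally show ?thesis by (simp add: sum_distrib_left mult.assoc if_distrib cong: if_cong)
  qed
  have C2: "(\<Sum>m\<in>?B. if ?w m then (\<Prod>k\<in>?I. (\<xi> k / of_nat k) ^ m k / fact (m k)) * N' m else 0)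
        = cf (\<Prod>C\<in>orbs. Ws M \<xi> (card C)) 0 (2 * e)" for \<xi>
  proof -
    let ?F = "\<lambda>z. \<Sum>m\<in>?B. if ?w m then (\<Prod>k\<in>?I. (\<xi> k / of_nat k) ^ m k / fact (m k)) * (\<Prod>k\<in>?I. pow_sum z k ^ m k) else 0"
    \<comment> \<open>The kernel splits over the orbits because the power sums are sums over orbits;
      its coefficients are therefore products of single-orbit coefficients.\<close>
    have P3: "is_poly orbs K ?F (\<lambda>n. if (\<Sum>C\<in>orbs. 1 * n C) = 2 * e then \<Prod>C\<in>orbs. cf (Qs M \<xi> (card C)) 0 (n C) else 0)"
      unfolding is_poly_def
    proof
      fix z
      have "?F z = (\<Sum>m\<in>?B. if ?w m then \<Prod>k\<in>?I. 1 / fact (m k) * (\<xi> k * pow_sum z k / of_nat k) ^ m k else 0)"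
        by (intro sum.cong) (auto simp: prod.distrib[symmetric] power_mult_distrib power_divide intro!: prod.cong)
      also have "\<dots> = cf (\<Prod>k\<in>?I. tsum (\<lambda>n. scalar (1 / fact n * (\<xi> k * pow_sum z k / of_nat k) ^ n) * var_t ^ (k * n))) 0 (2 * e)"
        by (rule cf_prod_scalar[symmetric]) (use K in auto)
      also have "(\<Prod>k\<in>?I. tsum (\<lambda>n. scalar (1 / fact n * (\<xi> k * pow_sum z k / of_nat k) ^ n) * var_t ^ (k * n)))
          = (\<Prod>k\<in>?I. EXP (scalar (\<xi> k * pow_sum z k / of_nat k) * var_t ^ k))"
        unfolding EXP_def by (simp only: power_mult_distrib scalar_power[symmetric] mult.assoc[symmetric] scalar_mult[symmetric] power_mult)
      also have "\<dots> = EXP (\<Sum>k\<in>?I. scalar (\<xi> k * pow_sum z k / of_nat k) * var_t ^ k)"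
        by (rule EXP_sum[symmetric]) (auto intro: small_scalar_t_pow)
      also have "(\<Sum>k\<in>?I. scalar (\<xi> k * pow_sum z k / of_nat k) * var_t ^ k)
         = (\<Sum>k\<in>?I. \<Sum>C\<in>orbs. if card C dvd k then scalar (of_nat (card C) * \<xi> k / of_nat k * z C ^ k) * var_t ^ k else 0)"
      proof (rule sum.cong[OF refl])
        fix k
        have "\<xi> k * pow_sum z k / of_nat k = (\<Sum>C\<in>orbs. if card C dvd k then of_nat (card C) * \<xi> k / of_nat k * z C ^ k else 0)"
          unfolding pow_sum_def sum_distrib_left sum_divide_distrib by (rule sum.cong) auto
        then show "scalar (\<xi> k * pow_sum z k / of_nat k) * var_t ^ k =
          (\<Sum>C\<in>orbs. if card C dvd k then scalar (of_nat (card C) * \<xi> k / of_nat k * z C ^ k) * var_t ^ k else 0)"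
          by (simp add: scalar_sum sum_distrib_right if_distrib[of scalar] if_distrib[of "\<lambda>x. x * _"] cong: if_cong)
      qed
      also have "\<dots> = (\<Sum>C\<in>orbs. \<Sum>k\<in>{k\<in>?I. card C dvd k}. scalar (of_nat (card C) * \<xi> k / of_nat k * z C ^ k) * var_t ^ k)"
        by (subst sum.swap) (simp only: sum.inter_filter finite_atLeastAtMost)
      also have "EXP \<dots> = (\<Prod>C\<in>orbs. EXP (\<Sum>k\<in>{k\<in>?I. card C dvd k}. scalar (of_nat (card C) * \<xi> k / of_nat k * z C ^ k) * var_t ^ k))"
        by (rule EXP_sum[OF finO(1) small_Qs_exponent])
      also have "\<dots> = (\<Prod>C\<in>orbs. sub (z C) (Qs M \<xi> (card C)))"
        unfolding Qs_def sub_EXP sub_sum sub_t_pow ..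
      also have "\<dots> = (\<Prod>C\<in>orbs. tsum (\<lambda>n. scalar (cf (Qs M \<xi> (card C)) 0 n * z C ^ n) * var_t ^ (1 * n)))"
      proof (rule prod.cong[OF refl])
        fix C
        have "Eul 1 0 (sub (z C) (Qs M \<xi> (card C))) = 0"
        proof (rule ser_eqI)
          fix v n show "cf (Eul 1 0 (sub (z C) (Qs M \<xi> (card C)))) v n = cf 0 v n"
            using arg_cong[OF Eul10_Qs[of M \<xi> "card C"], of "\<lambda>F. cf F v n"] by (auto simp: cf_sub)
        qed
        from t_only_expand[OF this]
        show "sub (z C) (Qs M \<xi> (card C)) = tsum (\<lambda>n. scalar (cf (Qs M \<xi> (card C)) 0 n * z C ^ n) * var_t ^ (1 * n))"
          by (simp add: cf_sub mult.commute[of "z C ^ _"])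
      qed
      also have "cf \<dots> 0 (2 * e) = (\<Sum>n\<in>?O. if (\<Sum>C\<in>orbs. 1 * n C) = 2 * e then \<Prod>C\<in>orbs. cf (Qs M \<xi> (card C)) 0 (n C) * z C ^ n C else 0)"
        by (rule cf_prod_scalar) (use K in auto)
      finally show "?F z = (\<Sum>n\<in>?O. (if (\<Sum>C\<in>orbs. 1 * n C) = 2 * e then \<Prod>C\<in>orbs. cf (Qs M \<xi> (card C)) 0 (n C) else 0) * (\<Prod>C\<in>orbs. z C ^ n C))"
        by (simp add: prod.distrib if_distrib[of "\<lambda>x. x * _"] cong: if_cong)
    qed
    have "(\<Sum>m\<in>?B. if ?w m then (\<Prod>k\<in>?I. (\<xi> k / of_nat k) ^ m k / fact (m k)) * N' m else 0)
       = (\<Sum>n\<in>good_box K. \<Sum>m\<in>?B. if ?w m then (\<Prod>k\<in>?I. (\<xi> k / of_nat k) ^ m k / fact (m k)) * c m n else 0)"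
      by (rule swap[symmetric])
    also have "\<dots> = (\<Sum>n\<in>good_box K. if (\<Sum>C\<in>orbs. 1 * n C) = 2 * e then \<Prod>C\<in>orbs. cf (Qs M \<xi> (card C)) 0 (n C) else 0)"
      by (rule sum.cong[OF refl], rule is_poly_unique[OF finO(1) lin P3]) (use gb in auto)
    also have "\<dots> = (\<Sum>n\<in>?O. if (\<Sum>C\<in>orbs. 1 * n C) = 2 * e
        then \<Prod>C\<in>orbs. if 3 * card C \<le> n C then cf (Qs M \<xi> (card C)) 0 (n C) else 0 else 0)"
    proof (rule sum.mono_neutral_cong_left[OF finO(2) gb(1)])
      show "\<forall>n\<in>?O - good_box K. (if (\<Sum>C\<in>orbs. 1 * n C) = 2 * e
        then \<Prod>C\<in>orbs. if 3 * card C \<le> n C then cf (Qs M \<xi> (card C)) 0 (n C) else 0 else 0) = 0"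
      proof
        fix n assume "n \<in> ?O - good_box K"
        then obtain C where "C \<in> orbs" "\<not> 3 * card C \<le> n C" unfolding good_box_def by blast
        then have "(\<Prod>C\<in>orbs. if 3 * card C \<le> n C then cf (Qs M \<xi> (card C)) 0 (n C) else 0) = 0"
          by (intro prod_zero[OF finO(1)]) auto
        then show "(if (\<Sum>C\<in>orbs. 1 * n C) = 2 * e
          then \<Prod>C\<in>orbs. if 3 * card C \<le> n C then cf (Qs M \<xi> (card C)) 0 (n C) else 0 else 0) = 0" by simp
      qed
      fix n assume "n \<in> good_box K"
      then have "(\<Prod>C\<in>orbs. if 3 * card C \<le> n C then cf (Qs M \<xi> (card C)) 0 (n C) else 0) = (\<Prod>C\<in>orbs. cf (Qs M \<xi> (card C)) 0 (n C))"
        by (intro prod.cong) (auto simp: good_box_def)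
      then show "(if (\<Sum>C\<in>orbs. 1 * n C) = 2 * e then \<Prod>C\<in>orbs. cf (Qs M \<xi> (card C)) 0 (n C) else 0) =
          (if (\<Sum>C\<in>orbs. 1 * n C) = 2 * e
          then \<Prod>C\<in>orbs. if 3 * card C \<le> n C then cf (Qs M \<xi> (card C)) 0 (n C) else 0 else 0)" by simp
    qed
    also have "\<dots> = cf (\<Prod>C\<in>orbs. tsum (\<lambda>n. scalar (if 3 * card C \<le> n then cf (Qs M \<xi> (card C)) 0 n else 0) * var_t ^ (1 * n))) 0 (2 * e)"
      by (rule cf_prod_scalar[symmetric]) (use K in auto)
    finally show ?thesis by (simp add: Ws_def)
  qed
  show ?thesis using C1 C2 by blast
qed

end

section \<open>The generating function as a sum of Gaussian pairings\<close>

lemma cf_mult_s_pow: "cf (F * var_s ^ i) v n = (if i \<le> v then cf F (v - i) n else 0)"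
  by (simp add: var_s_def fps_X_power_mult_right_nth)

lemma Eul_s_pow: "Eul p q (var_s ^ n) = of_nat (p * n) * var_s ^ n"
proof (rule ser_eqI)
  fix v m show "cf (Eul p q (var_s ^ n)) v m = cf (of_nat (p * n) * var_s ^ n) v m"
    using cf_mult_s_pow[of 1 n v m] cf_mult_s_pow[of "of_nat (p * n)" n v m]
    by (cases "v = n") (auto simp: of_nat_ser cf_scalar)
qed

lemma small_s_pow: "small (var_s ^ n) n"
  by (rule small_power1[OF small_s])

lemma cf_PS_s:
  assumes "\<And>n. Eul 1 0 (f n) = 0" shows "cf (PS var_s f) v n = cf (f v) 0 n"
proof -
  have f: "cf (f i) w n = 0" if "w > 0" for i w
    using arg_cong[OF assms[of i], of "\<lambda>F. cf F w n"] that by simp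
  have "cf (PS var_s f) v n = (\<Sum>i\<le>v+n. cf (f i * var_s ^ i) v n)" by (simp add: PS_def cf_tsum)
  also have "\<dots> = (\<Sum>i\<le>v+n. if i = v then cf (f v) 0 n else 0)"
    by (rule sum.cong) (auto simp: cf_mult_s_pow intro!: f)
  also have "\<dots> = cf (f v) 0 n" by simp
  finally show ?thesis .
qed

lemma Eul_perm_egf:
  assumes "Eul p q \<kappa> = 0" "\<And>k. Eul p q (w k) = 0" shows "Eul p q (perm_egf \<kappa> w n) = 0"
proof -
  have "Eul p q (cyc_sum \<kappa> w n r) = 0" for n r
    by (induct n arbitrary: r) (auto simp: Eul_mult Eul_add assms of_nat_ser simp del: of_nat_Suc)
  then show ?thesis
    unfolding perm_egf_def Eul_scalar perm_sum_def by (cases n) auto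
qed

definition ts :: "rat \<Rightarrow> nat \<Rightarrow> ser" where
  "ts \<kappa> a = scalar (\<kappa> ^ (a - 1) / of_nat a) * var_s ^ a"

lemma small_ts: "a \<ge> 1 \<Longrightarrow> small (ts \<kappa> a) 1"
  unfolding ts_def by (intro small_mult_right small_mono[OF small_s_pow])

lemma Eul01_ts [simp]: "Eul 0 1 (ts \<kappa> a) = 0"
  by (simp add: ts_def Eul_scalar Eul_s_pow)

lemma cyc_log_Ws: "cyc_log var_s (scalar \<kappa>) (Ws M \<xi>) = (\<Sum>a\<in>{1..M}. ts \<kappa> a * Ws M \<xi> a)"
proof -
  let ?g = "\<lambda>k. ts \<kappa> (Suc k) * Ws M \<xi> (Suc k)"
  have sm: "small (?g k) k" for k
    unfolding ts_def by (intro small_mult_left small_mult_right small_mono[OF small_s_pow]) simp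
  have "cyc_log var_s (scalar \<kappa>) (Ws M \<xi>) = tsum (\<lambda>k. var_s * (scalar (1 / of_nat (Suc k)) * scalar \<kappa> ^ k * Ws M \<xi> (Suc k) * var_s ^ k))"
    unfolding cyc_log_def PS_def by (rule tsum_mult') (rule small_PS_term[OF small_s])
  also have "\<dots> = tsum ?g"
  proof (intro arg_cong[where f=tsum] ext)
    fix k
    have "scalar (\<kappa> ^ (Suc k - 1) / of_nat (Suc k)) = scalar (1 / of_nat (Suc k)) * scalar \<kappa> ^ k"
      by (simp add: scalar_power[symmetric] scalar_mult[symmetric] del: of_nat_Suc)
    then show "var_s * (scalar (1 / of_nat (Suc k)) * scalar \<kappa> ^ k * Ws M \<xi> (Suc k) * var_s ^ k) = ?g k"
      unfolding ts_def by (simp only: power_Suc mult_ac)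
  qed
  also have "\<dots> = (\<Sum>k\<le>M. ?g k)" by (rule tsum_finite) (use sm in \<open>auto simp: Ws_eq_0\<close>)
  also have "\<dots> = (\<Sum>a\<in>{1..M}. ts \<kappa> a * Ws M \<xi> a)"
  proof -
    have "(\<Sum>k\<le>M. ?g k) = (\<Sum>a\<in>Suc ` {..M}. ts \<kappa> a * Ws M \<xi> a)"
      by (subst sum.reindex) auto
    also have "\<dots> = (\<Sum>a\<in>{1..M}. ts \<kappa> a * Ws M \<xi> a)"
    proof (rule sum.mono_neutral_right)
      show "\<forall>a\<in>Suc ` {..M} - {1..M}. ts \<kappa> a * Ws M \<xi> a = 0"
        by (auto simp: Ws_eq_0 not_le One_nat_def)
      show "{1..M} \<subseteq> Suc ` {..M}"
      proof
        fix a assume "a \<in> {1..M}"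
        then show "a \<in> Suc ` {..M}" by (intro image_eqI[of _ _ "a - 1"]) auto
      qed
    qed auto
    finally show ?thesis .
  qed
  finally show ?thesis .
qed

text \<open>A power sum evaluated at a cycle type: the number of points fixed by the
  \<open>k\<close>-th power of a permutation with \<open>j a\<close> cycles of length
  \<open>a\<close> for \<open>a \<le> M\<close>.\<close>

definition xj :: "nat \<Rightarrow> (nat \<Rightarrow> nat) \<Rightarrow> nat \<Rightarrow> rat" where
  "xj M j k = (\<Sum>a\<in>{a\<in>{1..M}. a dvd k}. of_nat (a * j a))"

text \<open>The coefficient of \<xi>_k \<open>u^k\<close> in the exponent: \<open>xj / k\<close>
  from the powers of the \<open>Qs\<close>, minus the linear terms of \<open>Rs\<close>, which come
  from \<open>a = k\<close> (valence 1) and, for even \<open>k\<close>, from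
  \<open>a = k / 2\<close> (valence 2).\<close>

definition ds :: "rat \<Rightarrow> nat \<Rightarrow> (nat \<Rightarrow> nat) \<Rightarrow> nat \<Rightarrow> ser" where
  "ds \<kappa> M j k = scalar (xj M j k / of_nat k) - ts \<kappa> k - (if even k then scalar (1/2) * ts \<kappa> (k div 2) else 0)"

lemma Eul01_ds [simp]: "Eul 0 1 (ds \<kappa> M j k) = 0"
  by (simp add: ds_def Eul_diff Eul_scalar)

text \<open>The exponent is regrouped by the index of \<xi> instead of the cycle length. No products
  of different \<xi>_k occur, so the pairing can later be carried out one \<open>k\<close> at a
  time.\<close>

lemma exponent_rearrange:
  "- (\<Sum>a\<in>{1..M}. ts \<kappa> a * Rs M \<xi> a)
     + (\<Sum>a\<in>{1..M}. of_nat (j a) * (\<Sum>k\<in>{k\<in>{1..M}. a dvd k}. scalar (of_nat a * \<xi> k / of_nat k) * var_t ^ k))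
   = - (\<Sum>a\<in>{1..M}. ts \<kappa> a) + (\<Sum>k\<in>{1..M}. (ds \<kappa> M j k * scalar (\<xi> k)) * var_t ^ k
        + scalar (1/2) * (- ts \<kappa> k * scalar (\<xi> k) ^ 2) * (var_t ^ k)\<^sup>2)"
proof -
  let ?I = "{1..M}"
  let ?h = "\<lambda>k. scalar (1/2) * ts \<kappa> (k div 2) * scalar (\<xi> k) * var_t ^ k"
  have 1: "(\<Sum>a\<in>?I. if 2 * a \<le> M then ts \<kappa> a * (scalar (\<xi> (2 * a) / 2) * var_t ^ (2 * a)) else 0) = (\<Sum>k\<in>?I. if even k then ?h k else 0)"
  proof -
    have "(\<Sum>k\<in>?I. if even k then ?h k else 0) = (\<Sum>k\<in>{k\<in>?I. even k}. ?h k)"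
      by (rule sum.inter_filter[symmetric]) simp
    also have "{k\<in>?I. even k} = (\<lambda>a. 2 * a) ` {a\<in>?I. 2 * a \<le> M}"
    proof (intro Set.set_eqI iffI)
      fix k assume "k \<in> {k\<in>?I. even k}"
      then show "k \<in> (\<lambda>a. 2 * a) ` {a\<in>?I. 2 * a \<le> M}"
        by (intro image_eqI[of _ _ "k div 2"]) (auto elim!: evenE)
    qed auto
    also have "(\<Sum>k\<in>(\<lambda>a. 2 * a) ` {a\<in>?I. 2 * a \<le> M}. ?h k) = (\<Sum>a\<in>{a\<in>?I. 2 * a \<le> M}. ?h (2 * a))"
      by (subst sum.reindex) (auto simp: inj_on_def)
    also have "\<dots> = (\<Sum>a\<in>{a\<in>?I. 2 * a \<le> M}. ts \<kappa> a * (scalar (\<xi> (2 * a) / 2) * var_t ^ (2 * a)))"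
    proof (rule sum.cong[OF refl])
      fix a
      have "scalar (\<xi> (2 * a) / 2) = scalar (1/2) * scalar (\<xi> (2 * a))" by (simp flip: scalar_mult)
      then show "?h (2 * a) = ts \<kappa> a * (scalar (\<xi> (2 * a) / 2) * var_t ^ (2 * a))" by (simp add: mult_ac)
    qed
    also have "\<dots> = (\<Sum>a\<in>?I. if 2 * a \<le> M then ts \<kappa> a * (scalar (\<xi> (2 * a) / 2) * var_t ^ (2 * a)) else 0)"
      by (rule sum.inter_filter) simp
    finally show ?thesis by (rule sym)
  qed
  have 2: "(\<Sum>a\<in>?I. of_nat (j a) * (\<Sum>k\<in>{k\<in>?I. a dvd k}. scalar (of_nat a * \<xi> k / of_nat k) * var_t ^ k))
     = (\<Sum>k\<in>?I. scalar (xj M j k / of_nat k) * scalar (\<xi> k) * var_t ^ k)"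
  proof -
    have "(\<Sum>a\<in>?I. of_nat (j a) * (\<Sum>k\<in>{k\<in>?I. a dvd k}. scalar (of_nat a * \<xi> k / of_nat k) * var_t ^ k))
      = (\<Sum>a\<in>?I. \<Sum>k\<in>?I. if a dvd k then scalar (of_nat (a * j a)) * (scalar (1 / of_nat k) * scalar (\<xi> k) * var_t ^ k) else 0)"
    proof (rule sum.cong[OF refl])
      fix a
      have "of_nat (j a) * (scalar (of_nat a * \<xi> k / of_nat k) * var_t ^ k)
          = scalar (of_nat (a * j a)) * (scalar (1 / of_nat k) * scalar (\<xi> k) * var_t ^ k)" for k
        unfolding of_nat_ser mult.assoc[symmetric] scalar_mult[symmetric] by (simp add: mult_ac)
      then have "of_nat (j a) * (\<Sum>k\<in>{k\<in>?I. a dvd k}. scalar (of_nat a * \<xi> k / of_nat k) * var_t ^ k) =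
        (\<Sum>k\<in>{k\<in>?I. a dvd k}. scalar (of_nat (a * j a)) * (scalar (1 / of_nat k) * scalar (\<xi> k) * var_t ^ k))"
        unfolding sum_distrib_left by (intro sum.cong refl)
      also have "\<dots> = (\<Sum>k\<in>?I. if a dvd k then scalar (of_nat (a * j a)) * (scalar (1 / of_nat k) * scalar (\<xi> k) * var_t ^ k) else 0)"
        by (rule sum.inter_filter) simp
      finally show "of_nat (j a) * (\<Sum>k\<in>{k\<in>?I. a dvd k}. scalar (of_nat a * \<xi> k / of_nat k) * var_t ^ k) =
        (\<Sum>k\<in>?I. if a dvd k then scalar (of_nat (a * j a)) * (scalar (1 / of_nat k) * scalar (\<xi> k) * var_t ^ k) else 0)" .
    qed
    also have "\<dots> = (\<Sum>k\<in>?I. \<Sum>a\<in>{a\<in>?I. a dvd k}. scalar (of_nat (a * j a)) * (scalar (1 / of_nat k) * scalar (\<xi> k) * var_t ^ k))"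
      by (subst sum.swap) (rule sum.cong[OF refl], rule sum.inter_filter[symmetric], simp)
    also have "\<dots> = (\<Sum>k\<in>?I. scalar (xj M j k / of_nat k) * scalar (\<xi> k) * var_t ^ k)"
    proof (rule sum.cong[OF refl])
      fix k
      have "scalar (xj M j k / of_nat k) = scalar (xj M j k) * scalar (1 / of_nat k)" by (simp flip: scalar_mult)
      then show "(\<Sum>a\<in>{a\<in>?I. a dvd k}. scalar (of_nat (a * j a)) * (scalar (1 / of_nat k) * scalar (\<xi> k) * var_t ^ k)) =
        scalar (xj M j k / of_nat k) * scalar (\<xi> k) * var_t ^ k"
        by (simp only: sum_distrib_right[symmetric] xj_def scalar_sum mult.assoc)
    qed
    finally show ?thesis .
  qed
  have 3: "(\<Sum>a\<in>?I. ts \<kappa> a * Rs M \<xi> a) = (\<Sum>a\<in>?I. ts \<kappa> a) + (\<Sum>a\<in>?I. ts \<kappa> a * scalar (\<xi> a) * var_t ^ a)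
      + (\<Sum>a\<in>?I. scalar (1/2) * (ts \<kappa> a * scalar (\<xi> a) ^ 2) * (var_t ^ a)\<^sup>2) + (\<Sum>k\<in>?I. if even k then ?h k else 0)"
    unfolding 1[symmetric] sum.distrib[symmetric]
  proof (rule sum.cong[OF refl])
    fix a
    have e1: "scalar (\<xi> a ^ 2 / 2) = scalar (1/2) * scalar (\<xi> a) ^ 2" by (simp flip: scalar_mult scalar_power)
    have e2: "var_t ^ (2 * a) = (var_t ^ a)\<^sup>2" by (simp add: power_mult[symmetric] mult.commute)
    show "ts \<kappa> a * Rs M \<xi> a = ts \<kappa> a + ts \<kappa> a * scalar (\<xi> a) * var_t ^ a + scalar (1/2) * (ts \<kappa> a * scalar (\<xi> a) ^ 2) * (var_t ^ a)\<^sup>2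
       + (if 2 * a \<le> M then ts \<kappa> a * (scalar (\<xi> (2 * a) / 2) * var_t ^ (2 * a)) else 0)"
      unfolding Rs_def e1 e2 by (simp add: algebra_simps)
  qed
  have 4: "(\<Sum>k\<in>?I. (ds \<kappa> M j k * scalar (\<xi> k)) * var_t ^ k + scalar (1/2) * (- ts \<kappa> k * scalar (\<xi> k) ^ 2) * (var_t ^ k)\<^sup>2)
    = (\<Sum>k\<in>?I. scalar (xj M j k / of_nat k) * scalar (\<xi> k) * var_t ^ k) - (\<Sum>a\<in>?I. ts \<kappa> a * scalar (\<xi> a) * var_t ^ a)
      - (\<Sum>k\<in>?I. if even k then ?h k else 0) - (\<Sum>a\<in>?I. scalar (1/2) * (ts \<kappa> a * scalar (\<xi> a) ^ 2) * (var_t ^ a)\<^sup>2)"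
    unfolding sum_subtractf[symmetric] by (rule sum.cong) (auto simp: ds_def algebra_simps)
  show ?thesis unfolding 2 3 4 by (simp add: algebra_simps)
qed

text \<open>Expanding \<open>exp (\<Sum>a. ts a * Qs a)\<close> in powers of the \<open>Qs a\<close> is what introduces the sequence \<open>j\<close> of the theorem:
  the \<open>j\<close>-th term is \<open>Cs j\<close> times the exponential of a polynomial of degree two in each \<open>\<xi> k\<close> separately.\<close>

definition Cs :: "rat \<Rightarrow> nat \<Rightarrow> (nat \<Rightarrow> nat) \<Rightarrow> ser" where
  "Cs \<kappa> M j = EXP (- (\<Sum>a\<in>{1..M}. ts \<kappa> a)) * (\<Prod>a\<in>{1..M}. scalar (1 / fact (j a)) * ts \<kappa> a ^ j a)"

lemma small_Rs_sum: "small (- (\<Sum>a\<in>{1..M}. ts \<kappa> a * Rs M \<xi> a)) 1"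
  by (intro small_minus small_sum small_mult_left small_ts) auto

lemma small_quadratic:
  "k \<ge> 1 \<Longrightarrow> small (d * var_t ^ k + c * (var_t ^ k)\<^sup>2) 1"
  by (intro small_add small_mult_right) (auto simp: power2_eq_square intro!: small_mult_right small_mono[OF small_t_pow])

text \<open>\<open>Rs\<close> stays in the exponent, being quadratic in \<xi>. The exponential of
  \<open>ts a * Qs a\<close> is expanded, because a power of \<open>Qs\<close> is again the
  exponential of something linear in \<xi>. All expansion terms gain order with each index, so the
  box bounded by \<open>K\<close> loses nothing.\<close>

lemma EXP_W_expand:
  assumes K: "v + N \<le> K"
  shows "cf (EXP (cyc_log var_s (scalar \<kappa>) (Ws M \<xi>))) v N =
    (\<Sum>j\<in>{1..M} \<rightarrow>\<^sub>E {..K}. \<Sum>m\<in>{1..M} \<rightarrow>\<^sub>E {..K}.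
       cf (Cs \<kappa> M j * (\<Prod>k\<in>{1..M}. herm (- ts \<kappa> k) (ds \<kappa> M j k) (m k) * var_t ^ (k * m k))) v N * (\<Prod>k\<in>{1..M}. \<xi> k ^ m k))"
proof -
  let ?I = "{1..M}"
  let ?Z = "\<lambda>a. (\<Sum>k\<in>{k\<in>?I. a dvd k}. scalar (of_nat a * \<xi> k / of_nat k) * var_t ^ k)"
  define R where "R = - (\<Sum>a\<in>?I. ts \<kappa> a * Rs M \<xi> a)"
  have sR: "small R 1" unfolding R_def by (rule small_Rs_sum)
  have sT: "small (- (\<Sum>a\<in>?I. ts \<kappa> a)) 1" by (intro small_minus small_sum small_ts) auto
  have stQ: "small (ts \<kappa> a * Qs M \<xi> a) 1" if "a \<in> ?I" for a using that by (intro small_mult_left small_ts) auto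
  have "cyc_log var_s (scalar \<kappa>) (Ws M \<xi>) = R + (\<Sum>a\<in>?I. ts \<kappa> a * Qs M \<xi> a)"
  proof -
    have "(\<Sum>a\<in>?I. ts \<kappa> a * Ws M \<xi> a) = (\<Sum>a\<in>?I. ts \<kappa> a * Qs M \<xi> a - ts \<kappa> a * Rs M \<xi> a)"
      by (rule sum.cong) (auto simp: Ws_eq right_diff_distrib)
    then show ?thesis by (simp add: cyc_log_Ws R_def sum_subtractf)
  qed
  then have "EXP (cyc_log var_s (scalar \<kappa>) (Ws M \<xi>)) = EXP R * (\<Prod>a\<in>?I. tsum (\<lambda>i. scalar (1 / fact i) * (ts \<kappa> a * Qs M \<xi> a) ^ i))"
  proof -
    assume eq: "cyc_log var_s (scalar \<kappa>) (Ws M \<xi>) = R + (\<Sum>a\<in>?I. ts \<kappa> a * Qs M \<xi> a)"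
    have "EXP (R + (\<Sum>a\<in>?I. ts \<kappa> a * Qs M \<xi> a)) = EXP R * (\<Prod>a\<in>?I. EXP (ts \<kappa> a * Qs M \<xi> a))"
    proof -
      have e1: "EXP (R + (\<Sum>a\<in>?I. ts \<kappa> a * Qs M \<xi> a)) = EXP R * EXP (\<Sum>a\<in>?I. ts \<kappa> a * Qs M \<xi> a)"
        by (rule EXP_add[OF sR small_sum]) (rule stQ)
      have e2: "EXP (\<Sum>a\<in>?I. ts \<kappa> a * Qs M \<xi> a) = (\<Prod>a\<in>?I. EXP (ts \<kappa> a * Qs M \<xi> a))"
        by (rule EXP_sum) (use stQ in auto)
      show ?thesis by (simp only: e1 e2)
    qed
    then show ?thesis unfolding eq EXP_def[of "ts \<kappa> _ * _"] .
  qed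
  then have "cf (EXP (cyc_log var_s (scalar \<kappa>) (Ws M \<xi>))) v N =
     (\<Sum>j\<in>?I \<rightarrow>\<^sub>E {..K}. cf (EXP R * (\<Prod>a\<in>?I. scalar (1 / fact (j a)) * (ts \<kappa> a * Qs M \<xi> a) ^ j a)) v N)"
    using stQ K by (simp only:) (rule cf_prod_tsum, auto intro: small_EXP_term)
  also have "\<dots> = (\<Sum>j\<in>?I \<rightarrow>\<^sub>E {..K}. cf (Cs \<kappa> M j * (\<Prod>k\<in>?I. tsum (\<lambda>n. herm (- ts \<kappa> k) (ds \<kappa> M j k) n * scalar (\<xi> k) ^ n * (var_t ^ k) ^ n))) v N)"
  proof (rule sum.cong[OF refl])
    fix j
    let ?E = "\<lambda>k. (ds \<kappa> M j k * scalar (\<xi> k)) * var_t ^ k + scalar (1/2) * (- ts \<kappa> k * scalar (\<xi> k) ^ 2) * (var_t ^ k)\<^sup>2"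
    have sE: "small (?E k) 1" if "k \<in> ?I" for k by (rule small_quadratic) (use that in simp)
    have "EXP R * (\<Prod>a\<in>?I. scalar (1 / fact (j a)) * (ts \<kappa> a * Qs M \<xi> a) ^ j a) =
       EXP R * (\<Prod>a\<in>?I. Qs M \<xi> a ^ j a) * (\<Prod>a\<in>?I. scalar (1 / fact (j a)) * ts \<kappa> a ^ j a)"
      by (simp add: power_mult_distrib prod.distrib mult_ac)
    also have "(\<Prod>a\<in>?I. Qs M \<xi> a ^ j a) = EXP (\<Sum>a\<in>?I. of_nat (j a) * ?Z a)"
      unfolding Qs_def EXP_of_nat_mult[OF small_Qs_exponent, symmetric]
      by (rule EXP_sum[symmetric]) (simp, rule small_mult_right, rule small_Qs_exponent)
    also have "EXP R * EXP (\<Sum>a\<in>?I. of_nat (j a) * ?Z a) = EXP (R + (\<Sum>a\<in>?I. of_nat (j a) * ?Z a))"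
      by (rule EXP_add[symmetric, OF sR]) (rule small_sum, rule small_mult_right, rule small_Qs_exponent)
    also have "R + (\<Sum>a\<in>?I. of_nat (j a) * ?Z a) = - (\<Sum>a\<in>?I. ts \<kappa> a) + (\<Sum>k\<in>?I. ?E k)"
      unfolding R_def by (rule exponent_rearrange)
    also have "EXP \<dots> = EXP (- (\<Sum>a\<in>?I. ts \<kappa> a)) * (\<Prod>k\<in>?I. EXP (?E k))"
    proof -
      have e1: "EXP (- (\<Sum>a\<in>?I. ts \<kappa> a) + (\<Sum>k\<in>?I. ?E k)) = EXP (- (\<Sum>a\<in>?I. ts \<kappa> a)) * EXP (\<Sum>k\<in>?I. ?E k)"
        by (rule EXP_add[OF sT small_sum]) (rule sE)
      have e2: "EXP (\<Sum>k\<in>?I. ?E k) = (\<Prod>k\<in>?I. EXP (?E k))" by (rule EXP_sum) (use sE in auto)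
      show ?thesis by (simp only: e1 e2)
    qed
    also have "(\<Prod>k\<in>?I. EXP (?E k)) = (\<Prod>k\<in>?I. tsum (\<lambda>n. herm (- ts \<kappa> k) (ds \<kappa> M j k) n * scalar (\<xi> k) ^ n * (var_t ^ k) ^ n))"
    proof (rule prod.cong[OF refl])
      fix k assume k: "k \<in> ?I"
      interpret gauss_var "var_t ^ k" k using k by (intro gauss_var_t) simp
      have E0: "Eul 0 1 (scalar (\<xi> k) ^ n) = 0" for n by (simp flip: scalar_power)
      show "EXP (?E k) = tsum (\<lambda>n. herm (- ts \<kappa> k) (ds \<kappa> M j k) n * scalar (\<xi> k) ^ n * (var_t ^ k) ^ n)"
        by (subst EXP_herm) (simp_all only: Eul_mult Eul_minus Eul01_ts Eul01_ds E0 Eul_scalar_const mult_zero_left mult_zero_right add_0 minus_zero PS_def herm_rescale)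
    qed
    finally show "cf (EXP R * (\<Prod>a\<in>?I. scalar (1 / fact (j a)) * (ts \<kappa> a * Qs M \<xi> a) ^ j a)) v N =
      cf (Cs \<kappa> M j * (\<Prod>k\<in>?I. tsum (\<lambda>n. herm (- ts \<kappa> k) (ds \<kappa> M j k) n * scalar (\<xi> k) ^ n * (var_t ^ k) ^ n))) v N"
      unfolding Cs_def by (simp only: mult_ac)
  qed
  also have "\<dots> = (\<Sum>j\<in>?I \<rightarrow>\<^sub>E {..K}. \<Sum>m\<in>?I \<rightarrow>\<^sub>E {..K}. cf (Cs \<kappa> M j * (\<Prod>k\<in>?I. herm (- ts \<kappa> k) (ds \<kappa> M j k) (m k) * scalar (\<xi> k) ^ m k * (var_t ^ k) ^ m k)) v N)"
  proof (rule sum.cong[OF refl], rule cf_prod_tsum[OF _ _ K])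
    fix j k n assume "k \<in> ?I"
    then show "small (herm (- ts \<kappa> k) (ds \<kappa> M j k) n * scalar (\<xi> k) ^ n * (var_t ^ k) ^ n) n"
      by (intro small_mult_right small_power1 small_mono[OF small_t_pow]) simp
  qed simp
  also have "\<dots> = (\<Sum>j\<in>?I \<rightarrow>\<^sub>E {..K}. \<Sum>m\<in>?I \<rightarrow>\<^sub>E {..K}.
       cf (Cs \<kappa> M j * (\<Prod>k\<in>?I. herm (- ts \<kappa> k) (ds \<kappa> M j k) (m k) * var_t ^ (k * m k))) v N * (\<Prod>k\<in>?I. \<xi> k ^ m k))"
  proof (intro sum.cong refl)
    fix j m
    have "Cs \<kappa> M j * (\<Prod>k\<in>?I. herm (- ts \<kappa> k) (ds \<kappa> M j k) (m k) * scalar (\<xi> k) ^ m k * (var_t ^ k) ^ m k)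
       = scalar (\<Prod>k\<in>?I. \<xi> k ^ m k) * (Cs \<kappa> M j * (\<Prod>k\<in>?I. herm (- ts \<kappa> k) (ds \<kappa> M j k) (m k) * var_t ^ (k * m k)))"
      unfolding scalar_prod scalar_power power_mult prod.distrib by (simp only: mult_ac)
    then show "cf (Cs \<kappa> M j * (\<Prod>k\<in>?I. herm (- ts \<kappa> k) (ds \<kappa> M j k) (m k) * scalar (\<xi> k) ^ m k * (var_t ^ k) ^ m k)) v N =
      cf (Cs \<kappa> M j * (\<Prod>k\<in>?I. herm (- ts \<kappa> k) (ds \<kappa> M j k) (m k) * var_t ^ (k * m k))) v N * (\<Prod>k\<in>?I. \<xi> k ^ m k)"
      by (simp only: cf_scalar_mult mult.commute)
  qed
  finally show ?thesis .
qed

text \<open>The exponent of \<open>gaussian_pairing\<close> at \<open>x = u^k\<close>. The factors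
  \<open>of_nat k\<close> on the edge side undo the division of \<xi>_k by \<open>k\<close> in the
  kernel.\<close>

definition Zs :: "rat \<Rightarrow> nat \<Rightarrow> (nat \<Rightarrow> nat) \<Rightarrow> nat \<Rightarrow> ser" where
  "Zs \<kappa> M j k = (let a = scalar (ah \<kappa> k) * scalar (of_nat k) ^ 2; b = scalar (bh \<kappa> k) * scalar (of_nat k);
      c = - ts \<kappa> k; d = ds \<kappa> M j k; x = var_t ^ k in
     (b * d * x + scalar (1/2) * (a * d\<^sup>2 + c * b\<^sup>2) * x\<^sup>2) * GEO (a * c * x\<^sup>2) + scalar (1/2) * LOG1 (a * c * x\<^sup>2))"

lemma small_Zs: "k \<ge> 1 \<Longrightarrow> small (Zs \<kappa> M j k) 1"
proof -
  assume k: "k \<ge> 1"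
  have x: "small (var_t ^ k) 1" using small_mono[OF small_t_pow k] .
  have x2: "small ((var_t ^ k)\<^sup>2) 1" using x by (simp add: power2_eq_square small_mult_right)
  show ?thesis unfolding Zs_def Let_def
    by (rule small_add[OF small_mult_left[OF small_add[OF small_mult_right[OF x] small_mult_right[OF x2]]]
        small_mult_right[OF small_LOG1[OF small_mult_right[OF x2]]]])
qed

text \<open>In the kernel \<open>p_k^n\<close> is multiplied by \<open>(\<xi>_k / k)^n / n!\<close>;
  reading off coefficients of the \<xi> therefore multiplies the edge coefficient \<open>eh\<close>
  by \<open>k^n n!\<close>, and the \<open>n!\<close> is the one in Mehler's formula.\<close>

lemma pairing_series:
  assumes k: "k \<ge> 1"
  shows "tsum (\<lambda>n. scalar (eh \<kappa> k n * of_nat k ^ n * fact n) * herm (- ts \<kappa> k) (ds \<kappa> M j k) n * var_t ^ (k * n)) = EXP (Zs \<kappa> M j k)"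
proof -
  interpret gauss_var "var_t ^ k" k using k by (rule gauss_var_t)
  have E0: "Eul 0 1 (scalar c ^ n) = 0" for n c by (simp flip: scalar_power)
  have "EXP (Zs \<kappa> M j k) = PS (var_t ^ k) (\<lambda>n. of_nat (fact n) * herm (scalar (ah \<kappa> k) * scalar (of_nat k) ^ 2) (scalar (bh \<kappa> k) * scalar (of_nat k)) n * herm (- ts \<kappa> k) (ds \<kappa> M j k) n)"
    unfolding Zs_def Let_def
    by (rule gaussian_pairing[symmetric])
      (simp_all only: Eul_mult Eul_minus Eul01_ts Eul01_ds E0 Eul_scalar_const mult_zero_left mult_zero_right add_0 minus_zero)
  also have "\<dots> = tsum (\<lambda>n. scalar (eh \<kappa> k n * of_nat k ^ n * fact n) * herm (- ts \<kappa> k) (ds \<kappa> M j k) n * var_t ^ (k * n))"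
  proof -
    have "of_nat (fact n) * herm (scalar (ah \<kappa> k) * scalar (of_nat k) ^ 2) (scalar (bh \<kappa> k) * scalar (of_nat k)) n
        = scalar (eh \<kappa> k n * of_nat k ^ n * fact n)" for n
    proof -
      have "scalar (eh \<kappa> k n * of_nat k ^ n * fact n) = of_nat (fact n) * (scalar (eh \<kappa> k n) * scalar (of_nat k) ^ n)"
        unfolding of_nat_ser scalar_mult scalar_power of_nat_fact by (simp only: mult_ac)
      then show ?thesis unfolding herm_rescale eh by simp
    qed
    then show ?thesis unfolding PS_def by (simp only: power_mult)
  qed
  finally show ?thesis by simp
qed

text \<open>The two sign patterns for which reversals, edge permutations and vertex permutations
  carry the characters \<kappa>^|R|, \<open>sg (- \<kappa>)\<close> and
  \<open>sg \<kappa>\<close>.\<close>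

definition sign_type :: "rat \<Rightarrow> pm \<Rightarrow> pm \<Rightarrow> pm \<Rightarrow> bool" where
  "sign_type \<kappa> snu smu srho \<longleftrightarrow> (\<kappa> = 1 \<and> snu = Pos \<and> smu = Neg \<and> srho = Pos) \<or> (\<kappa> = -1 \<and> snu = Neg \<and> smu = Pos \<and> srho = Neg)"

lemma prod_scalar_factor: "C * (\<Prod>k\<in>I. scalar (f k) * G k * H k) = scalar (prod f I) * (C * (\<Prod>k\<in>I. G k * H k))"
  by (simp add: scalar_prod prod.distrib mult_ac)

text \<open>The dimension is a linear expression in numbers \<open>A m\<close> that are not
  computed. The vertex side determines the same numbers as coefficients of a polynomial in \<xi>,
  and substituting them yields the pairing.\<close>

theorem dim_series:
  fixes K :: "('a, 'm) ring_scheme"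
  assumes F: "field K" and char: "\<And>n::nat. n > 0 \<Longrightarrow> add_pow K n \<one>\<^bsub>K\<^esub> \<noteq> \<zero>\<^bsub>K\<^esub>"
    and st: "sign_type \<kappa> snu smu srho" and M: "2 * e \<le> M" and L: "v + 2 * e \<le> L"
  shows "of_nat (vdim K (graph_space K v e 3 snu smu srho)) =
    (\<Sum>j\<in>{1..M} \<rightarrow>\<^sub>E {..L}. cf (Cs \<kappa> M j * EXP (\<Sum>k\<in>{1..M}. Zs \<kappa> M j k)) v (2 * e))"
proof -
  let ?I = "{1..M}" and ?B = "{1..M} \<rightarrow>\<^sub>E {..L}" and ?P = "{p. p permutes {1..e}}" and ?Q = "{q. q permutes {1..v}}"
  let ?w = "\<lambda>m. (\<Sum>k\<in>{1..M}. k * m k) = 2 * e"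
  define D where "D = vdim K (graph_space K v e 3 snu smu srho)"
  interpret graph_action v e 3 snu smu srho .
  have sq: "\<kappa> * \<kappa> = 1" using st by (auto simp: sign_type_def)
  have tw: "of_int (tw snu (odd n)) = \<kappa> ^ n" "of_int (tw smu (\<not> evenperm p)) = sg (- \<kappa>) p" "of_int (tw srho (\<not> evenperm p)) = sg \<kappa> p"
    for n and p :: "nat \<Rightarrow> nat"
    using st by (auto simp: sign_type_def tw_def sg_def)
  have S1: "2 ^ e * fact e * fact v * of_nat D = (\<Sum>q\<in>?Q. sg \<kappa> q * (\<Sum>R\<in>Pow {1..e}. \<Sum>p\<in>?P. \<kappa> ^ card R * sg (- \<kappa>) p *
        of_nat (card {g\<in>gra v e 3. act (R, p, q) g = g})))"
  proof -
    have "2 ^ e * fact e * fact v * of_nat D = (of_int (int (2 ^ e * fact e * fact v * D)) :: rat)" by simp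
    also have "\<dots> = (\<Sum>h\<in>H. of_int (sn h) * of_nat (card {g\<in>gra v e 3. act h g = g}))"
      using arg_cong[OF graph_space_dim[OF F char], of "of_int :: int \<Rightarrow> rat"] unfolding D_def by (simp add: mult_ac)
    also have "\<dots> = (\<Sum>R\<in>Pow {1..e}. \<Sum>p\<in>?P. \<Sum>q\<in>?Q. \<kappa> ^ card R * sg (- \<kappa>) p * sg \<kappa> q * of_nat (card {g\<in>gra v e 3. act (R, p, q) g = g}))"
      unfolding H_def by (simp add: sum.cartesian_product case_prod_unfold sn_def tw)
    also have "\<dots> = (\<Sum>R\<in>Pow {1..e}. \<Sum>q\<in>?Q. \<Sum>p\<in>?P. \<kappa> ^ card R * sg (- \<kappa>) p * sg \<kappa> q * of_nat (card {g\<in>gra v e 3. act (R, p, q) g = g}))"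
      by (rule sum.cong[OF refl]) (rule sum.swap)
    also have "\<dots> = (\<Sum>q\<in>?Q. \<Sum>R\<in>Pow {1..e}. \<Sum>p\<in>?P. \<kappa> ^ card R * sg (- \<kappa>) p * sg \<kappa> q * of_nat (card {g\<in>gra v e 3. act (R, p, q) g = g}))"
      by (rule sum.swap)
    also have "\<dots> = (\<Sum>q\<in>?Q. sg \<kappa> q * (\<Sum>R\<in>Pow {1..e}. \<Sum>p\<in>?P. \<kappa> ^ card R * sg (- \<kappa>) p *
        of_nat (card {g\<in>gra v e 3. act (R, p, q) g = g})))"
      unfolding sum_distrib_left by (intro sum.cong refl) (simp only: mult_ac)
    finally show ?thesis .
  qed
  have "\<forall>q\<in>?Q. \<exists>N'. (\<Sum>R\<in>Pow {1..e}. \<Sum>p\<in>?P. \<kappa> ^ card R * sg (- \<kappa>) p *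
        of_nat (card {g\<in>gra v e 3. act (R, p, q) g = g}))
      = 2 ^ e * fact e * (\<Sum>m\<in>?B. if ?w m then (\<Prod>k\<in>?I. eh \<kappa> k (m k)) * N' m else 0)
    \<and> (\<forall>\<xi>. (\<Sum>m\<in>?B. if ?w m then (\<Prod>k\<in>?I. (\<xi> k / of_nat k) ^ m k / fact (m k)) * N' m else 0)
        = cf (\<Prod>C\<in>orbit q ` {1..v}. Ws M \<xi> (card C)) 0 (2 * e))"
  proof
    fix q assume "q \<in> ?Q"
    then have vp: "vertex_perm v q \<kappa>" using sq by unfold_locales auto
    show "\<exists>N'. (\<Sum>R\<in>Pow {1..e}. \<Sum>p\<in>?P. \<kappa> ^ card R * sg (- \<kappa>) p *
        of_nat (card {g\<in>gra v e 3. act (R, p, q) g = g}))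
      = 2 ^ e * fact e * (\<Sum>m\<in>?B. if ?w m then (\<Prod>k\<in>?I. eh \<kappa> k (m k)) * N' m else 0)
    \<and> (\<forall>\<xi>. (\<Sum>m\<in>?B. if ?w m then (\<Prod>k\<in>?I. (\<xi> k / of_nat k) ^ m k / fact (m k)) * N' m else 0)
        = cf (\<Prod>C\<in>orbit q ` {1..v}. Ws M \<xi> (card C)) 0 (2 * e))"
      by (rule vertex_perm.good_count[OF vp M]) (use L in simp)
  qed
  then obtain N' where N': "\<forall>q\<in>?Q. (\<Sum>R\<in>Pow {1..e}. \<Sum>p\<in>?P. \<kappa> ^ card R * sg (- \<kappa>) p *
        of_nat (card {g\<in>gra v e 3. act (R, p, q) g = g}))
      = 2 ^ e * fact e * (\<Sum>m\<in>?B. if ?w m then (\<Prod>k\<in>?I. eh \<kappa> k (m k)) * N' q m else 0)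
    \<and> (\<forall>\<xi>. (\<Sum>m\<in>?B. if ?w m then (\<Prod>k\<in>?I. (\<xi> k / of_nat k) ^ m k / fact (m k)) * N' q m else 0)
        = cf (\<Prod>C\<in>orbit q ` {1..v}. Ws M \<xi> (card C)) 0 (2 * e))"
    by (rule bchoice[THEN exE])
  \<comment> \<open>The numbers \<open>N'\<close> summed over vertex permutations with
    signs.\<close>
  define A where "A m = (\<Sum>q\<in>?Q. sg \<kappa> q * N' q m)" for m
  have lin: "(\<Sum>q\<in>?Q. sg \<kappa> q * (\<Sum>m\<in>?B. if ?w m then h m * N' q m else 0)) = (\<Sum>m\<in>?B. if ?w m then h m * A m else 0)" for h
  proof -
    have "(\<Sum>q\<in>?Q. sg \<kappa> q * (\<Sum>m\<in>?B. if ?w m then h m * N' q m else 0)) = (\<Sum>q\<in>?Q. \<Sum>m\<in>?B. if ?w m then h m * (sg \<kappa> q * N' q m) else 0)"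
      unfolding sum_distrib_left by (intro sum.cong refl) simp
    also have "\<dots> = (\<Sum>m\<in>?B. \<Sum>q\<in>?Q. if ?w m then h m * (sg \<kappa> q * N' q m) else 0)" by (rule sum.swap)
    also have "\<dots> = (\<Sum>m\<in>?B. if ?w m then h m * A m else 0)"
      by (intro sum.cong refl) (simp add: A_def sum_distrib_left)
    finally show ?thesis .
  qed
  have "2 ^ e * fact e * (fact v * of_nat D) = 2 ^ e * fact e * (\<Sum>m\<in>?B. if ?w m then (\<Prod>k\<in>?I. eh \<kappa> k (m k)) * A m else 0)"
  proof -
    have "2 ^ e * fact e * (fact v * of_nat D) = (\<Sum>q\<in>?Q. sg \<kappa> q * (2 ^ e * fact e * (\<Sum>m\<in>?B. if ?w m then (\<Prod>k\<in>?I. eh \<kappa> k (m k)) * N' q m else 0)))"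
      using S1 N' by (simp add: mult.assoc)
    also have "\<dots> = 2 ^ e * fact e * (\<Sum>q\<in>?Q. sg \<kappa> q * (\<Sum>m\<in>?B. if ?w m then (\<Prod>k\<in>?I. eh \<kappa> k (m k)) * N' q m else 0))"
      by (simp only: mult.left_commute[of "sg \<kappa> q" for q] sum_distrib_left[symmetric])
    finally show ?thesis unfolding lin .
  qed
  then have S2: "fact v * of_nat D = (\<Sum>m\<in>?B. if ?w m then (\<Prod>k\<in>?I. eh \<kappa> k (m k)) * A m else 0)" by simp
  \<comment> \<open>On the vertex side the sum over \<open>q\<close> depends on cycle lengths only,
    so the exponential formula along \<open>s\<close> applies.\<close>
  have S3: "(\<Sum>m\<in>?B. if ?w m then (\<Prod>k\<in>?I. (\<xi> k / of_nat k) ^ m k / fact (m k)) * A m else 0)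
      = fact v * cf (EXP (cyc_log var_s (scalar \<kappa>) (Ws M \<xi>))) v (2 * e)" for \<xi>
  proof -
    have "(\<Sum>m\<in>?B. if ?w m then (\<Prod>k\<in>?I. (\<xi> k / of_nat k) ^ m k / fact (m k)) * A m else 0) =
      (\<Sum>q\<in>?Q. sg \<kappa> q * cf (\<Prod>C\<in>orbit q ` {1..v}. Ws M \<xi> (card C)) 0 (2 * e))"
      unfolding lin[symmetric] using N' by (intro sum.cong refl) simp
    also have "\<dots> = cf (\<Sum>q\<in>?Q. sg (scalar \<kappa>) q * (\<Prod>C\<in>orbit q ` {1..v}. Ws M \<xi> (card C))) 0 (2 * e)"
    proof -
      have "sg (scalar \<kappa>) q = scalar (sg \<kappa> q)" for q :: "nat \<Rightarrow> nat" by (simp add: sg_def)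
      then show ?thesis by (simp add: cf_sum)
    qed
    also have "(\<Sum>q\<in>?Q. sg (scalar \<kappa>) q * (\<Prod>C\<in>orbit q ` {1..v}. Ws M \<xi> (card C))) = perm_sum (scalar \<kappa>) (Ws M \<xi>) v"
      by (subst sum_permutes_orbits) (simp_all add: sq flip: scalar_mult)
    also have "cf (perm_sum (scalar \<kappa>) (Ws M \<xi>) v) 0 (2 * e) = fact v * cf (perm_egf (scalar \<kappa>) (Ws M \<xi>) v) 0 (2 * e)"
      by (simp add: perm_egf_def)
    also have "cf (perm_egf (scalar \<kappa>) (Ws M \<xi>) v) 0 (2 * e) = cf (PS var_s (perm_egf (scalar \<kappa>) (Ws M \<xi>))) v (2 * e)"
      by (rule cf_PS_s[symmetric]) (simp add: Eul_perm_egf Eul10_Ws)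
    also have "PS var_s (perm_egf (scalar \<kappa>) (Ws M \<xi>)) = EXP (cyc_log var_s (scalar \<kappa>) (Ws M \<xi>))"
      by (rule PS_s_perm_egf) (simp_all add: Eul10_Ws)
    finally show ?thesis .
  qed
  let ?G = "\<lambda>j m. cf (Cs \<kappa> M j * (\<Prod>k\<in>?I. herm (- ts \<kappa> k) (ds \<kappa> M j k) (m k) * var_t ^ (k * m k))) v (2 * e)"
  let ?F = "\<lambda>\<xi>. fact v * cf (EXP (cyc_log var_s (scalar \<kappa>) (Ws M \<xi>))) v (2 * e)"
  \<comment> \<open>Both descriptions are polynomial in the rational parameters \<xi>, so the
    coefficients agree and express \<open>A\<close>.\<close>
  have P1: "is_poly ?I L ?F (\<lambda>m. if ?w m then A m * (\<Prod>k\<in>?I. 1 / (of_nat k ^ m k * fact (m k))) else 0)"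
    unfolding is_poly_def S3[symmetric]
    by (intro allI sum.cong refl) (auto simp: prod.distrib[symmetric] power_divide prod_dividef field_simps)
  have P2: "is_poly ?I L ?F (\<lambda>m. fact v * (\<Sum>j\<in>?B. ?G j m))"
    unfolding is_poly_def
  proof
    fix \<xi>
    have "?F \<xi> = fact v * (\<Sum>j\<in>?B. \<Sum>m\<in>?B. ?G j m * (\<Prod>k\<in>?I. \<xi> k ^ m k))"
      by (simp only: EXP_W_expand[OF L])
    also have "\<dots> = fact v * (\<Sum>m\<in>?B. \<Sum>j\<in>?B. ?G j m * (\<Prod>k\<in>?I. \<xi> k ^ m k))" by (subst sum.swap) simp
    finally show "?F \<xi> = (\<Sum>m\<in>?B. fact v * (\<Sum>j\<in>?B. ?G j m) * (\<Prod>k\<in>?I. \<xi> k ^ m k))"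
      by (simp only: sum_distrib_left sum_distrib_right mult.assoc)
  qed
  have A: "(if ?w m then A m * (\<Prod>k\<in>?I. 1 / (of_nat k ^ m k * fact (m k))) else 0) = fact v * (\<Sum>j\<in>?B. ?G j m)" if "m \<in> ?B" for m
    using is_poly_unique[OF _ P1 P2 that] by simp
  have "fact v * of_nat D = (\<Sum>m\<in>?B. (\<Prod>k\<in>?I. eh \<kappa> k (m k) * of_nat k ^ m k * fact (m k)) *
      (if ?w m then A m * (\<Prod>k\<in>?I. 1 / (of_nat k ^ m k * fact (m k))) else 0))"
    unfolding S2
  proof (rule sum.cong[OF refl])
    fix m
    have "(\<Prod>k\<in>?I. eh \<kappa> k (m k) * of_nat k ^ m k * fact (m k)) * (\<Prod>k\<in>?I. 1 / (of_nat k ^ m k * fact (m k)))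
       = (\<Prod>k\<in>?I. eh \<kappa> k (m k))"
      unfolding prod.distrib[symmetric] by (rule prod.cong) auto
    then show "(if ?w m then (\<Prod>k\<in>?I. eh \<kappa> k (m k)) * A m else 0) = (\<Prod>k\<in>?I. eh \<kappa> k (m k) * of_nat k ^ m k * fact (m k)) *
      (if ?w m then A m * (\<Prod>k\<in>?I. 1 / (of_nat k ^ m k * fact (m k))) else 0)"
      by (simp add: mult_ac)
  qed
  also have "\<dots> = (\<Sum>m\<in>?B. (\<Prod>k\<in>?I. eh \<kappa> k (m k) * of_nat k ^ m k * fact (m k)) * (fact v * (\<Sum>j\<in>?B. ?G j m)))"
    by (rule sum.cong[OF refl]) (simp only: A)
  also have "\<dots> = fact v * (\<Sum>m\<in>?B. \<Sum>j\<in>?B. (\<Prod>k\<in>?I. eh \<kappa> k (m k) * of_nat k ^ m k * fact (m k)) * ?G j m)"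
    by (simp only: sum_distrib_left mult.left_commute)
  finally have "of_nat D = (\<Sum>m\<in>?B. \<Sum>j\<in>?B. (\<Prod>k\<in>?I. eh \<kappa> k (m k) * of_nat k ^ m k * fact (m k)) * ?G j m)" by simp
  also have "\<dots> = (\<Sum>j\<in>?B. \<Sum>m\<in>?B. (\<Prod>k\<in>?I. eh \<kappa> k (m k) * of_nat k ^ m k * fact (m k)) * ?G j m)" by (rule sum.swap)
  also have "\<dots> = (\<Sum>j\<in>?B. cf (Cs \<kappa> M j * EXP (\<Sum>k\<in>?I. Zs \<kappa> M j k)) v (2 * e))"
  proof (rule sum.cong[OF refl])
    fix j
    have "(\<Sum>m\<in>?B. (\<Prod>k\<in>?I. eh \<kappa> k (m k) * of_nat k ^ m k * fact (m k)) * ?G j m) =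
      (\<Sum>m\<in>?B. cf (Cs \<kappa> M j * (\<Prod>k\<in>?I. scalar (eh \<kappa> k (m k) * of_nat k ^ m k * fact (m k)) * herm (- ts \<kappa> k) (ds \<kappa> M j k) (m k) * var_t ^ (k * m k))) v (2 * e))"
    proof (rule sum.cong[OF refl])
      fix m
      have "Cs \<kappa> M j * (\<Prod>k\<in>?I. scalar (eh \<kappa> k (m k) * of_nat k ^ m k * fact (m k)) * herm (- ts \<kappa> k) (ds \<kappa> M j k) (m k) * var_t ^ (k * m k))
        = scalar (\<Prod>k\<in>?I. eh \<kappa> k (m k) * of_nat k ^ m k * fact (m k)) * (Cs \<kappa> M j * (\<Prod>k\<in>?I. herm (- ts \<kappa> k) (ds \<kappa> M j k) (m k) * var_t ^ (k * m k)))"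
        by (rule prod_scalar_factor)
      then show "(\<Prod>k\<in>?I. eh \<kappa> k (m k) * of_nat k ^ m k * fact (m k)) * ?G j m =
        cf (Cs \<kappa> M j * (\<Prod>k\<in>?I. scalar (eh \<kappa> k (m k) * of_nat k ^ m k * fact (m k)) * herm (- ts \<kappa> k) (ds \<kappa> M j k) (m k) * var_t ^ (k * m k))) v (2 * e)"
        by (simp only: cf_scalar_mult)
    qed
    also have "\<dots> = cf (Cs \<kappa> M j * (\<Prod>k\<in>?I. tsum (\<lambda>n. scalar (eh \<kappa> k n * of_nat k ^ n * fact n) * herm (- ts \<kappa> k) (ds \<kappa> M j k) n * var_t ^ (k * n)))) v (2 * e)"
    proof (rule cf_prod_tsum[symmetric, OF _ _ L])
      fix k n assume "k \<in> ?I"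
      then have "n \<le> k * n" by (cases k) auto
      then show "small (scalar (eh \<kappa> k n * of_nat k ^ n * fact n) * herm (- ts \<kappa> k) (ds \<kappa> M j k) n * var_t ^ (k * n)) n"
        by (intro small_mult_right small_mono[OF small_t_pow])
    qed simp
    also have "(\<Prod>k\<in>?I. tsum (\<lambda>n. scalar (eh \<kappa> k n * of_nat k ^ n * fact n) * herm (- ts \<kappa> k) (ds \<kappa> M j k) n * var_t ^ (k * n)))
       = (\<Prod>k\<in>?I. EXP (Zs \<kappa> M j k))"
      by (rule prod.cong[OF refl]) (rule pairing_series, simp)
    also have "\<dots> = EXP (\<Sum>k\<in>?I. Zs \<kappa> M j k)" by (rule EXP_sum[symmetric]) (auto intro: small_Zs)
    finally show "(\<Sum>m\<in>?B. (\<Prod>k\<in>?I. eh \<kappa> k (m k) * of_nat k ^ m k * fact (m k)) * ?G j m) =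
      cf (Cs \<kappa> M j * EXP (\<Sum>k\<in>?I. Zs \<kappa> M j k)) v (2 * e)" .
  qed
  finally show ?thesis unfolding D_def .
qed

section \<open>Logarithms of q-Pochhammer symbols\<close>

text \<open>Minus the logarithm of \<open>(a, q)_\<infinity>\<close>, that is, the sum of
  \<open>a^m / (m (1 - q^m))\<close> over \<open>m >= 1\<close>; the term \<open>m = 0\<close>
  vanishes because \<open>1 / 0 = 0\<close>.\<close>

definition lser :: "ser \<Rightarrow> ser \<Rightarrow> ser" where
  "lser a q = tsum (\<lambda>m. scalar (1 / of_nat m) * (a ^ m * GEO (q ^ m)))"

lemma small_lser_term: "small a 1 \<Longrightarrow> small (scalar c * (a ^ m * G)) m"
  by (intro small_mult_right small_mult_left small_power1)

lemma small_lser: assumes "small a 1" shows "small (lser a q) 1"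
  unfolding lser_def
proof (rule small_tsum)
  fix m show "small (scalar (1 / of_nat m) * (a ^ m * GEO (q ^ m))) 1"
    using small_mono[OF small_lser_term[OF assms, of _ m], of 1] by (cases "m = 0") auto
qed

lemma small_power_ge1: "small x 1 \<Longrightarrow> m \<ge> 1 \<Longrightarrow> small (x ^ m) 1"
  by (rule small_mono[OF small_power1])

lemma psi_lser: assumes "small a 1" "small q 1" shows "psi (lser a q) = lser (psi a) (psi q)"
proof -
  have "psi (scalar (1 / of_nat m) * (a ^ m * GEO (q ^ m))) = scalar (1 / of_nat m) * (psi a ^ m * GEO (psi q ^ m))" for m
    using small_power_ge1[OF assms(2), of m]
    by (cases "m = 0") (auto simp: psi_scalar_mult psi_scalar psi_mult psi_power psi_GEO)
  then show ?thesis unfolding lser_def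
    by (subst psi_tsum) (auto intro: small_lser_term assms)
qed

lemma tsum_nonzero_powers: assumes "small x 1" shows "tsum (\<lambda>k. if k = 0 then 0 else x ^ k) = x * GEO x"
proof -
  have "tsum (\<lambda>k. if k = 0 then 0 else x ^ k) = tsum (\<lambda>k. x * x ^ k)"
    by (subst tsum_Suc) (auto intro: small_power1 assms)
  also have "\<dots> = x * GEO x"
    unfolding GEO_def by (rule tsum_mult'[symmetric]) (rule small_power1[OF assms])
  finally show ?thesis .
qed

text \<open>Collects the square-root factors of Mehler's formula over all \<open>k >= 1\<close>.
  Exchanging the two sums gives geometric series, and the right side is
  \<open>lser q q\<close>.\<close>

lemma tsum_LOG1: assumes "small q 1"
  shows "tsum (\<lambda>k. if k = 0 then 0 else LOG1 (q ^ k)) = tsum (\<lambda>m. scalar (1 / of_nat m) * (q ^ m * GEO (q ^ m)))"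
proof -
  have "tsum (\<lambda>k. if k = 0 then 0 else LOG1 (q ^ k)) =
      tsum (\<lambda>k. tsum (\<lambda>m. scalar (1 / of_nat m) * (if k = 0 then 0 else (q ^ m) ^ k)))"
  proof (intro arg_cong[where f=tsum] ext)
    fix k
    have "(q ^ k) ^ m = (q ^ m) ^ k" for m by (simp add: power_mult[symmetric] mult.commute)
    then show "(if k = 0 then 0 else LOG1 (q ^ k)) = tsum (\<lambda>m. scalar (1 / of_nat m) * (if k = 0 then 0 else (q ^ m) ^ k))"
      by (cases "k = 0") (simp_all add: LOG1_def)
  qed
  also have "\<dots> = tsum (\<lambda>m. tsum (\<lambda>k. scalar (1 / of_nat m) * (if k = 0 then 0 else (q ^ m) ^ k)))" by (rule tsum_swap)
  also have "\<dots> = tsum (\<lambda>m. scalar (1 / of_nat m) * (q ^ m * GEO (q ^ m)))"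
  proof (intro arg_cong[where f=tsum] ext)
    fix m :: nat
    show "tsum (\<lambda>k. scalar (1 / of_nat m) * (if k = 0 then 0 else (q ^ m) ^ k)) = scalar (1 / of_nat m) * (q ^ m * GEO (q ^ m))"
      unfolding tsum_scalar using tsum_nonzero_powers[OF small_power_ge1[OF assms, of m]] by (cases "m = 0") simp_all
  qed
  finally show ?thesis .
qed

lemma tsum_multiples_weighted:
  assumes a: "a \<ge> 1" and F: "\<And>k. small (F k) k"
  shows "tsum (\<lambda>k. if a dvd k then scalar (of_nat a / of_nat k) * F k else 0) = tsum (\<lambda>m. scalar (1 / of_nat m) * F (a * m))"
proof -
  have "tsum (\<lambda>m. scalar (1 / of_nat m) * F (a * m)) = tsum (\<lambda>m. scalar (of_nat a / of_nat (a * m)) * F (a * m))"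
    using a by simp
  also have "\<dots> = tsum (\<lambda>k. if a dvd k then scalar (of_nat a / of_nat k) * F k else 0)"
    by (rule tsum_multiples[OF a, of "\<lambda>k. scalar (of_nat a / of_nat k) * F k"]) (intro small_mult_right F)
  finally show ?thesis by simp
qed

lemma tsum_even:
  assumes F: "\<And>k. small (F k) k"
  shows "tsum (\<lambda>k. if even k then scalar (c / of_nat k) * F k else 0) = tsum (\<lambda>m. scalar (c / 2 / of_nat m) * F (2 * m))"
proof -
  have "tsum (\<lambda>m. scalar (c / of_nat (2 * m)) * F (2 * m)) = tsum (\<lambda>k. if even k then scalar (c / of_nat k) * F k else 0)"
    by (rule tsum_multiples[of 2 "\<lambda>k. scalar (c / of_nat k) * F k"]) (auto intro: small_mult_right F)
  then show ?thesis by simp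
qed

lemma tsum_xj:
  assumes F: "\<And>k. small (F k) k"
  shows "tsum (\<lambda>k. scalar (xj M j k / of_nat k) * F k) =
    (\<Sum>a\<in>{1..M}. of_nat (j a) * tsum (\<lambda>m. scalar (1 / of_nat m) * F (a * m)))"
proof -
  have "scalar (xj M j k / of_nat k) * F k =
      (\<Sum>a\<in>{1..M}. scalar (of_nat (j a)) * (if a dvd k then scalar (of_nat a / of_nat k) * F k else 0))" for k
  proof -
    have "xj M j k / of_nat k = (\<Sum>a\<in>{1..M}. if a dvd k then of_nat (a * j a) / of_nat k else 0)"
      unfolding xj_def sum_divide_distrib by (rule sum.inter_filter) simp
    then have "scalar (xj M j k / of_nat k) * F k = (\<Sum>a\<in>{1..M}. scalar (if a dvd k then of_nat (a * j a) / of_nat k else 0) * F k)"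
      by (simp only: scalar_sum sum_distrib_right)
    also have "\<dots> = (\<Sum>a\<in>{1..M}. scalar (of_nat (j a)) * (if a dvd k then scalar (of_nat a / of_nat k) * F k else 0))"
    proof (rule sum.cong[OF refl])
      fix a
      have "scalar (of_nat (a * j a) / of_nat k) = scalar (of_nat (j a)) * scalar (of_nat a / of_nat k)" by (simp flip: scalar_mult add: mult.commute)
      then show "scalar (if a dvd k then of_nat (a * j a) / of_nat k else 0) * F k = scalar (of_nat (j a)) * (if a dvd k then scalar (of_nat a / of_nat k) * F k else 0)"
        by (simp only: mult.assoc split: if_split) simp
    qed
    finally show ?thesis .
  qed
  then have "tsum (\<lambda>k. scalar (xj M j k / of_nat k) * F k) =
     (\<Sum>a\<in>{1..M}. scalar (of_nat (j a)) * tsum (\<lambda>k. if a dvd k then scalar (of_nat a / of_nat k) * F k else 0))"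
    by (simp only: tsum_sum tsum_scalar)
  also have "\<dots> = (\<Sum>a\<in>{1..M}. of_nat (j a) * tsum (\<lambda>m. scalar (1 / of_nat m) * F (a * m)))"
    by (rule sum.cong[OF refl]) (simp only: tsum_multiples_weighted[OF _ F] of_nat_ser atLeastAtMost_iff)
  finally show ?thesis .
qed

text \<open>Source of the double product: \<open>a\<close> and \<open>b\<close> both divide
  \<open>k\<close> exactly when \<open>lcm a b\<close> does, and since
  \<open>a b = gcd a b * lcm a b\<close>, rescaling the sum over multiples of the lcm leaves the
  factor \<open>gcd a b\<close>.\<close>

lemma tsum_xj_square:
  assumes F: "\<And>k. small (F k) k"
  shows "tsum (\<lambda>k. scalar ((xj M j k)\<^sup>2 / of_nat k) * F k) =
    (\<Sum>a\<in>{1..M}. \<Sum>b\<in>{1..M}. of_nat (gcd a b * j a * j b) * tsum (\<lambda>m. scalar (1 / of_nat m) * F (lcm a b * m)))"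
proof -
  let ?I = "{1..M}"
  let ?g = "\<lambda>a b. scalar (of_nat (gcd a b * j a * j b))"
  let ?h = "\<lambda>a b k. if lcm a b dvd k then scalar (of_nat (lcm a b) / of_nat k) * F k else 0"
  have "scalar ((xj M j k)\<^sup>2 / of_nat k) * F k = (\<Sum>a\<in>?I. \<Sum>b\<in>?I. ?g a b * ?h a b k)" for k
  proof -
    have x: "xj M j k = (\<Sum>a\<in>?I. if a dvd k then of_nat (a * j a) else 0)"
      unfolding xj_def by (rule sum.inter_filter) simp
    have "(xj M j k)\<^sup>2 / of_nat k = (\<Sum>a\<in>?I. \<Sum>b\<in>?I. (if a dvd k then of_nat (a * j a) else 0) * (if b dvd k then of_nat (b * j b) else 0) / of_nat k)"
      unfolding power2_eq_square x sum_product sum_divide_distrib ..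
    then have "scalar ((xj M j k)\<^sup>2 / of_nat k) * F k = (\<Sum>a\<in>?I. \<Sum>b\<in>?I. scalar ((if a dvd k then of_nat (a * j a) else 0) * (if b dvd k then of_nat (b * j b) else 0) / of_nat k) * F k)"
      by (simp only: scalar_sum sum_distrib_right)
    also have "\<dots> = (\<Sum>a\<in>?I. \<Sum>b\<in>?I. ?g a b * ?h a b k)"
    proof (intro sum.cong refl)
      fix a b :: nat
      have ab: "gcd a b * lcm a b = a * b" by simp
      have "of_nat (gcd a b) * of_nat (lcm a b) = (of_nat a * of_nat b :: rat)" unfolding of_nat_mult[symmetric] ab ..
      then have "of_nat (a * j a) * of_nat (b * j b) / of_nat k = (of_nat (gcd a b * j a * j b) * (of_nat (lcm a b) / of_nat k) :: rat)" by (simp add: mult_ac)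
      then have e: "scalar (of_nat (a * j a) * of_nat (b * j b) / of_nat k) = ?g a b * scalar (of_nat (lcm a b) / of_nat k)" by (simp only: scalar_mult)
      show "scalar ((if a dvd k then of_nat (a * j a) else 0) * (if b dvd k then of_nat (b * j b) else 0) / of_nat k) * F k = ?g a b * ?h a b k"
      proof (cases "lcm a b dvd k")
        case True
        then have "a dvd k" "b dvd k" by auto
        then show ?thesis using True e by (simp only: if_True mult.assoc)
      next
        case False
        then have "\<not> a dvd k \<or> \<not> b dvd k" by auto
        then show ?thesis using False by auto
      qed
    qed
    finally show ?thesis .
  qed
  then have "tsum (\<lambda>k. scalar ((xj M j k)\<^sup>2 / of_nat k) * F k) = (\<Sum>a\<in>?I. \<Sum>b\<in>?I. ?g a b * tsum (?h a b))"
    by (simp only: tsum_sum tsum_scalar)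
  also have "\<dots> = (\<Sum>a\<in>?I. \<Sum>b\<in>?I. of_nat (gcd a b * j a * j b) * tsum (\<lambda>m. scalar (1 / of_nat m) * F (lcm a b * m)))"
  proof (intro sum.cong refl)
    fix a b assume "a \<in> ?I" "b \<in> ?I"
    then have "a \<noteq> 0" "b \<noteq> 0" by auto
    then have "lcm a b \<ge> 1" by (simp add: Suc_le_eq lcm_pos_nat One_nat_def)
    then show "?g a b * tsum (?h a b) = of_nat (gcd a b * j a * j b) * tsum (\<lambda>m. scalar (1 / of_nat m) * F (lcm a b * m))"
      by (simp only: tsum_multiples_weighted[OF _ F] of_nat_ser)
  qed
  finally show ?thesis .
qed

section \<open>The exponent in closed form\<close>

text \<open>The logarithm of the prefactor of the theorem, for both signs.\<close>

definition Psi :: "rat \<Rightarrow> ser \<Rightarrow> ser \<Rightarrow> ser" where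
  "Psi \<kappa> S T = (if \<kappa> = 1 then lser (S * T) ((S * T)\<^sup>2) else lser ((S * T)\<^sup>2) ((S * T)\<^sup>2)) - scalar \<kappa> * lser S ((S * T)\<^sup>2)"

text \<open>The logarithm of what one unit of \<open>j a\<close> contributes to the single product,
  apart from monomial and scalar. Even \<open>a = 2 \<alpha>\<close> and odd
  \<open>a = 2 \<alpha> - 1\<close> give the last two factors there; the odd case is the one with a
  square root.\<close>

definition linS :: "ser \<Rightarrow> ser \<Rightarrow> nat \<Rightarrow> ser" where
  "linS S T a = lser ((S * T) ^ a) ((S * T) ^ a) +
     (if even a then lser (S ^ (a div 2) * T ^ a) ((S * T) ^ a) - lser (T ^ (a div 2)) ((S * T) ^ a)
      else scalar (1/2) * (lser (S ^ a * T ^ (2 * a)) ((S * T) ^ (2 * a)) - lser (T ^ a) ((S * T) ^ (2 * a))))"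

text \<open>The logarithm of a summand without its monomial and scalar part; \<kappa> decides
  whether the double product stands in the numerator or in the denominator.\<close>

definition Phi :: "rat \<Rightarrow> ser \<Rightarrow> ser \<Rightarrow> nat \<Rightarrow> (nat \<Rightarrow> nat) \<Rightarrow> ser" where
  "Phi \<kappa> S T M j = (\<Sum>a\<in>{1..M}. of_nat (j a) * linS S T a)
     - scalar (\<kappa> / 2) * (\<Sum>a\<in>{1..M}. \<Sum>b\<in>{1..M}. of_nat (gcd a b * j a * j b) * lser (T ^ lcm a b) ((S * T) ^ lcm a b))"

text \<open>\<open>Ef\<close> is \<open>Zs - ts\<close> with \<open>S = \<kappa> s\<close>, \<open>T = - \<kappa> u^2\<close>, sorted by powers of \<open>X = xj\<close>; the quadratic, linear and
  constant parts sum to the double product, the single product and the prefactor of the theorem.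
  At \<open>k = 0\<close> it vanishes because \<open>1 / 0 = 0\<close>.\<close>

definition Ef :: "rat \<Rightarrow> ser \<Rightarrow> ser \<Rightarrow> rat \<Rightarrow> nat \<Rightarrow> ser" where
  "Ef \<kappa> S T X k = (let q = S * T; h = k div 2; G = GEO (q ^ k) in
     scalar (X\<^sup>2 / of_nat k) * (scalar (- \<kappa> / 2) * (T ^ k * G))
     + scalar (X / of_nat k) * (q ^ k * G + (if even k then (T ^ k * S ^ h - T ^ h) * G else 0))
     + (scalar (\<kappa> / of_nat k) * (- (S ^ k) - scalar (1/2) * (q ^ k * S ^ k * G))
        + (if even k then scalar (\<kappa> / of_nat k) * ((q ^ h * S ^ h + q ^ h) * (1 - q ^ h) * G) else 0))
     + scalar (1/2) * (if k = 0 then 0 else LOG1 (q ^ k)))"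

text \<open>\<open>T\<close> has order 2 because it stands for a multiple of \<open>u^2\<close>.
  Hence \<open>T ^ (k div 2)\<close> has order \<open>k\<close> for even \<open>k\<close>, and the
  sums over \<open>k\<close> converge as \<open>tsum\<close> requires.\<close>

context
  fixes \<kappa> :: rat and S T :: ser
  assumes S: "small S 1" and T: "small T 2" and \<kappa>: "\<kappa> = 1 \<or> \<kappa> = -1"
begin

lemma T1: "small T 1" using small_mono[OF T] by simp
lemma q1: "small (S * T) 1" by (intro small_mult_right T1)
lemma Tk: "small (T ^ k) k" by (rule small_power1[OF T1])
lemma qk: "small ((S * T) ^ k) k" by (rule small_power1[OF q1])
lemma Th: "even k \<Longrightarrow> small (T ^ (k div 2)) k" using small_power[OF T, of "k div 2"] by simp
lemma qh: "even k \<Longrightarrow> small ((S * T) ^ (k div 2)) k" unfolding power_mult_distrib by (intro small_mult_right Th)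

text \<open>For odd \<open>a\<close> only even \<open>m\<close> contribute to the second term;
  writing \<open>m\<close> as twice an index halves the weight and doubles the base. This is why
  half powers occur at odd indices only.\<close>

lemma tsum_lin:
  assumes a: "a \<ge> 1"
  shows "tsum (\<lambda>m. scalar (1 / of_nat m) * ((S * T) ^ (a * m) * GEO ((S * T) ^ (a * m))
      + (if even (a * m) then (T ^ (a * m) * S ^ (a * m div 2) - T ^ (a * m div 2)) * GEO ((S * T) ^ (a * m)) else 0))) = linS S T a"
    (is "tsum (\<lambda>m. ?c m * (?F m + ?E m)) = _")
proof -
  have F: "tsum (\<lambda>m. ?c m * ?F m) = lser ((S * T) ^ a) ((S * T) ^ a)" unfolding lser_def by (simp only: power_mult)
  have E: "tsum (\<lambda>m. ?c m * ?E m) = (if even a then lser (S ^ (a div 2) * T ^ a) ((S * T) ^ a) - lser (T ^ (a div 2)) ((S * T) ^ a)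
      else scalar (1/2) * (lser (S ^ a * T ^ (2 * a)) ((S * T) ^ (2 * a)) - lser (T ^ a) ((S * T) ^ (2 * a))))"
  proof (cases "even a")
    case True
    then obtain b where b: "a = 2 * b" by blast
    have "?c m * ?E m = scalar (1 / of_nat m) * ((S ^ b * T ^ a) ^ m * GEO (((S * T) ^ a) ^ m)) - scalar (1 / of_nat m) * ((T ^ b) ^ m * GEO (((S * T) ^ a) ^ m))" for m
    proof -
      have "a * m div 2 = b * m" "even (a * m)" by (simp_all add: b)
      then show ?thesis by (simp add: power_mult power_mult_distrib algebra_simps)
    qed
    then show ?thesis unfolding lser_def by (simp add: tsum_diff b)
  next
    case False
    let ?f = "\<lambda>m. (T ^ (a * m) * S ^ (a * m div 2) - T ^ (a * m div 2)) * GEO ((S * T) ^ (a * m))"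
    have "tsum (\<lambda>m. ?c m * ?E m) = tsum (\<lambda>k. if even k then scalar (1 / of_nat k) * (if even k then ?f k else 0) else 0)"
      using False by (intro arg_cong[where f=tsum] ext) auto
    also have "\<dots> = tsum (\<lambda>m. scalar (1 / 2 / of_nat m) * (if even (2 * m) then ?f (2 * m) else 0))"
    proof (rule tsum_even)
      fix k show "small (if even k then ?f k else 0) k"
      proof (cases "even k")
        case True
        have le: "k \<le> a * k" using a by simp
        have "small (T ^ (a * k div 2)) k" using small_mono[OF Th le] True by simp
        then have "small (?f k) k" by (intro small_mult_left small_diff small_mono[OF Tk le])
        then show ?thesis using True by simp
      qed simp
    qed
    also have "\<dots> = tsum (\<lambda>m. scalar (1/2) * (scalar (1 / of_nat m) * ((S ^ a * T ^ (2 * a)) ^ m * GEO (((S * T) ^ (2 * a)) ^ m))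
        - scalar (1 / of_nat m) * ((T ^ a) ^ m * GEO (((S * T) ^ (2 * a)) ^ m))))"
    proof (intro arg_cong[where f=tsum] ext)
      fix m
      have d: "2 * a * m div 2 = a * m" "a * (2 * m) = 2 * a * m" by simp_all
      have sc: "scalar (1 / 2 / of_nat m) = scalar (1/2) * scalar (1 / of_nat m)" by (simp flip: scalar_mult)
      have p: "T ^ (2 * a * m) = (T ^ (2 * a)) ^ m" "S ^ (a * m) = (S ^ a) ^ m" "T ^ (a * m) = (T ^ a) ^ m" "(S * T) ^ (2 * a * m) = ((S * T) ^ (2 * a)) ^ m"
        by (rule power_mult)+
      show "scalar (1 / 2 / of_nat m) * (if even (2 * m) then ?f (2 * m) else 0) = scalar (1/2) * (scalar (1 / of_nat m) * ((S ^ a * T ^ (2 * a)) ^ m * GEO (((S * T) ^ (2 * a)) ^ m))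
        - scalar (1 / of_nat m) * ((T ^ a) ^ m * GEO (((S * T) ^ (2 * a)) ^ m)))"
        unfolding d sc p power_mult_distrib[of "S ^ a"] by (simp add: algebra_simps)
    qed
    also have "\<dots> = scalar (1/2) * (lser (S ^ a * T ^ (2 * a)) ((S * T) ^ (2 * a)) - lser (T ^ a) ((S * T) ^ (2 * a)))"
      by (simp only: tsum_scalar tsum_diff lser_def)
    finally show ?thesis using False by simp
  qed
  show ?thesis unfolding distrib_left tsum_add F E linS_def ..
qed

text \<open>The even indices are reindexed by \<open>k = 2 m\<close>, and with
  \<open>p = q^m\<close> everything is brought over the denominator \<open>1 - p^2\<close>. The
  numerator that survives is \<open>p\<close> for \<kappa> = 1 and \<open>p^2\<close> for \<kappa> =
  -1, apart from the term with \<open>S\<close>; here the two prefactors part ways.\<close>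

lemma tsum_constant_part:
  "tsum (\<lambda>k. scalar (\<kappa> / of_nat k) * (- (S ^ k) - scalar (1/2) * ((S * T) ^ k * S ^ k * GEO ((S * T) ^ k)))
     + (if even k then scalar (\<kappa> / of_nat k) * (((S * T) ^ (k div 2) * S ^ (k div 2) + (S * T) ^ (k div 2)) * (1 - (S * T) ^ (k div 2)) * GEO ((S * T) ^ k)) else 0))
   + scalar (1/2) * tsum (\<lambda>k. if k = 0 then 0 else LOG1 ((S * T) ^ k)) = Psi \<kappa> S T" (is "tsum (\<lambda>k. ?A k + ?B k) + _ * ?C = _")
proof -
  define q where "q = S * T"
  let ?b = "\<lambda>k. (q ^ (k div 2) * S ^ (k div 2) + q ^ (k div 2)) * (1 - q ^ (k div 2)) * GEO (q ^ k)"
  have "tsum ?B = tsum (\<lambda>k. if even k then scalar (\<kappa> / of_nat k) * (if even k then ?b k else 0) else 0)"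
    unfolding q_def by (intro arg_cong[where f=tsum] ext) simp
  also have "\<dots> = tsum (\<lambda>m. scalar (\<kappa> / 2 / of_nat m) * (if even (2 * m) then ?b (2 * m) else 0))"
  proof (rule tsum_even)
    fix k show "small (if even k then ?b k else 0) k"
      using qh[of k] unfolding q_def by (auto intro!: small_mult_left small_add)
  qed
  also have "\<dots> = tsum (\<lambda>m. scalar (\<kappa> / 2 / of_nat m) * ((q ^ m * S ^ m + q ^ m) * (1 - q ^ m) * GEO (q ^ (2 * m))))" by simp
  finally have B: "tsum ?B = \<dots>" .
  have C: "?C = tsum (\<lambda>m. scalar (1 / of_nat m) * (q ^ m * GEO (q ^ m)))" unfolding q_def by (rule tsum_LOG1[OF q1])
  have "tsum (\<lambda>k. ?A k + ?B k) + scalar (1/2) * ?C = tsum (\<lambda>m. scalar (\<kappa> / of_nat m) * (- (S ^ m) - scalar (1/2) * (q ^ m * S ^ m * GEO (q ^ m)))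
     + scalar (\<kappa> / 2 / of_nat m) * ((q ^ m * S ^ m + q ^ m) * (1 - q ^ m) * GEO (q ^ (2 * m))) + scalar (1/2) * (scalar (1 / of_nat m) * (q ^ m * GEO (q ^ m))))"
    unfolding C tsum_add B tsum_scalar by (simp only: q_def)
  also have "\<dots> = tsum (\<lambda>m. scalar (1 / of_nat m) * ((if \<kappa> = 1 then q else q\<^sup>2) ^ m * GEO ((q\<^sup>2) ^ m)) - scalar \<kappa> * (scalar (1 / of_nat m) * (S ^ m * GEO ((q\<^sup>2) ^ m))))"
  proof (intro arg_cong[where f=tsum] ext)
    fix m :: nat
    define r where "r = scalar (1 / of_nat m)"
    define p where "p = q ^ m"
    define G where "G = GEO (q ^ (2 * m))"
    define f where "f = scalar (1/2)"
    have f: "f + f = 1" unfolding f_def scalar_add[symmetric] by simp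
    have sc: "scalar (\<kappa> / of_nat m) = scalar \<kappa> * r" "scalar (\<kappa> / 2 / of_nat m) = f * scalar \<kappa> * r"
      unfolding r_def f_def by (simp_all flip: scalar_mult)
    have k: "scalar \<kappa> = 1 \<or> scalar \<kappa> = - 1" using \<kappa> by (auto simp: scalar_minus)
    have p2: "q ^ (2 * m) = p * p" "(q\<^sup>2) ^ m = p * p" unfolding p_def by (simp_all add: power_mult[symmetric] power_add[symmetric] mult_2)
    show "scalar (\<kappa> / of_nat m) * (- (S ^ m) - scalar (1/2) * (q ^ m * S ^ m * GEO (q ^ m)))
     + scalar (\<kappa> / 2 / of_nat m) * ((q ^ m * S ^ m + q ^ m) * (1 - q ^ m) * GEO (q ^ (2 * m))) + scalar (1/2) * (scalar (1 / of_nat m) * (q ^ m * GEO (q ^ m)))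
     = scalar (1 / of_nat m) * ((if \<kappa> = 1 then q else q\<^sup>2) ^ m * GEO ((q\<^sup>2) ^ m)) - scalar \<kappa> * (scalar (1 / of_nat m) * (S ^ m * GEO ((q\<^sup>2) ^ m)))"
    proof (cases "m = 0")
      case True then show ?thesis by simp
    next
      case False
      have "small (q ^ m) 1" "small (q ^ (2 * m)) 1" using False unfolding q_def by (auto intro!: small_power_ge1 q1)
      then have "(1 - p) * GEO (q ^ m) = 1" and g2: "(1 - p * p) * G = 1"
        using GEO[of "q ^ m"] GEO[of "q ^ (2 * m)"] by (simp_all add: p_def G_def power_add[symmetric] mult_2)
      then have g1: "GEO (q ^ m) = (1 + p) * G" by Groebner_Basis.algebra
      define x where "x = S ^ m"
      have e: "(if \<kappa> = 1 then q else q\<^sup>2) ^ m = (if \<kappa> = 1 then p else p * p)" using p2(2) by (simp add: p_def)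
      have eq: "GEO (p * p) = G" "q ^ m = p" "q ^ (2 * m) = p * p" "(q\<^sup>2) ^ m = p * p" "S ^ m = x" "scalar (1 / of_nat m) = r" "scalar (1/2) = f"
        unfolding G_def p2 x_def r_def f_def by (simp_all add: p_def)
      have g1: "GEO p = (1 + p) * G" using g1 unfolding eq .
      have 1: "r * (- x - f * (p * x * ((1 + p) * G))) + f * r * ((p * x + p) * (1 - p) * G) + f * (r * (p * ((1 + p) * G))) = r * (p * G) - r * (x * G)"
        using f g2 by Groebner_Basis.algebra
      have 2: "- r * (- x - f * (p * x * ((1 + p) * G))) - f * r * ((p * x + p) * (1 - p) * G) + f * (r * (p * ((1 + p) * G))) = r * (p * p * G) + r * (x * G)"
        using f g2 by Groebner_Basis.algebra
      from \<kappa> show ?thesis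
      proof
        assume "\<kappa> = 1" then show ?thesis unfolding sc e eq g1 using 1 by simp
      next
        assume "\<kappa> = -1" then show ?thesis unfolding sc e eq g1 using 2 by (simp add: scalar_minus)
      qed
    qed
  qed
  also have "\<dots> = Psi \<kappa> S T" unfolding Psi_def tsum_diff tsum_scalar lser_def q_def by simp
  finally show ?thesis .
qed

lemma small_Ef: "small (Ef \<kappa> S T X k) k"
proof -
  have L: "small (if k = 0 then 0 else LOG1 ((S * T) ^ k)) k"
  proof -
    have "small (LOG1 ((S * T) ^ k)) k"
      unfolding LOG1_def
    proof (rule small_tsum)
      fix i show "small (scalar (1 / of_nat i) * ((S * T) ^ k) ^ i) k"
        by (cases "i = 0") (auto intro!: small_mult_right small_mono[OF small_power[OF qk]])
    qed
    then show ?thesis by simp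
  qed
  have E: "small (if even k then (T ^ k * S ^ (k div 2) - T ^ (k div 2)) * GEO ((S * T) ^ k) else 0) k"
    using Th[of k] Tk[of k] by (auto intro!: small_mult_left small_diff)
  have E2: "small (if even k then scalar (\<kappa> / of_nat k) * (((S * T) ^ (k div 2) * S ^ (k div 2) + (S * T) ^ (k div 2)) * (1 - (S * T) ^ (k div 2)) * GEO ((S * T) ^ k)) else 0) k"
  proof (cases "even k")
    case True
    have "small (((S * T) ^ (k div 2) * S ^ (k div 2) + (S * T) ^ (k div 2)) * (1 - (S * T) ^ (k div 2)) * GEO ((S * T) ^ k)) k"
      by (rule small_mult_left, rule small_mult_left, rule small_add, rule small_mult_left) (rule qh[OF True])+
    then show ?thesis using True by (simp add: small_mult_right)
  qed simp
  have A: "small (scalar (X\<^sup>2 / of_nat k) * (scalar (- \<kappa> / 2) * (T ^ k * GEO ((S * T) ^ k)))) k"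
    by (rule small_mult_right, rule small_mult_right, rule small_mult_left, rule Tk)
  have B: "small ((S * T) ^ k * GEO ((S * T) ^ k)) k" by (rule small_mult_left, rule qk)
  have C: "small (- (S ^ k) - scalar (1/2) * ((S * T) ^ k * S ^ k * GEO ((S * T) ^ k))) k"
    by (rule small_diff[OF small_minus[OF small_power1[OF S]] small_mult_right[OF small_mult_left[OF small_mult_left[OF qk]]]])
  show ?thesis unfolding Ef_def Let_def
    by (intro small_add A small_mult_right[OF small_add[OF B E]] small_mult_right[OF C] E2 small_mult_right[OF L])
qed

theorem tsum_Ef: "tsum (\<lambda>k. Ef \<kappa> S T (xj M j k) k) = Psi \<kappa> S T + Phi \<kappa> S T M j"
proof -
  have 1: "tsum (\<lambda>k. scalar ((xj M j k)\<^sup>2 / of_nat k) * (scalar (- \<kappa> / 2) * (T ^ k * GEO ((S * T) ^ k)))) =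
    - scalar (\<kappa> / 2) * (\<Sum>a\<in>{1..M}. \<Sum>b\<in>{1..M}. of_nat (gcd a b * j a * j b) * lser (T ^ lcm a b) ((S * T) ^ lcm a b))"
  proof -
    have "tsum (\<lambda>k. scalar ((xj M j k)\<^sup>2 / of_nat k) * (scalar (- \<kappa> / 2) * (T ^ k * GEO ((S * T) ^ k)))) =
      scalar (- \<kappa> / 2) * tsum (\<lambda>k. scalar ((xj M j k)\<^sup>2 / of_nat k) * (T ^ k * GEO ((S * T) ^ k)))"
      unfolding tsum_scalar[symmetric] by (simp only: mult.left_commute)
    also have "tsum (\<lambda>k. scalar ((xj M j k)\<^sup>2 / of_nat k) * (T ^ k * GEO ((S * T) ^ k))) =
      (\<Sum>a\<in>{1..M}. \<Sum>b\<in>{1..M}. of_nat (gcd a b * j a * j b) * lser (T ^ lcm a b) ((S * T) ^ lcm a b))"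
      unfolding lser_def power_mult[symmetric] by (rule tsum_xj_square) (intro small_mult_left Tk)
    finally show ?thesis by (simp add: scalar_minus)
  qed
  have 2: "tsum (\<lambda>k. scalar (xj M j k / of_nat k) * ((S * T) ^ k * GEO ((S * T) ^ k) + (if even k then (T ^ k * S ^ (k div 2) - T ^ (k div 2)) * GEO ((S * T) ^ k) else 0)))
    = (\<Sum>a\<in>{1..M}. of_nat (j a) * linS S T a)"
  proof -
    have "tsum (\<lambda>k. scalar (xj M j k / of_nat k) * ((S * T) ^ k * GEO ((S * T) ^ k) + (if even k then (T ^ k * S ^ (k div 2) - T ^ (k div 2)) * GEO ((S * T) ^ k) else 0)))
      = (\<Sum>a\<in>{1..M}. of_nat (j a) * tsum (\<lambda>m. scalar (1 / of_nat m) * ((S * T) ^ (a * m) * GEO ((S * T) ^ (a * m))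
      + (if even (a * m) then (T ^ (a * m) * S ^ (a * m div 2) - T ^ (a * m div 2)) * GEO ((S * T) ^ (a * m)) else 0))))"
    proof (rule tsum_xj)
      fix k show "small ((S * T) ^ k * GEO ((S * T) ^ k) + (if even k then (T ^ k * S ^ (k div 2) - T ^ (k div 2)) * GEO ((S * T) ^ k) else 0)) k"
        using Th[of k] Tk[of k] qk[of k] by (auto intro!: small_add small_mult_left small_diff)
    qed
    also have "\<dots> = (\<Sum>a\<in>{1..M}. of_nat (j a) * linS S T a)"
      by (rule sum.cong[OF refl]) (simp only: tsum_lin atLeastAtMost_iff)
    finally show ?thesis .
  qed
  have 3: "tsum (\<lambda>k. A k + B k + C k + scalar (1/2) * D k) = tsum A + tsum B + tsum C + scalar (1/2) * tsum D" for A B C D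
    by (simp only: tsum_add tsum_scalar)
  show ?thesis unfolding Ef_def Let_def 3 1 2 Phi_def tsum_constant_part[symmetric]
    by (simp only: diff_conv_add_uminus mult_minus_left add_ac)
qed

end

section \<open>Specialisation to the edge and vertex weights\<close>

definition s\<kappa> :: "rat \<Rightarrow> ser" where "s\<kappa> \<kappa> = scalar \<kappa> * var_s"
definition u\<kappa> :: "rat \<Rightarrow> ser" where "u\<kappa> \<kappa> = scalar (- \<kappa>) * var_t\<^sup>2"

lemma small_s\<kappa>: "small (s\<kappa> \<kappa>) 1" unfolding s\<kappa>_def by (intro small_mult_right small_s)
lemma small_u\<kappa>: "small (u\<kappa> \<kappa>) 2" unfolding u\<kappa>_def by (rule small_scalar_t_pow) simp

text \<open>Substitution of \<open>ah k^2 u^(2 k) = - \<kappa> k T^k\<close>,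
  \<open>bh k u^k = - T^(k/2)\<close> for even \<open>k\<close>, and
  \<open>ts k = \<kappa> S^k / k\<close>; the rest is algebra with \<kappa>^2 = 1. The subtracted
  \<open>ts\<close> comes from the first factor of \<open>Cs\<close>.\<close>

lemma Zs_eq:
  assumes k: "k \<ge> 1" and \<kappa>: "\<kappa> = 1 \<or> \<kappa> = -1"
  shows "Zs \<kappa> M j k - ts \<kappa> k = Ef \<kappa> (s\<kappa> \<kappa>) (u\<kappa> \<kappa>) (xj M j k) k"
proof -
  define S T where "S = s\<kappa> \<kappa>" and "T = u\<kappa> \<kappa>"
  define kp where "kp = scalar \<kappa>"
  define f where "f = scalar (1/2)"
  define r where "r = scalar (1 / of_nat k)"
  define n where "n = scalar (of_nat k)"
  define X where "X = scalar (xj M j k)"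
  have kk: "\<kappa> * \<kappa> = 1" using \<kappa> by auto
  have kp: "kp * kp = 1" unfolding kp_def scalar_mult[symmetric] kk by simp
  have ff: "f + f = 1" unfolding f_def scalar_add[symmetric] by simp
  have nr: "n * r = 1" using k unfolding n_def r_def scalar_mult[symmetric] by simp
  \<comment> \<open>\<kappa> is its own inverse.\<close>
  have pk: "\<kappa> ^ (m - 1) = \<kappa> * \<kappa> ^ m" "(- \<kappa>) ^ (m - 1) = - \<kappa> * (- \<kappa>) ^ m" if "m \<ge> 1" for m
    using that kk by (cases m; simp add: mult.assoc[symmetric] One_nat_def)+
  have ts: "ts \<kappa> m = scalar (1 / of_nat m) * (kp * S ^ m)" if "m \<ge> 1" for m
    unfolding ts_def pk(1)[OF that] S_def s\<kappa>_def power_mult_distrib kp_def scalar_power[symmetric] mult.assoc[symmetric] scalar_mult[symmetric]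
    by (simp add: mult_ac)
  have T: "T ^ m = scalar ((- \<kappa>) ^ m) * var_t ^ (2 * m)" for m
    unfolding T_def u\<kappa>_def power_mult_distrib scalar_power power_mult ..
  have ax: "scalar (ah \<kappa> k) * scalar (of_nat k) ^ 2 * (var_t ^ k)\<^sup>2 = - (kp * (n * T ^ k))"
  proof -
    have "scalar (ah \<kappa> k) * scalar (of_nat k) ^ 2 = scalar (- \<kappa> * of_nat k * (- \<kappa>) ^ k)"
      unfolding ah_def pk(2)[OF k] scalar_power[symmetric] scalar_mult[symmetric] using k by (simp add: power2_eq_square mult_ac)
    then have "scalar (ah \<kappa> k) * scalar (of_nat k) ^ 2 * (var_t ^ k)\<^sup>2 = scalar (- \<kappa> * of_nat k * (- \<kappa>) ^ k) * var_t ^ (2 * k)"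
      by (simp only: power_mult[symmetric] mult.commute[of k])
    then show ?thesis unfolding T kp_def n_def by (simp add: scalar_mult scalar_minus mult_ac)
  qed
  have bx: "scalar (bh \<kappa> k) * scalar (of_nat k) * var_t ^ k = (if even k then - (T ^ (k div 2)) else 0)"
  proof (cases "even k")
    case True
    then obtain h where h: "k = 2 * h" by blast
    then have h1: "h \<ge> 1" using k by simp
    have "bh \<kappa> k * of_nat k = - ((- \<kappa>) ^ h)"
      unfolding bh_def using True k kk by (simp add: h pk(2)[OF h1] mult.assoc[symmetric])
    then show ?thesis using True unfolding T by (simp add: h scalar_mult[symmetric] scalar_minus)
  qed (simp add: bh_def)
  have q: "(S * T) ^ k = - (kp * (n * T ^ k)) * (- ts \<kappa> k)"
  proof -
    have "- (kp * (n * T ^ k)) * (- ts \<kappa> k) = (kp * kp) * (n * r) * (S ^ k * T ^ k)"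
      unfolding ts[OF k] r_def[symmetric] by (simp add: mult_ac)
    then show ?thesis unfolding kp nr by (auto simp: power_mult_distrib)
  qed
  \<comment> \<open>The product of the two quadratic coefficients, on which the denominator of
    Mehler's formula depends, becomes the base of the q-Pochhammer symbols.\<close>
  have qac: "scalar (ah \<kappa> k) * scalar (of_nat k) ^ 2 * - ts \<kappa> k * (var_t ^ k)\<^sup>2 = (S * T) ^ k"
    unfolding q ax[symmetric] by (simp only: mult_ac)
  define d where "d = ds \<kappa> M j k"
  define G where "G = GEO ((S * T) ^ k)"
  define b where "b = scalar (bh \<kappa> k) * scalar (of_nat k) * var_t ^ k"
  define LL where "LL = scalar (1/2) * LOG1 ((S * T) ^ k)"
  have Z: "Zs \<kappa> M j k = (b * d + f * (- (kp * (n * T ^ k)) * d\<^sup>2 - r * (kp * S ^ k) * b\<^sup>2)) * G + LL"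
  proof -
    have "(scalar (ah \<kappa> k) * scalar (of_nat k) ^ 2 * d\<^sup>2 + - ts \<kappa> k * (scalar (bh \<kappa> k) * scalar (of_nat k))\<^sup>2) * (var_t ^ k)\<^sup>2
      = (scalar (ah \<kappa> k) * scalar (of_nat k) ^ 2 * (var_t ^ k)\<^sup>2) * d\<^sup>2 - r * (kp * S ^ k) * b\<^sup>2"
      unfolding ts[OF k] r_def[symmetric] b_def power_mult_distrib by (simp add: algebra_simps)
    then have e: "scalar (1/2) * (scalar (ah \<kappa> k) * scalar (of_nat k) ^ 2 * d\<^sup>2 + - ts \<kappa> k * (scalar (bh \<kappa> k) * scalar (of_nat k))\<^sup>2) * (var_t ^ k)\<^sup>2
      = f * (- (kp * (n * T ^ k)) * d\<^sup>2 - r * (kp * S ^ k) * b\<^sup>2)"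
      unfolding ax f_def by (simp only: mult.assoc)
    have e2: "scalar (bh \<kappa> k) * scalar (of_nat k) * d * var_t ^ k = b * d" unfolding b_def by (simp only: mult_ac)
    show ?thesis unfolding Zs_def Let_def d_def[symmetric] qac e e2 G_def[symmetric] LL_def ..
  qed
  have sc: "scalar ((xj M j k)\<^sup>2 / of_nat k) = X * X * r" "scalar (xj M j k / of_nat k) = X * r" "scalar (\<kappa> / of_nat k) = kp * r"
    "scalar (- \<kappa> / 2) = - (kp * f)" "scalar (1/2) = f"
    unfolding X_def r_def kp_def f_def by (simp_all add: power2_eq_square scalar_minus[symmetric] scalar_mult[symmetric])
  have k0: "k \<noteq> 0" using k by simp
  show ?thesis
  proof (cases "even k")
    case True
    then obtain h where h: "k = 2 * h" by blast
    then have h1: "h \<ge> 1" using k by simp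
    have hd: "k div 2 = h" using h by simp
    define P R where "P = T ^ h" and "R = S ^ h"
    have PR: "T ^ k = P * P" "S ^ k = R * R" "(S * T) ^ k = (P * R) * (P * R)" "(S * T) ^ h = P * R"
    proof -
      have sq: "X ^ (2 * h) = X ^ h * X ^ h" for X :: ser by (simp only: mult_2 power_add)
      show "T ^ k = P * P" "S ^ k = R * R" "(S * T) ^ k = (P * R) * (P * R)" "(S * T) ^ h = P * R"
        unfolding P_def R_def h sq power_mult_distrib by (simp_all only: mult_ac)
    qed
    have "f * ts \<kappa> h = r * (kp * R)"
      unfolding ts[OF h1] R_def r_def f_def mult.assoc[symmetric] scalar_mult[symmetric] by (simp add: h)
    then have d: "d = X * r - r * (kp * (R * R)) - r * (kp * R)"
      unfolding d_def ds_def ts[OF k] sc hd r_def[symmetric] PR using True by simp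
    have b: "b = - P" unfolding b_def bx hd P_def using True by simp
    have "(b * d + f * (- (kp * (n * (P * P))) * d\<^sup>2 - r * (kp * (R * R)) * b\<^sup>2)) * G + LL - r * (kp * (R * R)) =
      X * X * r * (- (kp * f) * (P * P * G)) + X * r * (P * R * (P * R) * G + (P * P * R - P) * G)
      + (kp * r * (- (R * R) - f * (P * R * (P * R) * (R * R) * G)) + kp * r * ((P * R * R + P * R) * (1 - P * R) * G)) + LL"
      unfolding d b power2_eq_square using kp nr ff by Groebner_Basis.algebra
    then show ?thesis
      unfolding Z Ef_def Let_def S_def[symmetric] T_def[symmetric] G_def[symmetric] LL_def[symmetric] hd sc(1-4) ts[OF k] r_def[symmetric]
      using True k0 by (simp only: if_True if_False PR P_def[symmetric] R_def[symmetric] LL_def sc(5))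
  next
    case False
    have d: "d = X * r - r * (kp * S ^ k)"
      unfolding d_def ds_def ts[OF k] sc r_def[symmetric] using False by simp
    have b: "b = 0" unfolding b_def bx using False by simp
    define R P where "R = S ^ k" and "P = T ^ k"
    have "(b * d + f * (- (kp * (n * P)) * d\<^sup>2 - r * (kp * R) * b\<^sup>2)) * G + LL - r * (kp * R) =
      X * X * r * (- (kp * f) * (P * G)) + X * r * (R * P * G + 0)
      + (kp * r * (- R - f * (R * P * R * G)) + 0) + LL"
      unfolding d b power2_eq_square R_def[symmetric] using kp nr ff by Groebner_Basis.algebra
    then show ?thesis
      unfolding Z Ef_def Let_def S_def[symmetric] T_def[symmetric] G_def[symmetric] LL_def[symmetric] sc(1-4) ts[OF k] r_def[symmetric]
      using False k0 by (simp only: if_False P_def[symmetric] R_def[symmetric] LL_def sc(5) power_mult_distrib)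
  qed
qed

lemma Ef_0: "Ef \<kappa> S T X 0 = 0"
  by (simp add: Ef_def)

text \<open>The terms of the exponent with index above \<open>M\<close> have order above
  \<open>M\<close>, so the finite sum may be replaced by the full one, which has a closed
  form.\<close>

theorem cf_Cs_EXP:
  assumes \<kappa>: "\<kappa> = 1 \<or> \<kappa> = -1" and vn: "v + n \<le> M"
  shows "cf (Cs \<kappa> M j * EXP (\<Sum>k\<in>{1..M}. Zs \<kappa> M j k)) v n =
    cf ((\<Prod>a\<in>{1..M}. scalar (1 / (fact (j a) * (\<kappa> * of_nat a) ^ j a)) * s\<kappa> \<kappa> ^ (a * j a))
       * EXP (Psi \<kappa> (s\<kappa> \<kappa>) (u\<kappa> \<kappa>) + Phi \<kappa> (s\<kappa> \<kappa>) (u\<kappa> \<kappa>) M j)) v n"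
proof -
  let ?E = "\<lambda>k. Ef \<kappa> (s\<kappa> \<kappa>) (u\<kappa> \<kappa>) (xj M j k) k"
  let ?A = "\<Prod>a\<in>{1..M}. scalar (1 / fact (j a)) * ts \<kappa> a ^ j a"
  have sT: "small (- (\<Sum>a\<in>{1..M}. ts \<kappa> a)) 1" by (intro small_minus small_sum small_ts) auto
  have sZ: "small (\<Sum>k\<in>{1..M}. Zs \<kappa> M j k) 1" by (intro small_sum small_Zs) auto
  have sE: "small (?E k) k" for k by (rule small_Ef[OF small_s\<kappa> small_u\<kappa> \<kappa>])
  have sE1: "small (?E k) 1" for k using small_mono[OF sE, of 1 k] by (cases "k = 0") (auto simp: Ef_0)
  have "- (\<Sum>a\<in>{1..M}. ts \<kappa> a) + (\<Sum>k\<in>{1..M}. Zs \<kappa> M j k) = (\<Sum>k\<in>{1..M}. ?E k)"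
  proof -
    have "(\<Sum>k\<in>{1..M}. Zs \<kappa> M j k - ts \<kappa> k) = (\<Sum>k\<in>{1..M}. ?E k)"
      by (rule sum.cong[OF refl]) (rule Zs_eq[OF _ \<kappa>], simp)
    then show ?thesis by (simp add: sum_subtractf)
  qed
  then have "Cs \<kappa> M j * EXP (\<Sum>k\<in>{1..M}. Zs \<kappa> M j k) = ?A * EXP (\<Sum>k\<in>{1..M}. ?E k)"
    unfolding Cs_def using EXP_add[OF sT sZ] by (simp add: mult_ac)
  also have "cf \<dots> v n = cf (?A * EXP (tsum ?E)) v n"
  proof (rule cf_EXP_cong[OF _ _ _ vn])
    show "small (\<Sum>k\<in>{1..M}. ?E k) 1" by (intro small_sum sE1)
    show "small (tsum ?E) 1" by (rule small_tsum) (rule sE1)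
    show "small ((\<Sum>k\<in>{1..M}. ?E k) - tsum ?E) (Suc M)"
    proof (rule smallI)
      fix w m assume "w + m < Suc M"
      then have "cf (tsum ?E) w m = (\<Sum>k\<le>M. cf (?E k) w m)" by (intro cf_tsum_ge sE) simp
      also have "\<dots> = (\<Sum>k\<in>{1..M}. cf (?E k) w m)"
        by (rule sum.mono_neutral_right) (auto simp: Ef_0 not_le One_nat_def)
      finally show "cf ((\<Sum>k\<in>{1..M}. ?E k) - tsum ?E) w m = 0" by (simp add: cf_sum)
    qed
  qed
  also have "tsum ?E = Psi \<kappa> (s\<kappa> \<kappa>) (u\<kappa> \<kappa>) + Phi \<kappa> (s\<kappa> \<kappa>) (u\<kappa> \<kappa>) M j"
    by (rule tsum_Ef[OF small_s\<kappa> small_u\<kappa> \<kappa>])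
  also have "?A = (\<Prod>a\<in>{1..M}. scalar (1 / (fact (j a) * (\<kappa> * of_nat a) ^ j a)) * s\<kappa> \<kappa> ^ (a * j a))"
  proof (rule prod.cong[OF refl])
    fix a assume "a \<in> {1..M}"
    then have a: "a \<ge> 1" by simp
    have kk: "\<kappa> * \<kappa> = 1" using \<kappa> by auto
    have "\<kappa> ^ (a - 1) = \<kappa> ^ a / \<kappa>" using a \<kappa> by (cases a) auto
    then have "ts \<kappa> a = scalar (1 / (\<kappa> * of_nat a)) * s\<kappa> \<kappa> ^ a"
      unfolding ts_def s\<kappa>_def power_mult_distrib scalar_power[symmetric] mult.assoc[symmetric] scalar_mult[symmetric] by simp
    then have "scalar (1 / fact (j a)) * ts \<kappa> a ^ j a = scalar (1 / fact (j a) * (1 / (\<kappa> * of_nat a)) ^ j a) * s\<kappa> \<kappa> ^ (a * j a)"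
      by (simp only: power_mult_distrib scalar_mult scalar_power power_mult mult.assoc)
    then show "scalar (1 / fact (j a)) * ts \<kappa> a ^ j a = scalar (1 / (fact (j a) * (\<kappa> * of_nat a) ^ j a)) * s\<kappa> \<kappa> ^ (a * j a)"
      by (simp add: power_divide)
  qed
  finally show ?thesis .
qed

section \<open>Infinite products\<close>

lemma tendsto_fpsI:
  assumes "\<And>N. \<forall>\<^sub>F x in F. \<forall>n<N. fps_nth (f x) n = fps_nth p n" shows "(f \<longlongrightarrow> p) F"
proof (rule topological_tendstoI)
  fix A :: "'b fps set" assume "open A" "p \<in> A"
  then obtain n where n: "{G. fps_cutoff n G = fps_cutoff n p} \<subseteq> A" unfolding open_fps_iff by blast
  show "\<forall>\<^sub>F x in F. f x \<in> A"
    using assms[of n]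
  proof (rule eventually_mono)
    fix x assume "\<forall>k<n. fps_nth (f x) k = fps_nth p k"
    then have "fps_cutoff n (f x) = fps_cutoff n p" by (simp add: fps_eq_iff)
    then show "f x \<in> A" using n by blast
  qed
qed

text \<open>Order in \<open>s\<close> alone: the measure of convergence in the metric in which the
  products and sums of the theorem are taken.\<close>

definition s_ord :: "nat \<Rightarrow> ser \<Rightarrow> bool" where "s_ord d F \<longleftrightarrow> (\<forall>v<d. fps_nth F v = 0)"

lemma s_ord_mult: "s_ord d F \<Longrightarrow> s_ord d (F * G)"
  by (simp add: s_ord_def fps_mult_nth)

lemma s_ord_mult': "s_ord d G \<Longrightarrow> s_ord d (F * G)"
  using s_ord_mult[of d G F] by (simp add: mult.commute)

lemma s_ord_mono: "s_ord d F \<Longrightarrow> d' \<le> d \<Longrightarrow> s_ord d' F"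
  by (simp add: s_ord_def)

lemma s_ord_power: "fps_nth q 0 = 0 \<Longrightarrow> s_ord n (q ^ n)"
  by (simp add: s_ord_def startsby_zero_power_prefix)

lemma s_ord_tsum: "(\<And>i. s_ord d (f i)) \<Longrightarrow> s_ord d (tsum f)"
  by (simp add: s_ord_def tsum_def fps_eq_iff)

lemma s_ord_minus: "s_ord d F \<Longrightarrow> s_ord d (- F)"
  by (simp add: s_ord_def)

text \<open>The logarithm of the functional equation
  \<open>(a, q) = (1 - a) (a q, q)\<close>.\<close>

lemma lser_shift: assumes a: "small a 1" and q: "small q 1"
  shows "lser a q = LOG1 a + lser (a * q) q"
proof -
  have "scalar (1 / of_nat m) * (a ^ m * GEO (q ^ m)) = scalar (1 / of_nat m) * a ^ m + scalar (1 / of_nat m) * ((a * q) ^ m * GEO (q ^ m))" for m :: nat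
  proof (cases "m = 0")
    case False
    then have "(1 - q ^ m) * GEO (q ^ m) = 1" using GEO[OF small_power_ge1[OF q, of m]] by simp
    then have "GEO (q ^ m) = 1 + q ^ m * GEO (q ^ m)" by (simp add: algebra_simps)
    then show ?thesis unfolding power_mult_distrib by (metis (no_types, lifting) distrib_left mult.assoc mult.right_neutral)
  qed simp
  then show ?thesis unfolding lser_def LOG1_def tsum_add[symmetric] by simp
qed

text \<open>Iterating the functional equation splits off the first \<open>n\<close> factors. The
  exponent that remains is divisible by \<open>q^n\<close>, hence by \<open>s^n\<close>, so the
  partial products agree with the exponential in all low powers of \<open>s\<close>.\<close>

lemma qpoch_eq:
  assumes a: "small a 1" and q: "small q 1" and q0: "fps_nth q 0 = 0"
  shows "qpoch a q = EXP (- lser a q)"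
proof -
  have sm: "small (a * q ^ n) 1" for n by (rule small_mult_left[OF a])
  have iter: "EXP (- lser a q) = (\<Prod>k<n. 1 - a * q ^ k) * EXP (- lser (a * q ^ n) q)" for n
  proof (induct n)
    case (Suc n)
    have "- lser (a * q ^ n) q = - LOG1 (a * q ^ n) + - lser (a * q ^ Suc n) q"
      using lser_shift[OF sm[of n] q] by (simp add: mult_ac)
    then have "EXP (- lser (a * q ^ n) q) = EXP (- LOG1 (a * q ^ n)) * EXP (- lser (a * q ^ Suc n) q)"
      by (simp only: EXP_add[OF small_minus[OF small_LOG1[OF sm]] small_minus[OF small_lser[OF sm]]])
    then show ?case using Suc by (simp only: EXP_LOG1[OF sm] prod.lessThan_Suc mult.assoc)
  qed simp
  have ord: "s_ord n (lser (a * q ^ n) q)" for n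
    unfolding lser_def
  proof (rule s_ord_tsum)
    fix m show "s_ord n (scalar (1 / of_nat m) * ((a * q ^ n) ^ m * GEO (q ^ m)))"
    proof (cases "m = 0")
      case False
      have "s_ord n (q ^ (n * m))" using s_ord_mono[OF s_ord_power[OF q0, of "n * m"], of n] False by simp
      then show ?thesis unfolding power_mult_distrib power_mult[symmetric] by (intro s_ord_mult' s_ord_mult)
    qed (simp add: s_ord_def)
  qed
  have agree: "fps_nth (\<Prod>k\<le>n. 1 - a * q ^ k) v = fps_nth (EXP (- lser a q)) v" if "v \<le> n" for n v
  proof -
    let ?P = "\<Prod>k\<le>n. 1 - a * q ^ k" and ?Z = "- lser (a * q ^ Suc n) q"
    obtain Y where "EXP ?Z = 1 + ?Z * Y" using EXP_eq_1_plus[OF small_minus[OF small_lser[OF sm]]] by blast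
    then have "EXP (- lser a q) = ?P + ?P * (?Z * Y)"
      using iter[of "Suc n"] by (simp only: lessThan_Suc_atMost distrib_left mult.right_neutral)
    moreover have "s_ord (Suc n) (?P * (?Z * Y))" by (intro s_ord_mult' s_ord_mult s_ord_minus ord)
    ultimately show ?thesis using that by (simp add: s_ord_def)
  qed
  \<comment> \<open>Convergence of an infinite product includes a nonzero limit, which an
    exponential always is.\<close>
  have "(\<lambda>k. 1 - a * q ^ k) has_prod EXP (- lser a q)"
    unfolding has_prod_def raw_has_prod_def
  proof (intro disjI1 conjI EXP_nonzero tendsto_fpsI)
    fix N show "\<forall>\<^sub>F n in sequentially. \<forall>v<N. fps_nth (\<Prod>i\<le>n. 1 - a * q ^ (i + 0)) v = fps_nth (EXP (- lser a q)) v"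
      using eventually_ge_at_top[of N] by (rule eventually_mono) (auto intro: agree)
  qed
  then show ?thesis unfolding qpoch_def by (rule has_prod_unique[symmetric])
qed

text \<open>Square roots in an integral domain are unique up to sign, and constant coefficient 1
  rules out the negative one.\<close>

lemma half_pow_EXP:
  assumes Z: "small Z 1" shows "half_pow (EXP Z) n = EXP (scalar (of_nat n / 2) * Z)"
proof -
  let ?G = "EXP (scalar (of_nat n / 2) * Z)"
  have e: "of_nat 2 * (scalar (of_nat n / 2) * Z) = of_nat n * Z"
    unfolding of_nat_ser mult.assoc[symmetric] scalar_mult[symmetric] by simp
  have sq: "?G\<^sup>2 = EXP Z ^ n"
    using EXP_of_nat_mult[OF small_mult_right[OF Z], of 2 "scalar (of_nat n / 2)"] EXP_of_nat_mult[OF Z, of n] by (simp only: e)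
  show ?thesis unfolding half_pow_def
  proof (rule the_equality)
    show "?G\<^sup>2 = EXP Z ^ n \<and> cf ?G 0 0 = 1" using sq by simp
    fix H assume H: "H\<^sup>2 = EXP Z ^ n \<and> cf H 0 0 = 1"
    then have "H = ?G \<or> H = - ?G" using sq by (simp add: power2_eq_iff[symmetric])
    then show "H = ?G" using H by (auto simp: fps_neg_nth)
  qed
qed

text \<open>The coefficients are themselves series in \<open>t\<close>, so division requires the
  coefficient of \<open>s^0\<close> to be a unit there; for an exponential it has constant term
  1.\<close>

lemma EXP_divide:
  assumes "small Y 1" "small Z 1" shows "EXP Y / EXP Z = EXP (Y - Z)"
proof -
  define c where "c = fps_nth (EXP Z) 0"
  have c: "fps_nth c 0 \<noteq> 0" unfolding c_def by simp
  have sd: "subdegree (EXP Z) = 0" using c unfolding c_def by (intro subdegree_eq_0) (metis fps_zero_nth)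
  have cc: "inverse c * c = 1" using c by (rule inverse_mult_eq_1)
  have "inverse (EXP Z) * EXP Z = 1"
    unfolding fps_inverse_def[symmetric]
    using fps_left_inverse'[of "inverse c" "EXP Z" "inverse c"] cc
    by (simp add: c_def mult.commute fps_inverse_def)
  moreover have "EXP Y / EXP Z = EXP Y * inverse (EXP Z)" unfolding fps_divide_def by (simp add: sd)
  ultimately have "EXP Y / EXP Z * EXP Z = EXP Y" by (simp add: mult.assoc)
  then have "EXP Y / EXP Z * EXP Z = EXP (Y - Z) * EXP Z" using EXP_diff[OF assms] by simp
  then show ?thesis using EXP_nonzero[of Z] by simp
qed

lemma inverse_EXP: "small Z 1 \<Longrightarrow> 1 / EXP Z = EXP (- Z)"
  using EXP_divide[of 0 Z] by simp

lemma prod_pos_finite: assumes "\<And>\<alpha>. \<alpha> > M \<Longrightarrow> f \<alpha> = 1" shows "prod_pos f = (\<Prod>\<alpha>\<in>{1..M}. f \<alpha>)"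
proof -
  have "(\<lambda>n. f (Suc n)) has_prod (\<Prod>n\<in>{..<M}. f (Suc n))" by (rule has_prod_finite) (auto intro: assms)
  then have "prod_pos f = (\<Prod>n\<in>{..<M}. f (Suc n))" unfolding prod_pos_def by (rule has_prod_unique[symmetric])
  also have "\<dots> = (\<Prod>\<alpha>\<in>Suc ` {..<M}. f \<alpha>)" by (subst prod.reindex) auto
  also have "Suc ` {..<M} = {1..M}" unfolding image_Suc_lessThan One_nat_def ..
  finally show ?thesis .
qed

text \<open>The common form of both summands: \<open>\<kappa> = 1\<close>, \<open>S = s\<close>, \<open>T = - t\<close> in the even case and \<open>\<kappa> = -1\<close>, \<open>S = - s\<close>, \<open>T = t\<close>
  in the odd case, with \<open>H F n\<close> standing for \<open>F\<close> to the power \<open>\<kappa> n / 2\<close>.\<close>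

definition gsum :: "rat \<Rightarrow> ser \<Rightarrow> ser \<Rightarrow> (ser \<Rightarrow> nat \<Rightarrow> ser) \<Rightarrow> (nat \<Rightarrow> nat) \<Rightarrow> ser" where
  "gsum \<kappa> S T H j =
     prod_pos (\<lambda>\<alpha>.
       S ^ (\<alpha> * j \<alpha>) * scalar (1 / (fact (j \<alpha>) * (\<kappa> * of_nat \<alpha>) ^ j \<alpha>))
       * (1 / qpoch ((S * T) ^ \<alpha>) ((S * T) ^ \<alpha>) ^ j \<alpha>)
       * half_pow (qpoch (T ^ (2 * \<alpha> - 1)) ((S * T) ^ (4 * \<alpha> - 2))
                   / qpoch (S ^ (2 * \<alpha> - 1) * T ^ (4 * \<alpha> - 2)) ((S * T) ^ (4 * \<alpha> - 2)))
           (j (2 * \<alpha> - 1))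
       * (qpoch (T ^ \<alpha>) ((S * T) ^ (2 * \<alpha>))
          / qpoch (S ^ \<alpha> * T ^ (2 * \<alpha>)) ((S * T) ^ (2 * \<alpha>))) ^ j (2 * \<alpha>))
     * prod_pos (\<lambda>\<alpha>. prod_pos (\<lambda>\<beta>.
         H (qpoch (T ^ lcm \<alpha> \<beta>) ((S * T) ^ lcm \<alpha> \<beta>)) (gcd \<alpha> \<beta> * j \<alpha> * j \<beta>)))"

text \<open>The factor of index \<alpha> in the theorem involves both
  \<open>j (2 * \<alpha> - 1)\<close> and \<open>j (2 * \<alpha>)\<close>; together these run
  through every index once.\<close>

lemma sum_odd_even:
  fixes A :: "nat \<Rightarrow> 'a::comm_monoid_add"
  assumes "\<And>a. a > M \<Longrightarrow> A a = 0"
  shows "(\<Sum>\<alpha>\<in>{1..M}. A (2 * \<alpha> - 1) + A (2 * \<alpha>)) = (\<Sum>a\<in>{1..M}. A a)"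
proof -
  have "(\<Sum>\<alpha>\<in>{1..n}. A (2 * \<alpha> - 1) + A (2 * \<alpha>)) = (\<Sum>a\<in>{1..2 * n}. A a)" for n
    by (induct n) (simp_all add: One_nat_def add.assoc)
  then have "(\<Sum>\<alpha>\<in>{1..M}. A (2 * \<alpha> - 1) + A (2 * \<alpha>)) = (\<Sum>a\<in>{1..2 * M}. A a)" .
  also have "\<dots> = (\<Sum>a\<in>{1..M}. A a)" by (rule sum.mono_neutral_right) (auto intro: assms)
  finally show ?thesis .
qed

context
  fixes S T :: ser
  assumes S: "small S 1" and T: "small T 1" and S0: "fps_nth S 0 = 0"
begin

lemma qpoch_pow: "small a 1 \<Longrightarrow> m \<ge> 1 \<Longrightarrow> qpoch a ((S * T) ^ m) = EXP (- lser a ((S * T) ^ m))"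
  by (rule qpoch_eq) (auto intro!: small_power_ge1 small_mult_left S simp: S0 fps_nth_power_0 fps_mult_nth_0)

lemma small_linS: "a \<ge> 1 \<Longrightarrow> small (linS S T a) 1"
proof -
  assume a: "a \<ge> 1"
  have h: "even a \<Longrightarrow> a div 2 \<ge> 1" using a by auto
  show ?thesis unfolding linS_def
    using a h by (auto intro!: small_add small_diff small_mult_right[of _ _ "scalar _"] small_lser small_power_ge1 small_mult_left[of _ _ T] small_mult_left[of "_ ^ _"] S T simp del: power_mult_distrib)
qed

lemma gsum_factor:
  assumes \<alpha>: "\<alpha> \<ge> 1"
  shows "S ^ (\<alpha> * j \<alpha>) * c * (1 / qpoch ((S * T) ^ \<alpha>) ((S * T) ^ \<alpha>) ^ j \<alpha>)
       * half_pow (qpoch (T ^ (2 * \<alpha> - 1)) ((S * T) ^ (4 * \<alpha> - 2))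
                   / qpoch (S ^ (2 * \<alpha> - 1) * T ^ (4 * \<alpha> - 2)) ((S * T) ^ (4 * \<alpha> - 2))) (j (2 * \<alpha> - 1))
       * (qpoch (T ^ \<alpha>) ((S * T) ^ (2 * \<alpha>)) / qpoch (S ^ \<alpha> * T ^ (2 * \<alpha>)) ((S * T) ^ (2 * \<alpha>))) ^ j (2 * \<alpha>)
     = c * S ^ (\<alpha> * j \<alpha>) * EXP (of_nat (j \<alpha>) * lser ((S * T) ^ \<alpha>) ((S * T) ^ \<alpha>)
        + (of_nat (j (2 * \<alpha> - 1)) * (linS S T (2 * \<alpha> - 1) - lser ((S * T) ^ (2 * \<alpha> - 1)) ((S * T) ^ (2 * \<alpha> - 1)))
         + of_nat (j (2 * \<alpha>)) * (linS S T (2 * \<alpha>) - lser ((S * T) ^ (2 * \<alpha>)) ((S * T) ^ (2 * \<alpha>)))))"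
proof -
  define L where "L = lser ((S * T) ^ \<alpha>) ((S * T) ^ \<alpha>)"
  define b where "b = 2 * \<alpha> - 1"
  have b: "4 * \<alpha> - 2 = 2 * b" "b \<ge> 1" "odd b" "2 * b \<ge> 1" "2 * \<alpha> \<ge> 1" using \<alpha> unfolding b_def by auto
  define L1 where "L1 = lser (T ^ b) ((S * T) ^ (2 * b))"
  define L2 where "L2 = lser (S ^ b * T ^ (2 * b)) ((S * T) ^ (2 * b))"
  define L3 where "L3 = lser (T ^ \<alpha>) ((S * T) ^ (2 * \<alpha>))"
  define L4 where "L4 = lser (S ^ \<alpha> * T ^ (2 * \<alpha>)) ((S * T) ^ (2 * \<alpha>))"
  have st: "small (S * T) 1" by (rule small_mult_left[OF S])
  have a: "small ((S * T) ^ \<alpha>) 1" "small (T ^ b) 1" "small (S ^ b * T ^ (2 * b)) 1" "small (T ^ \<alpha>) 1" "small (S ^ \<alpha> * T ^ (2 * \<alpha>)) 1"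
    by (rule small_power_ge1[OF st \<alpha>] small_power_ge1[OF T b(2)] small_power_ge1[OF T \<alpha>]
      small_mult_left[OF small_power_ge1[OF S b(2)]] small_mult_left[OF small_power_ge1[OF S \<alpha>]])+
  have L: "small L 1" "small L1 1" "small L2 1" "small L3 1" "small L4 1"
    unfolding L_def L1_def L2_def L3_def L4_def by (rule small_lser[OF a(1)] small_lser[OF a(2)] small_lser[OF a(3)] small_lser[OF a(4)] small_lser[OF a(5)])+
  have q: "qpoch ((S * T) ^ \<alpha>) ((S * T) ^ \<alpha>) = EXP (- L)" "qpoch (T ^ b) ((S * T) ^ (2 * b)) = EXP (- L1)"
    "qpoch (S ^ b * T ^ (2 * b)) ((S * T) ^ (2 * b)) = EXP (- L2)" "qpoch (T ^ \<alpha>) ((S * T) ^ (2 * \<alpha>)) = EXP (- L3)"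
    "qpoch (S ^ \<alpha> * T ^ (2 * \<alpha>)) ((S * T) ^ (2 * \<alpha>)) = EXP (- L4)"
    unfolding L_def L1_def L2_def L3_def L4_def
    by (rule qpoch_pow[OF a(1) \<alpha>] qpoch_pow[OF a(2) b(4)] qpoch_pow[OF a(3) b(4)] qpoch_pow[OF a(4) b(5)] qpoch_pow[OF a(5) b(5)])+
  have l1: "linS S T b - lser ((S * T) ^ b) ((S * T) ^ b) = scalar (1/2) * (L2 - L1)"
    unfolding linS_def L1_def L2_def using b(3) by simp
  have l2: "linS S T (2 * \<alpha>) - lser ((S * T) ^ (2 * \<alpha>)) ((S * T) ^ (2 * \<alpha>)) = L4 - L3"
    unfolding linS_def L3_def L4_def by simp
  have sn: "small (of_nat n * Z) 1" if "small Z 1" for n Z by (rule small_mult_right[OF that])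
  have f1: "1 / EXP (- L) ^ j \<alpha> = EXP (of_nat (j \<alpha>) * L)"
    unfolding EXP_of_nat_mult[OF small_minus[OF L(1)], symmetric] inverse_EXP[OF sn[OF small_minus[OF L(1)]]] by simp
  have "scalar (of_nat (j b) / 2) * (- L1 - - L2) = of_nat (j b) * (scalar (1/2) * (L2 - L1))"
  proof -
    have "scalar (of_nat (j b) / 2) = of_nat (j b) * scalar (1/2)" unfolding of_nat_ser scalar_mult[symmetric] by simp
    then show ?thesis by (simp add: mult.assoc)
  qed
  then have f2: "half_pow (EXP (- L1) / EXP (- L2)) (j b) = EXP (of_nat (j b) * (scalar (1/2) * (L2 - L1)))"
    unfolding EXP_divide[OF small_minus[OF L(2)] small_minus[OF L(3)]] half_pow_EXP[OF small_diff[OF small_minus[OF L(2)] small_minus[OF L(3)]]]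
    by (rule arg_cong[where f=EXP])
  have f3: "(EXP (- L3) / EXP (- L4)) ^ j (2 * \<alpha>) = EXP (of_nat (j (2 * \<alpha>)) * (L4 - L3))"
    unfolding EXP_divide[OF small_minus[OF L(4)] small_minus[OF L(5)]] EXP_of_nat_mult[OF small_diff[OF small_minus[OF L(4)] small_minus[OF L(5)]], symmetric] by simp
  have E: "EXP (of_nat (j \<alpha>) * L + (of_nat (j b) * (scalar (1/2) * (L2 - L1)) + of_nat (j (2 * \<alpha>)) * (L4 - L3)))
      = EXP (of_nat (j \<alpha>) * L) * (EXP (of_nat (j b) * (scalar (1/2) * (L2 - L1))) * EXP (of_nat (j (2 * \<alpha>)) * (L4 - L3)))"
    by (simp only: EXP_add[OF sn[OF L(1)] small_add[OF sn[OF small_mult_right[OF small_diff[OF L(3) L(2)]]] sn[OF small_diff[OF L(5) L(4)]]]]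
      EXP_add[OF sn[OF small_mult_right[OF small_diff[OF L(3) L(2)]]] sn[OF small_diff[OF L(5) L(4)]]])
  show ?thesis unfolding b(1) b_def[symmetric] L_def[symmetric] q l1 l2 f1 f2 f3 E by (simp only: mult_ac)
qed

text \<open>Beyond the support of \<open>j\<close> every factor is 1, so all products are finite and
  the logarithms of the q-Pochhammer symbols can be added.\<close>

theorem gsum_eq:
  assumes H: "\<And>Z n. small Z 1 \<Longrightarrow> H (EXP Z) n = EXP (scalar (\<kappa> * of_nat n / 2) * Z)"
    and j: "\<And>\<alpha>. \<alpha> > M \<Longrightarrow> j \<alpha> = 0"
  shows "gsum \<kappa> S T H j = (\<Prod>a\<in>{1..M}. scalar (1 / (fact (j a) * (\<kappa> * of_nat a) ^ j a)) * S ^ (a * j a)) * EXP (Phi \<kappa> S T M j)"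
proof -
  let ?I = "{1..M}"
  define Lq where "Lq a = lser ((S * T) ^ a) ((S * T) ^ a)" for a
  define B where "B a = linS S T a - Lq a" for a
  define c where "c a = scalar (1 / (fact (j a) * (\<kappa> * of_nat a) ^ j a))" for a
  define E where "E a = of_nat (j a) * Lq a + (of_nat (j (2 * a - 1)) * B (2 * a - 1) + of_nat (j (2 * a)) * B (2 * a))" for a
  define Q where "Q a b = scalar (\<kappa> * of_nat (gcd a b * j a * j b) / 2) * (- lser (T ^ lcm a b) ((S * T) ^ lcm a b))" for a b
  have st: "small (S * T) 1" by (rule small_mult_left[OF S])
  have sLq: "small (Lq a) 1" if "a \<ge> 1" for a unfolding Lq_def by (rule small_lser[OF small_power_ge1[OF st that]])
  have sB: "small (B a) 1" if "a \<ge> 1" for a unfolding B_def by (rule small_diff[OF small_linS[OF that] sLq[OF that]])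
  have sE: "small (E a) 1" if "a \<in> ?I" for a
    unfolding E_def using that by (intro small_add small_mult_right sLq sB) auto
  have lcm1: "lcm a b \<ge> 1" if "a \<ge> 1" "b \<ge> 1" for a b :: nat using that by (simp add: Suc_le_eq lcm_pos_nat One_nat_def)
  have sl: "small (- lser (T ^ lcm a b) ((S * T) ^ lcm a b)) 1" if "a \<ge> 1" "b \<ge> 1" for a b
    by (rule small_minus[OF small_lser[OF small_power_ge1[OF T lcm1[OF that]]]])
  have sQ: "small (Q a b) 1" if "a \<ge> 1" "b \<ge> 1" for a b unfolding Q_def by (rule small_mult_right[OF sl[OF that]])
  have Hq: "H (qpoch (T ^ lcm a b) ((S * T) ^ lcm a b)) (gcd a b * j a * j b) = EXP (Q a b)" if "a \<ge> 1" "b \<ge> 1" for a b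
    unfolding qpoch_pow[OF small_power_ge1[OF T lcm1[OF that]] lcm1[OF that]] H[OF sl[OF that]] Q_def ..
  have Q0: "Q a b = 0" if "a > M \<or> b > M" for a b using that j by (auto simp: Q_def)
  have first: "prod_pos (\<lambda>\<alpha>. S ^ (\<alpha> * j \<alpha>) * c \<alpha> * (1 / qpoch ((S * T) ^ \<alpha>) ((S * T) ^ \<alpha>) ^ j \<alpha>)
       * half_pow (qpoch (T ^ (2 * \<alpha> - 1)) ((S * T) ^ (4 * \<alpha> - 2))
                   / qpoch (S ^ (2 * \<alpha> - 1) * T ^ (4 * \<alpha> - 2)) ((S * T) ^ (4 * \<alpha> - 2))) (j (2 * \<alpha> - 1))
       * (qpoch (T ^ \<alpha>) ((S * T) ^ (2 * \<alpha>)) / qpoch (S ^ \<alpha> * T ^ (2 * \<alpha>)) ((S * T) ^ (2 * \<alpha>))) ^ j (2 * \<alpha>))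
     = (\<Prod>a\<in>?I. c a * S ^ (a * j a) * EXP (E a))" (is "prod_pos ?f = _")
  proof -
    have f: "?f \<alpha> = c \<alpha> * S ^ (\<alpha> * j \<alpha>) * EXP (E \<alpha>)" if "\<alpha> \<ge> 1" for \<alpha>
      unfolding gsum_factor[OF that] E_def B_def Lq_def ..
    have "?f \<alpha> = 1" if "\<alpha> > M" for \<alpha>
    proof -
      have "j \<alpha> = 0" "j (2 * \<alpha> - 1) = 0" "j (2 * \<alpha>) = 0" using that by (auto intro!: j)
      moreover have "\<alpha> \<ge> 1" using that by simp
      ultimately show ?thesis unfolding f[OF \<open>\<alpha> \<ge> 1\<close>] by (simp add: E_def c_def)
    qed
    then have "prod_pos ?f = (\<Prod>a\<in>?I. ?f a)" by (rule prod_pos_finite)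
    also have "\<dots> = (\<Prod>a\<in>?I. c a * S ^ (a * j a) * EXP (E a))" by (rule prod.cong[OF refl]) (rule f, simp)
    finally show ?thesis .
  qed
  have second: "prod_pos (\<lambda>\<alpha>. prod_pos (\<lambda>\<beta>. H (qpoch (T ^ lcm \<alpha> \<beta>) ((S * T) ^ lcm \<alpha> \<beta>)) (gcd \<alpha> \<beta> * j \<alpha> * j \<beta>)))
      = EXP (\<Sum>a\<in>?I. \<Sum>b\<in>?I. Q a b)"
  proof -
    have inner: "prod_pos (\<lambda>\<beta>. H (qpoch (T ^ lcm a \<beta>) ((S * T) ^ lcm a \<beta>)) (gcd a \<beta> * j a * j \<beta>)) = EXP (\<Sum>b\<in>?I. Q a b)"
      if a: "a \<ge> 1" for a
    proof -
      have "prod_pos (\<lambda>\<beta>. H (qpoch (T ^ lcm a \<beta>) ((S * T) ^ lcm a \<beta>)) (gcd a \<beta> * j a * j \<beta>))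
        = (\<Prod>b\<in>?I. H (qpoch (T ^ lcm a b) ((S * T) ^ lcm a b)) (gcd a b * j a * j b))"
      proof (rule prod_pos_finite)
        fix b assume b: "b > M"
        then have "b \<ge> 1" by simp
        from Hq[OF a this] show "H (qpoch (T ^ lcm a b) ((S * T) ^ lcm a b)) (gcd a b * j a * j b) = 1" using b by (simp add: Q0)
      qed
      also have "\<dots> = (\<Prod>b\<in>?I. EXP (Q a b))" by (rule prod.cong[OF refl]) (rule Hq[OF a], simp)
      also have "\<dots> = EXP (\<Sum>b\<in>?I. Q a b)" by (rule EXP_sum[symmetric]) (auto intro: sQ a)
      finally show ?thesis .
    qed
    have "prod_pos (\<lambda>\<alpha>. prod_pos (\<lambda>\<beta>. H (qpoch (T ^ lcm \<alpha> \<beta>) ((S * T) ^ lcm \<alpha> \<beta>)) (gcd \<alpha> \<beta> * j \<alpha> * j \<beta>)))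
      = (\<Prod>a\<in>?I. prod_pos (\<lambda>\<beta>. H (qpoch (T ^ lcm a \<beta>) ((S * T) ^ lcm a \<beta>)) (gcd a \<beta> * j a * j \<beta>)))"
      by (rule prod_pos_finite) (subst inner, simp_all add: Q0)
    also have "\<dots> = (\<Prod>a\<in>?I. EXP (\<Sum>b\<in>?I. Q a b))" by (rule prod.cong[OF refl]) (rule inner, simp)
    also have "\<dots> = EXP (\<Sum>a\<in>?I. \<Sum>b\<in>?I. Q a b)" by (rule EXP_sum[symmetric]) (auto intro!: small_sum sQ)
    finally show ?thesis .
  qed
  \<comment> \<open>Redistributes the terms from the indexing by \<alpha> to the entries of
    \<open>j\<close>.\<close>
  have "(\<Sum>a\<in>?I. E a) = (\<Sum>a\<in>?I. of_nat (j a) * Lq a) + (\<Sum>a\<in>?I. of_nat (j a) * B a)"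
    unfolding E_def sum.distrib[of "\<lambda>a. of_nat (j a) * Lq a"] by (subst sum_odd_even) (simp_all add: j)
  also have "\<dots> = (\<Sum>a\<in>?I. of_nat (j a) * linS S T a)"
    unfolding sum.distrib[symmetric] distrib_left[symmetric] B_def by simp
  finally have E: "(\<Sum>a\<in>?I. E a) = \<dots>" .
  have Q: "(\<Sum>a\<in>?I. \<Sum>b\<in>?I. Q a b) = - scalar (\<kappa> / 2) * (\<Sum>a\<in>?I. \<Sum>b\<in>?I. of_nat (gcd a b * j a * j b) * lser (T ^ lcm a b) ((S * T) ^ lcm a b))"
  proof -
    have "Q a b = - scalar (\<kappa> / 2) * (of_nat (gcd a b * j a * j b) * lser (T ^ lcm a b) ((S * T) ^ lcm a b))" for a b
    proof -
      have "scalar (\<kappa> * of_nat n / 2) = scalar (\<kappa> / 2) * of_nat n" for n unfolding of_nat_ser scalar_mult[symmetric] by simp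
      then show ?thesis unfolding Q_def by (simp only: mult_minus_left mult_minus_right mult.assoc)
    qed
    then show ?thesis by (simp only: sum_distrib_left)
  qed
  have Phi: "(\<Sum>a\<in>?I. E a) + (\<Sum>a\<in>?I. \<Sum>b\<in>?I. Q a b) = Phi \<kappa> S T M j" unfolding E Q Phi_def by simp
  have es: "EXP (\<Sum>a\<in>?I. E a) = (\<Prod>a\<in>?I. EXP (E a))" by (rule EXP_sum) (use sE in auto)
  have "gsum \<kappa> S T H j = (\<Prod>a\<in>?I. c a * S ^ (a * j a)) * (EXP (\<Sum>a\<in>?I. E a) * EXP (\<Sum>a\<in>?I. \<Sum>b\<in>?I. Q a b))"
    unfolding gsum_def c_def[symmetric] first second prod.distrib[of _ "\<lambda>a. EXP (E a)"] es by (simp only: mult.assoc)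
  also have "EXP (\<Sum>a\<in>?I. E a) * EXP (\<Sum>a\<in>?I. \<Sum>b\<in>?I. Q a b) = EXP (Phi \<kappa> S T M j)"
    unfolding Phi[symmetric] by (rule EXP_add[symmetric]) (auto intro!: small_sum sE sQ)
  finally show ?thesis unfolding c_def .
qed

end

section \<open>Summation over the finitely supported sequences\<close>

lemma has_sum_fpsI:
  fixes h :: "'b \<Rightarrow> 'c::ab_group_add fps"
  assumes "\<And>N. \<exists>X. finite X \<and> X \<subseteq> A \<and> (\<forall>Y. finite Y \<and> X \<subseteq> Y \<and> Y \<subseteq> A \<longrightarrow> (\<forall>v<N. fps_nth (sum h Y) v = fps_nth R v))"
  shows "(h has_sum R) A"
  unfolding has_sum_def by (rule tendsto_fpsI) (use assms in \<open>simp only: eventually_finite_subsets_at_top\<close>)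

definition seq_box :: "nat \<Rightarrow> (nat \<Rightarrow> nat) set" where
  "seq_box M = {j \<in> fin_seqs. \<forall>\<alpha>. j \<alpha> \<le> M \<and> (\<alpha> > M \<longrightarrow> j \<alpha> = 0)}"

text \<open>Functions in an extensional box are \<open>undefined\<close> outside it, whereas the
  sequences of the theorem are zero there.\<close>

definition extend0 :: "nat \<Rightarrow> (nat \<Rightarrow> nat) \<Rightarrow> nat \<Rightarrow> nat" where
  "extend0 M j \<alpha> = (if \<alpha> \<in> {1..M} then j \<alpha> else 0)"

lemma seq_box_eq: "seq_box M = extend0 M ` ({1..M} \<rightarrow>\<^sub>E {..M})"
proof (intro Set.set_eqI iffI)
  fix j assume j: "j \<in> seq_box M"
  show "j \<in> extend0 M ` ({1..M} \<rightarrow>\<^sub>E {..M})"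
  proof (rule image_eqI)
    show "j = extend0 M (restrict j {1..M})"
    proof
      fix \<alpha> show "j \<alpha> = extend0 M (restrict j {1..M}) \<alpha>"
        using j by (cases "\<alpha> = 0") (auto simp: extend0_def seq_box_def fin_seqs_def One_nat_def)
    qed
    show "restrict j {1..M} \<in> {1..M} \<rightarrow>\<^sub>E {..M}" using j by (auto simp: seq_box_def)
  qed
next
  fix j assume "j \<in> extend0 M ` ({1..M} \<rightarrow>\<^sub>E {..M})"
  then obtain i where i: "i \<in> {1..M} \<rightarrow>\<^sub>E {..M}" "j = extend0 M i" by blast
  have "finite {\<alpha>. extend0 M i \<alpha> \<noteq> 0}" by (rule finite_subset[of _ "{1..M}"]) (auto simp: extend0_def)
  then show "j \<in> seq_box M" using i by (auto simp: seq_box_def fin_seqs_def extend0_def)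
qed

lemma inj_extend0: "inj_on (extend0 M) ({1..M} \<rightarrow>\<^sub>E {..M})"
proof (rule inj_onI)
  fix i j assume i: "i \<in> {1..M} \<rightarrow>\<^sub>E {..M}" and j: "j \<in> {1..M} \<rightarrow>\<^sub>E {..M}" and eq: "extend0 M i = extend0 M j"
  show "i = j"
  proof (rule PiE_ext[OF i j])
    fix \<alpha> assume "\<alpha> \<in> {1..M}"
    then show "i \<alpha> = j \<alpha>" using fun_cong[OF eq, of \<alpha>] by (simp add: extend0_def)
  qed
qed

lemma finite_seq_box: "finite (seq_box M)"
  unfolding seq_box_eq by (intro finite_imageI finite_PiE) auto

lemma seq_box_mono: "M \<le> N \<Longrightarrow> seq_box M \<subseteq> seq_box N"
  by (auto simp: seq_box_def intro: order_trans)

lemma Phi_cong: "(\<And>a. a \<in> {1..M} \<Longrightarrow> i a = j a) \<Longrightarrow> Phi \<kappa> S T M i = Phi \<kappa> S T M j"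
  by (simp add: Phi_def)

lemma s_ord_sum: "(\<And>x. x \<in> A \<Longrightarrow> s_ord d (f x)) \<Longrightarrow> s_ord d (sum f A)"
  by (simp add: s_ord_def fps_sum_nth)

context
  fixes \<kappa> :: rat and S T :: ser and H :: "ser \<Rightarrow> nat \<Rightarrow> ser"
  assumes S: "small S 1" and T: "small T 1" and S0: "fps_nth S 0 = 0"
    and H: "\<And>Z n. small Z 1 \<Longrightarrow> H (EXP Z) n = EXP (scalar (\<kappa> * of_nat n / 2) * Z)"
begin

text \<open>Leaving the box means \<open>\<alpha> * j \<alpha> > M\<close> for some \<alpha>,
  through a large value or a large index; the monomial \<open>S ^ (\<alpha> * j \<alpha>)\<close> is
  then divisible by \<open>s^(M+1)\<close>.\<close>

lemma s_ord_gsum: assumes j: "j \<in> fin_seqs" and M: "j \<notin> seq_box M" shows "s_ord (Suc M) (gsum \<kappa> S T H j)"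
proof -
  have "finite {\<alpha>. j \<alpha> \<noteq> 0}" and j0: "j 0 = 0" using j by (auto simp: fin_seqs_def)
  then obtain N where N: "\<forall>\<alpha>\<in>{\<alpha>. j \<alpha> \<noteq> 0}. \<alpha> \<le> N" using finite_nat_set_iff_bounded_le by blast
  obtain \<alpha> where a: "j \<alpha> > M \<or> (\<alpha> > M \<and> j \<alpha> \<noteq> 0)" using j M by (auto simp: seq_box_def not_le)
  then have ja: "j \<alpha> \<noteq> 0" by auto
  then have a1: "\<alpha> \<noteq> 0" using j0 by (intro notI) simp
  have le: "j \<alpha> \<le> \<alpha> * j \<alpha>" "\<alpha> \<le> \<alpha> * j \<alpha>" using a1 ja by simp_all
  have big: "Suc M \<le> \<alpha> * j \<alpha>"
  proof (cases "j \<alpha> > M")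
    case True then show ?thesis using le(1) by linarith
  next
    case False then show ?thesis using a le(2) by linarith
  qed
  have aN: "\<alpha> \<in> {1..N}" using N ja a1 by auto
  have eq: "gsum \<kappa> S T H j = (\<Prod>a\<in>{1..N}. scalar (1 / (fact (j a) * (\<kappa> * of_nat a) ^ j a)) * S ^ (a * j a)) * EXP (Phi \<kappa> S T N j)"
    by (rule gsum_eq[OF S T S0 H]) (use N in \<open>auto simp: not_le\<close>)
  show ?thesis unfolding eq prod.remove[OF finite_atLeastAtMost aN]
    by (rule s_ord_mult, rule s_ord_mult, rule s_ord_mult', rule s_ord_mono[OF s_ord_power[OF S0] big])
qed

text \<open>The limit is prescribed coefficientwise: the coefficient of \<open>s^v\<close> only sees
  the sequences in the box of size \<open>v\<close>.\<close>

definition gtotal :: ser where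
  "gtotal = Abs_fps (\<lambda>v. fps_nth (\<Sum>j\<in>seq_box v. gsum \<kappa> S T H j) v)"

lemma gtotal_nth:
  assumes "finite Y" "seq_box v \<subseteq> Y" "Y \<subseteq> fin_seqs"
  shows "fps_nth (\<Sum>j\<in>Y. gsum \<kappa> S T H j) v = fps_nth gtotal v"
proof -
  have "(\<Sum>j\<in>Y. gsum \<kappa> S T H j) = (\<Sum>j\<in>seq_box v. gsum \<kappa> S T H j) + (\<Sum>j\<in>Y - seq_box v. gsum \<kappa> S T H j)"
    using sum.subset_diff[OF assms(2,1)] by (simp add: add.commute)
  moreover have "s_ord (Suc v) (\<Sum>j\<in>Y - seq_box v. gsum \<kappa> S T H j)"
    by (rule s_ord_sum) (use assms(3) in \<open>auto intro: s_ord_gsum\<close>)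
  ultimately show ?thesis by (simp add: gtotal_def s_ord_def)
qed

lemma gsum_has_sum: "(gsum \<kappa> S T H has_sum gtotal) fin_seqs"
proof (rule has_sum_fpsI)
  fix N
  have fs: "seq_box M \<subseteq> fin_seqs" for M by (auto simp: seq_box_def)
  show "\<exists>X. finite X \<and> X \<subseteq> fin_seqs \<and> (\<forall>Y. finite Y \<and> X \<subseteq> Y \<and> Y \<subseteq> fin_seqs \<longrightarrow> (\<forall>v<N. fps_nth (sum (gsum \<kappa> S T H) Y) v = fps_nth gtotal v))"
  proof (intro exI[of _ "seq_box N"] conjI allI impI)
    fix Y v assume Y: "finite Y \<and> seq_box N \<subseteq> Y \<and> Y \<subseteq> fin_seqs" and "v < N"
    then have "seq_box v \<subseteq> Y" using seq_box_mono[of v N] by auto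
    then show "fps_nth (sum (gsum \<kappa> S T H) Y) v = fps_nth gtotal v" using Y by (intro gtotal_nth) auto
  qed (rule finite_seq_box fs)+
qed

lemma cf_mult_gtotal:
  assumes "v \<le> M"
  shows "cf (G * gtotal) v n = (\<Sum>j\<in>{1..M} \<rightarrow>\<^sub>E {..M}.
    cf (G * ((\<Prod>a\<in>{1..M}. scalar (1 / (fact (j a) * (\<kappa> * of_nat a) ^ j a)) * S ^ (a * j a)) * EXP (Phi \<kappa> S T M j))) v n)"
proof -
  have fs: "seq_box M \<subseteq> fin_seqs" by (auto simp: seq_box_def)
  have "fps_nth gtotal w = fps_nth (\<Sum>j\<in>seq_box M. gsum \<kappa> S T H j) w" if "w \<le> v" for w
    using that assms by (intro gtotal_nth[symmetric] finite_seq_box seq_box_mono fs) auto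
  then have "fps_nth (G * gtotal) v = fps_nth (G * (\<Sum>j\<in>seq_box M. gsum \<kappa> S T H j)) v"
    unfolding fps_mult_nth by (intro sum.cong) auto
  then have "cf (G * gtotal) v n = (\<Sum>j\<in>seq_box M. cf (G * gsum \<kappa> S T H j) v n)"
    by (simp only: sum_distrib_left cf_sum)
  also have "\<dots> = (\<Sum>j\<in>{1..M} \<rightarrow>\<^sub>E {..M}. cf (G * gsum \<kappa> S T H (extend0 M j)) v n)"
    unfolding seq_box_eq by (subst sum.reindex[OF inj_extend0]) simp
  also have "\<dots> = (\<Sum>j\<in>{1..M} \<rightarrow>\<^sub>E {..M}.
    cf (G * ((\<Prod>a\<in>{1..M}. scalar (1 / (fact (j a) * (\<kappa> * of_nat a) ^ j a)) * S ^ (a * j a)) * EXP (Phi \<kappa> S T M j))) v n)"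
  proof (rule sum.cong[OF refl])
    fix j
    have e: "extend0 M j a = j a" if "a \<in> {1..M}" for a using that by (simp add: extend0_def)
    have "gsum \<kappa> S T H (extend0 M j) = (\<Prod>a\<in>{1..M}. scalar (1 / (fact (extend0 M j a) * (\<kappa> * of_nat a) ^ extend0 M j a)) * S ^ (a * extend0 M j a)) * EXP (Phi \<kappa> S T M (extend0 M j))"
      by (rule gsum_eq[OF S T S0 H]) (auto simp: extend0_def)
    also have "\<dots> = (\<Prod>a\<in>{1..M}. scalar (1 / (fact (j a) * (\<kappa> * of_nat a) ^ j a)) * S ^ (a * j a)) * EXP (Phi \<kappa> S T M j)"
      by (intro arg_cong2[where f="(*)"] prod.cong refl arg_cong[where f=EXP] Phi_cong) (simp_all only: e)
    finally show "cf (G * gsum \<kappa> S T H (extend0 M j)) v n = cf (G * ((\<Prod>a\<in>{1..M}. scalar (1 / (fact (j a) * (\<kappa> * of_nat a) ^ j a)) * S ^ (a * j a)) * EXP (Phi \<kappa> S T M j))) v n"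
      by (simp only:)
  qed
  finally show ?thesis .
qed

end

section \<open>The generating functions\<close>

lemma psi_s: "psi var_s = var_s"
  by (rule ser_eqI) (auto simp: cf_psi var_s_def fps_X_def One_nat_def elim: evenE)

lemma psi_t: "psi var_t = var_t\<^sup>2"
proof (rule ser_eqI)
  fix v n show "cf (psi var_t) v n = cf (var_t\<^sup>2) v n"
    using cf_t_pow[of 1 v "n div 2"] by (auto simp: cf_psi elim!: evenE)
qed

lemma psi_Psi:
  assumes "small S 1" "small T 1" shows "psi (Psi \<kappa> S T) = Psi \<kappa> (psi S) (psi T)"
proof -
  have q: "small (S * T) 1" "small ((S * T)\<^sup>2) 1" using assms by (auto intro!: small_mult_left small_power_ge1)
  show ?thesis unfolding Psi_def using q assms
    by (simp add: psi_diff psi_scalar_mult psi_scalar psi_lser psi_mult psi_power)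
qed

lemma psi_linS:
  assumes S: "small S 1" and T: "small T 1" and a: "a \<ge> 1" shows "psi (linS S T a) = linS (psi S) (psi T) a"
proof -
  have q: "small (S * T) 1" by (rule small_mult_left[OF S])
  have sm: "small ((S * T) ^ m) 1" "small (T ^ m) 1" "small (S ^ m * T ^ n) 1" if "m \<ge> 1" for m n
    using that by (auto intro!: small_mult_left small_power_ge1 S T simp del: power_mult_distrib)
  have h: "even a \<Longrightarrow> a div 2 \<ge> 1" and a2: "2 * a \<ge> 1" using a by auto
  show ?thesis
  proof (cases "even a")
    case True
    then show ?thesis unfolding linS_def
      by (simp only: True if_True psi_add psi_diff psi_lser[OF sm(1)[OF a] sm(1)[OF a]] psi_lser[OF sm(3)[OF h[OF True]] sm(1)[OF a]]
        psi_lser[OF sm(2)[OF h[OF True]] sm(1)[OF a]] psi_mult psi_power)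
  next
    case False
    then show ?thesis unfolding linS_def
      by (simp only: False if_False psi_add psi_diff psi_scalar_mult psi_lser[OF sm(1)[OF a] sm(1)[OF a]] psi_lser[OF sm(3)[OF a] sm(1)[OF a2]]
        psi_lser[OF sm(2)[OF a] sm(1)[OF a2]] psi_mult psi_power psi_scalar)
  qed
qed

lemma psi_of_nat_mult: "psi (of_nat n * F) = of_nat n * psi F"
  by (simp add: of_nat_ser psi_scalar_mult)

lemma psi_Phi:
  assumes S: "small S 1" and T: "small T 1" shows "psi (Phi \<kappa> S T M j) = Phi \<kappa> (psi S) (psi T) M j"
proof -
  have l: "psi (lser (T ^ lcm a b) ((S * T) ^ lcm a b)) = lser (psi T ^ lcm a b) ((psi S * psi T) ^ lcm a b)" if "a \<in> {1..M}" "b \<in> {1..M}" for a b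
  proof -
    have "lcm a b \<ge> 1" using that by (auto simp: Suc_le_eq lcm_pos_nat One_nat_def)
    then show ?thesis
      by (subst psi_lser) (auto intro!: small_power_ge1 small_mult_left S T simp: psi_power psi_mult)
  qed
  have "(\<Sum>a\<in>{1..M}. psi (of_nat (j a) * linS S T a)) = (\<Sum>a\<in>{1..M}. of_nat (j a) * linS (psi S) (psi T) a)"
    by (rule sum.cong[OF refl]) (simp add: psi_of_nat_mult psi_linS[OF S T])
  moreover have "(\<Sum>a\<in>{1..M}. \<Sum>b\<in>{1..M}. psi (of_nat (gcd a b * j a * j b) * lser (T ^ lcm a b) ((S * T) ^ lcm a b)))
      = (\<Sum>a\<in>{1..M}. \<Sum>b\<in>{1..M}. of_nat (gcd a b * j a * j b) * lser (psi T ^ lcm a b) ((psi S * psi T) ^ lcm a b))"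
    by (intro sum.cong refl) (simp only: psi_of_nat_mult l)
  ultimately show ?thesis unfolding Phi_def psi_diff psi_scalar_mult psi_sum by simp
qed

lemma small_Psi: assumes S: "small S 1" and T: "small T 1" shows "small (Psi \<kappa> S T) 1"
proof -
  have q: "small (S * T) 1" by (rule small_mult_left[OF S])
  have "small ((S * T)\<^sup>2) 1" by (rule small_power_ge1[OF q]) simp
  then show ?thesis unfolding Psi_def using small_lser q small_lser[OF S] small_mult_right[OF small_lser[OF S]] by (auto intro!: small_diff)
qed

lemma small_Phi: assumes S: "small S 1" and T: "small T 1" and S0: "fps_nth S 0 = 0" shows "small (Phi \<kappa> S T M j) 1"
proof -
  have "small (lser (T ^ lcm a b) q) 1" if "a \<in> {1..M}" "b \<in> {1..M}" for a b q
    using that by (intro small_lser small_power_ge1 T) (auto simp: Suc_le_eq lcm_pos_nat One_nat_def)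
  then show ?thesis unfolding Phi_def
    by (intro small_diff small_mult_right[of _ _ "scalar _"] small_sum small_mult_right[of _ _ "of_nat _"] small_linS[OF S T S0]) auto
qed

text \<open>Compared coefficient by coefficient, after applying \<open>psi\<close>: the coefficient
  of \<open>t^e\<close> becomes that of \<open>u^(2 e)\<close>, where the exponent counts
  half-edges.\<close>

theorem generating_function:
  fixes K :: "('a, 'm) ring_scheme"
  assumes F: "field K" and char: "\<And>n::nat. n > 0 \<Longrightarrow> add_pow K n \<one>\<^bsub>K\<^esub> \<noteq> \<zero>\<^bsub>K\<^esub>"
    and st: "sign_type \<kappa> snu smu srho"
    and S: "S = scalar \<kappa> * var_s" and T: "T = scalar (- \<kappa>) * var_t"
    and H: "\<And>Z n. small Z 1 \<Longrightarrow> H (EXP Z) n = EXP (scalar (\<kappa> * of_nat n / 2) * Z)"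
  shows "Abs_fps (\<lambda>v. Abs_fps (\<lambda>e. of_nat (vdim K (graph_space K v e 3 snu smu srho)))) = EXP (Psi \<kappa> S T) * gtotal \<kappa> S T H"
proof (rule ser_eqI)
  fix v e :: nat
  \<comment> \<open>One bound for three purposes: the number of half-edges, the size of the index
    boxes, and the degree \<open>v + 2 e\<close> up to which exponents must be exact.\<close>
  define M where "M = v + 2 * e"
  have \<kappa>: "\<kappa> = 1 \<or> \<kappa> = -1" using st by (auto simp: sign_type_def)
  have sS: "small S 1" unfolding S by (intro small_mult_right small_s)
  have sT: "small T 1" unfolding T using small_scalar_t_pow[of 1 1 "- \<kappa>"] by simp
  have S0: "fps_nth S 0 = 0" unfolding S by (simp add: var_s_def scalar_def)
  have pS: "psi S = s\<kappa> \<kappa>" unfolding S s\<kappa>_def psi_scalar_mult psi_s ..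
  have pT: "psi T = u\<kappa> \<kappa>" unfolding T u\<kappa>_def psi_scalar_mult psi_t ..
  let ?p = "\<lambda>S j. \<Prod>a\<in>{1..M}. scalar (1 / (fact (j a) * (\<kappa> * of_nat a) ^ j a)) * S ^ (a * j a)"
  have "cf (EXP (Psi \<kappa> S T) * gtotal \<kappa> S T H) v e = (\<Sum>j\<in>{1..M} \<rightarrow>\<^sub>E {..M}. cf (EXP (Psi \<kappa> S T) * (?p S j * EXP (Phi \<kappa> S T M j))) v e)"
    by (rule cf_mult_gtotal[OF sS sT S0 H]) (simp_all add: M_def)
  also have "\<dots> = (\<Sum>j\<in>{1..M} \<rightarrow>\<^sub>E {..M}. cf (Cs \<kappa> M j * EXP (\<Sum>k\<in>{1..M}. Zs \<kappa> M j k)) v (2 * e))"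
  proof (rule sum.cong[OF refl])
    fix j
    let ?A = "EXP (Psi \<kappa> S T) * (?p S j * EXP (Phi \<kappa> S T M j))"
    have "psi ?A = psi (?p S j) * (EXP (psi (Psi \<kappa> S T)) * EXP (psi (Phi \<kappa> S T M j)))"
      by (simp only: psi_mult psi_EXP[OF small_Psi[OF sS sT]] psi_EXP[OF small_Phi[OF sS sT S0]] mult_ac)
    also have "psi (?p S j) = ?p (s\<kappa> \<kappa>) j" unfolding psi_prod psi_scalar_mult psi_power pS ..
    also have "EXP (psi (Psi \<kappa> S T)) * EXP (psi (Phi \<kappa> S T M j)) = EXP (psi (Psi \<kappa> S T) + psi (Phi \<kappa> S T M j))"
      by (rule EXP_add[symmetric]) (intro small_psi small_Psi sS sT small_Phi S0)+
    also have "psi (Psi \<kappa> S T) + psi (Phi \<kappa> S T M j) = Psi \<kappa> (s\<kappa> \<kappa>) (u\<kappa> \<kappa>) + Phi \<kappa> (s\<kappa> \<kappa>) (u\<kappa> \<kappa>) M j"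
      by (simp only: psi_Psi[OF sS sT] psi_Phi[OF sS sT] pS pT)
    finally have "psi ?A = ?p (s\<kappa> \<kappa>) j * EXP (Psi \<kappa> (s\<kappa> \<kappa>) (u\<kappa> \<kappa>) + Phi \<kappa> (s\<kappa> \<kappa>) (u\<kappa> \<kappa>) M j)" .
    moreover have "cf ?A v e = cf (psi ?A) v (2 * e)" by (simp add: cf_psi)
    ultimately show "cf ?A v e = cf (Cs \<kappa> M j * EXP (\<Sum>k\<in>{1..M}. Zs \<kappa> M j k)) v (2 * e)"
      using cf_Cs_EXP[OF \<kappa>, of v "2 * e" M j] by (simp only: M_def order_refl)
  qed
  also have "\<dots> = of_nat (vdim K (graph_space K v e 3 snu smu srho))"
    by (rule dim_series[OF F char st, symmetric]) (simp_all add: M_def)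
  finally show "cf (Abs_fps (\<lambda>v. Abs_fps (\<lambda>e. of_nat (vdim K (graph_space K v e 3 snu smu srho))))) v e = cf (EXP (Psi \<kappa> S T) * gtotal \<kappa> S T H) v e"
    by simp
qed

text \<open>The exponent \<open>4 \<alpha> - 2\<close> is even, so the signs of \<open>S\<close> and
  \<open>T\<close> disappear there and the statement shows \<open>s t\<close> and \<open>t\<close>
  without sign.\<close>

lemma power_neg_st: "(- (var_s * var_t)) ^ (4 * \<alpha> - 2) = (var_s * var_t) ^ (4 * \<alpha> - 2)" "(- var_t) ^ (4 * \<alpha> - 2) = var_t ^ (4 * \<alpha> - 2)"
proof -
  have "4 * \<alpha> - 2 = 2 * (2 * \<alpha> - 1)" by simp
  then have "even (4 * \<alpha> - 2)" by (metis dvd_triv_left)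
  then show "(- (var_s * var_t)) ^ (4 * \<alpha> - 2) = (var_s * var_t) ^ (4 * \<alpha> - 2)" "(- var_t) ^ (4 * \<alpha> - 2) = var_t ^ (4 * \<alpha> - 2)"
    by (simp_all only: power_minus_even)
qed

lemma even_summand_eq: "even_summand = gsum 1 var_s (- var_t) half_pow"
  by (intro ext) (simp add: even_summand_def gsum_def Let_def power_neg_st)

lemma odd_summand_eq: "odd_summand = gsum (- 1) (- var_s) var_t (\<lambda>F n. 1 / half_pow F n)"
  by (intro ext) (simp add: odd_summand_def gsum_def Let_def power_neg_st)

theorem theorem1:
  fixes K :: "('a, 'm) ring_scheme"
  assumes "field K"
    and "\<And>n::nat. n > 0 \<Longrightarrow> add_pow K n \<one>\<^bsub>K\<^esub> \<noteq> \<zero>\<^bsub>K\<^esub>"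
  shows "odd_summand summable_on fin_seqs \<and> even_summand summable_on fin_seqs \<and>
    P_odd K =
      1 / (qpoch (- var_s) ((var_s * var_t) ^ 2) * qpoch ((var_s * var_t) ^ 2) ((var_s * var_t) ^ 2))
      * (\<Sum>\<^sub>\<infinity>j\<in>fin_seqs. odd_summand j) \<and>
    P_even K =
      qpoch var_s ((var_s * var_t) ^ 2) / qpoch (- (var_s * var_t)) ((var_s * var_t) ^ 2)
      * (\<Sum>\<^sub>\<infinity>j\<in>fin_seqs. even_summand j)"
proof -
  let ?q = "(var_s * var_t)\<^sup>2"
  let ?H = "\<lambda>F n. 1 / half_pow F n"
  have t: "small var_t 1" using small_t_pow[of 1] by simp
  have s0: "fps_nth var_s 0 = 0" by (simp add: var_s_def)
  have st: "small (var_s * var_t) 1" by (rule small_mult_left[OF small_s])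
  have q: "small ?q 1" by (rule small_power_ge1[OF st]) simp
  have q0: "fps_nth ?q 0 = 0" by (simp add: fps_nth_power_0 fps_mult_nth_0 s0)
  have He: "half_pow (EXP Z) n = EXP (scalar (1 * of_nat n / 2) * Z)" if "small Z 1" for Z n
    using half_pow_EXP[OF that] by simp
  \<comment> \<open>For \<kappa> = -1 the double product is inverted, which matches the exponent
    \<kappa> n / 2.\<close>
  have Ho: "?H (EXP Z) n = EXP (scalar (- 1 * of_nat n / 2) * Z)" if "small Z 1" for Z n
    unfolding half_pow_EXP[OF that] inverse_EXP[OF small_mult_right[OF that]] by (simp add: scalar_minus)
  have so: "(odd_summand has_sum gtotal (- 1) (- var_s) var_t ?H) fin_seqs"
    unfolding odd_summand_eq by (rule gsum_has_sum[OF small_minus[OF small_s] t _ Ho]) (simp add: s0)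
  have se: "(even_summand has_sum gtotal 1 var_s (- var_t) half_pow) fin_seqs"
    unfolding even_summand_eq by (rule gsum_has_sum[OF small_s small_minus[OF t] s0 He])
  have "P_odd K = EXP (Psi (- 1) (- var_s) var_t) * gtotal (- 1) (- var_s) var_t ?H"
    unfolding P_odd_def V_odd_def
    by (rule generating_function[OF assms _ _ _ Ho]) (simp_all add: sign_type_def scalar_minus)
  also have "EXP (Psi (- 1) (- var_s) var_t) = 1 / (qpoch (- var_s) ?q * qpoch ?q ?q)"
  proof -
    have l: "small (lser (- var_s) ?q) 1" "small (lser ?q ?q) 1" by (intro small_lser small_minus small_s q)+
    have "qpoch (- var_s) ?q * qpoch ?q ?q = EXP (- lser (- var_s) ?q + - lser ?q ?q)"
      unfolding qpoch_eq[OF small_minus[OF small_s] q q0] qpoch_eq[OF q q q0] by (rule EXP_add[symmetric]) (intro small_minus l)+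
    then have "1 / (qpoch (- var_s) ?q * qpoch ?q ?q) = EXP (- (- lser (- var_s) ?q + - lser ?q ?q))"
      by (simp only: inverse_EXP[OF small_add[OF small_minus[OF l(1)] small_minus[OF l(2)]]])
    then show ?thesis by (simp add: Psi_def scalar_minus)
  qed
  finally have o: "P_odd K = 1 / (qpoch (- var_s) ?q * qpoch ?q ?q) * (\<Sum>\<^sub>\<infinity>j\<in>fin_seqs. odd_summand j)"
    unfolding infsumI[OF so] .
  have "P_even K = EXP (Psi 1 var_s (- var_t)) * gtotal 1 var_s (- var_t) half_pow"
    unfolding P_even_def V_even_def
    by (rule generating_function[OF assms _ _ _ He]) (simp_all add: sign_type_def scalar_minus)
  also have "EXP (Psi 1 var_s (- var_t)) = qpoch var_s ?q / qpoch (- (var_s * var_t)) ?q"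
  proof -
    have l: "small (lser var_s ?q) 1" "small (lser (- (var_s * var_t)) ?q) 1" by (intro small_lser small_minus small_s st)+
    show ?thesis
      unfolding qpoch_eq[OF small_s q q0] qpoch_eq[OF small_minus[OF st] q q0] EXP_divide[OF small_minus[OF l(1)] small_minus[OF l(2)]]
      by (simp add: Psi_def)
  qed
  finally have e: "P_even K = qpoch var_s ?q / qpoch (- (var_s * var_t)) ?q * (\<Sum>\<^sub>\<infinity>j\<in>fin_seqs. even_summand j)"
    unfolding infsumI[OF se] .
  show ?thesis using so se o e unfolding summable_on_def by blast
qed

end
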